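(* Let $K$ be a field of positive characteristic $p$, let $n\ge2$, let $V$ be an arbitrary linear subvariety of $\mathbf{P}_n$ defined over $K$, and let $G$ be a subgroup of $K^*$ such that $\sqrt{G}$ is finitely generated. Then there is a power $q$ of $p$ such that $V(G)$ is an effectively computable finite union of sets $(\pi_0,\pi_1,\dots,\pi_h)_qS(G)$ with points $\pi_0,\pi_1,\dots,\pi_h$ ($0\le h\le n-1$) defined over $\sqrt{G}$ and subgroups $S$.
   Context: For a subgroup $G\subseteq K^*$, $\sqrt{G}$ is the set of $\gamma\in K$ with $\gamma^s\in G$ for some positive integer $s$. $\mathbf{P}_n(G)$ is the set of points of $\mathbf{P}_n$ having homogeneous coordinates all in $G$ ("defined over $G$"), and $V(G)=V\cap\mathbf{P}_n(G)$. A subgroup (linear subgroup) is a linear subvariety of $\mathbf{P}_n$ defined solely by equations of the form $X_i=X_j$. Points with nonzero coordinates are multiplied coordinatewise on homogeneous coordinates, and $\pi^Q$ means raising each homogeneous coordinate to the $Q$-th power. With $\varphi(\pi)=\pi^q$, define $$(\pi_0,\pi_1,\dots,\pi_h)_q=\pi_0\bigcup_{l_1=0}^\infty\cdots\bigcup_{l_h=0}^\infty(\varphi^{l_1}\pi_1)\cdots(\varphi^{l_h}\pi_h),$$ (meaning $\{\pi_0\}$ if $h=0$), and $(\pi_0,\dots,\pi_h)_qS(G)$ is the set of products $\pi\sigma$ with $\pi\in(\pi_0,\dots,\pi_h)_q$, $\sigma\in S(G)$. *)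

theory Defs
  imports Complex_Main "HOL.Hull" "HOL-Library.Nat_Bijection"
begin

subsection \<open>Multiplicative subgroups of a field\<close>

definition mult_subgroup :: "'k::field set \<Rightarrow> bool" where
  "mult_subgroup G \<longleftrightarrow> 0 \<notin> G \<and> 1 \<in> G \<and> (\<forall>x\<in>G. \<forall>y\<in>G. x * y \<in> G) \<and> (\<forall>x\<in>G. inverse x \<in> G)"

definition fin_gen :: "'k::field set \<Rightarrow> bool" where
  "fin_gen G \<longleftrightarrow> (\<exists>B. finite B \<and> B \<subseteq> G \<and> G = mult_subgroup hull B)"

definition root_closure :: "'k::field set \<Rightarrow> 'k set" where
  "root_closure G = {x. \<exists>s>0. x ^ s \<in> G}"


subsection \<open>Projective space\<close>

text \<open>
  A vector of homogeneous coordinates for a point of projective \<open>n\<close>-space is a list of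
  length \<open>n + 1\<close> that is not identically zero; the point itself is the class of all nonzero
  scalar multiples of such a vector.
\<close>

type_synonym 'k point = "'k list set"

definition hom_coords :: "nat \<Rightarrow> 'k::field list \<Rightarrow> bool" where
  "hom_coords n x \<longleftrightarrow> length x = n + 1 \<and> (\<exists>i\<le>n. x ! i \<noteq> 0)"

definition ppoint :: "'k::field list \<Rightarrow> 'k point" where
  "ppoint x = {map ((*) c) x | c. c \<noteq> 0}"

definition proj_over :: "nat \<Rightarrow> 'k::field set \<Rightarrow> 'k point set" where
  "proj_over n G = {ppoint x | x. hom_coords n x \<and> set x \<subseteq> G}"

text \<open>The linear variety cut out by a set of linear forms, each given by its coefficient vector.\<close>

definition linear_variety :: "nat \<Rightarrow> 'k::field list set \<Rightarrow> 'k point set" where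
  "linear_variety n L = {ppoint x | x. hom_coords n x \<and> (\<forall>a\<in>L. (\<Sum>i\<le>n. a ! i * x ! i) = 0)}"

definition linear_subvariety :: "nat \<Rightarrow> 'k::field point set \<Rightarrow> bool" where
  "linear_subvariety n V \<longleftrightarrow>
     (\<exists>L. finite L \<and> (\<forall>a\<in>L. length a = n + 1) \<and> V = linear_variety n L)"

text \<open>The pair \<open>(i, j)\<close> stands for the equation \<open>X\<^sub>i = X\<^sub>j\<close>.\<close>

definition equal_coords :: "nat \<Rightarrow> (nat \<times> nat) set \<Rightarrow> 'k::field point set" where
  "equal_coords n E = {ppoint x | x. hom_coords n x \<and> (\<forall>(i, j)\<in>E. x ! i = x ! j)}"

definition linear_subgroup :: "nat \<Rightarrow> 'k::field point set \<Rightarrow> bool" where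
  "linear_subgroup n S \<longleftrightarrow> (\<exists>E \<subseteq> {..n} \<times> {..n}. S = equal_coords n E)"

definition pmult :: "'k::field point \<Rightarrow> 'k point \<Rightarrow> 'k point" where
  "pmult P Q = (\<Union>x\<in>P. \<Union>y\<in>Q. ppoint (map2 (*) x y))"

definition ppower :: "nat \<Rightarrow> 'k::field point \<Rightarrow> 'k point" where
  "ppower m P = (\<Union>x\<in>P. ppoint (map (\<lambda>c. c ^ m) x))"

lemma ppoint_self: "x \<in> ppoint x"
  unfolding ppoint_def by (auto intro!: exI[of _ 1] simp: map_idI)

lemma ppoint_scale:
  assumes "c \<noteq> 0"
  shows "ppoint (map ((*) c) x) = ppoint x"
proof (intro equalityI subsetI)
  fix y assume "y \<in> ppoint (map ((*) c) x)"
  then obtain d where d: "d \<noteq> 0" "y = map ((*) d) (map ((*) c) x)"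
    by (auto simp: ppoint_def)
  hence "y = map ((*) (d * c)) x" by (simp add: mult.assoc)
  with assms d show "y \<in> ppoint x" unfolding ppoint_def by (auto intro!: exI[of _ "d * c"])
next
  fix y assume "y \<in> ppoint x"
  then obtain d where d: "d \<noteq> 0" "y = map ((*) d) x"
    by (auto simp: ppoint_def)
  hence "y = map ((*) (d / c)) (map ((*) c) x)" using assms by simp
  with assms d show "y \<in> ppoint (map ((*) c) x)" unfolding ppoint_def
    by (metis (mono_tags, lifting) divide_eq_0_iff mem_Collect_eq)
qed

lemma pmult_ppoint: "pmult (ppoint x) (ppoint y) = ppoint (map2 (*) x y)"
proof -
  have "ppoint (map2 (*) (map ((*) c) x) (map ((*) d) y)) = ppoint (map2 (*) x y)"
    if "c \<noteq> 0" "d \<noteq> 0" for c d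
  proof -
    have "map2 (*) (map ((*) c) x) (map ((*) d) y) = map ((*) (c * d)) (map2 (*) x y)"
      by (rule nth_equalityI) (auto simp: algebra_simps)
    with that show ?thesis by (simp add: ppoint_scale del: map_map)
  qed
  hence "ppoint (map2 (*) x' y') = ppoint (map2 (*) x y)" if "x' \<in> ppoint x" "y' \<in> ppoint y" for x' y'
    using that by (auto simp: ppoint_def[of x] ppoint_def[of y])
  thus ?thesis
    unfolding pmult_def using ppoint_self[of x] ppoint_self[of y] by blast
qed

lemma ppower_ppoint: "ppower m (ppoint x) = ppoint (map (\<lambda>c. c ^ m) x)"
proof -
  have "ppoint (map (\<lambda>c. c ^ m) (map ((*) d) x)) = ppoint (map (\<lambda>c. c ^ m) x)" if "d \<noteq> 0" for d
  proof -
    have "map (\<lambda>c. c ^ m) (map ((*) d) x) = map ((*) (d ^ m)) (map (\<lambda>c. c ^ m) x)"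
      by (simp add: power_mult_distrib)
    with that show ?thesis by (simp add: ppoint_scale del: map_map)
  qed
  hence "ppoint (map (\<lambda>c. c ^ m) x') = ppoint (map (\<lambda>c. c ^ m) x)" if "x' \<in> ppoint x" for x'
    using that by (auto simp: ppoint_def[of x])
  thus ?thesis
    unfolding ppower_def using ppoint_self[of x] by blast
qed


subsection \<open>The sets \<open>(\<pi>\<^sub>0, \<dots>, \<pi>\<^sub>h)\<^sub>q S(G)\<close>\<close>

definition frob_orbit :: "nat \<Rightarrow> 'k::field point \<Rightarrow> 'k point list \<Rightarrow> 'k point set" where
  "frob_orbit q \<pi>0 \<pi>s =
     {foldl pmult \<pi>0 (map2 (\<lambda>l \<pi>. (ppower q ^^ l) \<pi>) ls \<pi>s) | ls. length ls = length \<pi>s}"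

definition orbit_translates ::
    "nat \<Rightarrow> nat \<Rightarrow> 'k::field set \<Rightarrow> 'k point \<Rightarrow> 'k point list \<Rightarrow> 'k point set \<Rightarrow> 'k point set" where
  "orbit_translates n q G \<pi>0 \<pi>s S =
     {pmult \<pi> \<sigma> | \<pi> \<sigma>. \<pi> \<in> frob_orbit q \<pi>0 \<pi>s \<and> \<sigma> \<in> S \<inter> proj_over n G}"

text \<open>
  A triple \<open>(\<pi>0, \<pi>s, S)\<close> in \<open>C\<close> stands for \<open>(\<pi>\<^sub>0, \<dots>, \<pi>\<^sub>h)\<^sub>q S(G)\<close>
  with \<open>\<pi>s = [\<pi>\<^sub>1, \<dots>, \<pi>\<^sub>h]\<close>.
\<close>

definition is_decomposition ::
    "nat \<Rightarrow> nat \<Rightarrow> 'k::field set \<Rightarrow> 'k point set \<Rightarrow>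
     ('k point \<times> 'k point list \<times> 'k point set) set \<Rightarrow> bool" where
  "is_decomposition n q G V C \<longleftrightarrow>
     finite C \<and>
     (\<forall>(\<pi>0, \<pi>s, S)\<in>C.
        \<pi>0 \<in> proj_over n (root_closure G) \<and> set \<pi>s \<subseteq> proj_over n (root_closure G) \<and>
        length \<pi>s \<le> n - 1 \<and> linear_subgroup n S) \<and>
     V \<inter> proj_over n G = (\<Union>(\<pi>0, \<pi>s, S)\<in>C. orbit_translates n q G \<pi>0 \<pi>s S)"


subsection \<open>Partial recursive functions\<close>

datatype recf =
    Zero
  | Succ
  | Proj nat
  | Comp recf "recf list"
  | PrimRec recf recf
  | Mu recf

text \<open>\<open>computes f xs y\<close>: the program \<open>f\<close> halts on the arguments \<open>xs\<close> with value \<open>y\<close>.\<close>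

inductive computes :: "recf \<Rightarrow> nat list \<Rightarrow> nat \<Rightarrow> bool" where
  "computes Zero xs 0"
| "computes Succ (x # xs) (Suc x)"
| "i < length xs \<Longrightarrow> computes (Proj i) xs (xs ! i)"
| "list_all2 (\<lambda>g y. computes g xs y) gs ys \<Longrightarrow> computes f ys z \<Longrightarrow> computes (Comp f gs) xs z"
| "computes f xs y \<Longrightarrow> computes (PrimRec f g) (0 # xs) y"
| "computes (PrimRec f g) (m # xs) y \<Longrightarrow> computes g (m # y # xs) z \<Longrightarrow>
     computes (PrimRec f g) (Suc m # xs) z"
| "computes f (m # xs) 0 \<Longrightarrow> (\<forall>k<m. \<exists>y. computes f (k # xs) (Suc y)) \<Longrightarrow> computes (Mu f) xs m"
monos list_all2_mono


subsection \<open>Effectively presented subfields\<close>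

definition is_subfield :: "'k::field set \<Rightarrow> bool" where
  "is_subfield F \<longleftrightarrow> 0 \<in> F \<and> 1 \<in> F \<and> (\<forall>x\<in>F. \<forall>y\<in>F. x - y \<in> F \<and> x * y \<in> F) \<and>
     (\<forall>x\<in>F. inverse x \<in> F)"

text \<open>
  To speak of algorithms one must say how field elements are given. Only finitely many elements of
  the ambient field matter at a time, so they are taken in a subfield that is finitely generated
  over the prime field, and named there by natural numbers (possibly several for one element) such
  that addition, multiplication and equality are computable on names. Negatives and inverses are
  then computable by unbounded search.
\<close>

definition effective_presentation :: "(nat \<Rightarrow> 'k::field) \<Rightarrow> bool" where
  "effective_presentation \<nu> \<longleftrightarrow>
     (\<exists>B. finite B \<and> range \<nu> = is_subfield hull B) \<and>
     (\<exists>f. \<forall>i j. \<exists>k. computes f [i, j] k \<and> \<nu> k = \<nu> i + \<nu> j) \<and>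
     (\<exists>f. \<forall>i j. \<exists>k. computes f [i, j] k \<and> \<nu> k = \<nu> i * \<nu> j) \<and>
     (\<exists>f. \<forall>i j. computes f [i, j] (if \<nu> i = \<nu> j then 1 else 0))"

text \<open>
  Finite description of a set \<open>(\<pi>\<^sub>0, \<dots>, \<pi>\<^sub>h)\<^sub>q S(G)\<close>: names of homogeneous
  coordinates of \<open>\<pi>\<^sub>0\<close> and of \<open>\<pi>\<^sub>1, \<dots>, \<pi>\<^sub>h\<close>, and the equations
  \<open>X\<^sub>i = X\<^sub>j\<close> of \<open>S\<close>.
\<close>

type_synonym descr = "nat list \<times> nat list list \<times> (nat \<times> nat) list"

fun denote :: "nat \<Rightarrow> (nat \<Rightarrow> 'k::field) \<Rightarrow> descr \<Rightarrow> 'k point \<times> 'k point list \<times> 'k point set" where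
  "denote n \<nu> (v0, vs, E) =
     (ppoint (map \<nu> v0), map (\<lambda>v. ppoint (map \<nu> v)) vs, equal_coords n (set E))"

fun equations_in_range :: "nat \<Rightarrow> descr \<Rightarrow> bool" where
  "equations_in_range n (v0, vs, E) \<longleftrightarrow> set E \<subseteq> {..n} \<times> {..n}"

definition vecs_code :: "nat list list \<Rightarrow> nat" where
  "vecs_code vs = list_encode (map list_encode vs)"

fun descr_code :: "descr \<Rightarrow> nat" where
  "descr_code (v0, vs, E) =
     list_encode [list_encode v0, vecs_code vs, list_encode (map prod_encode E)]"

text \<open>
  The algorithm \<open>A\<close> receives \<open>n\<close>, the coefficients of linear forms defining \<open>V\<close>
  and generators of \<open>G\<close>, and returns the exponent \<open>e\<close> of \<open>q = p ^ e\<close> together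
  with descriptions of finitely many sets whose union is \<open>V(G)\<close>. It may depend on the
  presented subfield, but not on \<open>n\<close>, \<open>V\<close>, \<open>G\<close>.
\<close>

definition computes_decompositions :: "nat \<Rightarrow> (nat \<Rightarrow> 'k::field) \<Rightarrow> recf \<Rightarrow> bool" where
  "computes_decompositions p \<nu> A \<longleftrightarrow>
     (\<forall>n rows gs.
        let V = linear_variety n (map \<nu> ` set rows); G = mult_subgroup hull (\<nu> ` set gs) in
        n \<ge> 2 \<and> (\<forall>r\<in>set rows. length r = n + 1) \<and> 0 \<notin> \<nu> ` set gs \<and>
        fin_gen (root_closure G) \<and> root_closure G \<subseteq> range \<nu> \<longrightarrow>
        (\<exists>e ds. computes A [n, vecs_code rows, list_encode gs]
                   (prod_encode (e, list_encode (map descr_code ds))) \<and>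
                e > 0 \<and> (\<forall>d\<in>set ds. equations_in_range n d) \<and>
                is_decomposition n (p ^ e) G V (denote n \<nu> ` set ds)))"

end

theory Submission
  imports Defs "HOL-Computational_Algebra.Primes" "HOL-Library.Countable_Set"
begin

text \<open>
  Let \<open>\<Gamma>\<close> be the radical of \<open>G\<close>, let \<open>F\<close> be a finitely generated field containing \<open>\<Gamma>\<close> and
  the coefficients of \<open>V\<close>, and regard \<open>V\<close> as a linear space over \<open>F\<close>. The points of \<open>V\<close> over \<open>\<Gamma>\<close>
  in a given class modulo \<open>p\<^sup>m\<close>-th powers correspond, by expanding the equations in a basis over
  the \<open>p\<^sup>m\<close>-th powers, to points over \<open>\<Gamma>\<close> of another linear space, the descent of \<open>V\<close>. If for
  some \<open>m\<close> all descents have smaller dimension, induction on the dimension applies. Otherwise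
  finite generation of \<open>\<Gamma>\<close> and \<open>F\<close> makes \<open>V\<close> isotrivial: some point over \<open>\<Gamma>\<close> translates it to
  a space defined over a finite field. Then a power of Frobenius acts on \<open>V\<close>, all but one of the
  descents have smaller dimension (up to factors constant on blocks of coordinates), and iterating
  Frobenius over the solutions coming from these produces one further \<open>\<pi>\<^sub>i\<close>.

  To return from \<open>\<Gamma>\<close> to \<open>G\<close>, choose \<open>q\<close> with \<open>q\<^sup>2 \<equiv> q\<close> modulo an exponent of \<open>\<Gamma> / G\<close>: then the class
  of a product modulo \<open>G\<close> depends only on which of the indices \<open>l\<^sub>j\<close> vanish.

  Every choice made on the way is witnessed by a finite certificate whose correctness is a
  recursively enumerable condition and which by itself guarantees the decomposition. As a
  certificate always exists, an unbounded search for one is an algorithm.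
\<close>

text \<open>Dimension is counted by the positions of leading entries (\<open>piv\<close>), because
  these survive Frobenius and multiplication by nonzero coordinates. So descent never raises the
  dimension, and if it keeps it, the entries of the reduced basis are \<open>p ^ m\<close>-th powers
  up to factors from \<Gamma>. That such entries for all \<open>m\<close> lie in \<Gamma> itself
  rests on the finiteness of \<open>F\<close> over its \<open>p\<close>-th powers: an operator of
  Cartier type keeps all successive roots in one finite set. Block factors are unavoidable: a linear
  space may split over disjoint sets of coordinates, and each summand scales independently. The
  obstacle to effectivity lies in negative conditions, namely independence of generators and
  non-membership in \<open>G\<close>. They become positive through coordinates in a basis over the
  \<open>p\<close>-th powers and through classes modulo \<open>N\<close>-th powers. The covering
  part of a certificate bounds V(G) only from above; the opposite inclusion is an infinite family of
  linear conditions, which exponents up to \<open>n\<close> already imply. The bound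
  \<open>n - 1\<close> arises because each moving point costs one dimension, while the full space
  has none.\<close>

lemma prod_decode_0: "prod_decode 0 = (0, 0)"
  using prod_encode_inverse[of "(0, 0)"] by (simp add: prod_encode_def)

section \<open>Total functions computed by programs, and Cantor pairing\<close>

definition prog :: "nat \<Rightarrow> (nat list \<Rightarrow> nat) \<Rightarrow> bool" where
  "prog k f \<longleftrightarrow> (\<exists>r. \<forall>xs. length xs = k \<longrightarrow> computes r xs (f xs))"

lemma prog_proj: "i < k \<Longrightarrow> prog k (\<lambda>xs. xs ! i)"
  unfolding prog_def by (auto intro: computes.intros)

lemma prog_comp:
  assumes "prog (length gs) f" "\<And>g. g \<in> set gs \<Longrightarrow> prog k g"
  shows "prog k (\<lambda>xs. f (map (\<lambda>g. g xs) gs))"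
proof -
  obtain r where r: "\<And>xs. length xs = length gs \<Longrightarrow> computes r xs (f xs)"
    using assms(1) unfolding prog_def by blast
  obtain h where h: "\<And>g xs. g \<in> set gs \<Longrightarrow> length xs = k \<Longrightarrow> computes (h g) xs (g xs)"
    using assms(2) unfolding prog_def by metis
  have "computes (Comp r (map h gs)) xs (f (map (\<lambda>g. g xs) gs))" if "length xs = k" for xs
    by (rule computes.intros(4)[where ys = "map (\<lambda>g. g xs) gs"])
       (auto simp: list_all2_conv_all_nth intro!: h that r)
  thus ?thesis unfolding prog_def by blast
qed

lemma prog_comp1: "prog 1 f \<Longrightarrow> prog k g \<Longrightarrow> prog k (\<lambda>xs. f [g xs])"
  using prog_comp[of "[g]" f k] by simp

lemma prog_comp2: "prog 2 f \<Longrightarrow> prog k g \<Longrightarrow> prog k h \<Longrightarrow> prog k (\<lambda>xs. f [g xs, h xs])"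
  by (rule prog_comp[of "[g, h]" f k, simplified]) (auto simp: numeral_2_eq_2)

lemma prog_primrec:
  assumes "prog k f" "prog (k + 2) g"
  shows "prog (Suc k) (\<lambda>xs. rec_nat (f (tl xs)) (\<lambda>m y. g (m # y # tl xs)) (hd xs))"
proof -
  obtain r where r: "\<And>xs. length xs = k \<Longrightarrow> computes r xs (f xs)"
    using assms(1) unfolding prog_def by blast
  obtain s where s: "\<And>xs. length xs = k + 2 \<Longrightarrow> computes s xs (g xs)"
    using assms(2) unfolding prog_def by blast
  have "computes (PrimRec r s) (m # xs) (rec_nat (f xs) (\<lambda>m y. g (m # y # xs)) m)"
    if "length xs = k" for m xs
    by (induction m) (use r s that in \<open>auto intro: computes.intros\<close>)
  hence "computes (PrimRec r s) xs (rec_nat (f (tl xs)) (\<lambda>m y. g (m # y # tl xs)) (hd xs))"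
    if "length xs = Suc k" for xs
    using that by (cases xs) auto
  thus ?thesis unfolding prog_def by blast
qed

lemma prog_const: "prog k (\<lambda>xs. c)"
proof (induction c)
  case 0
  show ?case unfolding prog_def by (auto intro: computes.intros)
next
  case (Suc c)
  have "prog 1 (\<lambda>xs. Suc (xs ! 0))"
    unfolding prog_def by (auto simp: length_Suc_conv intro!: exI[of _ Succ] computes.intros)
  from prog_comp1[OF this Suc] show ?case by simp
qed

lemma prog_Suc: "prog k f \<Longrightarrow> prog k (\<lambda>xs. Suc (f xs))"
proof -
  have "prog 1 (\<lambda>xs. Suc (xs ! 0))"
    unfolding prog_def by (auto simp: length_Suc_conv intro!: exI[of _ Succ] computes.intros)
  thus "prog k f \<Longrightarrow> prog k (\<lambda>xs. Suc (f xs))" using prog_comp1 by fastforce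
qed

text \<open>A single parameter \<open>b\<close> is enough: several parameters can be packed into it
  by \<open>prod_encode\<close>, as in \<open>prog_If\<close>.\<close>

lemma prog_rec2:
  assumes "prog k a" "prog k b" "prog 1 f" "prog 3 g"
  shows "prog k (\<lambda>xs. rec_nat (f [b xs]) (\<lambda>m y. g [m, y, b xs]) (a xs))"
proof -
  have "prog 2 (\<lambda>xs. rec_nat (f (tl xs)) (\<lambda>m y. g (m # y # tl xs)) (hd xs))"
    using prog_primrec[OF assms(3), of g] assms(4) by (simp add: numeral_2_eq_2 numeral_3_eq_3)
  from prog_comp2[OF this assms(1,2)] show ?thesis by simp
qed

lemma prog_add:
  assumes "prog k a" "prog k b"
  shows "prog k (\<lambda>xs. a xs + b xs)"
proof -
  have "rec_nat ([n] ! 0) (\<lambda>i y. Suc ([i, y, n] ! 1)) m = m + n" for m n :: nat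
    by (induction m) auto
  with prog_rec2[OF assms, of "\<lambda>xs. xs ! 0" "\<lambda>xs. Suc (xs ! 1)"] show ?thesis
    by (simp add: prog_proj prog_Suc del: nth_Cons_Suc)
qed

lemma prog_pred:
  assumes "prog k a"
  shows "prog k (\<lambda>xs. a xs - 1)"
proof -
  have "rec_nat 0 (\<lambda>i y. [i, y, n] ! 0) m = m - 1" for m n :: nat
    by (cases m) auto
  with prog_rec2[OF assms assms, of "\<lambda>xs. 0" "\<lambda>xs. xs ! 0"] show ?thesis
    by (simp add: prog_proj prog_const)
qed

lemma prog_diff:
  assumes "prog k a" "prog k b"
  shows "prog k (\<lambda>xs. a xs - b xs)"
proof -
  have "rec_nat ([n] ! 0) (\<lambda>i y. [i, y, n] ! 1 - 1) m = n - m" for m n :: nat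
    by (induction m) auto
  with prog_rec2[OF assms(2,1), of "\<lambda>xs. xs ! 0" "\<lambda>xs. xs ! 1 - 1"] show ?thesis
    by (simp add: prog_proj prog_pred del: nth_Cons_Suc One_nat_def)
qed

lemma prog_triangle:
  assumes "prog k a"
  shows "prog k (\<lambda>xs. triangle (a xs))"
proof -
  have "rec_nat 0 (\<lambda>i y. [i, y, n] ! 1 + Suc ([i, y, n] ! 0)) m = triangle m" for m n :: nat
    by (induction m) auto
  with prog_rec2[OF assms assms, of "\<lambda>xs. 0" "\<lambda>xs. xs ! 1 + Suc (xs ! 0)"] show ?thesis
    by (simp add: prog_proj prog_const prog_add prog_Suc del: nth_Cons_Suc add_Suc_right One_nat_def)
qed

text \<open>The index of the diagonal of Cantor's enumeration on which a number lies.\<close>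

definition diag :: "nat \<Rightarrow> nat" where
  "diag z = rec_nat 0 (\<lambda>m y. y + (1 - (triangle (Suc y) - Suc m))) z"

lemma diag_bounds: "triangle (diag z) \<le> z \<and> z < triangle (Suc (diag z))"
proof (induction z)
  case (Suc z)
  have "diag (Suc z) = diag z + (1 - (triangle (Suc (diag z)) - Suc z))" by (simp add: diag_def)
  hence "diag (Suc z) = (if triangle (Suc (diag z)) \<le> Suc z then Suc (diag z) else diag z)"
    by (simp del: triangle_Suc)
  with Suc show ?case by auto
qed (simp add: diag_def)

text \<open>The code lies between the triangular numbers of \<open>m + n\<close> and
  \<open>m + n + 1\<close>, and \<open>diag_bounds\<close> leaves only one diagonal for it.\<close>

lemma diag_prod_encode: "diag (prod_encode (m, n)) = m + n"
proof -
  let ?z = "prod_encode (m, n)"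
  have mono: "triangle a \<le> triangle b" if "a \<le> b" for a b
    using that by (induction rule: dec_induct) auto
  have "triangle (m + n) \<le> ?z" "?z < triangle (Suc (m + n))" by (auto simp: prod_encode_def)
  with diag_bounds[of ?z] have "\<not> Suc (diag ?z) \<le> m + n" "\<not> Suc (m + n) \<le> diag ?z"
    using mono by (metis leD le_less_trans)+
  thus ?thesis by linarith
qed

lemma prog_diag:
  assumes "prog k a"
  shows "prog k (\<lambda>xs. diag (a xs))"
proof -
  let ?g = "\<lambda>xs :: nat list. xs ! 1 + (1 - (triangle (Suc (xs ! 1)) - Suc (xs ! 0)))"
  have "prog 3 ?g"
    by (intro prog_add prog_diff prog_const prog_triangle prog_Suc prog_proj) auto
  with prog_rec2[OF assms assms, of "\<lambda>xs. 0" ?g] show ?thesis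
    by (simp add: diag_def prog_const)
qed

lemma prog_prod_encode: "prog k a \<Longrightarrow> prog k b \<Longrightarrow> prog k (\<lambda>xs. prod_encode (a xs, b xs))"
  by (auto simp: prod_encode_def intro!: prog_add prog_triangle)

text \<open>Once the diagonal is known, decoding is truncated subtraction; this is what makes the
  projections programmable.\<close>

lemma fst_prod_decode: "fst (prod_decode z) = z - triangle (diag z)"
  and snd_prod_decode: "snd (prod_decode z) = diag z - fst (prod_decode z)"
proof -
  obtain m n where z: "z = prod_encode (m, n)" by (metis prod_decode_inverse surj_pair)
  have "prod_encode (m, n) - triangle (m + n) = m" by (simp add: prod_encode_def)
  thus "fst (prod_decode z) = z - triangle (diag z)"
       "snd (prod_decode z) = diag z - fst (prod_decode z)"
    unfolding z diag_prod_encode by simp_all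
qed

lemma prog_fst: "prog k a \<Longrightarrow> prog k (\<lambda>xs. fst (prod_decode (a xs)))"
  unfolding fst_prod_decode by (intro prog_diff prog_triangle prog_diag)

lemma prog_snd: "prog k a \<Longrightarrow> prog k (\<lambda>xs. snd (prod_decode (a xs)))"
  unfolding snd_prod_decode by (intro prog_diff prog_diag prog_fst)

text \<open>A case distinction is a recursion that ignores its previous value: the start value is
  one branch, every later value the other. Both branches travel in the single parameter of
  \<open>prog_rec2\<close>.\<close>

lemma prog_If:
  assumes "prog k c" "prog k a" "prog k b"
  shows "prog k (\<lambda>xs. if c xs = 0 then b xs else a xs)"
proof -
  have "rec_nat ([prod_encode (u, v)] ! 0 - [prod_encode (u, v)] ! 0 + snd (prod_decode ([prod_encode (u, v)] ! 0)))
          (\<lambda>i y. fst (prod_decode ([i, y, prod_encode (u, v)] ! 2))) m = (if m = 0 then v else u)" for m u v :: nat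
    by (cases m) (auto simp: numeral_2_eq_2)
  with prog_rec2[OF assms(1) prog_prod_encode[OF assms(2,3)], of "\<lambda>xs. xs ! 0 - xs ! 0 + snd (prod_decode (xs ! 0))"
      "\<lambda>xs. fst (prod_decode (xs ! 2))"]
  show ?thesis
    by (simp add: prog_proj prog_fst prog_snd prog_add prog_diff)
qed


subsection \<open>Computable functions on coded types\<close>

text \<open>A bijection, not merely an injection: every number then names a value, so no validity
  tests arise and a search over numbers is a search over values.\<close>

class coded =
  fixes enc :: "'a \<Rightarrow> nat"
  assumes bij_enc: "bij enc"
begin

definition denc :: "nat \<Rightarrow> 'a" where "denc = the_inv enc"

lemma enc_eq_iff [simp]: "enc x = enc y \<longleftrightarrow> x = y"
  using bij_enc by (simp add: bij_def inj_eq)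

lemma denc_enc [simp]: "denc (enc x) = x"
  unfolding denc_def using bij_enc by (simp add: bij_def the_inv_f_f)

lemma enc_denc [simp]: "enc (denc m) = m"
  unfolding denc_def using bij_enc f_the_inv_into_f_bij_betw by fastforce

end

instantiation nat :: coded
begin
definition enc_nat :: "nat \<Rightarrow> nat" where [simp]: "enc_nat x = x"
instance by standard (simp add: enc_nat_def[abs_def] bij_def inj_def surj_def)
end

instantiation prod :: (coded, coded) coded
begin
definition enc_prod :: "'a \<times> 'b \<Rightarrow> nat" where "enc_prod z = prod_encode (enc (fst z), enc (snd z))"
instance
proof
  have "\<exists>x :: 'a \<times> 'b. m = enc x" for m
    by (rule exI[of _ "(denc (fst (prod_decode m)), denc (snd (prod_decode m)))"]) (simp add: enc_prod_def)
  thus "bij (enc :: 'a \<times> 'b \<Rightarrow> nat)"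
    by (auto simp: bij_def inj_def surj_def enc_prod_def[abs_def] prod_eq_iff)
qed
end

instantiation list :: (coded) coded
begin
definition enc_list :: "'a list \<Rightarrow> nat" where "enc_list xs = list_encode (map enc xs)"
instance
proof
  have "\<exists>x :: 'a list. m = enc x" for m
    by (rule exI[of _ "map denc (list_decode m)"]) (simp add: enc_list_def o_def)
  moreover have "inj (enc :: 'a list \<Rightarrow> nat)"
    using inj_map_eq_map[OF bij_is_inj[OF bij_enc[where 'a = 'a]]]
    by (auto simp: inj_def enc_list_def list_encode_eq)
  ultimately show "bij (enc :: 'a list \<Rightarrow> nat)" by (auto simp: bij_def surj_def)
qed
end

definition computable :: "('a::coded \<Rightarrow> 'b::coded) \<Rightarrow> bool" where
  "computable f \<longleftrightarrow> prog 1 (\<lambda>xs. enc (f (denc (xs ! 0))))"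

named_theorems computable_intros

lemma computable_prog:
  assumes "computable f" "prog k g"
  shows "prog k (\<lambda>xs. enc (f (denc (g xs))))"
  using prog_comp1[OF assms(1)[unfolded computable_def] assms(2)] by simp

lemma computable_const [computable_intros]: "computable (\<lambda>x. c)"
  unfolding computable_def by (rule prog_const)

lemma computable_id [computable_intros]: "computable (\<lambda>x. x)"
  unfolding computable_def by (simp add: prog_proj)

lemma computable_comp:
  assumes "computable f" "computable g"
  shows "computable (\<lambda>x. f (g x))"
  using computable_prog[OF assms(1) assms(2)[unfolded computable_def]]
  unfolding computable_def by simp

lemma computable_Pair [computable_intros]:
  "computable f \<Longrightarrow> computable g \<Longrightarrow> computable (\<lambda>x. (f x, g x))"
  unfolding computable_def enc_prod_def by (auto intro: prog_prod_encode)

lemma computable_fst [computable_intros]: "computable f \<Longrightarrow> computable (\<lambda>x. fst (f x))"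
  unfolding computable_def by (drule prog_fst) (simp add: enc_prod_def)

lemma computable_snd [computable_intros]: "computable f \<Longrightarrow> computable (\<lambda>x. snd (f x))"
  unfolding computable_def by (drule prog_snd) (simp add: enc_prod_def)

lemma computable_enc [computable_intros]: "computable f \<Longrightarrow> computable (\<lambda>x. enc (f x))"
  unfolding computable_def by simp

lemma computable_denc [computable_intros]: "computable f \<Longrightarrow> computable (\<lambda>x. denc (f x))"
  unfolding computable_def by simp

text \<open>The recursion scheme behind products, powers, bounded quantifiers and
  \<open>foldl\<close>: each is written as an iteration whose number of rounds is computable
  beforehand.\<close>

lemma computable_funpow [computable_intros]:
  fixes F :: "'a::coded \<Rightarrow> 'b::coded \<Rightarrow> 'b"
  assumes "computable N" "computable a" "computable (\<lambda>z. F (fst z) (snd z))"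
  shows "computable (\<lambda>x. (F x ^^ N x) (a x))"
proof -
  define f where "f = (\<lambda>xs. enc (a (denc (xs ! 0))))"
  define g where "g = (\<lambda>xs. enc (F (denc (xs ! 2)) (denc (xs ! 1))))"
  have "denc (prod_encode (u, v)) = (denc u :: 'a, denc v :: 'b)" for u v
    by (metis enc_prod_def denc_enc enc_denc fst_conv snd_conv)
  moreover have "prog 3 (\<lambda>xs. prod_encode (xs ! 2, xs ! 1))"
    by (intro prog_prod_encode prog_proj) auto
  ultimately have g: "prog 3 g"
    using computable_prog[OF assms(3), of 3 "\<lambda>xs. prod_encode (xs ! 2, xs ! 1)"]
    unfolding g_def by simp
  have f: "prog 1 f" and N: "prog 1 (\<lambda>xs. enc (N (denc (xs ! 0))))"
    using assms(1,2) unfolding computable_def f_def by blast+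
  have "rec_nat (f [x]) (\<lambda>m y. g [m, y, x]) m = enc ((F (denc x) ^^ m) (a (denc x)))" for x m
    by (induction m) (simp_all add: f_def g_def numeral_2_eq_2)
  with prog_rec2[OF N prog_proj[OF zero_less_one] f g] show ?thesis
    unfolding computable_def by (simp only: enc_nat_def)
qed

lemma computable_Suc [computable_intros]: "computable f \<Longrightarrow> computable (\<lambda>x. Suc (f x))"
  unfolding computable_def by (simp add: prog_Suc)

lemma computable_add [computable_intros]:
  "computable f \<Longrightarrow> computable g \<Longrightarrow> computable (\<lambda>x. f x + g x :: nat)"
  unfolding computable_def by (simp add: prog_add)

lemma computable_diff [computable_intros]:
  "computable f \<Longrightarrow> computable g \<Longrightarrow> computable (\<lambda>x. f x - g x :: nat)"
  unfolding computable_def by (simp add: prog_diff)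

lemma computable_mult [computable_intros]:
  assumes "computable f" "computable g"
  shows "computable (\<lambda>x. f x * g x :: nat)"
proof -
  have "((\<lambda>y. y + b) ^^ a) 0 = a * b" for a b :: nat by (induction a) auto
  moreover have "computable (\<lambda>x. ((\<lambda>y. y + g x) ^^ f x) 0)"
    by (intro computable_intros assms computable_comp[OF assms(2)])
  ultimately show ?thesis by simp
qed

lemma computable_power [computable_intros]:
  assumes "computable f" "computable g"
  shows "computable (\<lambda>x. f x ^ g x :: nat)"
proof -
  have "((\<lambda>y. y * b) ^^ a) (Suc 0) = b ^ a" for a b :: nat by (induction a) auto
  moreover have "computable (\<lambda>x. ((\<lambda>y. y * f x) ^^ g x) (Suc 0))"
    by (intro computable_intros assms computable_comp[OF assms(1)])
  ultimately show ?thesis by simp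
qed

lemma computable_case_nat_0:
  "computable c \<Longrightarrow> computable f \<Longrightarrow> computable g \<Longrightarrow>
     computable (\<lambda>x. if c x = (0::nat) then g x else f x)"
  using prog_If[of 1 "\<lambda>xs. enc (c (denc (xs ! 0)))" "\<lambda>xs. enc (f (denc (xs ! 0)))"
      "\<lambda>xs. enc (g (denc (xs ! 0)))"]
  unfolding computable_def by (simp add: if_distrib)

definition decidable :: "('a::coded \<Rightarrow> bool) \<Rightarrow> bool" where
  "decidable P \<longleftrightarrow> computable (\<lambda>x. if P x then 1 else 0 :: nat)"

lemma computable_If [computable_intros]:
  assumes "decidable P" "computable f" "computable g"
  shows "computable (\<lambda>x. if P x then f x else g x)"
proof -
  have "(if (if P x then 1 else 0) = (0::nat) then g x else f x) = (if P x then f x else g x)" for x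
    by simp
  with computable_case_nat_0[OF assms(1)[unfolded decidable_def] assms(2,3)] show ?thesis by simp
qed

lemma decidable_comp: "decidable P \<Longrightarrow> computable f \<Longrightarrow> decidable (\<lambda>x. P (f x))"
  unfolding decidable_def by (rule computable_comp)

lemma decidable_le [computable_intros]:
  assumes "computable f" "computable g"
  shows "decidable (\<lambda>x. (f x :: nat) \<le> g x)"
proof -
  have "computable (\<lambda>x. 1 - (f x - g x))" by (intro computable_intros assms)
  moreover have "1 - (a - b) = (if a \<le> b then 1 else 0)" for a b :: nat by simp
  ultimately show ?thesis unfolding decidable_def by simp
qed

lemma decidable_not [computable_intros]: "decidable P \<Longrightarrow> decidable (\<lambda>x. \<not> P x)"
proof -
  assume "decidable P"
  hence "computable (\<lambda>x. 1 - (if P x then 1 else 0 :: nat))"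
    unfolding decidable_def by (rule computable_diff[OF computable_const])
  moreover have "1 - (if Q then 1 else 0 :: nat) = (if \<not> Q then 1 else 0)" for Q by simp
  ultimately show ?thesis unfolding decidable_def by simp
qed

lemma decidable_conj [computable_intros]:
  assumes "decidable P" "decidable Q" shows "decidable (\<lambda>x. P x \<and> Q x)"
proof -
  have "computable (\<lambda>x. (if P x then 1 else 0) * (if Q x then 1 else 0 :: nat))"
    using assms unfolding decidable_def by (rule computable_mult)
  moreover have "(if P then 1 else 0) * (if Q then 1 else 0 :: nat) = (if P \<and> Q then 1 else 0)" for P Q
    by simp
  ultimately show ?thesis unfolding decidable_def by simp
qed

lemma decidable_disj [computable_intros]:
  assumes "decidable P" "decidable Q" shows "decidable (\<lambda>x. P x \<or> Q x)"
proof -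
  have "decidable (\<lambda>x. \<not> (\<not> P x \<and> \<not> Q x))" by (intro computable_intros assms)
  thus ?thesis by simp
qed

lemma decidable_less [computable_intros]:
  assumes "computable f" "computable g"
  shows "decidable (\<lambda>x. (f x :: nat) < g x)"
proof -
  have "decidable (\<lambda>x. Suc (f x) \<le> g x)" by (intro computable_intros assms)
  thus ?thesis by (simp add: Suc_le_eq)
qed

lemma decidable_eq [computable_intros]:
  assumes "computable f" "computable g"
  shows "decidable (\<lambda>x. f x = g x)"
proof -
  have "decidable (\<lambda>x. enc (f x) \<le> enc (g x) \<and> enc (g x) \<le> enc (f x))"
    by (intro computable_intros assms)
  moreover have "enc a \<le> enc b \<and> enc b \<le> enc a \<longleftrightarrow> a = b" for a b :: 'b
    by (metis enc_eq_iff order_antisym order_refl)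
  ultimately show ?thesis by simp
qed

lemma decidable_all_less [computable_intros]:
  fixes P :: "'a::coded \<Rightarrow> nat \<Rightarrow> bool"
  assumes "computable N" "decidable (\<lambda>z. P (fst z) (snd z))"
  shows "decidable (\<lambda>x. \<forall>i<N x. P x i)"
proof -
  let ?F = "\<lambda>x z. (Suc (fst z), if P x (fst z) then snd z else 0 :: nat)"
  have iter: "(?F x ^^ m) (0, 1) = (m, if \<forall>i<m. P x i then 1 else 0)" for x m
    by (induction m) (auto simp: less_Suc_eq)
  have "computable (\<lambda>x. snd ((?F x ^^ N x) (0, 1)))"
    by (intro computable_intros assms(1) decidable_comp[OF assms(2),
          of "\<lambda>z. (fst z, fst (snd z))", simplified])
  thus ?thesis unfolding iter decidable_def by simp
qed

lemma decidable_ex_less [computable_intros]: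
  fixes P :: "'a::coded \<Rightarrow> nat \<Rightarrow> bool"
  assumes "computable N" "decidable (\<lambda>z. P (fst z) (snd z))"
  shows "decidable (\<lambda>x. \<exists>i<N x. P x i)"
proof -
  have "decidable (\<lambda>x. \<not> (\<forall>i<N x. \<not> P x i))"
    by (intro computable_intros assms)
  thus ?thesis by simp
qed


subsubsection \<open>Lists\<close>

lemma enc_Nil [simp]: "enc [] = 0"
  by (simp add: enc_list_def)

lemma enc_Cons: "enc (x # xs) = Suc (prod_encode (enc x, enc xs))"
  by (simp add: enc_list_def)

text \<open>The code of a list bounds the number of rounds of a loop over it, and it is available
  before any list function is known to be computable.\<close>

lemma length_le_enc: "length xs \<le> enc xs"
proof (induction xs)
  case (Cons x xs)
  have "enc xs \<le> prod_encode (enc x, enc xs)" by (rule le_prod_encode_2)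
  with Cons show ?case by (simp add: enc_Cons)
qed simp

lemma computable_Cons [computable_intros]:
  "computable f \<Longrightarrow> computable g \<Longrightarrow> computable (\<lambda>x. f x # g x)"
  unfolding computable_def enc_Cons by (auto intro: prog_prod_encode prog_Suc)

lemma computable_tl [computable_intros]:
  assumes "computable f" shows "computable (\<lambda>x. tl (f x))"
proof -
  have "enc (tl l) = snd (prod_decode (enc l - 1))" for l :: "'b list"
    by (cases l) (simp_all add: enc_Cons prod_decode_0)
  with assms prog_snd[OF prog_pred[OF assms[unfolded computable_def]]] show ?thesis
    unfolding computable_def by simp
qed

definition head :: "'a::coded list \<Rightarrow> 'a" where
  "head l = (case l of [] \<Rightarrow> denc 0 | x # _ \<Rightarrow> x)"

lemma head_Cons [simp]: "head (x # xs) = x"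
  by (simp add: head_def)

lemma computable_head [computable_intros]:
  assumes "computable f" shows "computable (\<lambda>x. head (f x))"
proof -
  have "enc (head l) = fst (prod_decode (enc l - 1))" for l :: "'b list"
    by (cases l) (simp_all add: head_def enc_Cons prod_decode_0)
  with assms prog_fst[OF prog_pred[OF assms[unfolded computable_def]]] show ?thesis
    unfolding computable_def by simp
qed

text \<open>The state carries the accumulator and the unread rest. Running \<open>enc (l x)\<close>
  rounds may be too many, but a state with empty rest no longer changes.\<close>

lemma computable_foldl [computable_intros]:
  assumes "computable a" "computable l" "computable (\<lambda>z. F (fst z) (fst (snd z)) (snd (snd z)))"
  shows "computable (\<lambda>x. foldl (F x) (a x) (l x))"
proof -
  let ?S = "\<lambda>x z. if snd z = [] then z else (F x (fst z) (head (snd z)), tl (snd z))"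
  have iter: "(?S x ^^ m) (b, ys) = (foldl (F x) b ys, [])" if "length ys \<le> m" for x m b ys
    using that
  proof (induction m arbitrary: b ys)
    case (Suc m)
    show ?case
    proof (cases ys)
      case Nil
      hence "(?S x ^^ m) (b, ys) = (b, [])" using Suc.IH[of ys b] by simp
      thus ?thesis using Nil by simp
    next
      case (Cons y zs)
      have "(?S x ^^ Suc m) (b, ys) = (?S x ^^ m) (?S x (b, ys))"
        by (simp only: funpow_Suc_right o_apply)
      also have "?S x (b, ys) = (F x b y, zs)" using Cons by simp
      also have "(?S x ^^ m) (F x b y, zs) = (foldl (F x) (F x b y) zs, [])"
        using Suc.prems Cons by (intro Suc.IH) simp
      finally show ?thesis using Cons by (simp only: foldl_Cons)
    qed
  qed simp
  have "computable (\<lambda>x. fst ((?S x ^^ enc (l x)) (a x, l x)))"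
    by (intro computable_intros assms(1,2) computable_comp[OF assms(3),
          of "\<lambda>z. (fst z, fst (snd z), head (snd (snd z)))", simplified])
  thus ?thesis unfolding iter[OF length_le_enc] by simp
qed

lemma computable_rev [computable_intros]:
  assumes "computable l" shows "computable (\<lambda>x. rev (l x))"
proof -
  have "foldl (\<lambda>acc y. y # acc) [] ys = rev ys" for ys :: "'b list"
    by (simp add: foldl_conv_fold fold_Cons_rev)
  moreover have "computable (\<lambda>x. foldl (\<lambda>acc y. y # acc) [] (l x))"
    by (intro computable_intros assms)
  ultimately show ?thesis by simp
qed

lemma computable_map [computable_intros]:
  assumes "computable l" "computable (\<lambda>z. F (fst z) (snd z))"
  shows "computable (\<lambda>x. map (F x) (l x))"
proof -
  have "foldl (\<lambda>acc y. F x y # acc) acc ys = rev (map (F x) ys) @ acc" for x ys acc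
    by (induction ys arbitrary: acc) auto
  moreover have "computable (\<lambda>x. rev (foldl (\<lambda>acc y. F x y # acc) [] (l x)))"
    by (intro computable_intros assms(1) computable_comp[OF assms(2),
          of "\<lambda>z. (fst z, snd (snd z))", simplified])
  ultimately show ?thesis by simp
qed

lemma computable_append [computable_intros]:
  assumes "computable l" "computable k" shows "computable (\<lambda>x. l x @ k x)"
proof -
  have "foldl (\<lambda>acc y. y # acc) k l = rev l @ k" for l k :: "'b list"
    by (induction l arbitrary: k) auto
  moreover have "computable (\<lambda>x. foldl (\<lambda>acc y. y # acc) (k x) (rev (l x)))"
    by (intro computable_intros assms)
  ultimately show ?thesis by simp
qed

lemma computable_concat [computable_intros]:
  assumes "computable l" shows "computable (\<lambda>x. concat (l x))"
proof -
  have "foldl (@) acc ys = acc @ concat ys" for acc :: "'b list" and ys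
    by (induction ys arbitrary: acc) auto
  moreover have "computable (\<lambda>x. foldl (\<lambda>a b. a @ b) [] (l x))"
    by (intro computable_intros assms)
  ultimately show ?thesis by simp
qed

lemma computable_length [computable_intros]:
  assumes "computable l" shows "computable (\<lambda>x. length (l x))"
proof -
  have "foldl (\<lambda>a b. Suc a) k ys = k + length ys" for k and ys :: "'b list"
    by (induction ys arbitrary: k) auto
  moreover have "computable (\<lambda>x. foldl (\<lambda>a b. Suc a) 0 (l x))"
    by (intro computable_intros assms)
  ultimately show ?thesis by simp
qed

text \<open>A total lookup: \<open>nth\<close> is unspecified beyond the end of a list, whereas
  \<open>get\<close> returns a fixed default there and is therefore computable.\<close>

definition get :: "'a::coded list \<Rightarrow> nat \<Rightarrow> 'a" where
  "get l i = head ((tl ^^ i) l)"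

lemma get_nth: "i < length l \<Longrightarrow> get l i = l ! i"
proof -
  have "(tl ^^ i) l = drop i l" by (induction i) (auto simp: drop_Suc drop_tl)
  moreover assume "i < length l"
  hence "drop i l = l ! i # drop (Suc i) l" by (simp add: Cons_nth_drop_Suc)
  ultimately show "get l i = l ! i" by (simp add: get_def)
qed

lemma computable_get [computable_intros]:
  "computable l \<Longrightarrow> computable i \<Longrightarrow> computable (\<lambda>x. get (l x) (i x))"
  unfolding get_def by (intro computable_intros)

lemma computable_upt [computable_intros]:
  assumes "computable a" "computable b" shows "computable (\<lambda>x. [a x..<b x])"
proof -
  let ?S = "\<lambda>x z. if fst z < b x then (Suc (fst z), snd z @ [fst z]) else z"
  have iter: "(?S x ^^ m) (k, l) = (if k \<le> b x then (min (k + m) (b x), l @ [k..<min (k + m) (b x)]) else (k, l))"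
    for x m k l
    by (induction m) (auto simp: min_def)
  have "computable (\<lambda>x. snd ((?S x ^^ b x) (a x, [])))"
    by (intro computable_intros assms computable_comp[OF assms(2)])
  moreover have "snd ((?S x ^^ b x) (a x, [])) = [a x..<b x]" for x
    unfolding iter by (auto simp: min_def)
  ultimately show ?thesis by simp
qed

lemma decidable_ball [computable_intros]:
  assumes "computable l" "decidable (\<lambda>z. P (fst z) (snd z))"
  shows "decidable (\<lambda>x. \<forall>y\<in>set (l x). P x y)"
proof -
  have "decidable (\<lambda>x. \<forall>i<length (l x). P x (get (l x) i))"
    by (intro computable_intros assms(1) computable_comp[OF assms(1)]
       decidable_comp[OF assms(2), of "\<lambda>z. (fst z, get (l (fst z)) (snd z))", simplified])
  thus ?thesis by (simp add: get_nth all_set_conv_all_nth)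
qed

lemma decidable_bex [computable_intros]:
  assumes "computable l" "decidable (\<lambda>z. P (fst z) (snd z))"
  shows "decidable (\<lambda>x. \<exists>y\<in>set (l x). P x y)"
proof -
  have "decidable (\<lambda>x. \<not> (\<forall>y\<in>set (l x). \<not> P x y))"
    by (intro computable_intros assms)
  thus ?thesis by simp
qed

lemma decidable_mem [computable_intros]:
  assumes "computable a" "computable l"
  shows "decidable (\<lambda>x. a x \<in> set (l x))"
proof -
  have "decidable (\<lambda>x. \<exists>y\<in>set (l x). a x = y)"
    by (intro computable_intros assms computable_comp[OF assms(1)])
  thus ?thesis by simp
qed

lemma computable_n_lists [computable_intros]:
  assumes "computable N" "computable l"
  shows "computable (\<lambda>x. List.n_lists (N x) (l x))"
proof -
  let ?S = "\<lambda>l yss. concat (map (\<lambda>ys. map (\<lambda>y. y # ys) l) yss)"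
  have "(?S l ^^ m) [[]] = List.n_lists m l" for m and l :: "'b list"
    by (induction m) auto
  moreover have "computable (\<lambda>x. (?S (l x) ^^ N x) [[]])"
    by (intro computable_intros assms computable_comp[OF assms(2)])
  ultimately show ?thesis by simp
qed


lemma computable_take [computable_intros]:
  assumes "computable i" "computable l"
  shows "computable (\<lambda>x. take (i x) (l x))"
proof -
  have "map (get k) [0..<if m \<le> length k then m else length k] = take m k" for m and k :: "'b list"
    by (rule nth_equalityI) (auto simp: get_nth split: if_splits)
  moreover have "computable (\<lambda>x. map (get (l x)) [0..<if i x \<le> length (l x) then i x else length (l x)])"
    by (intro computable_intros assms computable_comp[OF assms(2)])
  ultimately show ?thesis by simp
qed


subsection \<open>Recursively enumerable predicates\<close>

definition enumerable :: "('a::coded \<Rightarrow> bool) \<Rightarrow> bool" where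
  "enumerable P \<longleftrightarrow> (\<exists>Q. decidable Q \<and> (\<forall>x. P x \<longleftrightarrow> (\<exists>c::nat. Q (x, c))))"

named_theorems enumerable_intros

lemma enumerable_decidable: "decidable P \<Longrightarrow> enumerable P"
  unfolding enumerable_def
  by (rule exI[of _ "\<lambda>z. P (fst z)"]) (auto intro!: decidable_comp computable_intros)

lemma enumerable_comp:
  assumes "enumerable P" "computable f"
  shows "enumerable (\<lambda>x. P (f x))"
proof -
  obtain Q where Q: "decidable Q" "\<And>x. P x \<longleftrightarrow> (\<exists>c::nat. Q (x, c))"
    using assms(1) unfolding enumerable_def by blast
  have "decidable (\<lambda>z. Q (f (fst z), snd z))"
    by (intro decidable_comp[OF Q(1)] computable_comp[OF assms(2)] computable_intros)
  thus ?thesis unfolding enumerable_def Q(2) by (intro exI[of _ "\<lambda>z. Q (f (fst z), snd z)"]) simp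
qed

text \<open>The value \<open>y\<close> and the witness confirming it are packed into one number, so
  existential quantifiers can be nested freely.\<close>

lemma enumerable_ex [enumerable_intros]:
  fixes P :: "'a::coded \<Rightarrow> 'b::coded \<Rightarrow> bool"
  assumes "enumerable (\<lambda>z. P (fst z) (snd z))"
  shows "enumerable (\<lambda>x. \<exists>y. P x y)"
proof -
  obtain Q where Q: "decidable Q" "\<And>x y. P x y \<longleftrightarrow> (\<exists>c::nat. Q ((x, y), c))"
    using assms unfolding enumerable_def by fastforce
  have "decidable (\<lambda>z. Q ((fst z, fst (denc (snd z) :: 'b \<times> nat)), snd (denc (snd z) :: 'b \<times> nat)))"
    by (intro decidable_comp[OF Q(1)] computable_intros)
  moreover have "(\<exists>y. P x y) \<longleftrightarrow> (\<exists>c. Q ((x, fst (denc c :: 'b \<times> nat)), snd (denc c :: 'b \<times> nat)))" for x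
    unfolding Q(2) by (metis denc_enc fst_conv snd_conv)
  ultimately show ?thesis unfolding enumerable_def
    by (intro exI[of _ "\<lambda>z. Q ((fst z, fst (denc (snd z) :: 'b \<times> nat)), snd (denc (snd z) :: 'b \<times> nat))"]) simp
qed

lemma enumerable_conj [enumerable_intros]:
  assumes "enumerable P" "enumerable P'"
  shows "enumerable (\<lambda>x. P x \<and> P' x)"
proof -
  obtain Q where Q: "decidable Q" "\<And>x. P x \<longleftrightarrow> (\<exists>c::nat. Q (x, c))"
    using assms(1) unfolding enumerable_def by blast
  obtain Q' where Q': "decidable Q'" "\<And>x. P' x \<longleftrightarrow> (\<exists>c::nat. Q' (x, c))"
    using assms(2) unfolding enumerable_def by blast
  have "enumerable (\<lambda>x. \<exists>c c'. Q (x, c) \<and> Q' (x, c'))"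
    by (intro enumerable_ex enumerable_decidable decidable_conj decidable_comp[OF Q(1)]
        decidable_comp[OF Q'(1)] computable_intros)
  thus ?thesis by (simp add: Q(2) Q'(2))
qed

lemma enumerable_disj [enumerable_intros]:
  assumes "enumerable P" "enumerable P'"
  shows "enumerable (\<lambda>x. P x \<or> P' x)"
proof -
  obtain Q where Q: "decidable Q" "\<And>x. P x \<longleftrightarrow> (\<exists>c::nat. Q (x, c))"
    using assms(1) unfolding enumerable_def by blast
  obtain Q' where Q': "decidable Q'" "\<And>x. P' x \<longleftrightarrow> (\<exists>c::nat. Q' (x, c))"
    using assms(2) unfolding enumerable_def by blast
  have "enumerable (\<lambda>x. \<exists>c. Q (x, c) \<or> Q' (x, c))"
    by (intro enumerable_ex enumerable_decidable decidable_disj decidable_comp[OF Q(1)]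
        decidable_comp[OF Q'(1)] computable_intros)
  thus ?thesis by (simp add: Q(2) Q'(2) ex_disj_distrib)
qed

text \<open>A bounded quantifier over witnesses needs only one bound for all of them.\<close>

lemma enumerable_ball [enumerable_intros]:
  fixes P :: "'a::coded \<Rightarrow> 'b::coded \<Rightarrow> bool"
  assumes "computable l" "enumerable (\<lambda>z. P (fst z) (snd z))"
  shows "enumerable (\<lambda>x. \<forall>y\<in>set (l x). P x y)"
proof -
  obtain Q where Q: "decidable Q" "\<And>x y. P x y \<longleftrightarrow> (\<exists>c::nat. Q ((x, y), c))"
    using assms(2) unfolding enumerable_def by fastforce
  have "enumerable (\<lambda>x. \<exists>w. \<forall>y\<in>set (l x). \<exists>c<w. Q ((x, y), c))"
    by (intro enumerable_ex enumerable_decidable decidable_ball decidable_ex_less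
        decidable_comp[OF Q(1)] computable_comp[OF assms(1)] computable_intros)
  moreover have "(\<forall>y\<in>set (l x). P x y) \<longleftrightarrow> (\<exists>w. \<forall>y\<in>set (l x). \<exists>c<w. Q ((x, y), c))" for x
  proof
    assume "\<forall>y\<in>set (l x). P x y"
    then obtain c where c: "\<And>y. y \<in> set (l x) \<Longrightarrow> Q ((x, y), c y)" unfolding Q(2) by metis
    hence "\<exists>k<Suc (Max (c ` set (l x))). Q ((x, y), k)" if "y \<in> set (l x)" for y
      using that by (intro exI[of _ "c y"]) (auto simp: less_Suc_eq_le)
    thus "\<exists>w. \<forall>y\<in>set (l x). \<exists>c<w. Q ((x, y), c)" by blast
  qed (auto simp: Q(2))
  ultimately show ?thesis by simp
qed

lemma enumerable_all_less [enumerable_intros]: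
  fixes N :: "'a::coded \<Rightarrow> nat"
  assumes "computable N" "enumerable (\<lambda>z. P (fst z) (snd z))"
  shows "enumerable (\<lambda>x. \<forall>i<N x. P x i)"
proof -
  have "enumerable (\<lambda>x. \<forall>i\<in>set [0..<N x]. P x i)"
    by (intro enumerable_ball computable_intros assms)
  thus ?thesis by (simp add: atLeast0LessThan Ball_def)
qed

lemma enumerable_bex [enumerable_intros]:
  assumes "computable l" "enumerable (\<lambda>z. P (fst z) (snd z))"
  shows "enumerable (\<lambda>x. \<exists>y\<in>set (l x). P x y)"
proof -
  have "enumerable (\<lambda>x. \<exists>y. y \<in> set (l x) \<and> P x y)"
    by (intro enumerable_ex enumerable_conj enumerable_decidable assms(2) decidable_mem
        computable_comp[OF assms(1)] computable_intros)
  thus ?thesis by (simp add: Bex_def)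
qed

subsubsection \<open>Derivations\<close>

text \<open>An inductive predicate presented by finite derivations. In this form it is an
  existential statement about one list with a bounded quantifier inside, and so it is enumerable
  whenever \<open>R\<close> is.\<close>

definition derivable :: "('a list \<Rightarrow> 'a \<Rightarrow> bool) \<Rightarrow> 'a \<Rightarrow> bool" where
  "derivable R x \<longleftrightarrow> (\<exists>L. x \<in> set L \<and> (\<forall>i<length L. R (take i L) (L ! i)))"

lemma derivable_induct:
  assumes "derivable R x" "\<And>L x. (\<And>y. y \<in> set L \<Longrightarrow> P y) \<Longrightarrow> R L x \<Longrightarrow> P x"
  shows "P x"
proof -
  obtain L where L: "x \<in> set L" "\<And>i. i < length L \<Longrightarrow> R (take i L) (L ! i)"
    using assms(1) unfolding derivable_def by blast
  have "i < length L \<longrightarrow> P (L ! i)" for i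
  proof (induction i rule: less_induct)
    case (less i)
    show ?case
    proof
      assume i: "i < length L"
      have "P y" if "y \<in> set (take i L)" for y
        using that less i by (auto simp: in_set_conv_nth)
      thus "P (L ! i)" using assms(2) L(2)[OF i] by blast
    qed
  qed
  thus ?thesis using L(1) by (metis in_set_conv_nth)
qed

text \<open>Derivations are concatenated; monotonicity of \<open>R\<close> keeps the steps of a
  later one valid after the longer prefix.\<close>

lemma derivable_list:
  assumes "\<And>L L' x. set L \<subseteq> set L' \<Longrightarrow> R L x \<Longrightarrow> R L' x" "\<And>y. y \<in> set cs \<Longrightarrow> derivable R y"
  shows "\<exists>L. set cs \<subseteq> set L \<and> (\<forall>i<length L. R (take i L) (L ! i))"
  using assms(2)
proof (induction cs)
  case (Cons c cs)
  then obtain L where L: "set cs \<subseteq> set L" "\<And>i. i < length L \<Longrightarrow> R (take i L) (L ! i)" by auto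
  obtain M where M: "c \<in> set M" "\<And>i. i < length M \<Longrightarrow> R (take i M) (M ! i)"
    using Cons.prems[of c] unfolding derivable_def by auto
  have "R (take i (L @ M)) ((L @ M) ! i)" if i: "i < length (L @ M)" for i
  proof (cases "i < length L")
    case False
    hence "R (take (i - length L) M) (M ! (i - length L))" using i by (intro M(2)) auto
    thus ?thesis using False by (auto simp: nth_append intro: assms(1)[rotated])
  qed (auto simp: nth_append L(2))
  thus ?case using L(1) M(1) by (intro exI[of _ "L @ M"]) auto
qed (auto intro: exI[of _ "[]"])

lemma derivable_step:
  assumes "\<And>L L' x. set L \<subseteq> set L' \<Longrightarrow> R L x \<Longrightarrow> R L' x"
    and "\<And>y. y \<in> set cs \<Longrightarrow> derivable R y" "R cs x"
  shows "derivable R x"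
proof -
  obtain L where L: "set cs \<subseteq> set L" "\<And>i. i < length L \<Longrightarrow> R (take i L) (L ! i)"
    using derivable_list[of R cs] assms(1,2) by blast
  have "R L x" using assms(1)[OF L(1) assms(3)] .
  hence "R (take i (L @ [x])) ((L @ [x]) ! i)" if "i < length (L @ [x])" for i
    using that L(2) by (cases "i < length L") (auto simp: nth_append less_Suc_eq)
  thus ?thesis unfolding derivable_def by (intro exI[of _ "L @ [x]"]) auto
qed

lemma enumerable_derivable:
  assumes "enumerable (\<lambda>z. R (fst z) (fst (snd z)) (snd (snd z)))" "computable c" "computable f"
  shows "enumerable (\<lambda>x. derivable (R (c x)) (f x))"
proof -
  have "enumerable (\<lambda>x. \<exists>L. f x \<in> set L \<and> (\<forall>i<length L. R (c x) (take i L) (get L i)))"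
    by (intro enumerable_intros enumerable_decidable[OF decidable_mem] computable_intros
        computable_comp[OF assms(3)] enumerable_comp[OF assms(1),
          of "\<lambda>z. (c (fst (fst z)), take (snd z) (snd (fst z)), get (snd (fst z)) (snd z))", simplified]
        computable_comp[OF assms(2)])
  moreover have "(\<exists>L. f x \<in> set L \<and> (\<forall>i<length L. R (c x) (take i L) (get L i))) = derivable (R (c x)) (f x)" for x
    unfolding derivable_def by (auto simp: get_nth)
  ultimately show ?thesis by simp
qed


subsubsection \<open>Search\<close>

text \<open>The number found by minimisation packs an answer together with the witness that confirms
  it; the program returns its first component.\<close>

lemma search:
  fixes R :: "'a::coded \<Rightarrow> 'b::coded \<Rightarrow> bool"
  assumes "enumerable (\<lambda>z. R (fst z) (snd z))"
  shows "\<exists>A. \<forall>x. (\<exists>y. R x y) \<longrightarrow> (\<exists>y. R x y \<and> computes A [enc x] (enc y))"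
proof -
  obtain Q where Q: "decidable Q" "\<And>x y. R x y \<longleftrightarrow> (\<exists>c::nat. Q ((x, y), c))"
    using assms unfolding enumerable_def by fastforce
  define P where "P = (\<lambda>m x. Q ((x, fst (denc m :: 'b \<times> nat)), snd (denc m :: 'b \<times> nat)))"
  have RP: "(\<exists>y. R x y) \<longleftrightarrow> (\<exists>m. P m x)" for x
    unfolding Q(2) P_def by (metis denc_enc fst_conv snd_conv)
  have "computable (\<lambda>z. if P (fst z) (snd z) then 0 else 1 :: nat)"
    unfolding P_def by (intro computable_intros decidable_comp[OF Q(1)])
  from computable_prog[OF this, of 2 "\<lambda>xs. prod_encode (xs ! 0, xs ! 1)"]
  have "prog 2 (\<lambda>xs. if P (xs ! 0) (denc (xs ! 1)) then 0 else 1)"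
  proof -
    have "denc (prod_encode (u, v)) = (u, denc v :: 'a)" for u v
      by (metis enc_prod_def denc_enc enc_denc enc_nat_def fst_conv snd_conv)
    moreover have "prog 2 (\<lambda>xs. prod_encode (xs ! 0, xs ! 1))"
      by (intro prog_prod_encode prog_proj) auto
    ultimately show ?thesis
      using \<open>prog 2 _ \<Longrightarrow> _\<close> by simp
  qed
  then obtain r where r: "\<And>m x. computes r [m, enc x] (if P m x then 0 else Suc 0)"
    unfolding prog_def by (metis (no_types, lifting) One_nat_def denc_enc length_Cons list.size(3)
        nth_Cons_0 nth_Cons_Suc numeral_2_eq_2)
  have "prog 1 (\<lambda>xs. fst (prod_decode (xs ! 0)))" by (intro prog_fst prog_proj) auto
  then obtain s where s: "\<And>m. computes s [m] (fst (prod_decode m))"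
    unfolding prog_def by (metis One_nat_def length_Cons list.size(3) nth_Cons_0)
  show ?thesis
  proof (intro exI[of _ "Comp s [Mu r]"] allI impI)
    fix x assume "\<exists>y. R x y"
    hence ex: "\<exists>m. P m x" by (simp add: RP)
    define m where "m = (LEAST m. P m x)"
    have m: "P m x" "\<And>k. k < m \<Longrightarrow> \<not> P k x"
      unfolding m_def using LeastI_ex[OF ex] not_less_Least by blast+
    \<comment> \<open>Minimisation requires a halting run with a successor value at every smaller
      argument; \<open>r\<close> is total and returns \<open>Suc 0\<close> there.\<close>
    have "computes (Mu r) [enc x] m"
      by (rule computes.intros(7)) (use r[of m x] r[of _ x] m in \<open>auto, metis\<close>)
    hence "computes (Comp s [Mu r]) [enc x] (fst (prod_decode m))"
      by (intro computes.intros(4)[where ys = "[m]"]) (auto intro: s)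
    moreover have "fst (prod_decode m) = enc (fst (denc m :: 'b \<times> nat))"
      by (metis enc_denc enc_prod_def fst_conv prod_encode_inverse)
    moreover have "R x (fst (denc m :: 'b \<times> nat))"
      using m(1) unfolding Q(2) P_def by blast
    ultimately show "\<exists>y. R x y \<and> computes (Comp s [Mu r]) [enc x] (enc y)" by metis
  qed
qed


subsection \<open>Vectors over a subfield\<close>

locale subfield_char =
  fixes F :: "'k::field set" and p :: nat
  assumes subfield: "is_subfield F" and char: "CHAR('k) = p" and p_pos: "p > 0"
begin

lemma prime_p: "prime p"
  using prime_CHAR_semidom[where 'a = 'k] char p_pos by simp

lemma p_ge_2: "p \<ge> 2"
  using prime_p by (rule prime_ge_2_nat)

lemma frob_add: "(x + y :: 'k) ^ (p ^ m) = x ^ (p ^ m) + y ^ (p ^ m)"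
  by (rule freshmans_dream'[where n = m]) (simp_all add: char prime_p)

lemma frob_sum: "(sum f A :: 'k) ^ (p ^ m) = (\<Sum>i\<in>A. f i ^ (p ^ m))"
  by (rule freshmans_dream_sum'[where n = m]) (simp_all add: char prime_p)

lemma frob_minus: "(x - y :: 'k) ^ (p ^ m) = x ^ (p ^ m) - y ^ (p ^ m)"
  using frob_add[of "x - y" y m] by (simp add: algebra_simps)

lemma frob_eq_iff [simp]: "(x :: 'k) ^ (p ^ m) = y ^ (p ^ m) \<longleftrightarrow> x = y"
proof
  assume "x ^ (p ^ m) = y ^ (p ^ m)"
  hence "(x - y) ^ (p ^ m) = 0" by (simp add: frob_minus)
  thus "x = y" by simp
qed simp

lemma F_0: "0 \<in> F" and F_1: "1 \<in> F" and F_diff: "x \<in> F \<Longrightarrow> y \<in> F \<Longrightarrow> x - y \<in> F"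
  and F_mult: "x \<in> F \<Longrightarrow> y \<in> F \<Longrightarrow> x * y \<in> F" and F_inverse: "x \<in> F \<Longrightarrow> inverse x \<in> F"
  using subfield unfolding is_subfield_def by blast+

lemma F_uminus: "x \<in> F \<Longrightarrow> - x \<in> F"
  using F_diff[OF F_0, of x] by simp

lemma F_add: "x \<in> F \<Longrightarrow> y \<in> F \<Longrightarrow> x + y \<in> F"
  using F_diff[OF _ F_uminus, of x y] by simp

lemma F_divide: "x \<in> F \<Longrightarrow> y \<in> F \<Longrightarrow> x / y \<in> F"
  by (simp add: divide_inverse F_mult F_inverse)

lemma F_power: "x \<in> F \<Longrightarrow> x ^ k \<in> F"
  by (induction k) (auto intro: F_1 F_mult)

lemma F_sum: "(\<And>i. i \<in> A \<Longrightarrow> f i \<in> F) \<Longrightarrow> sum f A \<in> F"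
  by (induction A rule: infinite_finite_induct) (auto intro: F_0 F_add)

lemma F_prod: "(\<And>i. i \<in> A \<Longrightarrow> f i \<in> F) \<Longrightarrow> prod f A \<in> F"
  by (induction A rule: infinite_finite_induct) (auto intro: F_1 F_mult)

lemmas F_closed = F_0 F_1 F_diff F_mult F_inverse F_uminus F_add F_divide F_power F_sum F_prod

text \<open>Coordinate vectors are functions vanishing beyond \<open>n\<close>, so that they can be compared as functions.\<close>

definition vecs :: "nat \<Rightarrow> (nat \<Rightarrow> 'k) set" where
  "vecs n = {x. (\<forall>i\<le>n. x i \<in> F) \<and> (\<forall>i>n. x i = 0)}"

definition subsp :: "nat \<Rightarrow> (nat \<Rightarrow> 'k) set \<Rightarrow> bool" where
  "subsp n V \<longleftrightarrow> V \<subseteq> vecs n \<and> (\<lambda>_. 0) \<in> V \<and> (\<forall>x\<in>V. \<forall>y\<in>V. (\<lambda>i. x i + y i) \<in> V) \<and>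
     (\<forall>c\<in>F. \<forall>x\<in>V. (\<lambda>i. c * x i) \<in> V)"

lemma subspD:
  assumes "subsp n V"
  shows "V \<subseteq> vecs n" "(\<lambda>_. 0) \<in> V" "x \<in> V \<Longrightarrow> y \<in> V \<Longrightarrow> (\<lambda>i. x i + y i) \<in> V"
    "c \<in> F \<Longrightarrow> x \<in> V \<Longrightarrow> (\<lambda>i. c * x i) \<in> V"
  using assms unfolding subsp_def by blast+

lemma subspI:
  assumes "V \<subseteq> vecs n" "(\<lambda>_. 0) \<in> V" "\<And>x y. x \<in> V \<Longrightarrow> y \<in> V \<Longrightarrow> (\<lambda>i. x i + y i) \<in> V"
    "\<And>c x. c \<in> F \<Longrightarrow> x \<in> V \<Longrightarrow> (\<lambda>i. c * x i) \<in> V"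
  shows "subsp n V"
  using assms unfolding subsp_def by blast

lemma subsp_diff:
  assumes "subsp n V" "x \<in> V" "y \<in> V"
  shows "(\<lambda>i. x i - y i) \<in> V"
  using subspD(3)[OF assms(1,2) subspD(4)[OF assms(1) F_uminus[OF F_1] assms(3)]] by simp

lemma subsp_sum:
  assumes "subsp n V" "\<And>s. s \<in> A \<Longrightarrow> c s \<in> F" "\<And>s. s \<in> A \<Longrightarrow> f s \<in> V"
  shows "(\<lambda>i. \<Sum>s\<in>A. c s * f s i) \<in> V"
  using assms(2,3)
proof (induction A rule: infinite_finite_induct)
  case (insert a A)
  thus ?case using subspD(3)[OF assms(1) subspD(4)[OF assms(1), of "c a" "f a"]] by simp
qed (use subspD(2)[OF assms(1)] in auto)

lemma vecs_subsp: "subsp n (vecs n)"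
  by (rule subspI) (auto simp: vecs_def intro: F_closed)

lemma vecs_F: "x \<in> vecs n \<Longrightarrow> x i \<in> F"
  by (cases "i \<le> n") (auto simp: vecs_def F_0)

text \<open>The pivot columns of the reduced echelon form; for a subspace their number is the
  dimension. Unlike a basis, this set can be compared directly between \<open>V\<close> and its
  Frobenius preimages.\<close>

definition piv :: "(nat \<Rightarrow> 'k) set \<Rightarrow> nat set" where
  "piv V = {i. \<exists>x\<in>V. x i \<noteq> 0 \<and> (\<forall>j<i. x j = 0)}"

lemma piv_le: "V \<subseteq> vecs n \<Longrightarrow> piv V \<subseteq> {..n}"
proof
  fix i assume V: "V \<subseteq> vecs n" and "i \<in> piv V"
  then obtain x where x: "x \<in> V" "x i \<noteq> 0" unfolding piv_def by blast
  have "\<forall>j>n. x j = 0" using subsetD[OF V x(1)] by (simp add: vecs_def)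
  thus "i \<in> {..n}" using x(2) by (cases "i \<le> n") auto
qed

lemma finite_piv: "V \<subseteq> vecs n \<Longrightarrow> finite (piv V)"
  by (rule finite_subset[OF piv_le]) simp_all

lemma card_piv_le: "V \<subseteq> vecs n \<Longrightarrow> card (piv V) \<le> Suc n"
  using card_mono[OF _ piv_le[of V n]] by simp

lemma piv_mono: "V \<subseteq> W \<Longrightarrow> piv V \<subseteq> piv W"
  by (auto simp: piv_def)

lemma leading:
  assumes "x \<in> V" "x i \<noteq> 0"
  shows "\<exists>j\<in>piv V. x j \<noteq> 0"
proof -
  let ?j = "LEAST j. x j \<noteq> 0"
  have "x ?j \<noteq> 0" "\<forall>k<?j. x k = 0"
    using LeastI[of "\<lambda>j. x j \<noteq> 0" i] assms(2) by (auto dest: not_less_Least)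
  thus ?thesis using assms(1) unfolding piv_def by blast
qed

lemma piv_unique:
  assumes "subsp n V" "x \<in> V" "y \<in> V" "\<And>i. i \<in> piv V \<Longrightarrow> x i = y i"
  shows "x = y"
proof
  fix i
  show "x i = y i"
  proof (rule ccontr)
    assume "x i \<noteq> y i"
    then obtain j where "j \<in> piv V" "x j - y j \<noteq> 0"
      using leading[OF subsp_diff[OF assms(1-3)], of i] by auto
    thus False using assms(4) by simp
  qed
qed

text \<open>Prescribed values are reached from left to right: a multiple of a vector led by position
  \<open>k\<close> corrects the entry there without touching the earlier ones.\<close>

lemma piv_exists:
  assumes V: "subsp n V" and c: "\<And>i. i \<in> piv V \<Longrightarrow> c i \<in> F"
  shows "\<exists>x\<in>V. \<forall>i\<in>piv V. x i = c i"
proof -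
  have "\<exists>x\<in>V. \<forall>i\<in>piv V. i < k \<longrightarrow> x i = c i" for k
  proof (induction k)
    case 0
    show ?case by (rule bexI[OF _ subspD(2)[OF V]]) simp
  next
    case (Suc k)
    then obtain x where x: "x \<in> V" "\<And>i. i \<in> piv V \<Longrightarrow> i < k \<Longrightarrow> x i = c i" by auto
    show ?case
    proof (cases "k \<in> piv V")
      case False
      hence "\<forall>i\<in>piv V. i < Suc k \<longrightarrow> x i = c i" using x(2) by (auto simp: less_Suc_eq)
      thus ?thesis by (rule bexI[OF _ x(1)])
    next
      case True
      then obtain y where y: "y \<in> V" "y k \<noteq> 0" "\<And>j. j < k \<Longrightarrow> y j = 0" unfolding piv_def by blast
      let ?d = "(c k - x k) / y k"
      have "x k \<in> F" "y k \<in> F"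
        using vecs_F[OF subsetD[OF subspD(1)[OF V]]] x(1) y(1) by simp_all
      hence "?d \<in> F" using c[OF True] by (intro F_closed)
      hence "(\<lambda>i. x i + ?d * y i) \<in> V" by (intro subspD(3)[OF V] subspD(4)[OF V] x(1) y(1))
      moreover have "\<forall>i\<in>piv V. i < Suc k \<longrightarrow> x i + ?d * y i = c i"
        using x(2) y(2,3) by (auto simp: less_Suc_eq)
      ultimately show ?thesis by (intro bexI[of _ "\<lambda>i. x i + ?d * y i"])
    qed
  qed
  from this[of "Suc n"] show ?thesis
    using subsetD[OF piv_le[OF subspD(1)[OF V]]] by (auto simp: less_Suc_eq_le)
qed

lemma subsp_eqI:
  assumes "subsp n V" "subsp n W" "V \<subseteq> W" "piv W \<subseteq> piv V"
  shows "V = W"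
proof
  show "W \<subseteq> V"
  proof
    fix x assume x: "x \<in> W"
    have "\<And>i. x i \<in> F" using vecs_F[OF subsetD[OF subspD(1)[OF assms(2)] x]] .
    then obtain y where y: "y \<in> V" "\<forall>i\<in>piv V. y i = x i" using piv_exists[OF assms(1), of x] by blast
    have "y = x" using piv_unique[OF assms(2), of y x] y x assms(3,4) by blast
    thus "x \<in> V" using y by simp
  qed
qed fact

text \<open>The member with pivot \<open>s\<close> of the reduced echelon basis. By
  \<open>rvec_unique\<close> it is recognised from its entries at the pivots alone, which is how
  \<open>V\<close> is compared with its descents and its blocks.\<close>

definition rvec :: "(nat \<Rightarrow> 'k) set \<Rightarrow> nat \<Rightarrow> nat \<Rightarrow> 'k" where
  "rvec V s = (SOME x. x \<in> V \<and> x s = 1 \<and> (\<forall>i\<in>piv V. i \<noteq> s \<longrightarrow> x i = 0))"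

lemma rvec:
  assumes "subsp n V" "s \<in> piv V"
  shows "rvec V s \<in> V" "rvec V s s = 1" "i \<in> piv V \<Longrightarrow> i \<noteq> s \<Longrightarrow> rvec V s i = 0"
proof -
  have "\<exists>x\<in>V. \<forall>i\<in>piv V. x i = (if i = s then 1 else 0)"
    using F_0 F_1 piv_exists[OF assms(1), of "\<lambda>i. if i = s then 1 else 0"] by simp
  then obtain y where "y \<in> V" "\<forall>i\<in>piv V. y i = (if i = s then 1 else 0)" by blast
  hence "\<exists>x. x \<in> V \<and> x s = 1 \<and> (\<forall>i\<in>piv V. i \<noteq> s \<longrightarrow> x i = 0)"
    using assms(2) by (intro exI[of _ y]) auto
  from someI_ex[OF this] show "rvec V s \<in> V" "rvec V s s = 1" "i \<in> piv V \<Longrightarrow> i \<noteq> s \<Longrightarrow> rvec V s i = 0"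
    unfolding rvec_def by blast+
qed

lemma rvec_unique:
  assumes "subsp n V" "s \<in> piv V" "x \<in> V" "x s = 1" "\<And>i. i \<in> piv V \<Longrightarrow> i \<noteq> s \<Longrightarrow> x i = 0"
  shows "rvec V s = x"
proof (rule piv_unique[OF assms(1) rvec(1)[OF assms(1,2)] assms(3)])
  fix i assume "i \<in> piv V"
  thus "rvec V s i = x i" using rvec(2,3)[OF assms(1,2)] assms(4,5) by (cases "i = s") auto
qed

lemma sum_delta_piv:
  assumes "subsp n V" "t \<in> piv V"
  shows "(\<Sum>s\<in>piv V. c s * rvec V s t) = c t"
proof -
  have "(\<Sum>s\<in>piv V. c s * rvec V s t) = (\<Sum>s\<in>piv V. if s = t then c s else 0)"
    using assms(2) by (intro sum.cong) (auto simp: rvec[OF assms(1)])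
  thus ?thesis using assms finite_piv[OF subspD(1)] by (simp add: sum.delta)
qed

lemma expansion:
  assumes "subsp n V" "x \<in> V"
  shows "x j = (\<Sum>s\<in>piv V. x s * rvec V s j)"
proof -
  have "(\<lambda>j. \<Sum>s\<in>piv V. x s * rvec V s j) \<in> V"
    using vecs_F[OF subsetD[OF subspD(1)[OF assms(1)] assms(2)]] rvec(1)[OF assms(1)]
    by (intro subsp_sum[OF assms(1)]) simp_all
  from piv_unique[OF assms(1) this assms(2)] sum_delta_piv[OF assms(1)]
  have "(\<lambda>j. \<Sum>s\<in>piv V. x s * rvec V s j) = x" by blast
  thus ?thesis by (rule fun_cong[OF sym])
qed

lemma expansion_mem:
  assumes "subsp n V" "x \<in> vecs n" "\<And>j. j \<le> n \<Longrightarrow> x j = (\<Sum>s\<in>piv V. x s * rvec V s j)"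
  shows "x \<in> V"
proof -
  have y: "(\<lambda>j. \<Sum>s\<in>piv V. x s * rvec V s j) \<in> V"
    using vecs_F[OF assms(2)] rvec(1)[OF assms(1)] by (intro subsp_sum[OF assms(1)]) simp_all
  moreover have "(\<lambda>j. \<Sum>s\<in>piv V. x s * rvec V s j) = x"
  proof
    fix j
    show "(\<Sum>s\<in>piv V. x s * rvec V s j) = x j"
      using assms(2) assms(3)[of j] subsetD[OF subspD(1)[OF assms(1)] y]
      by (cases "j \<le> n") (simp_all add: vecs_def)
  qed
  ultimately show ?thesis by simp
qed


subsubsection \<open>Solution spaces and duality\<close>

definition sol :: "nat \<Rightarrow> (nat \<Rightarrow> 'k) set \<Rightarrow> (nat \<Rightarrow> 'k) set" where
  "sol n R = {x \<in> vecs n. \<forall>a\<in>R. (\<Sum>i\<le>n. a i * x i) = 0}"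

lemma subsp_sol: "subsp n (sol n R)"
proof (rule subspI)
  fix x y assume "x \<in> sol n R" "y \<in> sol n R"
  thus "(\<lambda>i. x i + y i) \<in> sol n R"
    using subspD(3)[OF vecs_subsp] by (auto simp: sol_def distrib_left sum.distrib)
next
  fix c x assume "c \<in> F" "x \<in> sol n R"
  moreover have "(\<Sum>i\<le>n. a i * (c * x i)) = c * (\<Sum>i\<le>n. a i * x i)" for a
    by (simp add: sum_distrib_left mult_ac)
  ultimately show "(\<lambda>i. c * x i) \<in> sol n R"
    using subspD(4)[OF vecs_subsp] by (auto simp: sol_def)
qed (use subspD(2)[OF vecs_subsp] in \<open>auto simp: sol_def\<close>)

text \<open>A linear form vanishing on all common zeros of the rows is a combination of the rows:
  with \<open>W\<close> the row space, the defect of the echelon expansion of \<open>c\<close> at a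
  non-pivot column is the value of \<open>c\<close> at a common zero of the rows.\<close>

lemma duality:
  assumes rs: "\<And>a i. a \<in> set rs \<Longrightarrow> i \<le> n \<Longrightarrow> a i \<in> F" and c: "\<And>i. i \<le> n \<Longrightarrow> c i \<in> F"
    and kills: "\<And>x. x \<in> sol n (set rs) \<Longrightarrow> (\<Sum>i\<le>n. c i * x i) = 0"
  shows "\<exists>ks. (\<forall>j. ks j \<in> F) \<and> (\<forall>i\<le>n. c i = (\<Sum>j<length rs. ks j * (rs ! j) i))"
proof -
  define W where "W = {w \<in> vecs n. \<exists>ks. (\<forall>j. ks j \<in> F) \<and> (\<forall>i\<le>n. w i = (\<Sum>j<length rs. ks j * (rs ! j) i))}"
  have W: "subsp n W"
  proof (rule subspI)
    fix x y assume x: "x \<in> W" and y: "y \<in> W"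
    then obtain k l where kl: "\<forall>j. k j \<in> F" "\<forall>i\<le>n. x i = (\<Sum>j<length rs. k j * (rs ! j) i)"
      "\<forall>j. l j \<in> F" "\<forall>i\<le>n. y i = (\<Sum>j<length rs. l j * (rs ! j) i)" unfolding W_def by blast
    have "(\<lambda>i. x i + y i) \<in> vecs n" using x y subspD(3)[OF vecs_subsp] by (auto simp: W_def)
    moreover have "\<forall>j. k j + l j \<in> F" using kl by (auto intro: F_closed)
    moreover have "\<forall>i\<le>n. x i + y i = (\<Sum>j<length rs. (k j + l j) * (rs ! j) i)"
      using kl by (simp add: distrib_right sum.distrib)
    ultimately show "(\<lambda>i. x i + y i) \<in> W" unfolding W_def
      by (intro CollectI conjI exI[of _ "\<lambda>j. k j + l j"])
  next
    fix d x assume d: "d \<in> F" and x: "x \<in> W"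
    then obtain k where k: "\<forall>j. k j \<in> F" "\<forall>i\<le>n. x i = (\<Sum>j<length rs. k j * (rs ! j) i)"
      unfolding W_def by blast
    have "(\<lambda>i. d * x i) \<in> vecs n" using x d subspD(4)[OF vecs_subsp] by (auto simp: W_def)
    moreover have "\<forall>j. d * k j \<in> F" using k d by (auto intro: F_closed)
    moreover have "\<forall>i\<le>n. d * x i = (\<Sum>j<length rs. (d * k j) * (rs ! j) i)"
      using k by (simp add: sum_distrib_left mult_ac)
    ultimately show "(\<lambda>i. d * x i) \<in> W" unfolding W_def
      by (intro CollectI conjI exI[of _ "\<lambda>j. d * k j"])
  next
    show "(\<lambda>_. 0) \<in> W" unfolding W_def using subspD(2)[OF vecs_subsp]
      by (auto intro!: exI[of _ "\<lambda>_. 0"] F_0)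
  qed (auto simp: W_def)
  have row: "(\<lambda>i. if i \<le> n then a i else 0) \<in> W" if a: "a \<in> set rs" for a
  proof -
    obtain m where m: "m < length rs" "rs ! m = a" using a by (auto simp: in_set_conv_nth)
    have "(\<Sum>j<length rs. (if j = m then 1 else 0) * (rs ! j) i) = (\<Sum>j<length rs. if j = m then a i else 0)" for i
      by (rule sum.cong) (auto simp: m)
    hence "\<forall>i\<le>n. a i = (\<Sum>j<length rs. (if j = m then 1 else 0) * (rs ! j) i)"
      using m by simp
    thus ?thesis unfolding W_def using rs[OF a]
      by (intro CollectI conjI exI[of _ "\<lambda>j. if j = m then 1 else 0"]) (auto simp: vecs_def F_closed)
  qed
  let ?P = "piv W"
  have Pn: "?P \<subseteq> {..n}" "finite ?P" using piv_le[OF subspD(1)[OF W]] finite_piv[OF subspD(1)[OF W]] by simp_all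
  have rW: "rvec W s i \<in> F" if "s \<in> ?P" for s i
    using vecs_F[OF subsetD[OF subspD(1)[OF W] rvec(1)[OF W that]]] .
  \<comment> \<open>The vector is the solution belonging to the free column \<open>j\<close>.
    Pairing it with \<open>w\<close> measures how far the echelon expansion of \<open>w\<close>
    fails at \<open>j\<close>.\<close>
  have pair: "(\<Sum>i\<le>n. w i * (if i = j then 1 else if i \<in> ?P then - rvec W i j else 0))
      = w j - (\<Sum>s\<in>?P. w s * rvec W s j)" if "j \<le> n" "j \<notin> ?P" for w j
  proof -
    have "(\<Sum>i\<le>n. w i * (if i = j then 1 else if i \<in> ?P then - rvec W i j else 0))
        = (\<Sum>i\<le>n. (if i = j then w i else 0) + (if i \<in> ?P then - (w i * rvec W i j) else 0))"
      using that by (intro sum.cong) auto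
    also have "\<dots> = w j + (\<Sum>i\<in>{..n} \<inter> ?P. - (w i * rvec W i j))"
      using that by (simp add: sum.distrib sum.inter_restrict)
    also have "{..n} \<inter> ?P = ?P" using Pn by blast
    finally show ?thesis by (simp add: sum_negf)
  qed
  define c' where "c' = (\<lambda>i. if i \<le> n then c i else 0)"
  have cF: "c' \<in> vecs n" using c by (auto simp: vecs_def c'_def)
  have "c' \<in> W"
  proof (rule expansion_mem[OF W cF])
    fix j assume j: "j \<le> n"
    show "c' j = (\<Sum>s\<in>?P. c' s * rvec W s j)"
    proof (cases "j \<in> ?P")
      case True
      thus ?thesis using sum_delta_piv[OF W True, of c'] by simp
    next
      case False
      let ?x = "\<lambda>i. if i = j then 1 else if i \<in> ?P then - rvec W i j else 0"
      have "?x \<in> vecs n" using rW j Pn by (auto simp: vecs_def F_closed)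
      moreover have "(\<Sum>i\<le>n. a i * ?x i) = 0" if "a \<in> set rs" for a
      proof -
        have "(\<Sum>i\<le>n. a i * ?x i) = (\<Sum>i\<le>n. (if i \<le> n then a i else 0) * ?x i)"
          by (rule sum.cong) auto
        also have "\<dots> = 0" using expansion[OF W row[OF that], of j]
          unfolding pair[OF j False] by simp
        finally show ?thesis .
      qed
      ultimately have "?x \<in> sol n (set rs)" by (auto simp: sol_def)
      hence "(\<Sum>i\<le>n. c i * ?x i) = 0" by (rule kills)
      moreover have "(\<Sum>i\<le>n. c i * ?x i) = (\<Sum>i\<le>n. c' i * ?x i)"
        by (rule sum.cong) (auto simp: c'_def)
      ultimately show ?thesis using pair[OF j False, of c'] by simp
    qed
  qed
  thus ?thesis unfolding W_def c'_def by auto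
qed


subsubsection \<open>Frobenius\<close>

abbreviation vpow :: "(nat \<Rightarrow> 'k) \<Rightarrow> nat \<Rightarrow> nat \<Rightarrow> 'k" where
  "vpow x q \<equiv> (\<lambda>i. x i ^ q)"

lemma vecs_vpow: "x \<in> vecs n \<Longrightarrow> q > 0 \<Longrightarrow> vpow x q \<in> vecs n"
  by (auto simp: vecs_def F_closed)

lemma vecs_mult: "x \<in> vecs n \<Longrightarrow> y \<in> vecs n \<Longrightarrow> (\<lambda>i. x i * y i) \<in> vecs n"
  by (auto simp: vecs_def F_closed)

text \<open>For \<open>m = 0\<close> this is the preimage of \<open>V\<close> under multiplication
  by \<open>g\<close>, a case used later to freeze all factors of a product but one.\<close>

definition descent :: "nat \<Rightarrow> (nat \<Rightarrow> 'k) set \<Rightarrow> (nat \<Rightarrow> 'k) \<Rightarrow> nat \<Rightarrow> (nat \<Rightarrow> 'k) set" where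
  "descent n V g m = {y \<in> vecs n. (\<lambda>i. g i * y i ^ (p ^ m)) \<in> V}"

lemma subsp_descent:
  assumes "subsp n V"
  shows "subsp n (descent n V g m)"
proof (rule subspI)
  fix x y assume "x \<in> descent n V g m" "y \<in> descent n V g m"
  thus "(\<lambda>i. x i + y i) \<in> descent n V g m"
    using subspD(3)[OF assms, of "\<lambda>i. g i * x i ^ (p ^ m)" "\<lambda>i. g i * y i ^ (p ^ m)"]
      subspD(3)[OF vecs_subsp, of x n y]
    by (auto simp: descent_def frob_add distrib_left)
next
  fix c x assume "c \<in> F" "x \<in> descent n V g m"
  thus "(\<lambda>i. c * x i) \<in> descent n V g m"
    using subspD(4)[OF assms, of "c ^ (p ^ m)" "\<lambda>i. g i * x i ^ (p ^ m)"]
      subspD(4)[OF vecs_subsp, of c x n]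
    by (auto simp: descent_def power_mult_distrib mult_ac F_power)
next
  show "(\<lambda>_. 0) \<in> descent n V g m"
    using subspD(2)[OF assms] subspD(2)[OF vecs_subsp] p_pos by (simp add: descent_def power_0_left)
qed (auto simp: descent_def)

text \<open>Frobenius and multiplication by nonzero entries move no leading position; hence descent
  never raises the dimension.\<close>

lemma piv_descent:
  assumes "subsp n V" "\<And>i. i \<le> n \<Longrightarrow> g i \<noteq> 0"
  shows "piv (descent n V g m) \<subseteq> piv V"
proof
  fix i assume "i \<in> piv (descent n V g m)"
  then obtain y where y: "y \<in> descent n V g m" "y i \<noteq> 0" "\<forall>j<i. y j = 0" by (auto simp: piv_def)
  have "i \<le> n" using y by (auto simp: descent_def vecs_def not_le[symmetric])
  hence "g i * y i ^ (p ^ m) \<noteq> 0" "\<forall>j<i. g j * y j ^ (p ^ m) = 0"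
    using y assms(2) p_pos by (auto simp: power_0_left)
  thus "i \<in> piv V" using y(1) unfolding piv_def descent_def
    by (intro CollectI bexI[of _ "\<lambda>i. g i * y i ^ (p ^ m)"]) simp_all
qed

text \<open>If the dimension does not drop, the pivots agree. The Frobenius image of the reduced
  vector of the descent, multiplied by \<open>g\<close> and divided by \<open>g s\<close>, then has
  the entries at the pivots that characterise \<open>rvec V s\<close>.\<close>

lemma descent_rvec:
  assumes V: "subsp n V" and g: "\<And>i. i \<le> n \<Longrightarrow> g i \<noteq> 0"
    and card: "card (piv V) \<le> card (piv (descent n V g m))" and s: "s \<in> piv V"
  shows "\<exists>u\<in>vecs n. \<forall>j. rvec V s j = inverse (g s) * (g j * u j ^ (p ^ m))"
proof -
  let ?U = "descent n V g m"
  have eq: "piv ?U = piv V"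
    using card_seteq[OF finite_piv[OF subspD(1)[OF V]] piv_descent[OF V g] card] by simp
  have sn: "s \<le> n" using s piv_le[OF subspD(1)[OF V]] by blast
  have su: "s \<in> piv ?U" using s eq by simp
  note r = rvec[OF subsp_descent[OF V] su]
  have mem: "(\<lambda>j. g j * rvec ?U s j ^ (p ^ m)) \<in> V" using r(1) by (simp add: descent_def)
  have "inverse (g s) \<in> F"
  proof -
    have "g s * rvec ?U s s ^ (p ^ m) \<in> F"
      using vecs_F[OF subsetD[OF subspD(1)[OF V] mem]] .
    thus ?thesis using r(2) by (simp add: F_inverse)
  qed
  hence "(\<lambda>j. inverse (g s) * (g j * rvec ?U s j ^ (p ^ m))) \<in> V"
    by (rule subspD(4)[OF V _ mem])
  hence "rvec V s = (\<lambda>j. inverse (g s) * (g j * rvec ?U s j ^ (p ^ m)))"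
    by (rule rvec_unique[OF V s]) (use r(2,3) g[OF sn] eq p_pos in \<open>auto simp: power_0_left\<close>)
  moreover have "rvec ?U s \<in> vecs n" using r(1) by (simp add: descent_def)
  ultimately show ?thesis by (intro bexI[of _ "rvec ?U s"]) simp_all
qed

section \<open>Spans of Frobenius orbits\<close>

definition spn :: "nat \<Rightarrow> (nat \<Rightarrow> 'k) set \<Rightarrow> (nat \<Rightarrow> 'k) set" where
  "spn n X = \<Inter>{W. subsp n W \<and> X \<subseteq> W}"

lemma spn_iff: "x \<in> spn n X \<longleftrightarrow> (\<forall>W. subsp n W \<longrightarrow> X \<subseteq> W \<longrightarrow> x \<in> W)"
  by (auto simp: spn_def)

lemma subsp_spn: "X \<subseteq> vecs n \<Longrightarrow> subsp n (spn n X)"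
proof (rule subspI)
  show "X \<subseteq> vecs n \<Longrightarrow> spn n X \<subseteq> vecs n" using vecs_subsp[of n] by (auto simp: spn_def)
qed (unfold spn_iff, (intro allI impI, (rule subspD(2-4); simp))+)

lemma spn_least: "subsp n W \<Longrightarrow> X \<subseteq> W \<Longrightarrow> spn n X \<subseteq> W"
  by (auto simp: spn_def)

lemma spn_superset: "X \<subseteq> spn n X"
  by (auto simp: spn_def)

lemma spn_mono: "X \<subseteq> Y \<Longrightarrow> spn n X \<subseteq> spn n Y"
  by (auto simp: spn_def)

text \<open>The vectors whose Frobenius image lies in a given subspace form a subspace, namely a
  descent with multiplier 1, so it is enough to look at generators.\<close>

lemma spn_vpow:
  assumes "X \<subseteq> vecs n" "Y \<subseteq> vecs n" "\<And>x. x \<in> X \<Longrightarrow> vpow x (p ^ e) \<in> spn n Y" "y \<in> spn n X"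
  shows "vpow y (p ^ e) \<in> spn n Y"
proof -
  have "spn n X \<subseteq> descent n (spn n Y) (\<lambda>_. 1) e"
    by (intro spn_least subsp_descent subsp_spn) (use assms in \<open>auto simp: descent_def\<close>)
  thus ?thesis using assms(4) by (auto simp: descent_def)
qed

lemma piv_vpow:
  assumes "\<And>y. y \<in> S \<Longrightarrow> vpow y (p ^ e) \<in> S'"
  shows "piv S \<subseteq> piv S'"
proof
  fix i assume "i \<in> piv S"
  then obtain y where y: "y \<in> S" "y i \<noteq> 0" "\<forall>j<i. y j = 0" unfolding piv_def by blast
  thus "i \<in> piv S'" using p_pos assms[OF y(1)] unfolding piv_def
    by (intro CollectI bexI[of _ "vpow y (p ^ e)"]) (simp_all add: power_0_left)
qed

text \<open>Frobenius does not change leading positions, so a span and its shift have equally many pivots.\<close>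

lemma shift_down:
  assumes A: "subsp n A" and x: "x \<in> vecs n" and N: "\<And>l. l \<ge> N \<Longrightarrow> vpow x ((p ^ e) ^ l) \<in> A"
  shows "vpow x ((p ^ e) ^ l) \<in> A"
proof -
  let ?X = "\<lambda>N. {vpow x ((p ^ e) ^ l) |l. l \<ge> N}"
  define S where "S = (\<lambda>N. spn n (?X N))"
  have X: "?X N \<subseteq> vecs n" for N using x p_pos by (auto intro!: vecs_vpow)
  have "S N = S (Suc N)" for N
  proof (rule sym, rule subsp_eqI)
    show "subsp n (S N)" "subsp n (S (Suc N))" unfolding S_def by (rule subsp_spn[OF X])+
    show "S (Suc N) \<subseteq> S N" unfolding S_def by (rule spn_mono) auto
    have "vpow y (p ^ e) \<in> S (Suc N)" if "y \<in> S N" for y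
      unfolding S_def
    proof (rule spn_vpow[OF X X _ that[unfolded S_def]])
      fix z assume "z \<in> ?X N"
      then obtain l where "l \<ge> N" "z = vpow x ((p ^ e) ^ l)" by auto
      hence "vpow z (p ^ e) \<in> ?X (Suc N)"
        by (intro CollectI exI[of _ "Suc l"]) (auto simp: power_mult[symmetric] mult.commute)
      thus "vpow z (p ^ e) \<in> spn n (?X (Suc N))" by (rule subsetD[OF spn_superset])
    qed
    thus "piv (S N) \<subseteq> piv (S (Suc N))" by (rule piv_vpow)
  qed
  hence "S N = S 0" for N by (induction N) auto
  moreover have "S N \<subseteq> A" unfolding S_def using N by (intro spn_least A) auto
  moreover have "vpow x ((p ^ e) ^ l) \<in> S 0" unfolding S_def by (rule subsetD[OF spn_superset]) auto
  ultimately show ?thesis by (metis subsetD)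
qed

text \<open>The spans of the first \<open>k\<close> Frobenius images grow with \<open>k\<close>, and
  each strict step adds a pivot, so two consecutive ones agree for some \<open>k\<close> up to
  \<open>Suc n\<close>. That span is stable under Frobenius and contains the whole orbit.\<close>

lemma shift_up:
  assumes A: "subsp n A" and x: "x \<in> vecs n" and N: "\<And>l. l \<le> n \<Longrightarrow> vpow x ((p ^ e) ^ l) \<in> A"
  shows "vpow x ((p ^ e) ^ l) \<in> A"
proof -
  let ?X = "\<lambda>k. {vpow x ((p ^ e) ^ l) |l. l < k}"
  define S where "S = (\<lambda>k. spn n (?X k))"
  have X: "?X N \<subseteq> vecs n" for N using x p_pos by (auto intro!: vecs_vpow)
  have S: "subsp n (S k)" for k unfolding S_def by (rule subsp_spn[OF X])
  have mono: "S k \<subseteq> S (Suc k)" for k unfolding S_def by (rule spn_mono) auto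
  have "\<exists>k\<le>Suc n. piv (S (Suc k)) \<subseteq> piv (S k)"
  proof (rule ccontr)
    assume *: "\<not> ?thesis"
    have "k \<le> card (piv (S k))" if "k \<le> Suc (Suc n)" for k
      using that
    proof (induction k)
      case (Suc k)
      have "piv (S k) \<subset> piv (S (Suc k))" using * Suc.prems piv_mono[OF mono[of k]] by auto
      from psubset_card_mono[OF finite_piv[OF subspD(1)[OF S]] this] Suc show ?case by simp
    qed simp
    from this[of "Suc (Suc n)"] show False using card_piv_le[OF subspD(1)[OF S], of "Suc (Suc n)"] by simp
  qed
  then obtain k where k: "k \<le> Suc n" "S k = S (Suc k)" using subsp_eqI[OF S S mono] by metis
  have step: "vpow y (p ^ e) \<in> S k" if "y \<in> S k" for y
    unfolding k(2) unfolding S_def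
  proof (rule spn_vpow[OF X X _ that[unfolded S_def]])
    fix z assume "z \<in> ?X k"
    then obtain l where "l < k" "z = vpow x ((p ^ e) ^ l)" by auto
    hence "vpow z (p ^ e) \<in> ?X (Suc k)"
      by (intro CollectI exI[of _ "Suc l"]) (auto simp: power_mult[symmetric] mult.commute)
    thus "vpow z (p ^ e) \<in> spn n (?X (Suc k))" by (rule subsetD[OF spn_superset])
  qed
  have "vpow x ((p ^ e) ^ l) \<in> S k"
  proof (induction l)
    case 0
    have "vpow x ((p ^ e) ^ 0) \<in> ?X (Suc k)" by (intro CollectI exI[of _ 0]) simp
    thus ?case unfolding k(2) unfolding S_def by (rule subsetD[OF spn_superset])
  next
    case (Suc l)
    from step[OF this] show ?case by (simp add: power_mult[symmetric] mult.commute)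
  qed
  moreover have "S k \<subseteq> A" unfolding S_def using N k(1) by (intro spn_least A) auto
  ultimately show ?thesis by (rule subsetD[rotated])
qed


subsubsection \<open>Block decompositions\<close>

text \<open>For a subspace: \<open>V\<close> is the direct sum of its parts supported on the fibres
  of \<open>\<beta>\<close>.\<close>

definition bstable :: "(nat \<Rightarrow> nat) \<Rightarrow> (nat \<Rightarrow> 'k) set \<Rightarrow> bool" where
  "bstable \<beta> V \<longleftrightarrow> (\<forall>b. \<forall>x\<in>V. (\<lambda>i. if \<beta> i = b then x i else 0) \<in> V)"

text \<open>Cutting \<open>rvec V s\<close> down to the block of \<open>s\<close> changes none of
  its entries at the pivots, so by uniqueness it changes nothing.\<close>

lemma bstable_rvec:
  assumes V: "subsp n V" "bstable \<beta> V" and s: "s \<in> piv V" and j: "rvec V s j \<noteq> 0"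
  shows "\<beta> j = \<beta> s"
proof -
  let ?y = "\<lambda>i. if \<beta> i = \<beta> s then rvec V s i else 0"
  have "?y \<in> V" using V(2) rvec(1)[OF V(1) s] unfolding bstable_def by simp
  hence "rvec V s = ?y" using rvec[OF V(1) s] by (intro rvec_unique[OF V(1) s]) auto
  thus ?thesis using j by (metis (mono_tags))
qed

lemma bstable_descent:
  assumes "bstable \<beta> V"
  shows "bstable \<beta> (descent n V g m)"
  unfolding bstable_def
proof (intro allI ballI)
  fix b x assume x: "x \<in> descent n V g m"
  let ?y = "\<lambda>i. if \<beta> i = b then x i else 0"
  have "(\<lambda>i. if \<beta> i = b then g i * x i ^ (p ^ m) else 0) \<in> V"
    using x assms by (auto simp: descent_def bstable_def)
  moreover have "(\<lambda>i. if \<beta> i = b then g i * x i ^ (p ^ m) else 0) = (\<lambda>i. g i * ?y i ^ (p ^ m))"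
    using p_pos by (auto simp: power_0_left)
  moreover have "?y \<in> vecs n" using x by (auto simp: descent_def vecs_def F_0)
  ultimately show "?y \<in> descent n V g m" by (simp add: descent_def)
qed

end


subsection \<open>Bases over the field of \<open>p\<close>-th powers\<close>

locale fg_subfield = subfield_char F p for F :: "'k::field set" and p +
  fixes B :: "'k set"
  assumes finite_B: "finite B" and F_hull: "F = is_subfield hull B"
begin

lemma B_F: "B \<subseteq> F"
  unfolding F_hull by (rule hull_subset)

lemma F_least: "B \<subseteq> T \<Longrightarrow> is_subfield T \<Longrightarrow> F \<subseteq> T"
  unfolding F_hull by (rule hull_minimal)

lemma frob1_add: "(x + y :: 'k) ^ p = x ^ p + y ^ p"
  using frob_add[of x y 1] by simp

lemma frob1_sum: "(sum f A :: 'k) ^ p = (\<Sum>i\<in>A. f i ^ p)"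
  using frob_sum[of f A 1] by simp

lemma frob1_minus: "(x - y :: 'k) ^ p = x ^ p - y ^ p"
  using frob_minus[of x y 1] by simp

lemma frob1_eq_iff [simp]: "(x :: 'k) ^ p = y ^ p \<longleftrightarrow> x = y"
  using frob_eq_iff[of x 1 y] by simp

text \<open>The span over the field of \<open>p\<close>-th powers of \<open>F\<close>; a scalar is
  given by its \<open>p\<close>-th root, which is unique.\<close>

definition pspan :: "'k set \<Rightarrow> 'k set" where
  "pspan S = {x. \<exists>c. (\<forall>s. c s \<in> F) \<and> x = (\<Sum>s\<in>S. c s ^ p * s)}"

lemma pspanI: "(\<And>s. c s \<in> F) \<Longrightarrow> x = (\<Sum>s\<in>S. c s ^ p * s) \<Longrightarrow> x \<in> pspan S"
  by (auto simp: pspan_def)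

lemma pspanE:
  assumes "x \<in> pspan S"
  obtains c where "\<And>s. c s \<in> F" "x = (\<Sum>s\<in>S. c s ^ p * s)"
  using assms by (auto simp: pspan_def)

lemma pspan_add: "x \<in> pspan S \<Longrightarrow> y \<in> pspan S \<Longrightarrow> x + y \<in> pspan S"
proof (elim pspanE)
  fix c d assume "\<And>s. c s \<in> F" "x = (\<Sum>s\<in>S. c s ^ p * s)" "\<And>s. d s \<in> F" "y = (\<Sum>s\<in>S. d s ^ p * s)"
  thus ?thesis
    by (intro pspanI[of "\<lambda>s. c s + d s"]) (auto simp: F_add frob1_add distrib_right sum.distrib)
qed

lemma pspan_scale: "d \<in> F \<Longrightarrow> x \<in> pspan S \<Longrightarrow> d ^ p * x \<in> pspan S"
proof (elim pspanE)
  fix c assume "d \<in> F" "\<And>s. c s \<in> F" "x = (\<Sum>s\<in>S. c s ^ p * s)"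
  thus ?thesis
    by (intro pspanI[of "\<lambda>s. d * c s"]) (auto simp: F_mult power_mult_distrib sum_distrib_left mult_ac)
qed

lemma pspan_0: "0 \<in> pspan S"
  using p_pos by (intro pspanI[of "\<lambda>_. 0"]) (auto simp: F_0 power_0_left)

lemma pspan_sum: "(\<And>i. i \<in> A \<Longrightarrow> f i \<in> pspan S) \<Longrightarrow> sum f A \<in> pspan S"
  by (induction A rule: infinite_finite_induct) (auto intro: pspan_0 pspan_add)

lemma pspan_base:
  assumes "finite S" "s \<in> S"
  shows "s \<in> pspan S"
proof (rule pspanI)
  have "(\<Sum>t\<in>S. (if t = s then 1 else 0) ^ p * t) = (\<Sum>t\<in>S. if t = s then t else 0)"
    using p_pos by (intro sum.cong) (auto simp: power_0_left)
  thus "s = (\<Sum>t\<in>S. (if t = s then 1 else 0) ^ p * t)" using assms by simp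
qed (auto simp: F_0 F_1)

lemma pspan_subset: "S \<subseteq> F \<Longrightarrow> pspan S \<subseteq> F"
  by (auto elim!: pspanE intro!: F_sum F_mult F_power)

definition monom :: "('k \<Rightarrow> nat) \<Rightarrow> 'k" where
  "monom e = (\<Prod>b\<in>B. b ^ e b)"

lemma monom_F: "monom e \<in> F"
  unfolding monom_def using B_F by (intro F_prod F_power) auto

lemma monom_add: "monom e * monom e' = monom (\<lambda>b. e b + e' b)"
  by (simp add: monom_def power_add prod.distrib)

lemma monom_divmod: "monom e = monom (\<lambda>b. e b div p) ^ p * monom (\<lambda>b. e b mod p)"
  by (simp add: monom_def prod_power_distrib flip: power_mult power_add prod.distrib)

lemma finite_monos: "finite {monom e |e. \<forall>b\<in>B. e b \<le> N}"
proof (rule finite_surj)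
  let ?A = "{e :: 'k \<Rightarrow> nat. \<forall>b. (b \<in> B \<longrightarrow> e b \<in> {..N}) \<and> (b \<notin> B \<longrightarrow> e b = 0)}"
  show "finite ?A" by (rule finite_set_of_finite_funs[OF finite_B]) simp
  show "{monom e |e. \<forall>b\<in>B. e b \<le> N} \<subseteq> monom ` ?A"
  proof
    fix x assume "x \<in> {monom e |e. \<forall>b\<in>B. e b \<le> N}"
    then obtain e where e: "x = monom e" "\<forall>b\<in>B. e b \<le> N" by blast
    show "x \<in> monom ` ?A"
      by (rule image_eqI[of _ _ "\<lambda>b. if b \<in> B then e b else 0"]) (use e in \<open>auto simp: monom_def\<close>)
  qed
qed

text \<open>Finiteness of \<open>F\<close> over its \<open>p\<close>-th powers. The span is a ring
  because a monomial splits into a \<open>p\<close>-th power and one with exponents below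
  \<open>p\<close>; it is a field because \<open>inverse x\<close> equals
  \<open>inverse x ^ p * x ^ (p - 1)\<close>.\<close>

lemma pspan_monos: "pspan {monom e |e. \<forall>b\<in>B. e b \<le> p} = F" (is "pspan ?M = F")
proof
  have M: "?M \<subseteq> F" "finite ?M" using monom_F finite_monos by blast+
  show sub: "pspan ?M \<subseteq> F" by (rule pspan_subset[OF M(1)])
  have monom: "monom e \<in> pspan ?M" for e
  proof -
    have "monom (\<lambda>b. e b mod p) \<in> ?M" using p_pos by (auto intro!: exI[of _ "\<lambda>b. e b mod p"] simp: less_imp_le)
    thus ?thesis by (subst monom_divmod) (rule pspan_scale[OF monom_F pspan_base[OF M(2)]])
  qed
  have mult1: "x * monom e \<in> pspan ?M" if "x \<in> pspan ?M" for x e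
    using that
  proof (elim pspanE)
    fix c assume c: "\<And>s. c s \<in> F" "x = (\<Sum>s\<in>?M. c s ^ p * s)"
    have "x * monom e = (\<Sum>s\<in>?M. c s ^ p * (s * monom e))" unfolding c(2) sum_distrib_right mult.assoc ..
    also have "\<dots> \<in> pspan ?M"
      by (intro pspan_sum pspan_scale c) (auto simp: monom_add monom)
    finally show ?thesis .
  qed
  have mult: "x * y \<in> pspan ?M" if "x \<in> pspan ?M" "y \<in> pspan ?M" for x y
    using that(2)
  proof (elim pspanE)
    fix c assume c: "\<And>s. c s \<in> F" "y = (\<Sum>s\<in>?M. c s ^ p * s)"
    have "x * y = (\<Sum>s\<in>?M. c s ^ p * (x * s))" unfolding c(2) sum_distrib_left by (rule sum.cong) (simp_all add: mult_ac)
    also have "\<dots> \<in> pspan ?M"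
      by (intro pspan_sum pspan_scale c) (use mult1[OF that(1)] in blast)
    finally show ?thesis .
  qed
  have one: "1 \<in> pspan ?M" using monom[of "\<lambda>_. 0"] by (simp add: monom_def)
  have pow: "x ^ k \<in> pspan ?M" if "x \<in> pspan ?M" for x k
    by (induction k) (auto intro: one mult that)
  have inv: "inverse x \<in> pspan ?M" if x: "x \<in> pspan ?M" for x
  proof (cases "x = 0")
    case False
    have "inverse x = inverse x ^ p * x ^ (p - 1)"
      using False p_pos by (simp add: power_inverse field_simps flip: power_Suc)
    moreover have "inverse x \<in> F" using sub x by (auto intro: F_inverse)
    ultimately show ?thesis using pspan_scale[OF _ pow[OF x], of "inverse x" "p - 1"] by simp
  qed (simp add: pspan_0)
  have neg: "- x \<in> pspan ?M" if "x \<in> pspan ?M" for x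
    using pspan_scale[OF F_uminus[OF F_1] that] frob1_minus[of 0 1] p_pos by (simp add: power_0_left)
  have "is_subfield (pspan ?M)"
    unfolding is_subfield_def using pspan_0 one mult inv pspan_add[OF _ neg] by simp
  moreover have "B \<subseteq> pspan ?M"
  proof
    fix b assume b: "b \<in> B"
    have "monom (\<lambda>x. if x = b then 1 else 0) = b"
    proof -
      have "(\<Prod>x\<in>B. x ^ (if x = b then 1 else 0)) = (\<Prod>x\<in>B. if x = b then x else 1)"
        by (rule prod.cong) auto
      thus ?thesis using b finite_B by (simp add: monom_def)
    qed
    thus "b \<in> pspan ?M" using monom[of "\<lambda>x. if x = b then 1 else 0"] by simp
  qed
  ultimately show "F \<subseteq> pspan ?M" by (rule F_least[rotated])
qed

text \<open>The element 1 is required in the basis so that \<open>p\<close>-th powers are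
  recognisable: all their other coordinates vanish, and the coordinate at 1 is the root.\<close>

definition pbasis :: "'k set \<Rightarrow> bool" where
  "pbasis S \<longleftrightarrow> finite S \<and> 1 \<in> S \<and> S \<subseteq> F \<and> pspan S = F \<and>
     (\<forall>c. (\<forall>s. c s \<in> F) \<longrightarrow> (\<Sum>s\<in>S. c s ^ p * s) = 0 \<longrightarrow> (\<forall>s\<in>S. c s = 0))"

lemma ex_pbasis: "\<exists>S. pbasis S"
proof -
  define P where "P = (\<lambda>S. finite S \<and> 1 \<in> S \<and> S \<subseteq> F \<and> pspan S = F)"
  let ?M = "{monom e |e. \<forall>b\<in>B. e b \<le> p}"
  have "1 \<in> ?M" by (rule CollectI, rule exI[of _ "\<lambda>_. 0"]) (simp add: monom_def)
  hence "P ?M" unfolding P_def using monom_F finite_monos pspan_monos by blast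
  then obtain S where S: "P S" "\<And>S'. P S' \<Longrightarrow> card S \<le> card S'"
    using ex_has_least_nat[of P ?M card] by blast
  have fin: "finite S" and one: "1 \<in> S" and SF: "S \<subseteq> F" and span: "pspan S = F"
    using S(1) by (auto simp: P_def)
  have "c t = 0" if c: "\<forall>s. c s \<in> F" "(\<Sum>s\<in>S. c s ^ p * s) = 0" and t: "t \<in> S" "t \<noteq> 1" for c t
  proof (rule ccontr)
    assume ct: "c t \<noteq> 0"
    have "F \<subseteq> pspan (S - {t})"
    proof
      fix x assume "x \<in> F"
      then obtain d where d: "\<And>s. d s \<in> F" "x = (\<Sum>s\<in>S. d s ^ p * s)" using span pspanE by metis
      let ?k = "d t / c t"
      have kF: "?k \<in> F" using c d by (intro F_divide) auto
      have "x = (\<Sum>s\<in>S. d s ^ p * s) - ?k ^ p * (\<Sum>s\<in>S. c s ^ p * s)" using c d by simp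
      also have "\<dots> = (\<Sum>s\<in>S. (d s - ?k * c s) ^ p * s)"
        unfolding sum_distrib_left sum_subtractf[symmetric]
        by (rule sum.cong) (simp_all only: frob1_minus power_mult_distrib left_diff_distrib mult.assoc)
      also have "\<dots> = (\<Sum>s\<in>S - {t}. (d s - ?k * c s) ^ p * s)"
        using fin t ct p_pos by (subst sum.remove[OF fin t(1)]) (simp add: power_0_left)
      finally show "x \<in> pspan (S - {t})"
        using c(1) d(1) kF by (intro pspanI[of "\<lambda>s. d s - ?k * c s"] F_diff F_mult) blast+
    qed
    moreover have "pspan (S - {t}) \<subseteq> F" using SF by (intro pspan_subset) auto
    ultimately have "P (S - {t})" using fin one SF t by (auto simp: P_def)
    from S(2)[OF this] show False using card_Diff1_less[OF fin t(1)] by simp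
  qed note other = this
  have "c s = 0" if c: "\<forall>s. c s \<in> F" "(\<Sum>s\<in>S. c s ^ p * s) = 0" and s: "s \<in> S" for c s
  proof (cases "s = 1")
    case True
    have "(\<Sum>s\<in>S. c s ^ p * s) = c 1 ^ p * 1 + (\<Sum>s\<in>S - {1}. c s ^ p * s)"
      by (rule sum.remove[OF fin one])
    also have "(\<Sum>s\<in>S - {1}. c s ^ p * s) = 0"
      using other[OF c] p_pos by (intro sum.neutral) (auto simp: power_0_left)
    finally show ?thesis using c True by simp
  qed (use other[OF c] s in auto)
  thus ?thesis unfolding pbasis_def using fin one SF span by blast
qed

end

locale pbasis_subfield = fg_subfield +
  fixes S
  assumes pbasis: "pbasis S"
begin

lemma finite_S: "finite S" and one_S: "1 \<in> S" and S_F: "S \<subseteq> F"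
  and span_S: "x \<in> F \<Longrightarrow> x \<in> pspan S"
  and indep_S: "(\<And>s. c s \<in> F) \<Longrightarrow> (\<Sum>s\<in>S. c s ^ p * s) = 0 \<Longrightarrow> s \<in> S \<Longrightarrow> c s = 0"
  using pbasis unfolding pbasis_def by blast+

lemma coords_unique:
  assumes "\<And>s. c s \<in> F" "\<And>s. d s \<in> F" "(\<Sum>s\<in>S. c s ^ p * s) = (\<Sum>s\<in>S. d s ^ p * s)" "s \<in> S"
  shows "c s = d s"
  using indep_S[of "\<lambda>s. c s - d s" s] assms
  by (simp add: F_diff frob1_minus left_diff_distrib sum_subtractf)

lemma sum_single: "(\<Sum>s\<in>S. (if s = 1 then y else 0) ^ p * s) = y ^ p"
proof -
  have "(\<Sum>s\<in>S. (if s = 1 then y else 0) ^ p * s) = (\<Sum>s\<in>S. if s = 1 then y ^ p else 0)"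
    using p_pos by (intro sum.cong) (auto simp: power_0_left)
  thus ?thesis using finite_S one_S by simp
qed

lemma coords_of_power:
  assumes "\<And>s. c s \<in> F" "y \<in> F" "(\<Sum>s\<in>S. c s ^ p * s) = y ^ p" "s \<in> S" "s \<noteq> 1"
  shows "c s = 0"
  using coords_unique[of c "\<lambda>s. if s = 1 then y else 0" s] assms sum_single F_0 by auto

definition coord :: "'a \<Rightarrow> 'a \<Rightarrow> 'a" where
  "coord x = (SOME c. (\<forall>s. c s \<in> F) \<and> x = (\<Sum>s\<in>S. c s ^ p * s))"

lemma coord:
  assumes "x \<in> F"
  shows "coord x s \<in> F" "(\<Sum>s\<in>S. coord x s ^ p * s) = x"
proof -
  have "\<exists>c. (\<forall>s. c s \<in> F) \<and> x = (\<Sum>s\<in>S. c s ^ p * s)" using span_S[OF assms] by (auto simp: pspan_def)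
  from someI_ex[OF this] show "coord x s \<in> F" "(\<Sum>s\<in>S. coord x s ^ p * s) = x"
    unfolding coord_def by auto
qed

text \<open>An operator of Cartier type: additive, and taking a factor \<open>x ^ p\<close> out as
  \<open>x\<close>. In particular it inverts Frobenius on \<open>F\<close>.\<close>

definition lam :: "'a \<Rightarrow> 'a" where
  "lam x = coord x 1"

lemma lam_F: "x \<in> F \<Longrightarrow> lam x \<in> F"
  by (simp add: lam_def coord)

lemma lam_add:
  assumes "x \<in> F" "y \<in> F"
  shows "lam (x + y) = lam x + lam y"
  unfolding lam_def
  by (rule coords_unique[of "coord (x + y)" "\<lambda>s. coord x s + coord y s"])
     (use assms one_S in \<open>simp_all add: coord F_add frob1_add distrib_right sum.distrib\<close>)

lemma lam_0: "lam 0 = 0"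
proof -
  have "lam 0 + lam 0 = lam 0 + 0" using lam_add[OF F_0 F_0] by (simp only: add_0_right)
  thus ?thesis by (simp only: add_left_cancel)
qed

lemma lam_mult:
  assumes "x \<in> F" "y \<in> F"
  shows "lam (x ^ p * y) = x * lam y"
  unfolding lam_def
proof (rule coords_unique[of "coord (x ^ p * y)" "\<lambda>s. x * coord y s"])
  have "(\<Sum>s\<in>S. (x * coord y s) ^ p * s) = x ^ p * (\<Sum>s\<in>S. coord y s ^ p * s)"
    by (simp add: power_mult_distrib sum_distrib_left mult_ac)
  thus "(\<Sum>s\<in>S. coord (x ^ p * y) s ^ p * s) = (\<Sum>s\<in>S. (x * coord y s) ^ p * s)"
    using assms by (simp add: coord F_mult F_power)
qed (use assms one_S in \<open>simp_all add: coord F_mult F_power\<close>)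

lemma lam_power: "x \<in> F \<Longrightarrow> lam (x ^ p) = x"
  using lam_mult[OF _ F_1, of x] coords_unique[of "coord 1" "\<lambda>s. if s = 1 then 1 else 0" 1]
    sum_single[of 1] coord[OF F_1] one_S F_0 F_1
  by (simp add: lam_def)


subsubsection \<open>Bounded degree\<close>

text \<open>For finite \<open>X\<close> this is the span over the prime field, since -1 is the
  natural multiple \<open>p - 1\<close>. Its finiteness supplies the finite set for the later
  pigeonhole argument.\<close>

definition addspan :: "'a set \<Rightarrow> 'a set" where
  "addspan X = {\<Sum>m\<in>X. of_nat (k m) * m |k. True}"

lemma addspan_0: "0 \<in> addspan X"
  unfolding addspan_def by (rule CollectI, rule exI[of _ "\<lambda>_. 0"]) simp

lemma addspan_add: "x \<in> addspan X \<Longrightarrow> y \<in> addspan X \<Longrightarrow> x + y \<in> addspan X"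
proof -
  assume "x \<in> addspan X" "y \<in> addspan X"
  then obtain k l where "x = (\<Sum>m\<in>X. of_nat (k m) * m)" "y = (\<Sum>m\<in>X. of_nat (l m) * m)"
    unfolding addspan_def by blast
  thus ?thesis unfolding addspan_def
    by (intro CollectI exI[of _ "\<lambda>m. k m + l m"]) (simp add: distrib_right sum.distrib)
qed

lemma addspan_base:
  assumes "finite X" "m \<in> X"
  shows "m \<in> addspan X"
proof -
  have "(\<Sum>t\<in>X. of_nat (if t = m then 1 else 0) * t) = (\<Sum>t\<in>X. if t = m then t else 0)"
    by (intro sum.cong) auto
  also have "\<dots> = m" using assms by simp
  finally show ?thesis unfolding addspan_def
    by (intro CollectI exI[of _ "\<lambda>t. if t = m then 1 else 0"]) simp
qed

lemma addspan_least:
  assumes "x \<in> addspan X" "X \<subseteq> T" "0 \<in> T" "\<And>x y. x \<in> T \<Longrightarrow> y \<in> T \<Longrightarrow> x + y \<in> T"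
  shows "x \<in> T"
proof -
  have mult: "of_nat k * m \<in> T" if "m \<in> T" for m k
    by (induction k) (use assms that in \<open>auto simp: distrib_right\<close>)
  have sum: "sum f A \<in> T" if "\<And>i. i \<in> A \<Longrightarrow> f i \<in> T" for f :: "'a \<Rightarrow> 'a" and A
    using that by (induction A rule: infinite_finite_induct) (use assms in auto)
  obtain k where k: "x = (\<Sum>m\<in>X. of_nat (k m) * m)" using assms(1) unfolding addspan_def by auto
  show ?thesis unfolding k by (rule sum) (rule mult, use assms(2) in auto)
qed

lemma addspan_mono: "finite Y \<Longrightarrow> X \<subseteq> Y \<Longrightarrow> addspan X \<subseteq> addspan Y"
  by (rule subsetI, erule addspan_least) (auto intro: addspan_base addspan_0 addspan_add)

lemma addspan_mult:
  assumes "\<And>x y. x \<in> X \<Longrightarrow> y \<in> Y \<Longrightarrow> x * y \<in> addspan Z" "x \<in> addspan X" "y \<in> addspan Y"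
  shows "x * y \<in> addspan Z"
proof -
  have "x * b \<in> addspan Z" if "b \<in> Y" for b
    using addspan_least[OF assms(2), of "{x. x * b \<in> addspan Z}"] assms(1) that
    by (auto simp: distrib_right addspan_0 addspan_add)
  thus ?thesis
    using addspan_least[OF assms(3), of "{y. x * y \<in> addspan Z}"]
    by (auto simp: distrib_left addspan_0 addspan_add)
qed

lemma addspan_uminus:
  assumes "x \<in> addspan X"
  shows "- x \<in> addspan X"
proof -
  have "of_nat n * x \<in> addspan X" for n
    by (induction n) (auto simp: distrib_right addspan_0 addspan_add assms)
  moreover have "of_nat p = (0 :: 'a)" using char of_nat_CHAR by metis
  hence "of_nat (p - 1) * x = - x" using p_pos by (simp add: of_nat_diff)
  ultimately show ?thesis by metis
qed

lemma finite_addspan: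
  assumes "finite X"
  shows "finite (addspan X)"
proof (rule finite_surj)
  let ?A = "{k. \<forall>m. (m \<in> X \<longrightarrow> k m \<in> {..<p}) \<and> (m \<notin> X \<longrightarrow> k m = 0)}"
  show "finite ?A" by (rule finite_set_of_finite_funs[OF assms]) simp
  have p0: "of_nat p = (0 :: 'a)" using char of_nat_CHAR by metis
  have "of_nat (k mod p) = (of_nat k :: 'a)" for k
  proof -
    have "(of_nat k :: 'a) = of_nat (k div p * p + k mod p)" by simp
    thus ?thesis unfolding of_nat_add of_nat_mult p0 by simp
  qed
  hence "(\<Sum>m\<in>X. of_nat (k m) * m) = (\<Sum>m\<in>X. of_nat (if m \<in> X then k m mod p else 0) * m)" for k
    by (intro sum.cong) auto
  note red = this
  show "addspan X \<subseteq> (\<lambda>k. \<Sum>m\<in>X. of_nat (k m) * m) ` ?A"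
  proof
    fix x assume "x \<in> addspan X"
    then obtain k where k: "x = (\<Sum>m\<in>X. of_nat (k m) * m)" unfolding addspan_def by auto
    show "x \<in> (\<lambda>k. \<Sum>m\<in>X. of_nat (k m) * m) ` ?A"
      by (rule image_eqI[of _ _ "\<lambda>m. if m \<in> X then k m mod p else 0"])
         (use k red p_pos in auto)
  qed
qed

text \<open>Total degree in the generators \<open>B\<close>. These may satisfy relations, so an
  element has no well-defined degree; only upper bounds for some representation are used.\<close>

definition mons :: "nat \<Rightarrow> 'a set" where
  "mons N = {monom e |e. sum e B \<le> N}"

lemma finite_mons: "finite (mons N)"
proof (rule finite_subset[OF _ finite_monos[of N]])
  have "e b \<le> N" if "sum e B \<le> N" "b \<in> B" for e b
    using member_le_sum[OF that(2), of e] finite_B that(1) by simp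
  thus "mons N \<subseteq> {monom e |e. \<forall>b\<in>B. e b \<le> N}"
    unfolding mons_def by (intro Collect_mono) metis
qed

lemma mons_mono: "N \<le> M \<Longrightarrow> mons N \<subseteq> mons M"
  unfolding mons_def by (auto intro: order_trans)

lemma mons_mult: "x \<in> mons N \<Longrightarrow> y \<in> mons M \<Longrightarrow> x * y \<in> mons (N + M)"
proof -
  assume "x \<in> mons N" "y \<in> mons M"
  then obtain e f where "x = monom e" "sum e B \<le> N" "y = monom f" "sum f B \<le> M"
    unfolding mons_def by blast
  thus ?thesis unfolding mons_def
    by (intro CollectI exI[of _ "\<lambda>b. e b + f b"]) (simp add: monom_add sum.distrib)
qed

lemma mons_F: "mons N \<subseteq> F"
  using monom_F by (auto simp: mons_def)

abbreviation polys :: "nat \<Rightarrow> 'a set" where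
  "polys N \<equiv> addspan (mons N)"

lemma polys_mono: "N \<le> M \<Longrightarrow> x \<in> polys N \<Longrightarrow> x \<in> polys M"
  by (rule subsetD[OF addspan_mono[OF finite_mons mons_mono]])

lemma polys_mult: "x \<in> polys N \<Longrightarrow> y \<in> polys M \<Longrightarrow> x * y \<in> polys (N + M)"
  by (rule addspan_mult) (auto intro: addspan_base finite_mons mons_mult)

lemma polys_1: "1 \<in> polys N"
proof -
  have "monom (\<lambda>_. 0) \<in> mons N" unfolding mons_def by (intro CollectI exI[of _ "\<lambda>_. 0"]) simp
  thus ?thesis using addspan_base[OF finite_mons] by (simp add: monom_def)
qed

lemma polys_power: "x \<in> polys N \<Longrightarrow> x ^ k \<in> polys (k * N)"
  by (induction k) (auto intro: polys_1 polys_mult)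

lemma polys_F: "polys N \<subseteq> F"
  by (rule subsetI, erule addspan_least) (auto intro: subsetD[OF mons_F] F_0 F_add)

lemma polys_B: "b \<in> B \<Longrightarrow> b \<in> polys 1"
proof -
  assume b: "b \<in> B"
  have "(\<Prod>x\<in>B. x ^ (if x = b then 1 else 0)) = (\<Prod>x\<in>B. if x = b then x else 1)"
    by (rule prod.cong) auto
  hence "monom (\<lambda>x. if x = b then 1 else 0) = b" using b finite_B by (simp add: monom_def)
  moreover have "monom (\<lambda>x. if x = b then 1 else 0) \<in> mons 1"
    unfolding mons_def using finite_B by (intro CollectI exI[of _ "\<lambda>x. if x = b then 1 else 0"]) simp
  ultimately show ?thesis using addspan_base[OF finite_mons] by metis
qed

text \<open>The elements that are quotients of polynomials in the generators form a subfield
  containing \<open>B\<close>.\<close>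

lemma fraction:
  assumes "x \<in> F"
  shows "\<exists>N. \<exists>f\<in>polys N. f \<noteq> 0 \<and> x * f \<in> polys N"
proof -
  let ?T = "{x. \<exists>N. \<exists>f\<in>polys N. f \<noteq> 0 \<and> x * f \<in> polys N}"
  have T: "x \<in> ?T" if "f \<in> polys N" "f \<noteq> 0" "x * f \<in> polys M" for x f N M
    using that polys_mono[of N "max N M"] polys_mono[of M "max N M"] by auto
  have "B \<subseteq> ?T"
  proof
    fix b assume "b \<in> B"
    thus "b \<in> ?T" by (intro T[of 1 1 _ 1]) (simp_all add: polys_1 polys_B del: One_nat_def)
  qed
  moreover have "is_subfield ?T"
    unfolding is_subfield_def
  proof (intro conjI ballI)
    show "0 \<in> ?T" by (rule T[of 1 0 _ 0]) (simp_all add: polys_1 addspan_0)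
    show "1 \<in> ?T" by (rule T[of 1 0 _ 0]) (simp_all add: polys_1)
  next
    fix x y assume "x \<in> ?T" "y \<in> ?T"
    then obtain N f M g where f: "f \<in> polys N" "f \<noteq> 0" "x * f \<in> polys N"
      and g: "g \<in> polys M" "g \<noteq> 0" "y * g \<in> polys M" by blast
    have fg: "f * g \<in> polys (N + M)" "f * g \<noteq> 0" using f g polys_mult by auto
    have "x * f * g \<in> polys (N + M)" "f * (y * g) \<in> polys (N + M)" using f g polys_mult by auto
    hence "x * f * g + - (f * (y * g)) \<in> polys (N + M)" by (intro addspan_add addspan_uminus)
    moreover have "x * f * g + - (f * (y * g)) = (x - y) * (f * g)" by (simp add: algebra_simps)
    ultimately show "x - y \<in> ?T" by (intro T[OF fg, of "x - y" "N + M"]) simp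
    have "x * f * (y * g) \<in> polys (N + M)" using f g polys_mult by blast
    moreover have "x * f * (y * g) = x * y * (f * g)" by (simp add: mult_ac)
    ultimately show "x * y \<in> ?T" by (intro T[OF fg, of "x * y" "N + M"]) simp
  next
    fix x assume "x \<in> ?T"
    then obtain N f where f: "f \<in> polys N" "f \<noteq> 0" "x * f \<in> polys N" by blast
    show "inverse x \<in> ?T"
    proof (cases "x = 0")
      case True
      show ?thesis unfolding True by (rule T[of 1 0 _ 0]) (simp_all add: polys_1 addspan_0)
    next
      case False
      show ?thesis by (rule T[of "x * f" N _ N]) (use False f in \<open>simp_all flip: mult.assoc\<close>)
    qed
  qed
  ultimately have "F \<subseteq> ?T" by (rule F_least)
  thus ?thesis using assms by auto
qed

lemma common_denominator:
  assumes "finite P" "P \<subseteq> F"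
  shows "\<exists>N. \<exists>f\<in>polys N. f \<noteq> 0 \<and> (\<forall>x\<in>P. x * f \<in> polys N)"
  using assms
proof (induction P rule: finite_induct)
  case empty
  show ?case using polys_1 by (intro exI bexI[of _ 1]) auto
next
  case (insert y P)
  then obtain N f where f: "f \<in> polys N" "f \<noteq> 0" "\<forall>x\<in>P. x * f \<in> polys N" by auto
  obtain M g where g: "g \<in> polys M" "g \<noteq> 0" "y * g \<in> polys M" using fraction[of y] insert by auto
  have "x * (f * g) \<in> polys (N + M)" if "x \<in> P" for x
    using polys_mult[OF bspec[OF f(3) that] g(1)] by (simp add: mult_ac)
  moreover have "y * (f * g) \<in> polys (N + M)"
    using polys_mult[OF f(1) g(3)] by (simp add: mult_ac)
  ultimately show ?case using f g polys_mult[OF f(1) g(1)]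
    by (intro exI[of _ "N + M"] bexI[of _ "f * g"]) auto
qed

text \<open>
  Since \<open>lam\<close> divides degrees by \<open>p\<close> up to a bounded error, elements of bounded degree
  with a bounded power of a fixed denominator are stable under it.
\<close>

lemma lam_stable:
  assumes T: "finite T" "T \<subseteq> F" and w: "w \<in> F"
  shows "\<exists>H. finite H \<and> H \<subseteq> F \<and> w \<in> H \<and> (\<forall>t\<in>T. \<forall>h\<in>H. lam (t * h) \<in> H)"
proof -
  \<comment> \<open>A degree bound for the monomials that remain after splitting off a
    \<open>p\<close>-th power.\<close>
  let ?r = "(p - 1) * card B"
  obtain D f where f: "f \<in> polys D" "f \<noteq> 0"
    and den: "\<And>x. x \<in> lam ` mons ?r \<union> T \<union> {w} \<Longrightarrow> x * f \<in> polys D"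
  proof -
    have "finite (lam ` mons ?r \<union> T \<union> {w})" using T finite_mons by simp
    moreover have "lam ` mons ?r \<union> T \<union> {w} \<subseteq> F" using T w mons_F lam_F by auto
    ultimately show ?thesis using common_denominator that by metis
  qed
  have fF: "f \<in> F" by (rule subsetD[OF polys_F f(1)])
  \<comment> \<open>Of the three factors \<open>f\<close>, two come out of \<open>lam\<close> from
    \<open>f ^ (2 * p)\<close>, and one clears the denominators of \<open>lam\<close> on the
    remainder monomials. The degree after one application is at most
    \<open>3 * D + 3 * D div p\<close>, which does not exceed \<open>6 * D\<close>.\<close>
  define H where "H = {x. f ^ 3 * x \<in> polys (6 * D)}"
  have "H \<subseteq> (\<lambda>y. y / f ^ 3) ` polys (6 * D)"
  proof
    fix x assume "x \<in> H"
    thus "x \<in> (\<lambda>y. y / f ^ 3) ` polys (6 * D)"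
      using f(2) by (intro image_eqI[of _ _ "f ^ 3 * x"]) (auto simp: H_def)
  qed
  hence fin: "finite H" by (rule finite_surj[OF finite_addspan[OF finite_mons]])
  have HF: "H \<subseteq> F"
  proof
    fix x assume "x \<in> H"
    hence "f ^ 3 * x / f ^ 3 \<in> F" using polys_F fF by (intro F_divide F_power) (auto simp: H_def)
    thus "x \<in> F" using f(2) by simp
  qed
  have "f ^ 2 * (w * f) \<in> polys (2 * D + D)" using f den by (intro polys_mult polys_power) auto
  hence "w \<in> H" unfolding H_def using polys_mono[of "2 * D + D" "6 * D"] by (simp add: power3_eq_cube power2_eq_square mult_ac)
  moreover have "lam (t * h) \<in> H" if t: "t \<in> T" and h: "h \<in> H" for t h
  proof -
    have tF: "t \<in> F" and hF: "h \<in> F" using t T h HF by auto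
    \<comment> \<open>Together with the factors attached to \<open>t\<close> and \<open>h\<close>,
      the total power of \<open>f\<close> is \<open>2 * p\<close>, which \<open>lam\<close> releases
      as \<open>f ^ 2\<close>.\<close>
    define y where "y = f ^ (2 * p - 4) * ((t * f) * (f ^ 3 * h))"
    let ?M = "(2 * p - 4) * D + (D + 6 * D)"
    have y: "y \<in> polys ?M"
      unfolding y_def using f den t h by (intro polys_mult polys_power) (auto simp: H_def)
    have "f ^ (2 * p - 4) * f * f ^ 3 = f ^ (2 * p - 4 + 1 + 3)" by (simp only: power_add power_one_right)
    also have "2 * p - 4 + 1 + 3 = p * 2" using p_ge_2 by simp
    finally have "y = (f ^ 2) ^ p * (t * h)" unfolding y_def by (simp add: mult_ac flip: power_mult)
    hence lamy: "lam y = f ^ 2 * lam (t * h)" using lam_mult fF tF hF by (simp add: F_mult F_power)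
    have mon: "f * lam m \<in> polys (?M div p + D)" if m: "m \<in> mons ?M" for m
    proof -
      obtain e where e: "m = monom e" "sum e B \<le> ?M" using m unfolding mons_def by blast
      let ?u = "monom (\<lambda>b. e b div p)" and ?v = "monom (\<lambda>b. e b mod p)"
      have "p * (\<Sum>b\<in>B. e b div p) \<le> sum e B"
        unfolding sum_distrib_left by (rule sum_mono) simp
      hence "(\<Sum>b\<in>B. e b div p) \<le> ?M div p"
        using e(2) p_pos by (simp add: less_eq_div_iff_mult_less_eq mult.commute)
      hence u: "?u \<in> polys (?M div p)" by (intro addspan_base finite_mons) (auto simp: mons_def)
      have "(\<Sum>b\<in>B. e b mod p) \<le> (\<Sum>b\<in>B. p - 1)"
        using p_pos by (intro sum_mono) (metis Suc_pred' less_Suc_eq_le mod_less_divisor)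
      hence "?v \<in> mons ?r" unfolding mons_def by (auto simp: mult.commute)
      hence "lam ?v * f \<in> polys D" using den by blast
      from polys_mult[OF u this] have "?u * (lam ?v * f) \<in> polys (?M div p + D)" .
      moreover have "lam m = ?u * lam ?v"
        unfolding e(1) by (subst monom_divmod) (intro lam_mult monom_F)
      ultimately show ?thesis by (simp add: mult_ac)
    qed
    have "y \<in> {x. x \<in> F \<and> f * lam x \<in> polys (?M div p + D)}"
      by (rule addspan_least[OF y]) (use mons_F mon in \<open>auto simp: lam_0 lam_add F_0 F_add addspan_0 addspan_add distrib_left\<close>)
    moreover have "?M div p + D \<le> 6 * D"
    proof -
      have "?M \<le> p * 2 * D + 3 * D" using p_ge_2 by (simp add: diff_mult_distrib)
      hence "?M div p \<le> (p * (2 * D) + 3 * D) div p" by (intro div_le_mono) (simp add: mult_ac)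
      also have "\<dots> = 2 * D + 3 * D div p" using p_pos by simp
      also have "3 * D div p \<le> 3 * D div 2" using p_ge_2 by (intro div_le_mono2) auto
      finally show ?thesis by linarith
    qed
    ultimately have "f * lam y \<in> polys (6 * D)" using polys_mono[of "?M div p + D" "6 * D"] by simp
    thus ?thesis unfolding H_def lamy by (simp add: power3_eq_cube power2_eq_square mult_ac)
  qed
  ultimately show ?thesis using fin HF by blast
qed

text \<open>If \<open>w = g * u ^ (p ^ m)\<close> with \<open>m > 0\<close> and
  \<open>g = t * s ^ p\<close>, then \<open>lam (inverse t * w)\<close> is
  \<open>s * u ^ (p ^ (m - 1))\<close>, of the same form again. By \<open>lam_stable\<close> all
  elements met on the way lie in one finite set, so for every \<open>m\<close> the base
  \<open>u\<close> can be replaced, up to a factor in \<open>G\<close>, by a member of that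
  set.\<close>

lemma divisible_in_group:
  assumes G: "mult_subgroup G" "G \<subseteq> F"
    and root: "\<And>x s. x \<in> F \<Longrightarrow> s > 0 \<Longrightarrow> x ^ s \<in> G \<Longrightarrow> x \<in> G"
    and T: "finite T" "T \<subseteq> G" "\<And>x. x \<in> G \<Longrightarrow> \<exists>t\<in>T. \<exists>s\<in>G. x = t * s ^ p"
    and w: "w \<in> F" "w \<noteq> 0" and div: "\<And>m. \<exists>g\<in>G. \<exists>u\<in>F. w = g * u ^ (p ^ m)"
  shows "w \<in> G"
proof -
  have G0: "0 \<notin> G" "1 \<in> G" and Gm: "\<And>x y. x \<in> G \<Longrightarrow> y \<in> G \<Longrightarrow> x * y \<in> G"
    and Gi: "\<And>x. x \<in> G \<Longrightarrow> inverse x \<in> G" using G by (auto simp: mult_subgroup_def)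
  have Gp: "x ^ k \<in> G" if "x \<in> G" for x k by (induction k) (auto intro: G0 Gm that)
  obtain H where H: "finite H" "H \<subseteq> F" "w \<in> H" "\<And>t h. t \<in> T \<Longrightarrow> h \<in> H \<Longrightarrow> lam (inverse t * h) \<in> H"
  proof -
    have "inverse ` T \<subseteq> F" using T(2) G(2) F_inverse by auto
    from lam_stable[OF finite_imageI[OF T(1)] this w(1)] show ?thesis using that by auto
  qed
  have key: "\<exists>h'\<in>H. \<exists>\<gamma>\<in>G. h = \<gamma> * h' ^ (p ^ k)" if "h \<in> H" "u \<in> F" "g \<in> G" "h = g * u ^ (p ^ k)" for h u g k
    using that
  proof (induction k arbitrary: h u g)
    case 0
    show ?case by (rule bexI[of _ h], rule bexI[of _ 1]) (use 0 G0 in simp_all)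
  next
    case (Suc k)
    obtain t s where ts: "t \<in> T" "s \<in> G" "g = t * s ^ p" using T(3)[OF Suc.prems(3)] by blast
    have t0: "t \<noteq> 0" using ts T G0 by auto
    let ?h = "s * u ^ (p ^ k)"
    have hF: "?h \<in> F" using ts Suc.prems G by (intro F_mult F_power) auto
    have "h = t * ?h ^ p"
      unfolding Suc.prems(4) ts(3) by (simp add: power_mult_distrib mult_ac flip: power_mult)
    hence "inverse t * h = ?h ^ p" using t0 by simp
    hence "?h \<in> H" using H(4)[OF ts(1) Suc.prems(1)] lam_power[OF hF] by simp
    from Suc.IH[OF this Suc.prems(2) ts(2) refl] obtain h' \<gamma> where
      h': "h' \<in> H" "\<gamma> \<in> G" "?h = \<gamma> * h' ^ (p ^ k)" by blast
    have "h = t * \<gamma> ^ p * h' ^ (p ^ Suc k)"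
      unfolding \<open>h = t * ?h ^ p\<close> h'(3) by (simp add: power_mult_distrib mult_ac flip: power_mult)
    moreover have "t * \<gamma> ^ p \<in> G" using ts T h' by (intro Gm Gp) auto
    ultimately show ?case using h'(1) by blast
  qed
  have "\<exists>h\<in>H. \<exists>\<gamma>\<in>G. w = \<gamma> * h ^ (p ^ m)" for m using div[of m] key H(3) by metis
  then obtain h where h: "\<And>m. h m \<in> H" "\<And>m. \<exists>\<gamma>\<in>G. w = \<gamma> * h m ^ (p ^ m)" by metis
  \<comment> \<open>Two levels share the same base. Comparing them puts a positive power of it into
    \<open>G\<close>, and closure under roots then gives the base itself.\<close>
  have "\<not> inj h"
    using H(1) h(1) by (metis finite_subset image_subsetI infinite_UNIV_nat finite_imageD)
  then obtain m m' where m: "m < m'" "h m = h m'" by (metis linorder_injI)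
  obtain \<gamma> where \<gamma>: "\<gamma> \<in> G" "w = \<gamma> * h m ^ (p ^ m)" using h(2) by blast
  obtain \<delta> where \<delta>: "\<delta> \<in> G" "w = \<delta> * h m ^ (p ^ m')" using h(2) m(2) by metis
  note gd = \<gamma> \<delta>
  have lt: "p ^ m < p ^ m'" using m(1) p_ge_2 by (intro power_strict_increasing) auto
  have h0: "h m \<noteq> 0" using \<gamma>(2) w(2) p_pos by (auto simp: power_0_left)
  have "h m ^ (p ^ m') = h m ^ (p ^ m' - p ^ m) * h m ^ (p ^ m)"
    using lt by (simp flip: power_add)
  hence "\<gamma> * h m ^ (p ^ m) = \<delta> * h m ^ (p ^ m' - p ^ m) * h m ^ (p ^ m)"
    using \<gamma>(2) \<delta>(2) by (metis mult.assoc)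
  hence "\<gamma> = \<delta> * h m ^ (p ^ m' - p ^ m)" using h0 by simp
  moreover have "\<delta> \<noteq> 0" using \<delta>(1) G0 by auto
  ultimately have "h m ^ (p ^ m' - p ^ m) = \<gamma> * inverse \<delta>" by (simp add: field_simps)
  hence "h m ^ (p ^ m' - p ^ m) \<in> G" using gd by (auto intro: Gm Gi)
  hence "h m \<in> G" using root h(1) H(2) lt by (metis subsetD zero_less_diff)
  hence "\<gamma> * h m ^ (p ^ m) \<in> G" by (intro Gm Gp \<gamma>(1))
  thus ?thesis using \<gamma>(2) by simp
qed

end


subsection \<open>Finitely generated multiplicative groups\<close>

lemma mult_subgroupD:
  assumes "mult_subgroup G"
  shows "0 \<notin> G" "1 \<in> G" "x \<in> G \<Longrightarrow> y \<in> G \<Longrightarrow> x * y \<in> G" "x \<in> G \<Longrightarrow> inverse x \<in> G"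
    "x \<in> G \<Longrightarrow> x \<noteq> 0"
  using assms unfolding mult_subgroup_def by auto

lemma mult_subgroupI:
  "0 \<notin> G \<Longrightarrow> 1 \<in> G \<Longrightarrow> (\<And>x y. x \<in> G \<Longrightarrow> y \<in> G \<Longrightarrow> x * y \<in> G) \<Longrightarrow>
     (\<And>x. x \<in> G \<Longrightarrow> inverse x \<in> G) \<Longrightarrow> mult_subgroup G"
  unfolding mult_subgroup_def by simp

lemma mult_subgroup_divide: "mult_subgroup G \<Longrightarrow> x \<in> G \<Longrightarrow> y \<in> G \<Longrightarrow> x / y \<in> G"
  by (simp add: divide_inverse mult_subgroupD)

lemma mult_subgroup_power: "mult_subgroup G \<Longrightarrow> x \<in> G \<Longrightarrow> x ^ k \<in> G"
  by (induction k) (auto intro: mult_subgroupD)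

lemma mult_subgroup_power_int: "mult_subgroup G \<Longrightarrow> x \<in> G \<Longrightarrow> x powi k \<in> G"
  by (auto simp: power_int_def intro: mult_subgroup_power mult_subgroupD)

lemma mult_subgroup_prod: "mult_subgroup G \<Longrightarrow> (\<And>i. i \<in> A \<Longrightarrow> f i \<in> G) \<Longrightarrow> prod f A \<in> G"
  by (induction A rule: infinite_finite_induct) (auto intro: mult_subgroupD)

lemma mult_subgroup_hull:
  assumes "0 \<notin> X"
  shows "mult_subgroup (mult_subgroup hull X)"
proof -
  have "mult_subgroup (- {0 :: 'a})" by (auto simp: mult_subgroup_def)
  hence "mult_subgroup hull X \<subseteq> - {0}" using assms by (intro hull_minimal) auto
  thus ?thesis unfolding mult_subgroup_def by (auto simp: hull_def)
qed

lemma mult_subgroup_powers: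
  assumes "mult_subgroup G"
  shows "mult_subgroup ((\<lambda>s. s ^ q) ` G)"
  unfolding mult_subgroup_def
proof (intro conjI ballI)
  show "0 \<notin> (\<lambda>s. s ^ q) ` G" using mult_subgroupD[OF assms] by auto
  show "1 \<in> (\<lambda>s. s ^ q) ` G" by (rule image_eqI[of _ _ 1]) (use mult_subgroupD[OF assms] in auto)
next
  fix x y assume "x \<in> (\<lambda>s. s ^ q) ` G" "y \<in> (\<lambda>s. s ^ q) ` G"
  then obtain s t where "s \<in> G" "t \<in> G" "x = s ^ q" "y = t ^ q" by blast
  thus "x * y \<in> (\<lambda>s. s ^ q) ` G"
    by (intro image_eqI[of _ _ "s * t"]) (auto simp: power_mult_distrib mult_subgroupD[OF assms])
next
  fix x assume "x \<in> (\<lambda>s. s ^ q) ` G"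
  then obtain s where "s \<in> G" "x = s ^ q" by blast
  thus "inverse x \<in> (\<lambda>s. s ^ q) ` G"
    by (intro image_eqI[of _ _ "inverse s"]) (auto simp: power_inverse mult_subgroupD[OF assms])
qed

lemma root_closure_subgroup:
  assumes "mult_subgroup G"
  shows "mult_subgroup (root_closure G)"
  unfolding mult_subgroup_def
proof (intro conjI ballI)
  show "0 \<notin> root_closure G" using mult_subgroupD[OF assms] by (auto simp: root_closure_def power_0_left)
  show "1 \<in> root_closure G" using mult_subgroupD[OF assms] by (auto simp: root_closure_def)
next
  fix x y assume "x \<in> root_closure G" "y \<in> root_closure G"
  then obtain s t where st: "s > 0" "t > 0" "x ^ s \<in> G" "y ^ t \<in> G" by (auto simp: root_closure_def)
  have "(x * y) ^ (s * t) = (x ^ s) ^ t * (y ^ t) ^ s"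
    by (simp add: power_mult_distrib mult.commute flip: power_mult)
  hence "(x * y) ^ (s * t) \<in> G" using st assms by (simp add: mult_subgroup_power mult_subgroupD)
  thus "x * y \<in> root_closure G" using st by (auto simp: root_closure_def intro!: exI[of _ "s * t"])
next
  fix x assume "x \<in> root_closure G"
  then obtain s where "s > 0" "x ^ s \<in> G" by (auto simp: root_closure_def)
  thus "inverse x \<in> root_closure G"
    using mult_subgroupD(4)[OF assms] by (auto simp: root_closure_def power_inverse intro!: exI[of _ s])
qed

lemma root_closure_root: "x ^ s \<in> root_closure G \<Longrightarrow> s > 0 \<Longrightarrow> x \<in> root_closure G"
proof -
  assume "x ^ s \<in> root_closure G" "s > 0"
  moreover from this obtain t where "t > 0" "(x ^ s) ^ t \<in> G" by (auto simp: root_closure_def)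
  ultimately show ?thesis by (auto simp: root_closure_def intro!: exI[of _ "s * t"] simp flip: power_mult)
qed

lemma root_closure_superset: "G \<subseteq> root_closure G"
  unfolding root_closure_def by (auto intro!: exI[of _ 1])

text \<open>
  A set of representatives is recognised on generators. Inverses come for free because
  \<open>inverse a = a ^ (k - 1) / a ^ k\<close> with \<open>a ^ k\<close> in the subgroup.
\<close>

lemma reps_all:
  assumes B: "0 \<notin> B" and H: "mult_subgroup H"
    and step: "\<And>t b. t \<in> T \<Longrightarrow> b \<in> B \<Longrightarrow> \<exists>t'\<in>T. \<exists>h\<in>H. t * b = t' * h"
    and pow: "\<And>a. a \<in> mult_subgroup hull B \<Longrightarrow> \<exists>k>0. a ^ k \<in> H"
    and x: "x \<in> mult_subgroup hull B" and t: "t \<in> T"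
  shows "\<exists>t'\<in>T. \<exists>h\<in>H. t * x = t' * h"
proof -
  let ?G = "mult_subgroup hull B"
  note G = mult_subgroup_hull[OF B]
  define A where "A = {a \<in> ?G. \<forall>t\<in>T. \<exists>t'\<in>T. \<exists>h\<in>H. t * a = t' * h}"
  have mult: "a * b \<in> A" if a: "a \<in> A" and b: "b \<in> A" for a b
    unfolding A_def
  proof (intro CollectI conjI ballI)
    show "a * b \<in> ?G" using a b G by (auto simp: A_def mult_subgroupD)
    fix t assume "t \<in> T"
    then obtain t' h where 1: "t' \<in> T" "h \<in> H" "t * a = t' * h" using a unfolding A_def by blast
    then obtain t'' h' where 2: "t'' \<in> T" "h' \<in> H" "t' * b = t'' * h'" using b unfolding A_def by blast
    have "t * (a * b) = t'' * (h' * h)" using 1(3) 2(3) by (metis mult.assoc mult.commute)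
    thus "\<exists>t'\<in>T. \<exists>h\<in>H. t * (a * b) = t' * h" using 1 2 mult_subgroupD(3)[OF H] by blast
  qed
  have one: "1 \<in> A" unfolding A_def
  proof (intro CollectI conjI ballI)
    fix t assume "t \<in> T"
    thus "\<exists>t'\<in>T. \<exists>h\<in>H. t * 1 = t' * h" using mult_subgroupD(2)[OF H] by (intro bexI[of _ t] bexI[of _ 1]) auto
  qed (rule mult_subgroupD(2)[OF G])
  have pw: "a ^ k \<in> A" if "a \<in> A" for a k by (induction k) (auto intro: one mult that)
  have inv: "inverse a \<in> A" if a: "a \<in> A" for a
  proof -
    have aG: "a \<in> ?G" "a \<noteq> 0" using a mult_subgroupD(5)[OF G] by (auto simp: A_def)
    obtain k where k: "k > 0" "a ^ k \<in> H" using pow[OF aG(1)] by blast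
    have "inverse a = a ^ (k - 1) * inverse (a ^ k)"
      using k(1) aG(2) by (cases k) (auto simp: field_simps)
    moreover have "inverse (a ^ k) \<in> A"
      unfolding A_def
    proof (intro CollectI conjI ballI)
      fix t assume "t \<in> T"
      thus "\<exists>t'\<in>T. \<exists>h\<in>H. t * inverse (a ^ k) = t' * h"
        using mult_subgroupD(4)[OF H k(2)] by (intro bexI[of _ t] bexI[of _ "inverse (a ^ k)"]) auto
    qed (rule mult_subgroupD(4)[OF G mult_subgroup_power[OF G aG(1)]])
    ultimately show ?thesis using mult[OF pw[OF a]] by metis
  qed
  have "mult_subgroup A"
    unfolding mult_subgroup_def using one mult inv mult_subgroupD(1)[OF G] by (auto simp: A_def)
  moreover have "B \<subseteq> A"
  proof
    fix b assume b: "b \<in> B"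
    show "b \<in> A" unfolding A_def using hull_inc[OF b] step[OF _ b] by auto
  qed
  ultimately have "?G \<subseteq> A" by (intro hull_minimal)
  thus ?thesis using x t unfolding A_def by blast
qed

text \<open>The representatives are the monomials in the generators with the exponent of
  \<open>b\<close> below some \<open>k b\<close> for which \<open>b ^ k b\<close> lies in
  \<open>H\<close>. Multiplication by \<open>b\<close> either stays in range or returns the exponent
  to 0 and leaves a factor in \<open>H\<close>.\<close>

lemma ex_reps:
  assumes B: "finite B" "0 \<notin> B" and H: "mult_subgroup H" and pow: "\<And>b. b \<in> B \<Longrightarrow> \<exists>k>0. b ^ k \<in> H"
  shows "\<exists>T. finite T \<and> T \<subseteq> mult_subgroup hull B \<and> 1 \<in> T \<and>
           (\<forall>t\<in>T. \<forall>b\<in>B. \<exists>t'\<in>T. \<exists>h\<in>H. t * b = t' * h)"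
proof -
  obtain k where k: "\<And>b. b \<in> B \<Longrightarrow> k b > 0" "\<And>b. b \<in> B \<Longrightarrow> b ^ k b \<in> H" using pow by metis
  let ?E = "{e. \<forall>b. (b \<in> B \<longrightarrow> e b \<in> {..<Max (k ` B)}) \<and> (b \<notin> B \<longrightarrow> e b = 0)}"
  let ?E' = "{e \<in> ?E. \<forall>b\<in>B. e b < k b}"
  let ?m = "\<lambda>e. \<Prod>b\<in>B. b ^ e b"
  have fin: "finite (?m ` ?E')"
    using finite_set_of_finite_funs[OF B(1), of "{..<Max (k ` B)}" 0] by (intro finite_imageI) auto
  have lt: "e b < Max (k ` B)" if "b \<in> B" "e b < k b" for e b
    using that B(1) Max_ge[of "k ` B" "k b"] by (meson finite_imageI image_eqI less_le_trans)
  have "?m ` ?E' \<subseteq> mult_subgroup hull B"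
    using mult_subgroup_hull[OF B(2)] hull_subset[of B mult_subgroup]
    by (auto intro!: mult_subgroup_prod mult_subgroup_power)
  moreover have "1 \<in> ?m ` ?E'"
    by (rule image_eqI[of _ _ "\<lambda>_. 0"]) (use k lt[of _ "\<lambda>_. 0"] in auto)
  moreover have "\<exists>t'\<in>?m ` ?E'. \<exists>h\<in>H. t * b = t' * h" if t: "t \<in> ?m ` ?E'" and b: "b \<in> B" for t b
  proof -
    obtain e where e: "e \<in> ?E'" "t = ?m e" using t by blast
    have rem: "?m f = b ^ f b * (\<Prod>x\<in>B - {b}. x ^ f x)" for f by (rule prod.remove[OF B(1) b])
    show ?thesis
    proof (cases "Suc (e b) < k b")
      case True
      let ?f = "e(b := Suc (e b))"
      have "?f \<in> ?E'" using e(1) True lt b by auto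
      moreover have "t * b = ?m ?f * 1" unfolding e(2) rem by (simp add: mult_ac)
      ultimately show ?thesis using mult_subgroupD(2)[OF H] by blast
    next
      case False
      hence eb: "Suc (e b) = k b" using e(1) b by auto
      let ?f = "e(b := 0)"
      have "?f \<in> ?E'" using e(1) b k(1) lt by auto
      moreover have "t * b = ?m ?f * b ^ k b"
        unfolding e(2) rem eb[symmetric] by (simp add: mult_ac)
      ultimately show ?thesis using k(2)[OF b] by blast
    qed
  qed
  ultimately show ?thesis using fin by (intro exI[of _ "?m ` ?E'"]) auto
qed

definition torsion :: "'k::field set" where
  "torsion = {x. \<exists>s>0. x ^ s = 1}"

lemma torsion_subgroup: "mult_subgroup (torsion :: 'k::field set)"
proof -
  have "torsion = root_closure {1 :: 'k}" by (auto simp: torsion_def root_closure_def)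
  moreover have "mult_subgroup {1 :: 'k}" by (auto simp: mult_subgroup_def)
  ultimately show ?thesis using root_closure_subgroup by metis
qed

lemma torsion_root: "x ^ s \<in> torsion \<Longrightarrow> s > 0 \<Longrightarrow> x \<in> torsion"
proof -
  assume "x ^ s \<in> torsion" "s > 0"
  moreover from this obtain t where "t > 0" "(x ^ s) ^ t = 1" by (auto simp: torsion_def)
  ultimately show ?thesis by (auto simp: torsion_def intro!: exI[of _ "s * t"] simp flip: power_mult)
qed

lemma torsion_root_int:
  assumes "x powi k \<in> torsion" "k \<noteq> 0"
  shows "x \<in> torsion"
proof -
  have "x ^ nat \<bar>k\<bar> \<in> torsion"
    using assms mult_subgroupD(4)[OF torsion_subgroup, of "x powi k"]
    by (cases "k \<ge> 0") (auto simp: power_int_def power_inverse)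
  thus ?thesis using torsion_root assms(2) by force
qed

definition zprod :: "'i set \<Rightarrow> ('i \<Rightarrow> 'k::field) \<Rightarrow> ('i \<Rightarrow> int) \<Rightarrow> 'k" where
  "zprod A g f = (\<Prod>i\<in>A. g i powi f i)"

lemma zprod_add:
  assumes "\<And>i. i \<in> A \<Longrightarrow> g i \<noteq> 0"
  shows "zprod A g (\<lambda>i. f i + h i) = zprod A g f * zprod A g h"
  unfolding zprod_def prod.distrib[symmetric] using assms by (intro prod.cong) (auto simp: power_int_add)

lemma zprod_minus: "zprod A g (\<lambda>i. - f i) = inverse (zprod A g f)"
  unfolding zprod_def by (simp add: power_int_minus prod_inversef[symmetric] o_def)

lemma zprod_0 [simp]: "zprod A g (\<lambda>i. 0) = 1"
  by (simp add: zprod_def)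

lemma zprod_nonzero: "(\<And>i. i \<in> A \<Longrightarrow> g i \<noteq> 0) \<Longrightarrow> zprod A g f \<noteq> 0"
  by (induction A rule: infinite_finite_induct) (auto simp: zprod_def)

lemma zprod_mult: "zprod A g (\<lambda>i. f i * int k) = zprod A g f ^ k"
  unfolding zprod_def by (simp add: power_int_mult prod_power_distrib)

lemma zprod_mem: "mult_subgroup G \<Longrightarrow> (\<And>i. i \<in> A \<Longrightarrow> g i \<in> G) \<Longrightarrow> zprod A g f \<in> G"
  unfolding zprod_def by (intro mult_subgroup_prod mult_subgroup_power_int)

lemma zprod_single:
  assumes "finite A" "i \<in> A"
  shows "zprod A g (\<lambda>j. if j = i then 1 else 0) = g i"
proof -
  have "zprod A g (\<lambda>j. if j = i then 1 else 0) = (\<Prod>j\<in>A. if j = i then g j else 1)"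
    unfolding zprod_def by (rule prod.cong) auto
  thus ?thesis using assms by simp
qed

definition gens_mod_torsion :: "'k::field set \<Rightarrow> 'i set \<Rightarrow> ('i \<Rightarrow> 'k) \<Rightarrow> bool" where
  "gens_mod_torsion G A g \<longleftrightarrow> finite A \<and> (\<forall>i\<in>A. g i \<in> G) \<and> (\<forall>x\<in>G. \<exists>f. x / zprod A g f \<in> torsion)"

definition indep_mod_torsion :: "'i set \<Rightarrow> ('i \<Rightarrow> 'k::field) \<Rightarrow> bool" where
  "indep_mod_torsion A g \<longleftrightarrow> (\<forall>f. zprod A g f \<in> torsion \<longrightarrow> (\<forall>i\<in>A. f i = 0))"

lemma gens_finite:
  assumes B: "finite B" "0 \<notin> B"
  shows "gens_mod_torsion (mult_subgroup hull B) B (\<lambda>b. b)"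
proof -
  let ?T = "{x. x \<noteq> 0 \<and> (\<exists>f. x / zprod B (\<lambda>b. b) f \<in> torsion)}"
  have nz: "\<And>b. b \<in> B \<Longrightarrow> b \<noteq> 0" using B by auto
  note tor = mult_subgroupD[OF torsion_subgroup]
  have "mult_subgroup ?T"
    unfolding mult_subgroup_def
  proof (intro conjI ballI)
    show "1 \<in> ?T" using tor(2) by (auto intro!: exI[of _ "\<lambda>_. 0"])
  next
    fix x y assume "x \<in> ?T" "y \<in> ?T"
    then obtain f h where fh: "x \<noteq> 0" "y \<noteq> 0" "x / zprod B (\<lambda>b. b) f \<in> torsion"
      "y / zprod B (\<lambda>b. b) h \<in> torsion" by blast
    have "x * y / zprod B (\<lambda>b. b) (\<lambda>i. f i + h i) = (x / zprod B (\<lambda>b. b) f) * (y / zprod B (\<lambda>b. b) h)"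
      by (simp add: zprod_add[OF nz])
    thus "x * y \<in> ?T" using fh tor(3) by (metis (mono_tags, lifting) mem_Collect_eq mult_eq_0_iff)
  next
    fix x assume "x \<in> ?T"
    then obtain f where f: "x \<noteq> 0" "x / zprod B (\<lambda>b. b) f \<in> torsion" by blast
    have "inverse x / zprod B (\<lambda>b. b) (\<lambda>i. - f i) = inverse (x / zprod B (\<lambda>b. b) f)"
      by (simp add: zprod_minus field_simps)
    thus "inverse x \<in> ?T" using f tor(4) by (metis (mono_tags, lifting) mem_Collect_eq inverse_nonzero_iff_nonzero)
  qed simp
  moreover have "B \<subseteq> ?T"
  proof
    fix b assume b: "b \<in> B"
    have "b / zprod B (\<lambda>b. b) (\<lambda>j. if j = b then 1 else 0) \<in> torsion"
      unfolding zprod_single[OF B(1) b] using nz[OF b] tor(2) by simp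
    thus "b \<in> ?T" using nz[OF b] by blast
  qed
  ultimately have "mult_subgroup hull B \<subseteq> ?T" by (intro hull_minimal)
  thus ?thesis unfolding gens_mod_torsion_def using B hull_subset[of B mult_subgroup] by blast
qed

lemma zprod_remove: "finite A \<Longrightarrow> i \<in> A \<Longrightarrow> zprod A g f = g i powi f i * zprod (A - {i}) g f"
  unfolding zprod_def by (rule prod.remove)

lemma zprod_cong: "(\<And>i. i \<in> A \<Longrightarrow> g i powi f i = g' i powi f' i) \<Longrightarrow> zprod A g f = zprod A g' f'"
  unfolding zprod_def by (rule prod.cong) auto

text \<open>
  Euclid's algorithm on the exponents of a relation, changing the generators along, produces
  a superfluous generator.
\<close>

lemma drop_generator:
  fixes A :: "'i set" and g :: "'i \<Rightarrow> 'k::field"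
  assumes G: "mult_subgroup G"
  shows "gens_mod_torsion G A g \<Longrightarrow> zprod A g f \<in> torsion \<Longrightarrow> \<exists>i\<in>A. f i \<noteq> 0 \<Longrightarrow>
    \<exists>(A' :: 'i set) g'. gens_mod_torsion G A' g' \<and> card A' < card A"
proof (induction "\<Sum>i\<in>A. nat \<bar>f i\<bar>" arbitrary: f g rule: less_induct)
  case less
  note tor = mult_subgroupD[OF torsion_subgroup]
  have fin: "finite A" and gG: "\<And>i. i \<in> A \<Longrightarrow> g i \<in> G" and gen: "\<And>x. x \<in> G \<Longrightarrow> \<exists>h. x / zprod A g h \<in> torsion"
    using less.prems(1) by (auto simp: gens_mod_torsion_def)
  have nz: "g i \<noteq> 0" if "i \<in> A" for i using gG[OF that] mult_subgroupD(5)[OF G] by blast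
  obtain i where i: "i \<in> A" "f i \<noteq> 0" using less.prems by blast
  show ?case
  proof (cases "\<exists>j\<in>A. j \<noteq> i \<and> f j \<noteq> 0")
    case False
    have "zprod (A - {i}) g f = zprod (A - {i}) g (\<lambda>_. 0)" using False by (intro zprod_cong) auto
    hence "g i powi f i \<in> torsion" using less.prems(2) zprod_remove[OF fin i(1), of g f] by simp
    hence gi: "g i \<in> torsion" using torsion_root_int i(2) by blast
    have "\<exists>h. x / zprod (A - {i}) g h \<in> torsion" if x: "x \<in> G" for x
    proof -
      obtain h where h: "x / zprod A g h \<in> torsion" using gen[OF x] by blast
      have "g i powi h i * (x / zprod A g h) \<in> torsion"
        by (intro tor(3) mult_subgroup_power_int torsion_subgroup gi h)
      moreover have "g i powi h i * (x / zprod A g h) = x / zprod (A - {i}) g h"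
        unfolding zprod_remove[OF fin i(1)] using nz[OF i(1)] by simp
      ultimately show ?thesis by metis
    qed
    hence "gens_mod_torsion G (A - {i}) g" using fin gG by (auto simp: gens_mod_torsion_def)
    thus ?thesis using card_Diff1_less[OF fin i(1)] by blast
  next
    case True
    then obtain i j where ij: "i \<in> A" "j \<in> A" "i \<noteq> j" "f i \<noteq> 0" "f j \<noteq> 0" "\<bar>f j\<bar> \<le> \<bar>f i\<bar>"
      using i by (metis linorder_le_cases)
    \<comment> \<open>The sign is chosen so that \<open>f i - \<epsilon> * f j\<close> has absolute
      value \<open>\<bar>f i\<bar> - \<bar>f j\<bar>\<close>; replacing \<open>g j\<close> by
      \<open>g j * g i powi \<epsilon>\<close> compensates for the change of exponent.\<close>
    define \<epsilon> where "\<epsilon> = sgn (f i) * sgn (f j)"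
    define g' where "g' = g(j := g j * g i powi \<epsilon>)"
    have eq: "zprod A g' (h(i := h i - \<epsilon> * h j)) = zprod A g h" for h
    proof -
      have j: "j \<in> A - {i}" using ij by auto
      have "zprod (A - {i} - {j}) g' (h(i := h i - \<epsilon> * h j)) = zprod (A - {i} - {j}) g h"
        by (rule zprod_cong) (auto simp: g'_def)
      moreover have "g i powi (h i - \<epsilon> * h j) * (g i powi \<epsilon>) powi h j = g i powi h i"
        using nz[OF ij(1)] by (simp flip: power_int_mult power_int_add)
      ultimately show ?thesis
        unfolding zprod_remove[OF fin ij(1)] zprod_remove[OF finite_Diff[OF fin] j] g'_def
        using ij by (simp add: power_int_mult_distrib mult_ac)
    qed
    have g'G: "g' l \<in> G" if "l \<in> A" for l
      using gG ij that unfolding g'_def by (auto intro!: mult_subgroupD(3)[OF G] mult_subgroup_power_int[OF G])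
    have gens: "gens_mod_torsion G A g'"
      unfolding gens_mod_torsion_def
    proof (intro conjI ballI fin g'G)
      fix x assume "x \<in> G"
      then obtain h where "x / zprod A g h \<in> torsion" using gen by blast
      thus "\<exists>h. x / zprod A g' h \<in> torsion" using eq by metis
    qed
    let ?f = "f(i := f i - \<epsilon> * f j)"
    have "\<bar>?f i\<bar> < \<bar>f i\<bar>"
      using ij(4-6) unfolding \<epsilon>_def by (auto simp: sgn_if abs_if split: if_splits)
    moreover have "(\<Sum>l\<in>A. nat \<bar>h l\<bar>) = nat \<bar>h i\<bar> + (\<Sum>l\<in>A - {i}. nat \<bar>h l\<bar>)" for h :: "_ \<Rightarrow> int"
      by (rule sum.remove[OF fin ij(1)])
    moreover have "(\<Sum>l\<in>A - {i}. nat \<bar>?f l\<bar>) = (\<Sum>l\<in>A - {i}. nat \<bar>f l\<bar>)" by (rule sum.cong) auto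
    ultimately have "(\<Sum>l\<in>A. nat \<bar>?f l\<bar>) < (\<Sum>l\<in>A. nat \<bar>f l\<bar>)" by simp
    moreover have "\<exists>l\<in>A. ?f l \<noteq> 0" using ij by (intro bexI[of _ j]) auto
    ultimately show ?thesis
      using less.hyps[of ?f g'] gens less.prems(2) eq[of f] by simp
  qed
qed

text \<open>A family of least size that generates modulo torsion has no relation, by
  \<open>drop_generator\<close>. It is renumbered as a list, the form in which it enters
  certificates.\<close>

lemma ex_independent:
  assumes "mult_subgroup G" "fin_gen G"
  shows "\<exists>gs. set gs \<subseteq> G \<and> gens_mod_torsion G {..<length gs} ((!) gs) \<and> indep_mod_torsion {..<length gs} ((!) gs)"
proof -
  define P where "P = (\<lambda>(A :: 'a set, g :: 'a \<Rightarrow> 'a). gens_mod_torsion G A g)"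
  obtain B where B: "finite B" "B \<subseteq> G" "G = mult_subgroup hull B" using assms(2) by (auto simp: fin_gen_def)
  have "P (B, \<lambda>b. b)" using gens_finite[of B] B mult_subgroupD(1)[OF assms(1)] by (auto simp: P_def)
  then obtain z where z: "P z" "\<And>y. P y \<Longrightarrow> card (fst z) \<le> card (fst y)"
    using ex_has_least_nat[of P "(B, \<lambda>b. b)" "\<lambda>z. card (fst z)"] by blast
  obtain A g where Ag: "z = (A, g)" by fastforce
  have gens: "gens_mod_torsion G A g" using z(1) Ag by (simp add: P_def)
  have min: "\<not> card A' < card A" if "gens_mod_torsion G A' g'" for A' :: "'a set" and g'
    using z(2)[of "(A', g')"] that Ag by (simp add: P_def)
  have indep: "indep_mod_torsion A g"
    unfolding indep_mod_torsion_def using drop_generator[OF assms(1) gens] min by blast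
  have fin: "finite A" using gens by (simp add: gens_mod_torsion_def)
  obtain h where h: "bij_betw h {..<card A} A" using ex_bij_betw_nat_finite[OF fin] by (auto simp: atLeast0LessThan)
  define gs where "gs = map (\<lambda>i. g (h i)) [0..<card A]"
  have len: "length gs = card A" by (simp add: gs_def)
  have hA: "h i \<in> A" if "i < card A" for i using h that by (auto simp: bij_betw_def)
  have zp: "zprod {..<length gs} ((!) gs) f = zprod A g (\<lambda>a. f (the_inv_into {..<card A} h a))" for f
  proof -
    have "zprod A g (\<lambda>a. f (the_inv_into {..<card A} h a))
        = (\<Prod>i\<in>{..<card A}. g (h i) powi f (the_inv_into {..<card A} h (h i)))"
      unfolding zprod_def by (rule prod.reindex_bij_betw[OF h, symmetric])
    also have "\<dots> = zprod {..<length gs} ((!) gs) f"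
      unfolding zprod_def len using h
      by (intro prod.cong) (auto simp: gs_def the_inv_into_f_f bij_betw_def)
    finally show ?thesis ..
  qed
  have "\<exists>f. x / zprod {..<length gs} ((!) gs) f \<in> torsion" if x: "x \<in> G" for x
  proof -
    obtain f where f: "x / zprod A g f \<in> torsion" using gens x by (auto simp: gens_mod_torsion_def)
    have "zprod A g (\<lambda>a. f (h (the_inv_into {..<card A} h a))) = zprod A g f"
      using h by (intro zprod_cong) (simp add: f_the_inv_into_f_bij_betw)
    thus ?thesis using f zp[of "\<lambda>i. f (h i)"] by metis
  qed
  moreover have "gs ! i \<in> G" if "i < length gs" for i
    using gens hA that by (auto simp: gens_mod_torsion_def gs_def)
  moreover have "f i = 0" if "zprod {..<length gs} ((!) gs) f \<in> torsion" "i < length gs" for f i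
  proof -
    have "f (the_inv_into {..<card A} h (h i)) = 0"
      using indep that hA[of i] len unfolding zp indep_mod_torsion_def by auto
    thus ?thesis using that h by (simp add: the_inv_into_f_f bij_betw_def len)
  qed
  moreover have "set gs \<subseteq> G" using calculation(2) by (metis in_set_conv_nth subsetI)
  ultimately show ?thesis unfolding gens_mod_torsion_def indep_mod_torsion_def by (intro exI[of _ gs]) auto
qed

text \<open>Each generator is a torsion element times a product of independent elements. These
  finitely many torsion elements generate a finite group, and every element of \<open>G\<close> is
  one of its members times an independent part; for a torsion element the independent part is
  trivial.\<close>

lemma finite_torsion:
  assumes G: "mult_subgroup G" "fin_gen G"
  shows "finite (torsion \<inter> G)"
proof -
  obtain gs where gs: "set gs \<subseteq> G" "gens_mod_torsion G {..<length gs} ((!) gs)"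
    "indep_mod_torsion {..<length gs} ((!) gs)" using ex_independent[OF G] by blast
  let ?z = "zprod {..<length gs} ((!) gs)"
  have nz: "gs ! i \<noteq> 0" if "i \<in> {..<length gs}" for i
    using mult_subgroupD(5)[OF G(1) subsetD[OF gs(1) nth_mem]] that by simp
  obtain B where B: "finite B" "B \<subseteq> G" "G = mult_subgroup hull B" using G(2) by (auto simp: fin_gen_def)
  have B0: "0 \<notin> B" using B mult_subgroupD(1)[OF G(1)] by auto
  have "\<forall>b\<in>B. \<exists>f. b / ?z f \<in> torsion" using gs(2) B(2) unfolding gens_mod_torsion_def by blast
  then obtain f where f: "\<And>b. b \<in> B \<Longrightarrow> b / ?z (f b) \<in> torsion" by metis
  define \<zeta> where "\<zeta> = (\<lambda>b. b / ?z (f b))"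
  have \<zeta>t: "\<zeta> b \<in> torsion" if "b \<in> B" for b using f[OF that] by (simp add: \<zeta>_def)
  have \<zeta>0: "0 \<notin> \<zeta> ` B"
  proof
    assume "0 \<in> \<zeta> ` B"
    then obtain b where "b \<in> B" "0 = \<zeta> b" by blast
    thus False using \<zeta>t[of b] mult_subgroupD(1)[OF torsion_subgroup[where 'k = 'a]] by simp
  qed
  let ?Z = "mult_subgroup hull (\<zeta> ` B)"
  note Z = mult_subgroup_hull[OF \<zeta>0]
  have Ztor: "?Z \<subseteq> torsion" using \<zeta>t torsion_subgroup by (intro hull_minimal) auto
  have one: "mult_subgroup {1 :: 'a}" by (auto simp: mult_subgroup_def)
  have tp: "\<exists>k>0. a ^ k \<in> {1}" if "a \<in> torsion" for a :: 'a using that by (auto simp: torsion_def)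
  obtain T where T: "finite T" "1 \<in> T" "\<forall>t\<in>T. \<forall>b\<in>\<zeta> ` B. \<exists>t'\<in>T. \<exists>h\<in>{1}. t * b = t' * h"
    using ex_reps[OF finite_imageI[OF B(1)] \<zeta>0 one] \<zeta>t tp by (metis imageE)
  have "?Z \<subseteq> T"
  proof
    fix x assume "x \<in> ?Z"
    thus "x \<in> T" using reps_all[OF \<zeta>0 one, of T x 1] T tp Ztor by (auto simp: subset_iff)
  qed
  hence fin: "finite ?Z" using T(1) finite_subset by blast
  let ?A = "{x. x \<noteq> 0 \<and> (\<exists>h. x / ?z h \<in> ?Z)}"
  have "mult_subgroup ?A"
  proof (rule mult_subgroupI)
    show "1 \<in> ?A" using mult_subgroupD(2)[OF Z] by (auto intro!: exI[of _ "\<lambda>_. 0"])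
  next
    fix x y assume "x \<in> ?A" "y \<in> ?A"
    then obtain h k where hk: "x \<noteq> 0" "y \<noteq> 0" "x / ?z h \<in> ?Z" "y / ?z k \<in> ?Z" by blast
    have "x * y / ?z (\<lambda>i. h i + k i) = (x / ?z h) * (y / ?z k)" 
      using zprod_add[of "{..<length gs}" "(!) gs" h k] nz by simp
    thus "x * y \<in> ?A" using hk mult_subgroupD(3)[OF Z] by (metis (mono_tags, lifting) mem_Collect_eq mult_eq_0_iff)
  next
    fix x assume "x \<in> ?A"
    then obtain h where h: "x \<noteq> 0" "x / ?z h \<in> ?Z" by blast
    have "inverse x / ?z (\<lambda>i. - h i) = inverse (x / ?z h)" by (simp add: zprod_minus field_simps)
    thus "inverse x \<in> ?A" using h mult_subgroupD(4)[OF Z] by (metis (mono_tags, lifting) mem_Collect_eq inverse_nonzero_iff_nonzero)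
  qed auto
  moreover have "B \<subseteq> ?A"
    using B0 hull_subset[of "\<zeta> ` B" mult_subgroup] unfolding \<zeta>_def by blast
  ultimately have GA: "G \<subseteq> ?A" unfolding B(3) by (intro hull_minimal)
  have "torsion \<inter> G \<subseteq> ?Z"
  proof
    fix x assume x: "x \<in> torsion \<inter> G"
    then obtain h where h: "x / ?z h \<in> ?Z" "x \<noteq> 0" using GA by blast
    have "?z h = x / (x / ?z h)" using h by simp
    moreover have "x / (x / ?z h) \<in> torsion"
      by (rule mult_subgroup_divide[OF torsion_subgroup]) (use x h Ztor in blast)+
    ultimately have "\<forall>i\<in>{..<length gs}. h i = 0" using gs(3) unfolding indep_mod_torsion_def by metis
    hence "?z h = ?z (\<lambda>_. 0)" by (intro zprod_cong) simp
    thus "x \<in> ?Z" using h(1) by simp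
  qed
  thus ?thesis using fin finite_subset by blast
qed

text \<open>By independence every exponent of \<open>x\<close> modulo torsion is divisible by all
  powers of \<open>p\<close>, hence 0.\<close>

lemma infinitely_divisible_torsion:
  assumes gens: "gens_mod_torsion G A g" and indep: "indep_mod_torsion A g" and nz: "0 \<notin> G"
    and p: "p \<ge> (2::nat)" and div: "\<And>m. \<exists>v\<in>G. x = v ^ (p ^ m)"
  shows "x \<in> torsion"
proof -
  have nz': "g i \<noteq> 0" if "i \<in> A" for i using gens nz that by (auto simp: gens_mod_torsion_def)
  have gen: "\<exists>f. y / zprod A g f \<in> torsion" if "y \<in> G" for y
    using gens that by (auto simp: gens_mod_torsion_def)
  have "x \<in> G" using div[of 0] by auto
  then obtain f where f: "x / zprod A g f \<in> torsion" using gen by blast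
  have "f i = 0" if i: "i \<in> A" for i
  proof (rule ccontr)
    assume fi: "f i \<noteq> 0"
    obtain m where m: "nat \<bar>f i\<bar> < p ^ m"
      using p by (metis less_exp order_less_le_trans power_mono zero_le_numeral)
    obtain v where v: "v \<in> G" "x = v ^ (p ^ m)" using div by blast
    obtain h where h: "v / zprod A g h \<in> torsion" using gen[OF v(1)] by blast
    have x0: "v \<noteq> 0" using v nz by auto
    have "zprod A g (\<lambda>i. h i * int (p ^ m) + - f i) = zprod A g h ^ (p ^ m) * inverse (zprod A g f)"
      using zprod_add[of A g "\<lambda>i. h i * int (p ^ m)" "\<lambda>i. - f i"] nz'
      by (simp only: zprod_mult zprod_minus simp_thms)
    also have "\<dots> = (x / zprod A g f) / (v / zprod A g h) ^ (p ^ m)"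
      unfolding v(2) using x0 zprod_nonzero[OF nz', where f = h and A = A]
      by (simp add: field_simps)
    also have "\<dots> \<in> torsion"
      by (intro mult_subgroup_divide mult_subgroup_power torsion_subgroup f h)
    finally have "h i * int (p ^ m) + - f i = 0" using indep i unfolding indep_mod_torsion_def by blast
    hence "f i = int (p ^ m) * h i" by (simp add: algebra_simps)
    hence "int (p ^ m) dvd f i" by (rule dvdI)
    hence "int (p ^ m) \<le> \<bar>f i\<bar>" using fi by (intro zdvd_imp_le) simp_all
    thus False using m by linarith
  qed
  hence "zprod A g f = zprod A g (\<lambda>_. 0)" by (intro zprod_cong) simp
  thus ?thesis using f by simp
qed


subsection \<open>The isotrivial case\<close>

text \<open>
  The finest partition of the coordinates compatible with the reduced vectors, given by the
  least element of each class.
\<close>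

context subfield_char
begin

definition linked :: "nat \<Rightarrow> (nat \<Rightarrow> 'k) set \<Rightarrow> nat \<Rightarrow> nat \<Rightarrow> bool" where
  "linked n V i j \<longleftrightarrow> (\<forall>P. (\<forall>i. P i i) \<longrightarrow> (\<forall>i j. P i j \<longrightarrow> P j i) \<longrightarrow> (\<forall>i j k. P i j \<longrightarrow> P j k \<longrightarrow> P i k) \<longrightarrow>
     (\<forall>s\<in>piv V. \<forall>j\<le>n. rvec V s j \<noteq> 0 \<longrightarrow> P s j) \<longrightarrow> P i j)"

lemma linkedD:
  assumes "linked n V i j" "\<And>i. P i i" "\<And>i j. P i j \<Longrightarrow> P j i" "\<And>i j k. P i j \<Longrightarrow> P j k \<Longrightarrow> P i k"
    "\<And>s j. s \<in> piv V \<Longrightarrow> j \<le> n \<Longrightarrow> rvec V s j \<noteq> 0 \<Longrightarrow> P s j"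
  shows "P i j"
proof (rule assms(1)[unfolded linked_def, THEN spec, of P, THEN mp, THEN mp, THEN mp, THEN mp])
  show "\<forall>i. P i i" by (intro allI assms(2))
  show "\<forall>i j. P i j \<longrightarrow> P j i" by (intro allI impI) (rule assms(3))
  show "\<forall>i j k. P i j \<longrightarrow> P j k \<longrightarrow> P i k" by (intro allI impI) (rule assms(4))
  show "\<forall>s\<in>piv V. \<forall>j\<le>n. rvec V s j \<noteq> 0 \<longrightarrow> P s j" by (intro allI impI ballI) (rule assms(5))
qed

lemma linkedI:
  assumes "\<And>P. (\<And>i. P i i) \<Longrightarrow> (\<And>i j. P i j \<Longrightarrow> P j i) \<Longrightarrow> (\<And>i j k. P i j \<Longrightarrow> P j k \<Longrightarrow> P i k) \<Longrightarrow>
     (\<And>s j. s \<in> piv V \<Longrightarrow> j \<le> n \<Longrightarrow> rvec V s j \<noteq> 0 \<Longrightarrow> P s j) \<Longrightarrow> P i j"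
  shows "linked n V i j"
  unfolding linked_def
proof (intro allI impI)
  fix P :: "nat \<Rightarrow> nat \<Rightarrow> bool"
  assume *: "\<forall>i. P i i" "\<forall>i j. P i j \<longrightarrow> P j i" "\<forall>i j k. P i j \<longrightarrow> P j k \<longrightarrow> P i k"
    "\<forall>s\<in>piv V. \<forall>j\<le>n. rvec V s j \<noteq> 0 \<longrightarrow> P s j"
  show "P i j"
  proof (rule assms)
    show "P i i" for i using *(1) by (rule spec)
    show "P j i" if "P i j" for i j using *(2)[THEN spec, THEN spec, THEN mp, OF that] .
    show "P i k" if "P i j" "P j k" for i j k
      using *(3)[THEN spec, THEN spec, THEN spec, THEN mp, THEN mp, OF that] .
    show "P s j" if "s \<in> piv V" "j \<le> n" "rvec V s j \<noteq> 0" for s j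
      using *(4)[THEN bspec, OF that(1), THEN spec, THEN mp, THEN mp, OF that(2,3)] .
  qed
qed

lemma linked_refl: "linked n V i i"
proof (rule linkedI)
  fix P :: "nat \<Rightarrow> nat \<Rightarrow> bool" assume "\<And>i. P i i"
  thus "P i i" .
qed

lemma linked_sym:
  assumes "linked n V i j" shows "linked n V j i"
proof (rule linkedI)
  fix P assume *: "\<And>i. P i i" "\<And>i j. P i j \<Longrightarrow> P j i" "\<And>i j k. P i j \<Longrightarrow> P j k \<Longrightarrow> P i k"
     "\<And>s j. s \<in> piv V \<Longrightarrow> j \<le> n \<Longrightarrow> rvec V s j \<noteq> 0 \<Longrightarrow> P s j"
  have "P i j" by (rule linkedD[OF assms *])
  thus "P j i" by (rule *(2))
qed

lemma linked_trans:
  assumes "linked n V i j" "linked n V j k" shows "linked n V i k"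
proof (rule linkedI)
  fix P assume *: "\<And>i. P i i" "\<And>i j. P i j \<Longrightarrow> P j i" "\<And>i j k. P i j \<Longrightarrow> P j k \<Longrightarrow> P i k"
     "\<And>s j. s \<in> piv V \<Longrightarrow> j \<le> n \<Longrightarrow> rvec V s j \<noteq> 0 \<Longrightarrow> P s j"
  have "P i j" by (rule linkedD[OF assms(1) *])
  moreover have "P j k" by (rule linkedD[OF assms(2) *])
  ultimately show "P i k" by (rule *(3))
qed

lemma linked_edge: "s \<in> piv V \<Longrightarrow> j \<le> n \<Longrightarrow> rvec V s j \<noteq> 0 \<Longrightarrow> linked n V s j"
proof (rule linkedI)
  fix P assume *: "s \<in> piv V" "j \<le> n" "rvec V s j \<noteq> 0"
     "\<And>s j. s \<in> piv V \<Longrightarrow> j \<le> n \<Longrightarrow> rvec V s j \<noteq> 0 \<Longrightarrow> P s j"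
  show "P s j" by (rule *(4)[OF *(1-3)])
qed

definition block :: "nat \<Rightarrow> (nat \<Rightarrow> 'k) set \<Rightarrow> nat \<Rightarrow> nat" where
  "block n V i = (LEAST j. linked n V i j)"

lemma block_linked: "linked n V i (block n V i)"
  unfolding block_def by (rule LeastI[of _ i]) (rule linked_refl)

lemma block_le: "block n V i \<le> i"
  unfolding block_def by (rule Least_le) (rule linked_refl)

lemma block_eq: "linked n V i j \<Longrightarrow> block n V i = block n V j"
  unfolding block_def by (rule arg_cong[where f = Least]) (blast intro: linked_sym linked_trans)

lemma block_block: "block n V (block n V i) = block n V i"
  using block_eq[OF block_linked] by metis

end

text \<open>Since the dimension survives for every \<open>m\<close>, each nonzero entry of a reduced
  vector is, up to ratios of the classes \<open>g\<close>, a \<open>p ^ m\<close>-th power.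
  Comparing coordinates along links yields multipliers \<open>\<delta>\<close> independent of
  \<open>m\<close>; after translation by them the entries are \<open>p ^ m\<close>-th powers in
  \<open>G\<close> for all \<open>m\<close>, that is, torsion.\<close>

lemma (in pbasis_subfield) isotrivial:
  assumes G: "mult_subgroup G" "fin_gen G" "G \<subseteq> F" "\<And>x s. x ^ s \<in> G \<Longrightarrow> s > 0 \<Longrightarrow> x \<in> G"
    and V: "subsp n V"
    and desc: "\<And>m. \<exists>g. (\<forall>i\<le>n. g i \<in> G) \<and> card (piv V) \<le> card (piv (descent n V g m))"
  shows "\<exists>\<delta>. (\<forall>i\<le>n. \<delta> i \<in> G) \<and>
    (\<forall>s\<in>piv V. \<forall>j\<le>n. rvec V s j \<noteq> 0 \<longrightarrow> rvec V s j * \<delta> s / \<delta> j \<in> torsion \<inter> G)"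
proof -
  note GD = mult_subgroupD[OF G(1)]
  obtain g0 where g0: "\<And>m i. i \<le> n \<Longrightarrow> g0 m i \<in> G"
    "\<And>m. card (piv V) \<le> card (piv (descent n V (g0 m) m))" using desc by metis
  \<comment> \<open>The relation \<open>linked\<close> ranges over all indices, so the classes are
    continued by 1 beyond \<open>n\<close>.\<close>
  define g where "g = (\<lambda>m i. if i \<le> n then g0 m i else 1)"
  have gG: "g m i \<in> G" for m i using g0(1) GD(2) by (simp add: g_def)
  \<comment> \<open>By \<open>descent_rvec\<close> the entry is an element of \<open>G\<close> times
    a \<open>p ^ m\<close>-th power for every \<open>m\<close>. This places the entry in
    \<open>G\<close>, and afterwards the root \<open>u\<close> as well.\<close>
  have edge: "rvec V s j \<in> G \<and> (\<forall>m. \<exists>v\<in>G. rvec V s j * g m s = g m j * v ^ (p ^ m))"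
    if s: "s \<in> piv V" and j: "j \<le> n" and nz: "rvec V s j \<noteq> 0" for s j
  proof -
    have sn: "s \<le> n" using s piv_le[OF subspD(1)[OF V]] by blast
    have ex: "\<exists>u\<in>F. rvec V s j = inverse (g m s) * (g m j * u ^ (p ^ m))" for m
    proof -
      have "\<exists>u\<in>vecs n. \<forall>j. rvec V s j = inverse (g0 m s) * (g0 m j * u j ^ (p ^ m))"
        using descent_rvec[OF V _ g0(2) s] g0(1) GD(5) by blast
      then obtain u where "u \<in> vecs n" "rvec V s j = inverse (g0 m s) * (g0 m j * u j ^ (p ^ m))" by blast
      thus ?thesis using vecs_F sn j by (auto simp: g_def)
    qed
    have "rvec V s j \<in> F" by (rule vecs_F[OF subsetD[OF subspD(1)[OF V] rvec(1)[OF V s]]])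
    moreover have "\<exists>a\<in>G. \<exists>u\<in>F. rvec V s j = a * u ^ (p ^ m)" for m
    proof -
      obtain u where "u \<in> F" "rvec V s j = inverse (g m s) * (g m j * u ^ (p ^ m))" using ex by blast
      thus ?thesis using gG GD(3,4) by (intro bexI[of _ "inverse (g m s) * g m j"] bexI[of _ u]) (auto simp: mult.assoc)
    qed
    moreover have "\<exists>T. finite T \<and> T \<subseteq> G \<and> (\<forall>x\<in>G. \<exists>t\<in>T. \<exists>s\<in>G. x = t * s ^ p)"
    proof -
      obtain B where B: "finite B" "B \<subseteq> G" "G = mult_subgroup hull B" using G(2) by (auto simp: fin_gen_def)
      have B0: "0 \<notin> B" using B GD(1) by auto
      let ?H = "(\<lambda>s. s ^ p) ` G"
      have pw: "\<exists>k>0. a ^ k \<in> ?H" if "a \<in> G" for a using that p_pos by (intro exI[of _ p]) auto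
      obtain T where T: "finite T" "T \<subseteq> G" "1 \<in> T" "\<forall>t\<in>T. \<forall>b\<in>B. \<exists>t'\<in>T. \<exists>h\<in>?H. t * b = t' * h"
        using ex_reps[OF B(1) B0 mult_subgroup_powers[OF G(1)] pw[OF subsetD[OF B(2)]]]
        unfolding B(3)[symmetric] by metis
      have "\<exists>t\<in>T. \<exists>s\<in>G. x = t * s ^ p" if "x \<in> G" for x
      proof -
        have "\<exists>t'\<in>T. \<exists>h\<in>?H. 1 * x = t' * h"
          by (rule reps_all[OF B0 mult_subgroup_powers[OF G(1)], of T]) (use T pw B(3) that in auto)
        thus ?thesis by auto
      qed
      thus ?thesis using T by blast
    qed
    then obtain T where T: "finite T" "T \<subseteq> G" "\<And>x. x \<in> G \<Longrightarrow> \<exists>t\<in>T. \<exists>s\<in>G. x = t * s ^ p" by blast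
    ultimately have wG: "rvec V s j \<in> G"
      by (intro divisible_in_group[OF G(1,3) _ T _ nz]) (auto intro: G(4))
    moreover have "\<exists>v\<in>G. rvec V s j * g m s = g m j * v ^ (p ^ m)" for m
    proof -
      obtain u where u: "rvec V s j = inverse (g m s) * (g m j * u ^ (p ^ m))" using ex by blast
      hence "u ^ (p ^ m) = rvec V s j * g m s * inverse (g m j)" using GD(5)[OF gG] by (simp add: field_simps)
      also have "\<dots> \<in> G" by (intro GD(3,4) wG gG)
      finally have "u \<in> G" using G(4) p_pos by simp
      thus ?thesis using u GD(5)[OF gG] by (intro bexI[of _ u]) (simp_all add: field_simps)
    qed
    ultimately show ?thesis by blast
  qed
  \<comment> \<open>The factor \<open>c\<close> must serve all \<open>m\<close> at once, while
    \<open>g m\<close> and \<open>v\<close> vary with \<open>m\<close>. Along an edge it is the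
    entry of the reduced vector.\<close>
  define P where "P = (\<lambda>i j. \<exists>c\<in>G. \<forall>m. \<exists>v\<in>G. c * g m i = g m j * v ^ (p ^ m))"
  have "P i j" if "linked n V i j" for i j
    using that
  proof (rule linkedD)
    show "P i i" for i unfolding P_def by (intro bexI[of _ 1] allI) (auto simp: GD)
  next
    fix i j assume "P i j"
    then obtain c where c: "c \<in> G" "\<And>m. \<exists>v\<in>G. c * g m i = g m j * v ^ (p ^ m)" unfolding P_def by blast
    show "P j i" unfolding P_def
    proof (rule bexI[of _ "inverse c"], rule allI)
      fix m
      obtain v where v: "v \<in> G" "c * g m i = g m j * v ^ (p ^ m)" using c by blast
      show "\<exists>v\<in>G. inverse c * g m j = g m i * v ^ (p ^ m)"
        using v GD(5)[OF c(1)] GD(5)[OF v(1)]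
        by (intro bexI[OF _ GD(4)[OF v(1)]]) (simp add: field_simps)
    qed (use c GD in auto)
  next
    fix i j k assume "P i j" "P j k"
    then obtain c d where c: "c \<in> G" "\<And>m. \<exists>v\<in>G. c * g m i = g m j * v ^ (p ^ m)"
      and d: "d \<in> G" "\<And>m. \<exists>v\<in>G. d * g m j = g m k * v ^ (p ^ m)" unfolding P_def by metis
    show "P i k" unfolding P_def
    proof (rule bexI[of _ "c * d"], rule allI)
      fix m
      obtain v where v: "v \<in> G" "c * g m i = g m j * v ^ (p ^ m)" using c(2) by blast
      obtain w where w: "w \<in> G" "d * g m j = g m k * w ^ (p ^ m)" using d(2) by blast
      have "c * d * g m i = d * (c * g m i)" by (simp only: mult_ac)
      also have "\<dots> = d * g m j * v ^ (p ^ m)" unfolding v(2) by (simp only: mult.assoc)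
      also have "\<dots> = g m k * (v * w) ^ (p ^ m)" unfolding w(2) power_mult_distrib by (simp only: mult_ac)
      finally show "\<exists>v\<in>G. c * d * g m i = g m k * v ^ (p ^ m)" using GD(3)[OF v(1) w(1)] by blast
    qed (use c d GD in auto)
  next
    fix s j assume "s \<in> piv V" "j \<le> n" "rvec V s j \<noteq> 0"
    from edge[OF this] show "P s j" unfolding P_def by blast
  qed
  hence "\<exists>c\<in>G. \<forall>m. \<exists>v\<in>G. c * g m (block n V i) = g m i * v ^ (p ^ m)" for i
    using linked_sym[OF block_linked] unfolding P_def by blast
  then obtain \<delta> where \<delta>: "\<And>i. \<delta> i \<in> G" "\<And>i m. \<exists>v\<in>G. \<delta> i * g m (block n V i) = g m i * v ^ (p ^ m)" by metis
  obtain gs where gs: "set gs \<subseteq> G" "gens_mod_torsion G {..<length gs} ((!) gs)"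
    "indep_mod_torsion {..<length gs} ((!) gs)" using ex_independent[OF G(1,2)] by blast
  have "rvec V s j * \<delta> s / \<delta> j \<in> torsion \<inter> G" if s: "s \<in> piv V" "j \<le> n" "rvec V s j \<noteq> 0" for s j
  proof
    let ?w = "rvec V s j"
    show "?w * \<delta> s / \<delta> j \<in> G" using edge[OF s] \<delta>(1) by (intro mult_subgroup_divide[OF G(1)] GD(3)) auto
    have b: "block n V s = block n V j" by (rule block_eq[OF linked_edge[OF s]])
    \<comment> \<open>Modulo \<open>p ^ m\<close>-th powers, \<open>\<delta> s\<close> and
      \<open>\<delta> j\<close> are the ratios of \<open>g m s\<close> and \<open>g m j\<close> to
      the value at their common block, and \<open>?w\<close> is the ratio of \<open>g m j\<close> to
      \<open>g m s\<close>; everything cancels.\<close>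
    have "\<exists>v\<in>G. ?w * \<delta> s / \<delta> j = v ^ (p ^ m)" for m
    proof -
      obtain v1 where v1: "v1 \<in> G" "?w * g m s = g m j * v1 ^ (p ^ m)" using edge[OF s] by blast
      obtain v2 where v2: "v2 \<in> G" "\<delta> s * g m (block n V s) = g m s * v2 ^ (p ^ m)" using \<delta>(2) by blast
      obtain v3 where v3: "v3 \<in> G" "\<delta> j * g m (block n V s) = g m j * v3 ^ (p ^ m)" using \<delta>(2) b by metis
      let ?b = "g m (block n V s)"
      have "?w * \<delta> s * ?b * v3 ^ (p ^ m) = ?w * g m s * v2 ^ (p ^ m) * v3 ^ (p ^ m)"
        using v2(2) by (simp add: mult.assoc)
      also have "\<dots> = g m j * v3 ^ (p ^ m) * (v1 * v2) ^ (p ^ m)"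
        using v1(2) by (simp add: power_mult_distrib mult_ac)
      also have "\<dots> = \<delta> j * (v1 * v2) ^ (p ^ m) * ?b" using v3(2) by (simp add: mult_ac)
      finally have "?w * \<delta> s * v3 ^ (p ^ m) = \<delta> j * (v1 * v2) ^ (p ^ m)"
        using GD(5)[OF gG[of m "block n V s"]] by (simp add: mult_ac)
      hence "?w * \<delta> s / \<delta> j = (v1 * v2 / v3) ^ (p ^ m)"
        using GD(5)[OF \<delta>(1)] GD(5)[OF v3(1)] by (simp add: field_simps)
      moreover have "v1 * v2 / v3 \<in> G" using v1 v2 v3 by (intro mult_subgroup_divide[OF G(1)] GD(3)) auto
      ultimately show ?thesis by blast
    qed
    thus "?w * \<delta> s / \<delta> j \<in> torsion"
      by (rule infinitely_divisible_torsion[OF gs(2,3) GD(1) p_ge_2])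
  qed
  thus ?thesis using \<delta>(1) by blast
qed


subsection \<open>Orbits on vectors\<close>

definition orb :: "nat \<Rightarrow> (nat \<Rightarrow> 'k::field) list \<Rightarrow> nat list \<Rightarrow> nat \<Rightarrow> 'k" where
  "orb q vs ls i = prod_list (map2 (\<lambda>v l. v i ^ (q ^ l)) vs ls)"

lemma orb_Nil [simp]: "orb q [] ls i = 1" "orb q vs [] i = 1"
  by (simp_all add: orb_def)

lemma orb_Cons [simp]: "orb q (v # vs) (l # ls) i = v i ^ (q ^ l) * orb q vs ls i"
  by (simp add: orb_def)

lemma orb_power: "orb q (map (\<lambda>v i. v i ^ m) vs) ls i = orb q vs ls i ^ m"
proof (induction vs arbitrary: ls)
  case (Cons v vs)
  thus ?case by (cases ls) (simp_all add: power_mult_distrib mult.commute flip: power_mult)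
qed simp

lemma orb_shift: "orb q vs (map (\<lambda>l. l + k) ls) i = orb q vs ls i ^ (q ^ k)"
proof (induction vs arbitrary: ls)
  case (Cons v vs)
  thus ?case by (cases ls) (simp_all add: power_mult_distrib power_add flip: power_mult)
qed simp

lemma orb_mem:
  assumes "mult_subgroup G" "\<And>v. v \<in> set vs \<Longrightarrow> v i \<in> G"
  shows "orb q vs ls i \<in> G"
  using assms(2)
proof (induction vs arbitrary: ls)
  case (Cons v vs)
  thus ?case
    by (cases ls) (auto intro!: mult_subgroupD(3)[OF assms(1)] mult_subgroup_power[OF assms(1)] mult_subgroupD(2)[OF assms(1)])
qed (simp add: mult_subgroupD[OF assms(1)])

text \<open>Only the coordinates up to \<open>n\<close> matter in this affine version of the sets of the theorem.\<close>

definition orbit_set ::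
    "nat \<Rightarrow> nat \<Rightarrow> 'k::field set \<Rightarrow> (nat \<Rightarrow> 'k) \<Rightarrow> (nat \<Rightarrow> 'k) list \<Rightarrow> (nat \<times> nat) set \<Rightarrow> (nat \<Rightarrow> 'k) set" where
  "orbit_set n q G v0 vs E = {x. \<exists>ls \<sigma>. length ls = length vs \<and> (\<forall>i\<le>n. \<sigma> i \<in> G) \<and>
     (\<forall>z\<in>E. \<sigma> (fst z) = \<sigma> (snd z)) \<and> (\<forall>i\<le>n. x i = v0 i * orb q vs ls i * \<sigma> i)}"

lemma orbit_setI:
  assumes "length ls = length vs" "\<And>i. i \<le> n \<Longrightarrow> \<sigma> i \<in> G" "\<And>z. z \<in> E \<Longrightarrow> \<sigma> (fst z) = \<sigma> (snd z)"
    "\<And>i. i \<le> n \<Longrightarrow> x i = v0 i * orb q vs ls i * \<sigma> i"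
  shows "x \<in> orbit_set n q G v0 vs E"
  unfolding orbit_set_def
  by (rule CollectI, rule exI[of _ ls], rule exI[of _ \<sigma>]) (simp add: assms)

lemma orbit_setE:
  assumes "x \<in> orbit_set n q G v0 vs E"
  obtains ls \<sigma> where "length ls = length vs" "\<And>i. i \<le> n \<Longrightarrow> \<sigma> i \<in> G"
    "\<And>z. z \<in> E \<Longrightarrow> \<sigma> (fst z) = \<sigma> (snd z)" "\<And>i. i \<le> n \<Longrightarrow> x i = v0 i * orb q vs ls i * \<sigma> i"
proof -
  obtain ls \<sigma> where "length ls = length vs" "\<forall>i\<le>n. \<sigma> i \<in> G" "\<forall>z\<in>E. \<sigma> (fst z) = \<sigma> (snd z)"
    "\<forall>i\<le>n. x i = v0 i * orb q vs ls i * \<sigma> i"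
    using assms unfolding orbit_set_def by blast
  thus ?thesis by (intro that[of ls \<sigma>]) simp_all
qed


subsection \<open>Named field elements\<close>

text \<open>Operations on names are arbitrary functions here; computability enters only in
  \<open>computable_field\<close>. Thus the plain existence statement and the algorithm share one
  development.\<close>

locale named_field = pbasis_subfield F p B S for F :: "'k::field set" and p B S +
  fixes \<nu> :: "nat \<Rightarrow> 'k" and ad ml :: "nat \<Rightarrow> nat \<Rightarrow> nat" and z0 z1 :: nat and bs :: "nat list"
  assumes range_\<nu>: "range \<nu> = F"
    and \<nu>_ad [simp]: "\<nu> (ad i j) = \<nu> i + \<nu> j" and \<nu>_ml [simp]: "\<nu> (ml i j) = \<nu> i * \<nu> j"
    and \<nu>_z0 [simp]: "\<nu> z0 = 0" and \<nu>_z1 [simp]: "\<nu> z1 = 1"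
    and bs: "\<nu> ` set bs = S" "distinct (map \<nu> bs)"
begin

lemma \<nu>_F [simp]: "\<nu> i \<in> F"
  using range_\<nu> by blast

text \<open>A choice of names without algorithmic content: it serves to show that certificates exist
  and does not occur in the conditions that define them.\<close>

definition nm :: "'k \<Rightarrow> nat" where
  "nm x = (SOME i. \<nu> i = x)"

lemma \<nu>_nm [simp]: "x \<in> F \<Longrightarrow> \<nu> (nm x) = x"
  unfolding nm_def using range_\<nu> by (metis (mono_tags) imageE someI)

definition pw :: "nat \<Rightarrow> nat \<Rightarrow> nat" where
  "pw x k = (ml x ^^ k) z1"

lemma \<nu>_pw [simp]: "\<nu> (pw x k) = \<nu> x ^ k"
  unfolding pw_def by (induction k) auto

definition sm :: "nat list \<Rightarrow> nat" where
  "sm xs = foldl ad z0 xs"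

definition prd :: "nat list \<Rightarrow> nat" where
  "prd xs = foldl ml z1 xs"

lemma \<nu>_sm [simp]: "\<nu> (sm xs) = sum_list (map \<nu> xs)"
proof -
  have "\<nu> (foldl ad a xs) = \<nu> a + sum_list (map \<nu> xs)" for a
    by (induction xs arbitrary: a) (auto simp: add.assoc)
  thus ?thesis by (simp add: sm_def)
qed

lemma \<nu>_prd [simp]: "\<nu> (prd xs) = prod_list (map \<nu> xs)"
proof -
  have "\<nu> (foldl ml a xs) = \<nu> a * prod_list (map \<nu> xs)" for a
    by (induction xs arbitrary: a) (auto simp: mult.assoc)
  thus ?thesis by (simp add: prd_def)
qed

definition val :: "nat \<Rightarrow> nat list \<Rightarrow> nat \<Rightarrow> 'k" where
  "val n xs i = (if i \<le> n then \<nu> (get xs i) else 0)"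

lemma val_vecs: "val n xs \<in> vecs n"
  by (auto simp: vecs_def val_def)

lemma val_F [simp]: "val n xs i \<in> F"
  by (rule vecs_F[OF val_vecs])

definition tab :: "nat \<Rightarrow> (nat \<Rightarrow> nat) \<Rightarrow> nat list" where
  "tab n f = map f [0..<Suc n]"

lemma get_tab [simp]: "i \<le> n \<Longrightarrow> get (tab n f) i = f i"
  by (simp add: tab_def get_nth del: upt_Suc)

lemma length_tab [simp]: "length (tab n f) = Suc n"
  by (simp add: tab_def)

lemma val_tab: "val n (tab n f) i = (if i \<le> n then \<nu> (f i) else 0)"
  by (simp add: val_def)

definition name_vec :: "nat \<Rightarrow> (nat \<Rightarrow> 'k) \<Rightarrow> nat list" where
  "name_vec n x = tab n (\<lambda>i. nm (x i))"

lemma val_name_vec: "x \<in> vecs n \<Longrightarrow> val n (name_vec n x) = x"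
  by (rule ext) (auto simp: name_vec_def val_tab vecs_def)

definition vmul :: "nat \<Rightarrow> nat list \<Rightarrow> nat list \<Rightarrow> nat list" where
  "vmul n a b = tab n (\<lambda>i. ml (get a i) (get b i))"

definition vpw :: "nat \<Rightarrow> nat list \<Rightarrow> nat \<Rightarrow> nat list" where
  "vpw n a k = tab n (\<lambda>i. pw (get a i) k)"

lemma val_vmul: "val n (vmul n a b) i = val n a i * val n b i"
  by (simp add: vmul_def val_tab) (simp add: val_def)

lemma val_vpw: "k > 0 \<Longrightarrow> val n (vpw n a k) i = val n a i ^ k"
  by (simp add: vpw_def val_tab) (simp add: val_def)

definition dot :: "nat \<Rightarrow> nat list \<Rightarrow> nat list \<Rightarrow> nat" where
  "dot n a x = sm (tab n (\<lambda>i. ml (get a i) (get x i)))"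

lemma \<nu>_dot: "\<nu> (dot n a x) = (\<Sum>i\<le>n. val n a i * val n x i)"
proof -
  have "\<nu> (dot n a x) = (\<Sum>i\<in>{0..<Suc n}. \<nu> (get a i) * \<nu> (get x i))"
    unfolding dot_def tab_def \<nu>_sm map_map o_def \<nu>_ml
    by (subst interv_sum_list_conv_sum_set_nat) simp
  also have "\<dots> = (\<Sum>i\<le>n. val n a i * val n x i)"
    by (rule sum.cong) (auto simp: val_def)
  finally show ?thesis .
qed

definition sols :: "nat \<Rightarrow> nat list list \<Rightarrow> (nat \<Rightarrow> 'k) set" where
  "sols n rows = sol n (val n ` set rows)"

lemma subsp_sols: "subsp n (sols n rows)"
  unfolding sols_def by (rule subsp_sol)

lemma sols_iff: "x \<in> sols n rows \<longleftrightarrow> x \<in> vecs n \<and> (\<forall>a\<in>set rows. (\<Sum>i\<le>n. val n a i * x i) = 0)"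
  by (simp add: sols_def sol_def)

lemma solsI: "x \<in> vecs n \<Longrightarrow> (\<And>a. a \<in> set rows \<Longrightarrow> (\<Sum>i\<le>n. val n a i * x i) = 0) \<Longrightarrow> x \<in> sols n rows"
  by (simp add: sols_iff)

definition scale :: "nat \<Rightarrow> nat list \<Rightarrow> nat list list \<Rightarrow> nat list list" where
  "scale n g rows = map (vmul n g) rows"

lemma sols_scale: "x \<in> sols n (scale n g rows) \<longleftrightarrow> x \<in> vecs n \<and> (\<lambda>i. val n g i * x i) \<in> sols n rows"
  using vecs_mult[OF val_vecs] by (auto simp: sols_iff scale_def val_vmul mult_ac)


subsubsection \<open>Descent on equations\<close>

text \<open>
  Writing the coefficients of an equation in the basis \<open>S\<close>, a solution in \<open>p\<close>-th powers
  is the same as a solution of the equations formed by the coordinates.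
\<close>

definition coord_rows :: "nat \<Rightarrow> nat list list \<Rightarrow> nat list list \<Rightarrow> bool" where
  "coord_rows n rows rows' \<longleftrightarrow> (\<forall>c\<in>set rows'. \<exists>a cs. a \<in> set rows \<and> c \<in> set cs \<and> length cs = length bs \<and>
     (\<forall>i<Suc n. \<nu> (get a i) = \<nu> (sm (map (\<lambda>j. ml (pw (get (get cs j) i) p) (get bs j)) [0..<length bs]))))"

lemma sum_bs: "(\<Sum>j<length bs. f (\<nu> (get bs j))) = (\<Sum>s\<in>S. f s)"
proof -
  have "bij_betw (\<lambda>j. \<nu> (get bs j)) {..<length bs} S"
    unfolding bij_betw_def
  proof
    show "inj_on (\<lambda>j. \<nu> (get bs j)) {..<length bs}"
      using bs(2) by (auto simp: inj_on_def get_nth distinct_conv_nth)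
    have "set bs = get bs ` {..<length bs}" by (auto simp: get_nth in_set_conv_nth image_iff)
    hence "\<nu> ` set bs = (\<lambda>j. \<nu> (get bs j)) ` {..<length bs}" by (simp add: image_image)
    thus "(\<lambda>j. \<nu> (get bs j)) ` {..<length bs} = S" using bs(1) by simp
  qed
  from sum.reindex_bij_betw[OF this] show ?thesis .
qed

definition bindex :: "'k \<Rightarrow> nat" where
  "bindex s = (THE j. j < length bs \<and> \<nu> (get bs j) = s)"

lemma bindex: "j < length bs \<Longrightarrow> bindex (\<nu> (get bs j)) = j"
  unfolding bindex_def
proof (rule the_equality)
  fix k assume j: "j < length bs" and k: "k < length bs \<and> \<nu> (get bs k) = \<nu> (get bs j)"
  from k have "k < length bs" "\<nu> (get bs k) = \<nu> (get bs j)" by simp_all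
  thus "k = j" using j bs(2) nth_eq_iff_index_eq[of "map \<nu> bs" k j] by (simp add: get_nth)
qed simp

lemma sum_list_upt: "sum_list (map f [0..<k]) = (\<Sum>j<k. f j)" for f :: "nat \<Rightarrow> 'k"
  by (simp add: interv_sum_list_conv_sum_set_nat atLeast0LessThan)

lemma coord_rows_sound:
  assumes "coord_rows n rows rows'" "y \<in> vecs n" "vpow y p \<in> sols n rows"
  shows "y \<in> sols n rows'"
proof (rule solsI[OF assms(2)])
  fix c assume "c \<in> set rows'"
  then obtain a cs where a: "a \<in> set rows" "c \<in> set cs" "length cs = length bs"
    and eq: "\<forall>i<Suc n. \<nu> (get a i) = \<nu> (sm (map (\<lambda>j. ml (pw (get (get cs j) i) p) (get bs j)) [0..<length bs]))"
    using assms(1) unfolding coord_rows_def by blast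
  have av: "val n a i = (\<Sum>j<length bs. val n (get cs j) i ^ p * \<nu> (get bs j))" if "i \<le> n" for i
    using eq[rule_format, of i] that by (simp add: val_def o_def sum_list_upt)
  \<comment> \<open>Indexed by basis elements instead of positions in \<open>bs\<close>, because
    independence is stated for functions on \<open>S\<close>.\<close>
  define t where "t = (\<lambda>s. \<Sum>i\<le>n. val n (get cs (bindex s)) i * y i)"
  have tF: "t s \<in> F" for s unfolding t_def using vecs_F[OF assms(2)] by (intro F_sum F_mult) auto
  have "0 = (\<Sum>i\<le>n. val n a i * y i ^ p)" using assms(3) a(1) by (simp add: sols_iff)
  also have "\<dots> = (\<Sum>i\<le>n. \<Sum>j<length bs. (val n (get cs j) i * y i) ^ p * \<nu> (get bs j))"
    by (rule sum.cong) (simp_all add: av sum_distrib_right power_mult_distrib, simp add: mult_ac)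
  also have "\<dots> = (\<Sum>j<length bs. \<Sum>i\<le>n. (val n (get cs j) i * y i) ^ p * \<nu> (get bs j))"
    by (rule sum.swap)
  also have "\<dots> = (\<Sum>j<length bs. t (\<nu> (get bs j)) ^ p * \<nu> (get bs j))"
    by (rule sum.cong) (simp_all add: t_def bindex frob1_sum sum_distrib_right)
  also have "\<dots> = (\<Sum>s\<in>S. t s ^ p * s)" by (rule sum_bs)
  finally have zero: "t s = 0" if "s \<in> S" for s using indep_S[OF tF] that by simp
  obtain j where j: "j < length bs" "c = get cs j" using a(2,3) by (metis get_nth in_set_conv_nth)
  have "\<nu> (get bs j) \<in> S" using bs(1) j(1) by (auto simp: get_nth)
  from zero[OF this] show "(\<Sum>i\<le>n. val n c i * y i) = 0" using j by (simp add: t_def bindex)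
qed

lemma coord_rows_complete:
  "\<exists>rows'. coord_rows n rows rows' \<and> (\<forall>y. y \<in> sols n rows' \<longrightarrow> vpow y p \<in> sols n rows)"
proof -
  define cs where "cs = (\<lambda>a. map (\<lambda>j. tab n (\<lambda>i. nm (coord (\<nu> (get a i)) (\<nu> (get bs j))))) [0..<length bs])"
  define rows' where "rows' = concat (map cs rows)"
  have len: "length (cs a) = length bs" for a by (simp add: cs_def)
  have getcs: "\<nu> (get (get (cs a) j) i) = coord (\<nu> (get a i)) (\<nu> (get bs j))" if "j < length bs" "i \<le> n" for a i j
  proof -
    have "get (cs a) j = tab n (\<lambda>i. nm (coord (\<nu> (get a i)) (\<nu> (get bs j))))"
      using that(1) by (subst get_nth) (simp_all add: len, simp add: cs_def)
    thus ?thesis using that(2) by (simp add: coord)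
  qed
  have eq: "\<nu> (get a i) = (\<Sum>j<length bs. \<nu> (get (get (cs a) j) i) ^ p * \<nu> (get bs j))" if "i \<le> n" for a i
  proof -
    have "(\<Sum>j<length bs. \<nu> (get (get (cs a) j) i) ^ p * \<nu> (get bs j))
        = (\<Sum>j<length bs. coord (\<nu> (get a i)) (\<nu> (get bs j)) ^ p * \<nu> (get bs j))"
      by (rule sum.cong) (simp_all add: getcs that)
    also have "\<dots> = (\<Sum>s\<in>S. coord (\<nu> (get a i)) s ^ p * s)" by (rule sum_bs)
    also have "\<dots> = \<nu> (get a i)" by (rule coord) simp
    finally show ?thesis ..
  qed
  have "coord_rows n rows rows'"
    unfolding coord_rows_def
  proof
    fix c assume "c \<in> set rows'"
    then obtain a where a: "a \<in> set rows" "c \<in> set (cs a)" by (auto simp: rows'_def)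
    show "\<exists>a cs. a \<in> set rows \<and> c \<in> set cs \<and> length cs = length bs \<and>
     (\<forall>i<Suc n. \<nu> (get a i) = \<nu> (sm (map (\<lambda>j. ml (pw (get (get cs j) i) p) (get bs j)) [0..<length bs])))"
    proof (intro exI[of _ a] exI[of _ "cs a"] conjI allI impI)
      fix i assume i: "i < Suc n"
      have "\<nu> (sm (map (\<lambda>j. ml (pw (get (get (cs a) j) i) p) (get bs j)) [0..<length bs]))
          = (\<Sum>j<length bs. \<nu> (get (get (cs a) j) i) ^ p * \<nu> (get bs j))"
        by (simp add: o_def sum_list_upt)
      thus "\<nu> (get a i) = \<nu> (sm (map (\<lambda>j. ml (pw (get (get (cs a) j) i) p) (get bs j)) [0..<length bs]))"
        using eq[of i a] i by (metis less_Suc_eq_le)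
    qed (use a len in simp_all)
  qed
  moreover have "vpow y p \<in> sols n rows" if y: "y \<in> sols n rows'" for y
  proof (rule solsI)
    have yv: "y \<in> vecs n" using y by (simp add: sols_iff)
    thus "vpow y p \<in> vecs n" using p_pos by (rule vecs_vpow)
    fix a assume a: "a \<in> set rows"
    have av: "val n a i = (\<Sum>j<length bs. val n (get (cs a) j) i ^ p * \<nu> (get bs j))" if "i \<le> n" for i
      using eq[OF that, of a] that by (simp only: val_def if_True)
    have "(\<Sum>i\<le>n. val n a i * y i ^ p) = (\<Sum>i\<le>n. \<Sum>j<length bs. (val n (get (cs a) j) i * y i) ^ p * \<nu> (get bs j))"
      by (rule sum.cong) (simp_all add: av sum_distrib_right power_mult_distrib, simp add: mult_ac)
    also have "\<dots> = (\<Sum>j<length bs. \<Sum>i\<le>n. (val n (get (cs a) j) i * y i) ^ p * \<nu> (get bs j))"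
      by (rule sum.swap)
    also have "\<dots> = (\<Sum>j<length bs. (\<Sum>i\<le>n. val n (get (cs a) j) i * y i) ^ p * \<nu> (get bs j))"
      by (rule sum.cong) (simp_all add: frob1_sum sum_distrib_right)
    also have "\<dots> = 0"
    proof (rule sum.neutral, rule ballI)
      fix j assume "j \<in> {..<length bs}"
      hence "get (cs a) j \<in> set (cs a)" using len[of a] by (simp add: get_nth)
      hence "get (cs a) j \<in> set rows'" using a by (auto simp: rows'_def)
      thus "(\<Sum>i\<le>n. val n (get (cs a) j) i * y i) ^ p * \<nu> (get bs j) = 0"
        using y p_pos by (simp add: sols_iff power_0_left)
    qed
    finally show "(\<Sum>i\<le>n. val n a i * y i ^ p) = 0" .
  qed
  ultimately show ?thesis by blast
qed

text \<open>The basis handles \<open>p\<close>-th powers only, so a descent by \<open>p ^ m\<close>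
  is recorded as \<open>m\<close> successive systems.\<close>

definition coord_chain :: "nat \<Rightarrow> nat \<Rightarrow> nat list list \<Rightarrow> nat list list \<Rightarrow> bool" where
  "coord_chain n m rows U \<longleftrightarrow> (\<exists>L. get L 0 = rows \<and> get L m = U \<and> (\<forall>k<m. coord_rows n (get L k) (get L (Suc k))))"

lemma coord_chain_sound:
  assumes "coord_chain n m rows U" "y \<in> vecs n" "vpow y (p ^ m) \<in> sols n rows"
  shows "y \<in> sols n U"
proof -
  obtain L where L: "get L 0 = rows" "get L m = U" "\<And>k. k < m \<Longrightarrow> coord_rows n (get L k) (get L (Suc k))"
    using assms(1) unfolding coord_chain_def by blast
  have "k \<le> m \<longrightarrow> vpow y (p ^ (m - k)) \<in> sols n (get L k)" for k
  proof (induction k)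
    case (Suc k)
    show ?case
    proof
      assume k: "Suc k \<le> m"
      have "vpow (vpow y (p ^ (m - Suc k))) p \<in> sols n (get L k)"
        using Suc k by (simp add: Suc_diff_Suc flip: power_mult power_Suc2)
      thus "vpow y (p ^ (m - Suc k)) \<in> sols n (get L (Suc k))"
        using k assms(2) p_pos by (intro coord_rows_sound[OF L(3)] vecs_vpow) auto
    qed
  qed (simp add: L assms)
  from this[of m] show ?thesis by (simp add: L)
qed

lemma coord_chain_complete:
  "\<exists>U. coord_chain n m rows U \<and> sols n U = {y \<in> vecs n. vpow y (p ^ m) \<in> sols n rows}"
proof (induction m)
  case 0
  have "coord_chain n 0 rows rows" unfolding coord_chain_def
    by (rule exI[of _ "[rows]"]) (simp add: get_nth)
  moreover have "sols n rows \<subseteq> vecs n" by (auto simp: sols_iff)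
  ultimately show ?case by auto
next
  case (Suc m)
  then obtain U L where U: "sols n U = {y \<in> vecs n. vpow y (p ^ m) \<in> sols n rows}"
    and L: "get L 0 = rows" "get L m = U" "\<forall>k<m. coord_rows n (get L k) (get L (Suc k))"
    unfolding coord_chain_def by blast
  obtain W where W: "coord_rows n U W" "\<And>y. y \<in> sols n W \<Longrightarrow> vpow y p \<in> sols n U"
    using coord_rows_complete by blast
  define M where "M = map (get L) [0..<Suc m] @ [W]"
  have M: "get M k = get L k" if "k \<le> m" for k
    using that by (simp add: M_def get_nth nth_append del: upt_Suc)
  have M': "get M (Suc m) = W" by (simp add: M_def get_nth nth_append del: upt_Suc)
  have "coord_rows n (get M k) (get M (Suc k))" if "k < Suc m" for k
    using that L W(1) M M' by (cases "k = m") auto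
  hence chain: "coord_chain n (Suc m) rows W"
    unfolding coord_chain_def using M[of 0] M' L(1) by (intro exI[of _ M]) simp
  have pp: "vpow (vpow y p) (p ^ m) = vpow y (p ^ Suc m)" for y :: "nat \<Rightarrow> 'k"
    by (simp flip: power_mult)
  have "sols n W = {y \<in> vecs n. vpow y (p ^ Suc m) \<in> sols n rows}"
  proof (intro equalityI subsetI)
    fix y assume y: "y \<in> sols n W"
    have "vpow y p \<in> sols n U" by (rule W(2)[OF y])
    hence "vpow (vpow y p) (p ^ m) \<in> sols n rows" unfolding U by simp
    moreover have "y \<in> vecs n" using y by (simp add: sols_iff)
    ultimately show "y \<in> {y \<in> vecs n. vpow y (p ^ Suc m) \<in> sols n rows}" unfolding pp by simp
  next
    fix y assume "y \<in> {y \<in> vecs n. vpow y (p ^ Suc m) \<in> sols n rows}"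
    thus "y \<in> sols n W" by (intro coord_chain_sound[OF chain]) simp_all
  qed
  thus ?case using chain by blast
qed

lemma chain_descent:
  assumes "coord_chain n m (scale n g rows) U"
  shows "descent n (sols n rows) (val n g) m \<subseteq> sols n U"
proof
  fix y assume "y \<in> descent n (sols n rows) (val n g) m"
  thus "y \<in> sols n U"
    using vecs_vpow[of y n "p ^ m"] p_pos
    by (intro coord_chain_sound[OF assms]) (simp_all add: sols_scale descent_def)
qed

lemma ex_chain_descent:
  "\<exists>U. coord_chain n m (scale n g rows) U \<and> sols n U = descent n (sols n rows) (val n g) m"
proof -
  obtain U where U: "coord_chain n m (scale n g rows) U"
    "sols n U = {y \<in> vecs n. vpow y (p ^ m) \<in> sols n (scale n g rows)}"
    using coord_chain_complete by blast
  have "{y \<in> vecs n. vpow y (p ^ m) \<in> sols n (scale n g rows)} = descent n (sols n rows) (val n g) m"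
    using vecs_vpow p_pos by (auto simp: sols_scale descent_def)
  thus ?thesis using U by auto
qed


subsubsection \<open>Groups given by generators\<close>

definition grp :: "nat list \<Rightarrow> 'k set" where
  "grp gs = mult_subgroup hull (\<nu> ` set gs)"

text \<open>Membership by a finite witness: a quotient of two products of generators, cross
  multiplied because inversion is not among the operations on names.\<close>

definition in_grp :: "nat list \<Rightarrow> nat \<Rightarrow> bool" where
  "in_grp gs x \<longleftrightarrow> (\<exists>u w. (\<forall>y\<in>set u. y \<in> set gs) \<and> (\<forall>y\<in>set w. y \<in> set gs) \<and> \<nu> (ml x (prd u)) = \<nu> (prd w))"

lemma grp_gen: "b \<in> set gs \<Longrightarrow> \<nu> b \<in> grp gs"
  unfolding grp_def by (rule hull_inc) simp

lemma in_grp_iff: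
  assumes "0 \<notin> \<nu> ` set gs"
  shows "in_grp gs x \<longleftrightarrow> \<nu> x \<in> grp gs"
proof
  note G = mult_subgroup_hull[OF assms]
  have mem: "\<nu> (prd u) \<in> grp gs" if "\<forall>y\<in>set u. y \<in> set gs" for u
    using that by (induction u) (auto simp: grp_gen mult_subgroupD[OF G[folded grp_def]])
  assume "in_grp gs x"
  then obtain u w where uw: "\<forall>y\<in>set u. y \<in> set gs" "\<forall>y\<in>set w. y \<in> set gs" "\<nu> x * \<nu> (prd u) = \<nu> (prd w)"
    unfolding in_grp_def \<nu>_ml by blast
  have "\<nu> x = \<nu> (prd w) / \<nu> (prd u)"
    using uw(3) mult_subgroupD(5)[OF G[folded grp_def] mem[OF uw(1)]] by (simp add: field_simps)
  also have "\<dots> \<in> grp gs" unfolding grp_def by (rule mult_subgroup_divide[OF G]) (use mem uw in \<open>simp_all add: grp_def\<close>)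
  finally show "\<nu> x \<in> grp gs" .
next
  let ?A = "{x. x \<noteq> 0 \<and> (\<exists>u w. set u \<subseteq> set gs \<and> set w \<subseteq> set gs \<and> x * prod_list (map \<nu> u) = prod_list (map \<nu> w))}"
  have nz: "prod_list (map \<nu> u) \<noteq> 0" if "set u \<subseteq> set gs" for u
    using that assms by (auto simp: prod_list_zero_iff)
  have "mult_subgroup ?A"
  proof (rule mult_subgroupI)
    show "1 \<in> ?A" by (auto intro!: exI[of _ "[]"])
  next
    fix x y assume "x \<in> ?A" "y \<in> ?A"
    then obtain u w u' w' where "x \<noteq> 0" "y \<noteq> 0" "set u \<subseteq> set gs" "set w \<subseteq> set gs" "set u' \<subseteq> set gs" "set w' \<subseteq> set gs"
      "x * prod_list (map \<nu> u) = prod_list (map \<nu> w)" "y * prod_list (map \<nu> u') = prod_list (map \<nu> w')"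
      by blast
    moreover from this have "x * y * prod_list (map \<nu> (u @ u')) = prod_list (map \<nu> (w @ w'))"
      by (metis (no_types, lifting) map_append mult.assoc mult.left_commute prod_list.append)
    ultimately show "x * y \<in> ?A"
      by (intro CollectI conjI exI[of _ "u @ u'"] exI[of _ "w @ w'"]) auto
  next
    fix x assume "x \<in> ?A"
    then obtain u w where uw: "x \<noteq> 0" "set u \<subseteq> set gs" "set w \<subseteq> set gs"
      "x * prod_list (map \<nu> u) = prod_list (map \<nu> w)" by blast
    have "inverse x * prod_list (map \<nu> w) = prod_list (map \<nu> u)" using uw by (simp add: field_simps flip: uw(4))
    thus "inverse x \<in> ?A" using uw by (intro CollectI conjI exI[of _ w] exI[of _ u]) auto
  qed simp
  moreover have "\<nu> ` set gs \<subseteq> ?A"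
  proof
    fix y assume "y \<in> \<nu> ` set gs"
    then obtain g where "g \<in> set gs" "y = \<nu> g" by blast
    thus "y \<in> ?A" using assms by (intro CollectI conjI exI[of _ "[]"] exI[of _ "[g]"]) auto
  qed
  ultimately have "grp gs \<subseteq> ?A" unfolding grp_def by (intro hull_minimal)
  moreover assume "\<nu> x \<in> grp gs"
  ultimately have "\<nu> x \<in> ?A" by blast
  then obtain u w where "set u \<subseteq> set gs" "set w \<subseteq> set gs" "\<nu> x * prod_list (map \<nu> u) = prod_list (map \<nu> w)"
    by blast
  thus "in_grp gs x" unfolding in_grp_def by (intro exI[of _ u] exI[of _ w]) auto
qed

text \<open>Representatives modulo \<open>q\<close>-th powers, possibly several for one class.
  Testing multiplication by generators suffices by \<open>reps_all\<close>, and this keeps the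
  condition enumerable.\<close>

definition transversal :: "nat list \<Rightarrow> nat list \<Rightarrow> nat \<Rightarrow> bool" where
  "transversal gens T q \<longleftrightarrow> (\<exists>t\<in>set T. \<nu> t = 1) \<and> (\<forall>t\<in>set T. in_grp gens t) \<and>
     (\<forall>t\<in>set T. \<forall>b\<in>set gens. \<exists>t' s. t' \<in> set T \<and> in_grp gens s \<and> \<nu> (ml t b) = \<nu> (ml t' (pw s q)))"

lemma grp_subset_F:
  assumes "0 \<notin> \<nu> ` set gs"
  shows "grp gs \<subseteq> F"
proof -
  have "mult_subgroup (F - {0})" by (rule mult_subgroupI) (auto simp: F_0 F_1 F_mult F_inverse)
  moreover have "\<nu> ` set gs \<subseteq> F - {0}" using assms by auto
  ultimately have "grp gs \<subseteq> F - {0}" unfolding grp_def by (intro hull_minimal)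
  thus ?thesis by blast
qed

lemma transversal_all:
  assumes "0 \<notin> \<nu> ` set gens" "transversal gens T q" "q > 0" "x \<in> grp gens"
  shows "\<exists>t\<in>set T. \<exists>s\<in>grp gens. x = \<nu> t * s ^ q"
proof -
  note G = mult_subgroup_hull[OF assms(1), folded grp_def]
  let ?H = "(\<lambda>s. s ^ q) ` grp gens"
  obtain t where t: "t \<in> set T" "\<nu> t = 1" using assms(2) unfolding transversal_def by blast
  have "\<exists>t'\<in>\<nu> ` set T. \<exists>h\<in>?H. 1 * x = t' * h"
  proof (rule reps_all[OF assms(1) mult_subgroup_powers[OF G]])
    show "x \<in> mult_subgroup hull \<nu> ` set gens" using assms(4) by (simp add: grp_def)
    show "1 \<in> \<nu> ` set T" using t by force
    show "\<exists>k>0. a ^ k \<in> ?H" if "a \<in> mult_subgroup hull \<nu> ` set gens" for a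
      using that assms(3) by (auto simp: grp_def)
    fix t b assume "t \<in> \<nu> ` set T" "b \<in> \<nu> ` set gens"
    then obtain t0 b0 where 0: "t0 \<in> set T" "t = \<nu> t0" "b0 \<in> set gens" "b = \<nu> b0" by blast
    then obtain t' s where "t' \<in> set T" "in_grp gens s" "\<nu> t0 * \<nu> b0 = \<nu> t' * \<nu> s ^ q"
      using assms(2) unfolding transversal_def by (metis \<nu>_ml \<nu>_pw)
    thus "\<exists>t'\<in>\<nu> ` set T. \<exists>h\<in>?H. t * b = t' * h" using 0 in_grp_iff[OF assms(1)] by blast
  qed
  thus ?thesis by auto
qed

lemma ex_transversal:
  assumes "0 \<notin> \<nu> ` set gens" "q > 0"
  shows "\<exists>T. transversal gens T q"
proof -
  note G = mult_subgroup_hull[OF assms(1), folded grp_def]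
  note GF = grp_subset_F[OF assms(1)]
  let ?H = "(\<lambda>s. s ^ q) ` grp gens"
  have "\<exists>T. finite T \<and> T \<subseteq> grp gens \<and> 1 \<in> T \<and>
           (\<forall>t\<in>T. \<forall>b\<in>\<nu> ` set gens. \<exists>t'\<in>T. \<exists>h\<in>?H. t * b = t' * h)"
    unfolding grp_def
  proof (rule ex_reps[OF _ assms(1) mult_subgroup_powers[OF G[unfolded grp_def]]])
    fix b assume "b \<in> \<nu> ` set gens"
    hence "b \<in> mult_subgroup hull \<nu> ` set gens" by (rule hull_inc)
    thus "\<exists>k>0. b ^ k \<in> (\<lambda>s. s ^ q) ` (mult_subgroup hull \<nu> ` set gens)"
      using assms(2) by (intro exI[of _ q]) blast
  qed simp
  then obtain T where "finite T \<and> T \<subseteq> grp gens \<and> 1 \<in> T \<and>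
           (\<forall>t\<in>T. \<forall>b\<in>\<nu> ` set gens. \<exists>t'\<in>T. \<exists>h\<in>?H. t * b = t' * h)" ..
  hence T: "finite T" "T \<subseteq> grp gens" "1 \<in> T"
    "\<forall>t\<in>T. \<forall>b\<in>\<nu> ` set gens. \<exists>t'\<in>T. \<exists>h\<in>?H. t * b = t' * h" by argo+
  obtain l where l: "set l = T" using finite_list[OF T(1)] by blast
  have \<nu>l: "\<nu> (nm t) = t" if "t \<in> T" for t using that T(2) GF by (intro \<nu>_nm) blast
  have "transversal gens (map nm l) q"
    unfolding transversal_def
  proof (intro conjI ballI)
    show "\<exists>t\<in>set (map nm l). \<nu> t = 1" using T(3) l \<nu>l by auto
    show "in_grp gens t" if "t \<in> set (map nm l)" for t
      using that l \<nu>l T(2) by (auto simp: in_grp_iff[OF assms(1)])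
    fix t b assume t: "t \<in> set (map nm l)" and b: "b \<in> set gens"
    have "\<nu> t \<in> T" using t l \<nu>l by auto
    from T(4)[THEN bspec, OF this, THEN bspec, of "\<nu> b"] b
    obtain t' s where ts: "t' \<in> T" "s \<in> grp gens" "\<nu> t * \<nu> b = t' * s ^ q" by auto
    show "\<exists>t' s. t' \<in> set (map nm l) \<and> in_grp gens s \<and> \<nu> (ml t b) = \<nu> (ml t' (pw s q))"
      by (rule exI[of _ "nm t'"], rule exI[of _ "nm s"])
         (use ts l \<nu>l subsetD[OF GF ts(2)] in \<open>simp add: in_grp_iff[OF assms(1)]\<close>)
  qed
  thus ?thesis by blast
qed

lemma transversal_vec:
  assumes "0 \<notin> \<nu> ` set gens" "transversal gens T q" "q > 0" "\<And>i. i \<le> n \<Longrightarrow> x i \<in> grp gens"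
  shows "\<exists>g\<in>set (List.n_lists (Suc n) T). \<exists>s. (\<forall>i\<le>n. s i \<in> grp gens) \<and> (\<forall>i>n. s i = 0) \<and>
           (\<forall>i\<le>n. x i = val n g i * s i ^ q)"
proof -
  have "\<exists>t s. i \<le> n \<longrightarrow> t \<in> set T \<and> s \<in> grp gens \<and> x i = \<nu> t * s ^ q" for i
    using transversal_all[OF assms(1-3) assms(4)] by blast
  then obtain t s where ts: "\<And>i. i \<le> n \<Longrightarrow> t i \<in> set T \<and> s i \<in> grp gens \<and> x i = \<nu> (t i) * s i ^ q" by metis
  have "tab n t \<in> set (List.n_lists (Suc n) T)"
    unfolding set_n_lists using ts by (auto simp: tab_def less_Suc_eq_le simp del: upt_Suc)
  moreover have "\<forall>i\<le>n. x i = val n (tab n t) i * (if i \<le> n then s i else 0) ^ q"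
    using ts by (simp add: val_tab)
  ultimately show ?thesis using ts
    by (intro bexI[of _ "tab n t"] exI[of _ "\<lambda>i. if i \<le> n then s i else 0"]) auto
qed

lemma n_lists_val:
  assumes "g \<in> set (List.n_lists (Suc n) T)" "\<And>t. t \<in> set T \<Longrightarrow> \<nu> t \<in> G" "i \<le> n"
  shows "val n g i \<in> G"
proof -
  have "length g = Suc n" "set g \<subseteq> set T" using assms(1) unfolding set_n_lists by simp_all
  hence "get g i \<in> set T" using assms(3) get_nth[of i g] nth_mem[of i g] by auto
  thus ?thesis using assms(2,3) by (simp add: val_def)
qed

end


subsection \<open>Covering the points of a variety\<close>

context named_field
begin

definition dset :: "nat \<Rightarrow> nat \<Rightarrow> 'k set \<Rightarrow> descr \<Rightarrow> (nat \<Rightarrow> 'k) set" where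
  "dset n q G d = orbit_set n q G (val n (fst d)) (map (val n) (fst (snd d))) (set (snd (snd d)))"

text \<open>Only this inclusion is propagated by the derivation rules; the described sets may leave
  the variety. The reverse inclusion is tested once, on the final descriptions, by
  \<open>descr_ok\<close>.\<close>

definition covers :: "nat \<Rightarrow> nat \<Rightarrow> 'k set \<Rightarrow> nat list list \<Rightarrow> descr list \<Rightarrow> bool" where
  "covers n q G rows D \<longleftrightarrow> (\<forall>x\<in>sols n rows. (\<forall>i\<le>n. x i \<in> G) \<longrightarrow> (\<exists>d\<in>set D. x \<in> dset n q G d))"

definition shift_descr :: "nat \<Rightarrow> nat \<Rightarrow> nat list \<Rightarrow> descr \<Rightarrow> descr" where
  "shift_descr n k g d = (vmul n g (vpw n (fst d) k), map (\<lambda>v. vpw n v k) (fst (snd d)), snd (snd d))"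

text \<open>For a point \<open>\<delta> * (g * s ^ k) ^ (k ^ l)\<close>, the leading vector of
  \<open>s\<close>, raised to \<open>k\<close> and multiplied by \<open>g\<close>, becomes a new
  moving point. There the exponents of the other moving points are at least \<open>l\<close>; the
  description drops this restriction.\<close>

definition twist_descr :: "nat \<Rightarrow> nat \<Rightarrow> nat list \<Rightarrow> nat list \<Rightarrow> descr \<Rightarrow> descr" where
  "twist_descr n k \<delta> g d = (\<delta>, vmul n g (vpw n (fst d) k) # map (\<lambda>v. vpw n v k) (fst (snd d)), snd (snd d))"

definition blocks :: "nat \<Rightarrow> nat list \<Rightarrow> (nat \<times> nat) list" where
  "blocks n \<beta> = map (\<lambda>i. (i, get \<beta> i)) [0..<Suc n]"

definition lincomb :: "nat \<Rightarrow> nat list list \<Rightarrow> nat list \<Rightarrow> bool" where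
  "lincomb n rows r \<longleftrightarrow> (\<exists>ks. \<forall>i<Suc n. \<nu> (get r i) = \<nu> (sm (map (\<lambda>j. ml (get ks j) (get (get rows j) i)) [0..<length rows])))"

text \<open>Every class modulo \<open>p ^ m\<close>-th powers is handed to a descended system
  already covered in \<open>L\<close>, and its descriptions are carried back.\<close>

definition cov_split :: "nat \<Rightarrow> nat list \<Rightarrow> (nat list list \<times> descr list) list \<Rightarrow> nat list list \<Rightarrow> descr list \<Rightarrow> bool" where
  "cov_split n gens L rows D \<longleftrightarrow> (\<exists>m T. transversal gens T (p ^ m) \<and>
     (\<forall>g\<in>set (List.n_lists (Suc n) T). \<exists>U D'. coord_chain n m (scale n g rows) U \<and> (U, D') \<in> set L \<and>
        (\<forall>d\<in>set D'. shift_descr n (p ^ m) g d \<in> set D)))"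

text \<open>A weakening rule: \<open>rows'\<close> consists of consequences, so its solution space
  is at least as large. It allows \<open>cov_iso\<close> to be applied to normalised
  equations.\<close>

definition cov_comb :: "nat \<Rightarrow> (nat list list \<times> descr list) list \<Rightarrow> nat list list \<Rightarrow> descr list \<Rightarrow> bool" where
  "cov_comb n L rows D \<longleftrightarrow> (\<exists>rows'. (rows', D) \<in> set L \<and> (\<forall>r\<in>set rows'. lincomb n rows r))"

text \<open>Translated by \<open>\<delta>\<close>, the system has coefficients fixed by the
  \<open>p ^ e\<close>-Frobenius, and each row is supported in one fibre of \<open>\<beta>\<close>.
  Solutions \<open>\<delta> * \<zeta>\<close> with \<open>\<zeta>\<close> over \<open>mus\<close>
  are listed directly. A class \<open>g\<close> is trivial when it is constant on blocks up to
  \<open>p ^ e\<close>-th powers; any other class needs a covered descent whose equations stay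
  inside blocks.\<close>

definition cov_iso :: "nat \<Rightarrow> nat \<Rightarrow> nat list \<Rightarrow> nat list \<Rightarrow> (nat list list \<times> descr list) list \<Rightarrow> nat list list \<Rightarrow> descr list \<Rightarrow> bool" where
  "cov_iso n e mus gens L rows D \<longleftrightarrow> (\<exists>\<delta> \<beta> T.
     (\<forall>i<Suc n. in_grp gens (get \<delta> i)) \<and>
     (\<forall>i<Suc n. get \<beta> i < Suc n \<and> get \<beta> (get \<beta> i) = get \<beta> i) \<and>
     (\<forall>a\<in>set rows. \<forall>i<Suc n. \<nu> (pw (ml (get a i) (get \<delta> i)) (p ^ e)) = \<nu> (ml (get a i) (get \<delta> i))) \<and>
     (\<forall>a\<in>set rows. \<forall>i<Suc n. \<forall>j<Suc n. \<nu> (get a i) = \<nu> z0 \<or> \<nu> (get a j) = \<nu> z0 \<or> get \<beta> i = get \<beta> j) \<and>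
     transversal gens T (p ^ e) \<and>
     (\<forall>\<zeta>\<in>set (List.n_lists (Suc n) mus). (\<exists>a\<in>set rows. \<nu> (dot n a (vmul n \<delta> \<zeta>)) \<noteq> \<nu> z0) \<or>
        (vmul n \<delta> \<zeta>, [], blocks n \<beta>) \<in> set D) \<and>
     (\<forall>g\<in>set (List.n_lists (Suc n) T).
        (\<forall>i<Suc n. \<exists>s. in_grp gens s \<and> \<nu> (get g i) = \<nu> (ml (get g (get \<beta> i)) (pw s (p ^ e)))) \<or>
        (\<exists>U D'. coord_chain n e (scale n (vmul n \<delta> g) rows) U \<and> (U, D') \<in> set L \<and>
           (\<forall>d\<in>set D'. (\<forall>z\<in>set (snd (snd d)). fst z < Suc n \<and> snd z < Suc n \<and> get \<beta> (fst z) = get \<beta> (snd z)) \<and>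
              twist_descr n (p ^ e) \<delta> g d \<in> set D))))"

definition covstep :: "nat \<times> nat \<times> nat list \<times> nat list \<Rightarrow> (nat list list \<times> descr list) list \<Rightarrow> nat list list \<times> descr list \<Rightarrow> bool" where
  "covstep c L x \<longleftrightarrow> cov_split (fst c) (fst (snd (snd c)) @ snd (snd (snd c))) L (fst x) (snd x) \<or>
     cov_comb (fst c) L (fst x) (snd x) \<or>
     cov_iso (fst c) (fst (snd c)) (fst (snd (snd c))) (fst (snd (snd c)) @ snd (snd (snd c))) L (fst x) (snd x)"

section \<open>Soundness of the three covering rules\<close>

lemma map_val_vpw: "k > 0 \<Longrightarrow> map (val n) (map (\<lambda>v. vpw n v k) vs) = map (\<lambda>v i. v i ^ k) (map (val n) vs)"
  by (simp add: val_vpw fun_eq_iff)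

lemma grp_vecs:
  assumes "0 \<notin> \<nu> ` set gens" "\<And>i. i \<le> n \<Longrightarrow> s i \<in> grp gens" "\<And>i. i > n \<Longrightarrow> s i = 0"
  shows "s \<in> vecs n"
  using assms grp_subset_F[OF assms(1)] by (auto simp: vecs_def)

lemma split_sound:
  assumes gens: "0 \<notin> \<nu> ` set gens" and step: "cov_split n gens L rows D"
    and L: "\<And>U D'. (U, D') \<in> set L \<Longrightarrow> covers n q (grp gens) U D'"
  shows "covers n q (grp gens) rows D"
  unfolding covers_def
proof (intro ballI impI)
  note G = mult_subgroup_hull[OF gens, folded grp_def]
  fix x assume x: "x \<in> sols n rows" "\<forall>i\<le>n. x i \<in> grp gens"
  obtain m T where T: "transversal gens T (p ^ m)"
    and *: "\<And>g. g \<in> set (List.n_lists (Suc n) T) \<Longrightarrow> \<exists>U D'. coord_chain n m (scale n g rows) U \<and> (U, D') \<in> set L \<and>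
        (\<forall>d\<in>set D'. shift_descr n (p ^ m) g d \<in> set D)"
    using step unfolding cov_split_def by blast
  have pm: "p ^ m > 0" using p_pos by simp
  obtain g s where g: "g \<in> set (List.n_lists (Suc n) T)"
    and s: "\<forall>i\<le>n. s i \<in> grp gens" "\<forall>i>n. s i = 0" "\<forall>i\<le>n. x i = val n g i * s i ^ (p ^ m)"
    using transversal_vec[OF gens T pm, of n x] x(2) by auto
  obtain U D' where U: "coord_chain n m (scale n g rows) U" "(U, D') \<in> set L"
    and D': "\<And>d. d \<in> set D' \<Longrightarrow> shift_descr n (p ^ m) g d \<in> set D" using *[OF g] by blast
  have sv: "s \<in> vecs n" using s(1,2) by (intro grp_vecs[OF gens]) auto
  have xv: "\<And>i. i > n \<Longrightarrow> x i = 0" using x(1) by (simp add: sols_iff vecs_def)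
  have "x = (\<lambda>i. val n g i * s i ^ (p ^ m))"
  proof
    show "x i = val n g i * s i ^ (p ^ m)" for i using s(3) xv[of i] by (cases "i \<le> n") (auto simp: val_def)
  qed
  hence "s \<in> descent n (sols n rows) (val n g) m" using x(1) sv by (simp add: descent_def)
  hence "s \<in> sols n U" using chain_descent[OF U(1)] by blast
  then obtain d where d: "d \<in> set D'" "s \<in> dset n q (grp gens) d"
    using L[OF U(2)] s(1) unfolding covers_def by blast
  obtain ls \<sigma> where \<sigma>: "length ls = length (map (val n) (fst (snd d)))" "\<And>i. i \<le> n \<Longrightarrow> \<sigma> i \<in> grp gens"
    "\<And>z. z \<in> set (snd (snd d)) \<Longrightarrow> \<sigma> (fst z) = \<sigma> (snd z)"
    "\<And>i. i \<le> n \<Longrightarrow> s i = val n (fst d) i * orb q (map (val n) (fst (snd d))) ls i * \<sigma> i"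
    using d(2) unfolding dset_def by (rule orbit_setE) blast
  have "x \<in> dset n q (grp gens) (shift_descr n (p ^ m) g d)"
    unfolding dset_def shift_descr_def fst_conv snd_conv map_val_vpw[OF pm]
  proof (rule orbit_setI[of ls _ _ "\<lambda>i. \<sigma> i ^ (p ^ m)"])
    fix i assume i: "i \<le> n"
    show "\<sigma> i ^ p ^ m \<in> grp gens" by (rule mult_subgroup_power[OF G \<sigma>(2)[OF i]])
    show "x i = val n (vmul n g (vpw n (fst d) (p ^ m))) i *
         orb q (map (\<lambda>v i. v i ^ p ^ m) (map (val n) (fst (snd d)))) ls i * \<sigma> i ^ p ^ m"
      using s(3) i by (simp add: \<sigma>(4) val_vmul val_vpw[OF pm] orb_power power_mult_distrib mult_ac del: map_map)
  qed (use \<sigma> in simp_all)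
  thus "\<exists>d\<in>set D. x \<in> dset n q (grp gens) d" using D'[OF d(1)] by blast
qed

lemma lincomb_sols:
  assumes "lincomb n rows r" "x \<in> sols n rows"
  shows "(\<Sum>i\<le>n. val n r i * x i) = 0"
proof -
  obtain ks where ks: "\<And>i. i < Suc n \<Longrightarrow> \<nu> (get r i) = \<nu> (sm (map (\<lambda>j. ml (get ks j) (get (get rows j) i)) [0..<length rows]))"
    using assms(1) unfolding lincomb_def by blast
  have "(\<Sum>i\<le>n. val n r i * x i) = (\<Sum>i\<le>n. \<Sum>j<length rows. \<nu> (get ks j) * (val n (get rows j) i * x i))"
  proof (rule sum.cong)
    fix i assume "i \<in> {..n}"
    hence "val n r i = (\<Sum>j<length rows. \<nu> (get ks j) * val n (get rows j) i)"
      using ks[of i] by (simp add: val_def o_def sum_list_upt)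
    thus "val n r i * x i = (\<Sum>j<length rows. \<nu> (get ks j) * (val n (get rows j) i * x i))"
      by (simp add: sum_distrib_right mult.assoc)
  qed simp
  also have "\<dots> = (\<Sum>j<length rows. \<Sum>i\<le>n. \<nu> (get ks j) * (val n (get rows j) i * x i))" by (rule sum.swap)
  also have "\<dots> = (\<Sum>j<length rows. \<nu> (get ks j) * (\<Sum>i\<le>n. val n (get rows j) i * x i))"
    by (simp add: sum_distrib_left)
  also have "\<dots> = 0"
  proof (rule sum.neutral, rule ballI)
    fix j assume "j \<in> {..<length rows}"
    hence "get rows j \<in> set rows" by (simp add: get_nth)
    thus "\<nu> (get ks j) * (\<Sum>i\<le>n. val n (get rows j) i * x i) = 0" using assms(2) by (simp add: sols_iff)
  qed
  finally show ?thesis .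
qed

lemma comb_sound:
  assumes step: "cov_comb n L rows D" and L: "\<And>U D'. (U, D') \<in> set L \<Longrightarrow> covers n q G U D'"
  shows "covers n q G rows D"
proof -
  obtain rows' where r: "(rows', D) \<in> set L" "\<And>r. r \<in> set rows' \<Longrightarrow> lincomb n rows r"
    using step unfolding cov_comb_def by blast
  have "x \<in> sols n rows'" if "x \<in> sols n rows" for x
    using that lincomb_sols[OF r(2) that] by (simp add: sols_iff)
  thus ?thesis using L[OF r(1)] unfolding covers_def by blast
qed

lemma blocks_mem: "z \<in> set (blocks n \<beta>) \<longleftrightarrow> fst z \<le> n \<and> snd z = get \<beta> (fst z)"
  by (cases z) (auto simp: blocks_def less_Suc_eq_le simp del: upt_Suc)

text \<open>
  On an isotrivial variety the points in the trivial class are Frobenius images of points of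
  the same variety, up to a factor constant on blocks. A point for which this can be repeated
  forever has coordinates which are infinitely \<open>p\<close>-divisible relative to each other.
\<close>

lemma iso_sound:
  assumes gens: "0 \<notin> \<nu> ` set gens" and e: "e > 0"
    and div: "\<And>x. (\<And>m. \<exists>v\<in>grp gens. x = v ^ (p ^ m)) \<Longrightarrow> x \<in> \<nu> ` set mus"
    and step: "cov_iso n e mus gens L rows D"
    and L: "\<And>U D'. (U, D') \<in> set L \<Longrightarrow> covers n (p ^ e) (grp gens) U D'"
  shows "covers n (p ^ e) (grp gens) rows D"
  unfolding covers_def
proof (intro ballI impI, rule ccontr)
  let ?q = "p ^ e" and ?G = "grp gens"
  note G = mult_subgroup_hull[OF gens, folded grp_def]
  note GD = mult_subgroupD[OF G]
  have q: "?q > 0" using p_pos by simp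
  fix x assume x: "x \<in> sols n rows" "\<forall>i\<le>n. x i \<in> ?G" and nocov: "\<not> (\<exists>d\<in>set D. x \<in> dset n ?q ?G d)"
  obtain \<delta> \<beta> T where H: "(\<forall>i<Suc n. in_grp gens (get \<delta> i)) \<and>
     (\<forall>i<Suc n. get \<beta> i < Suc n \<and> get \<beta> (get \<beta> i) = get \<beta> i) \<and>
     (\<forall>a\<in>set rows. \<forall>i<Suc n. \<nu> (pw (ml (get a i) (get \<delta> i)) (p ^ e)) = \<nu> (ml (get a i) (get \<delta> i))) \<and>
     (\<forall>a\<in>set rows. \<forall>i<Suc n. \<forall>j<Suc n. \<nu> (get a i) = \<nu> z0 \<or> \<nu> (get a j) = \<nu> z0 \<or> get \<beta> i = get \<beta> j) \<and>
     transversal gens T (p ^ e) \<and>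
     (\<forall>\<zeta>\<in>set (List.n_lists (Suc n) mus). (\<exists>a\<in>set rows. \<nu> (dot n a (vmul n \<delta> \<zeta>)) \<noteq> \<nu> z0) \<or>
        (vmul n \<delta> \<zeta>, [], blocks n \<beta>) \<in> set D) \<and>
     (\<forall>g\<in>set (List.n_lists (Suc n) T).
        (\<forall>i<Suc n. \<exists>s. in_grp gens s \<and> \<nu> (get g i) = \<nu> (ml (get g (get \<beta> i)) (pw s (p ^ e)))) \<or>
        (\<exists>U D'. coord_chain n e (scale n (vmul n \<delta> g) rows) U \<and> (U, D') \<in> set L \<and>
           (\<forall>d\<in>set D'. (\<forall>z\<in>set (snd (snd d)). fst z < Suc n \<and> snd z < Suc n \<and> get \<beta> (fst z) = get \<beta> (snd z)) \<and>
              twist_descr n (p ^ e) \<delta> g d \<in> set D)))"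
    using step[unfolded cov_iso_def] by (elim exE) (rule that)
  note \<delta> = H[THEN conjunct1, rule_format]
    and \<beta> = H[THEN conjunct2, THEN conjunct1, rule_format]
    and frob = H[THEN conjunct2, THEN conjunct2, THEN conjunct1, rule_format]
    and supp = H[THEN conjunct2, THEN conjunct2, THEN conjunct2, THEN conjunct1, rule_format]
  note H' = H[THEN conjunct2, THEN conjunct2, THEN conjunct2, THEN conjunct2]
  note T = H'[THEN conjunct1] and tor = H'[THEN conjunct2, THEN conjunct1, rule_format]
    and ch = H'[THEN conjunct2, THEN conjunct2, rule_format]
  have \<delta>G: "val n \<delta> i \<in> ?G" if "i \<le> n" for i
    using \<delta>[of i] that by (simp add: val_def in_grp_iff[OF gens])
  have \<beta>n: "get \<beta> i \<le> n" "get \<beta> (get \<beta> i) = get \<beta> i" if "i \<le> n" for i using \<beta>[of i] that by auto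
  \<comment> \<open>The translate by the inverse of \<open>\<delta>\<close>, whose equations have
    coefficients fixed by Frobenius.\<close>
  define V where "V = {y \<in> vecs n. (\<lambda>i. val n \<delta> i * y i) \<in> sols n rows}"
  have V_iff: "y \<in> V \<longleftrightarrow> y \<in> vecs n \<and> (\<forall>a\<in>set rows. (\<Sum>i\<le>n. val n a i * val n \<delta> i * y i) = 0)" for y
    using vecs_mult[OF val_vecs[of n \<delta>], of y] by (auto simp: V_def sols_iff mult.assoc)
  \<comment> \<open>An equation supported in one block sees a factor constant on blocks as a single
    nonzero scalar, which can be cancelled.\<close>
  have unblock: "(\<Sum>i\<le>n. c i * y i) = 0"
    if "(\<Sum>i\<le>n. c i * (t (get \<beta> i) * y i)) = 0" "\<And>i. i \<le> n \<Longrightarrow> t (get \<beta> i) \<noteq> 0"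
      "\<And>i j. i \<le> n \<Longrightarrow> j \<le> n \<Longrightarrow> c i = 0 \<or> c j = 0 \<or> get \<beta> i = get \<beta> j" for c t y :: "nat \<Rightarrow> 'k"
  proof (cases "\<exists>k\<le>n. c k \<noteq> 0")
    case True
    then obtain k where k: "k \<le> n" "c k \<noteq> 0" by blast
    have "(\<Sum>i\<le>n. c i * (t (get \<beta> i) * y i)) = t (get \<beta> k) * (\<Sum>i\<le>n. c i * y i)"
      unfolding sum_distrib_left
    proof (rule sum.cong)
      fix i assume "i \<in> {..n}"
      thus "c i * (t (get \<beta> i) * y i) = t (get \<beta> k) * (c i * y i)"
        using that(3)[of i k] k by (cases "c i = 0") auto
    qed simp
    thus ?thesis using that(1) that(2)[OF k(1)] by simp
  qed (simp add: sum.neutral)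
  have asupp: "val n a i * val n \<delta> i = 0 \<or> val n a j * val n \<delta> j = 0 \<or> get \<beta> i = get \<beta> j"
    if "a \<in> set rows" "i \<le> n" "j \<le> n" for a i j
    using supp[OF that(1), of i j] that by (auto simp: val_def)
  \<comment> \<open>After cancelling \<open>t\<close>, the coefficients are their own
    \<open>?q\<close>-th powers, so the equation is a \<open>?q\<close>-th power and its root is the
    equation for \<open>y\<close>.\<close>
  have descend: "y \<in> V" if z: "(\<lambda>i. t (get \<beta> i) * y i ^ ?q) \<in> V" and t: "\<And>i. i \<le> n \<Longrightarrow> t (get \<beta> i) \<noteq> 0"
    and y: "y \<in> vecs n" for t y
    unfolding V_iff
  proof (intro conjI ballI y)
    fix a assume a: "a \<in> set rows"
    have "(\<Sum>i\<le>n. val n a i * val n \<delta> i * (t (get \<beta> i) * y i ^ ?q)) = 0" using z a unfolding V_iff by blast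
    from unblock[OF this t asupp[OF a]] have "(\<Sum>i\<le>n. val n a i * val n \<delta> i * y i ^ ?q) = 0" by blast
    moreover have "(\<Sum>i\<le>n. val n a i * val n \<delta> i * y i ^ ?q) = (\<Sum>i\<le>n. (val n a i * val n \<delta> i * y i) ^ ?q)"
    proof (rule sum.cong)
      fix i assume "i \<in> {..n}"
      hence "(val n a i * val n \<delta> i) ^ ?q = val n a i * val n \<delta> i"
        using frob[OF a, of i] by (simp add: val_def)
      thus "val n a i * val n \<delta> i * y i ^ ?q = (val n a i * val n \<delta> i * y i) ^ ?q" by (simp add: power_mult_distrib)
    qed simp
    ultimately show "(\<Sum>i\<le>n. val n a i * val n \<delta> i * y i) = 0"
      using q by (simp flip: frob_sum)
  qed
  define y where "y = (\<lambda>i. if i \<le> n then x i / val n \<delta> i else 0)"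
  have yG: "y i \<in> ?G" if "i \<le> n" for i using x(2) \<delta>G that by (auto simp: y_def intro: mult_subgroup_divide[OF G])
  have xy: "x i = val n \<delta> i * y i" if "i \<le> n" for i using GD(5)[OF \<delta>G[OF that]] that by (simp add: y_def)
  have yv: "y \<in> vecs n" using yG by (intro grp_vecs[OF gens]) (auto simp: y_def)
  have yV: "y \<in> V"
    unfolding V_iff
  proof (intro conjI ballI yv)
    fix a assume a: "a \<in> set rows"
    have "(\<Sum>i\<le>n. val n a i * val n \<delta> i * y i) = (\<Sum>i\<le>n. val n a i * x i)"
      by (rule sum.cong) (simp_all add: xy)
    thus "(\<Sum>i\<le>n. val n a i * val n \<delta> i * y i) = 0" using x(1) a by (simp add: sols_iff)
  qed
  \<comment> \<open>As \<open>x\<close> is assumed to be uncovered, its classes are trivial at every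
    stage and a further \<open>?q\<close>-th root can be taken; a nontrivial class would produce a
    covering description.\<close>
  have chain: "\<exists>t z. z \<in> V \<and> (\<forall>i\<le>n. z i \<in> ?G \<and> t i \<in> ?G \<and> y i = t (get \<beta> i) * z i ^ (?q ^ l))" for l
  proof (induction l)
    case 0
    show ?case using yV yG GD(2) by (intro exI[of _ "\<lambda>_. 1"] exI[of _ y]) simp
  next
    case (Suc l)
    then obtain t z where z: "z \<in> V" and tz: "\<And>i. i \<le> n \<Longrightarrow> z i \<in> ?G" "\<And>i. i \<le> n \<Longrightarrow> t i \<in> ?G"
      "\<And>i. i \<le> n \<Longrightarrow> y i = t (get \<beta> i) * z i ^ (?q ^ l)" by blast
    obtain g s where g: "g \<in> set (List.n_lists (Suc n) T)"
      and s: "\<forall>i\<le>n. s i \<in> ?G" "\<forall>i>n. s i = 0" "\<forall>i\<le>n. z i = val n g i * s i ^ ?q"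
      using transversal_vec[OF gens T q, of n z] tz(1) by auto
    have gG: "val n g i \<in> ?G" if "i \<le> n" for i
      by (rule n_lists_val[OF g _ that]) (use T in \<open>simp add: transversal_def in_grp_iff[OF gens]\<close>)
    have sv: "s \<in> vecs n" using s(1,2) by (intro grp_vecs[OF gens]) auto
    have zv: "\<And>i. i > n \<Longrightarrow> z i = 0" using z by (simp add: V_def vecs_def)
    have zfun: "z = (\<lambda>i. val n g i * s i ^ ?q)"
    proof
      show "z i = val n g i * s i ^ ?q" for i using s(3) zv[of i] by (cases "i \<le> n") (auto simp: val_def)
    qed
    from ch[OF g] consider
        (ret) "\<forall>i<Suc n. \<exists>s. in_grp gens s \<and> \<nu> (get g i) = \<nu> (ml (get g (get \<beta> i)) (pw s ?q))"
      | (child) U D' where "coord_chain n e (scale n (vmul n \<delta> g) rows) U" "(U, D') \<in> set L"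
        "\<And>d. d \<in> set D' \<Longrightarrow> (\<forall>z\<in>set (snd (snd d)). fst z < Suc n \<and> snd z < Suc n \<and> get \<beta> (fst z) = get \<beta> (snd z)) \<and>
              twist_descr n ?q \<delta> g d \<in> set D" by blast
    thus ?case
    proof cases
      case ret
      have "\<exists>r. i \<le> n \<longrightarrow> r \<in> ?G \<and> val n g i = val n g (get \<beta> i) * r ^ ?q" for i
      proof (cases "i \<le> n")
        case True
        then obtain r where "in_grp gens r" "\<nu> (get g i) = \<nu> (ml (get g (get \<beta> i)) (pw r ?q))"
          using ret by (meson less_Suc_eq_le)
        thus ?thesis using True \<beta>n(1)[OF True]
          by (intro exI[of _ "\<nu> r"]) (simp add: val_def in_grp_iff[OF gens])
      qed simp
      then obtain r where r: "\<And>i. i \<le> n \<Longrightarrow> r i \<in> ?G" "\<And>i. i \<le> n \<Longrightarrow> val n g i = val n g (get \<beta> i) * r i ^ ?q"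
        by metis
      define z' where "z' = (\<lambda>i. if i \<le> n then r i * s i else 0)"
      have z'G: "z' i \<in> ?G" if "i \<le> n" for i using that r(1) s(1) GD(3) by (simp add: z'_def)
      have zz': "z i = val n g (get \<beta> i) * z' i ^ ?q" if "i \<le> n" for i
      proof -
        have "z i = val n g (get \<beta> i) * r i ^ ?q * s i ^ ?q"
          using zfun r(2)[OF that] by metis
        thus ?thesis using that by (simp add: z'_def power_mult_distrib mult.assoc)
      qed
      have zf: "z = (\<lambda>i. val n g (get \<beta> i) * z' i ^ ?q)"
      proof
        show "z i = val n g (get \<beta> i) * z' i ^ ?q" for i
          using zz'[of i] zv[of i] q by (cases "i \<le> n") (auto simp: z'_def power_0_left)
      qed
      have zm: "(\<lambda>i. val n g (get \<beta> i) * z' i ^ ?q) \<in> V" by (rule z[unfolded zf])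
      have z'v: "z' \<in> vecs n" using z'G by (intro grp_vecs[OF gens]) (auto simp: z'_def)
      have "z' \<in> V"
        by (rule descend[of "val n g", OF zm _ z'v]) (rule GD(5), rule gG, rule \<beta>n(1))
      moreover have "y i = (t (get \<beta> i) * val n g (get \<beta> i) ^ (?q ^ l)) * z' i ^ (?q ^ Suc l)" if "i \<le> n" for i
        using tz(3)[OF that] zz'[OF that] by (simp add: power_mult_distrib mult.assoc flip: power_mult)
      moreover have "t i * val n g i ^ (?q ^ l) \<in> ?G" if "i \<le> n" for i
        using tz(2) gG that by (intro GD(3) mult_subgroup_power[OF G]) auto
      ultimately show ?thesis using z'G
        by (intro exI[of _ "\<lambda>i. t i * val n g i ^ (?q ^ l)"] exI[of _ z'] conjI allI impI)
    next
      case child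
      have "s \<in> descent n (sols n rows) (val n (vmul n \<delta> g)) e"
        using z zfun sv by (simp add: descent_def V_def val_vmul mult.assoc)
      hence "s \<in> sols n U" using chain_descent[OF child(1)] by blast
      then obtain d where d: "d \<in> set D'" "s \<in> dset n ?q ?G d"
        using L[OF child(2)] s(1) unfolding covers_def by blast
      obtain ls \<sigma> where \<sigma>: "length ls = length (map (val n) (fst (snd d)))" "\<And>i. i \<le> n \<Longrightarrow> \<sigma> i \<in> ?G"
        "\<And>z. z \<in> set (snd (snd d)) \<Longrightarrow> \<sigma> (fst z) = \<sigma> (snd z)"
        "\<And>i. i \<le> n \<Longrightarrow> s i = val n (fst d) i * orb ?q (map (val n) (fst (snd d))) ls i * \<sigma> i"
        using d(2) unfolding dset_def by (rule orbit_setE) blast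
      \<comment> \<open>After \<open>l\<close> returns the new moving point has exponent
        \<open>l\<close> and the old exponents shift by \<open>l\<close>. The factor
        \<open>t\<close>, constant on blocks, joins \<open>\<sigma>\<close> because the equations of
        \<open>d\<close> stay inside blocks.\<close>
      have "x \<in> dset n ?q ?G (twist_descr n ?q \<delta> g d)"
        unfolding dset_def twist_descr_def fst_conv snd_conv list.map(2) map_val_vpw[OF q]
      proof (rule orbit_setI[of "l # map (\<lambda>k. k + l) ls" _ _ "\<lambda>i. t (get \<beta> i) * \<sigma> i ^ (?q * ?q ^ l)"])
        fix i assume i: "i \<le> n"
        show "t (get \<beta> i) * \<sigma> i ^ (?q * ?q ^ l) \<in> ?G"
          using tz(2) \<beta>n(1)[OF i] \<sigma>(2)[OF i] by (intro GD(3) mult_subgroup_power[OF G]) auto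
        show "x i = val n \<delta> i * orb ?q (val n (vmul n g (vpw n (fst d) ?q)) # map (\<lambda>v i. v i ^ ?q) (map (val n) (fst (snd d))))
            (l # map (\<lambda>k. k + l) ls) i * (t (get \<beta> i) * \<sigma> i ^ (?q * ?q ^ l))"
          using s(3) i
          by (simp add: xy tz(3) \<sigma>(4) orb_shift orb_power val_vmul val_vpw[OF q] power_mult_distrib mult_ac
              del: map_map flip: power_mult)
      next
        fix z assume "z \<in> set (snd (snd d))"
        thus "t (get \<beta> (fst z)) * \<sigma> (fst z) ^ (?q * ?q ^ l) = t (get \<beta> (snd z)) * \<sigma> (snd z) ^ (?q * ?q ^ l)"
          using child(3)[OF d(1)] \<sigma>(3) by simp
      qed (use \<sigma>(1) in simp)
      thus ?thesis using nocov child(3)[OF d(1)] by blast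
    qed
  qed
  \<comment> \<open>Dividing by the value at the block representative removes the factor
    \<open>t\<close>, leaving a \<open>?q ^ m\<close>-th power for every \<open>m\<close>.\<close>
  have "y i / y (get \<beta> i) \<in> \<nu> ` set mus" if i: "i \<le> n" for i
  proof (rule div)
    fix m
    obtain t z where tz: "\<And>i. i \<le> n \<Longrightarrow> z i \<in> ?G \<and> t i \<in> ?G \<and> y i = t (get \<beta> i) * z i ^ (?q ^ m)"
      using chain[of m] by blast
    have b: "get \<beta> i \<le> n" "get \<beta> (get \<beta> i) = get \<beta> i" using \<beta>n[OF i] .
    have "y i / y (get \<beta> i) = (z i / z (get \<beta> i)) ^ (?q ^ m)"
      using tz[OF i] tz[OF b(1)] b(2) GD(5)[of "t (get \<beta> i)"] by (simp add: power_divide)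
    also have "?q ^ m = p ^ (e * m - m) * p ^ m"
      using e by (simp flip: power_add power_mult)
    also have "(z i / z (get \<beta> i)) ^ (p ^ (e * m - m) * p ^ m) = ((z i / z (get \<beta> i)) ^ (p ^ (e * m - m))) ^ (p ^ m)"
      by (rule power_mult)
    finally show "\<exists>v\<in>?G. y i / y (get \<beta> i) = v ^ (p ^ m)"
      using tz[OF i] tz[OF b(1)] by (blast intro: mult_subgroup_power[OF G] mult_subgroup_divide[OF G])
  qed
  hence "\<exists>c. i \<le> n \<longrightarrow> c \<in> set mus \<and> y i / y (get \<beta> i) = \<nu> c" for i by blast
  then obtain c where c: "\<And>i. i \<le> n \<Longrightarrow> c i \<in> set mus" "\<And>i. i \<le> n \<Longrightarrow> y i / y (get \<beta> i) = \<nu> (c i)" by metis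
  let ?\<zeta> = "tab n c"
  have mem: "?\<zeta> \<in> set (List.n_lists (Suc n) mus)"
    unfolding set_n_lists using c(1) by (auto simp: tab_def less_Suc_eq_le simp del: upt_Suc)
  have y\<zeta>: "y i = y (get \<beta> i) * val n ?\<zeta> i" if "i \<le> n" for i
    using c(2)[OF that] GD(5)[OF yG[OF \<beta>n(1)[OF that]]] that by (simp add: val_tab field_simps)
  have "\<nu> (dot n a (vmul n \<delta> ?\<zeta>)) = 0" if a: "a \<in> set rows" for a
  proof -
    have "(\<Sum>i\<le>n. val n a i * val n \<delta> i * (y (get \<beta> i) * val n ?\<zeta> i)) = (\<Sum>i\<le>n. val n a i * val n \<delta> i * y i)"
      by (rule sum.cong) (simp_all flip: y\<zeta>)
    also have "\<dots> = 0" using yV a unfolding V_iff by blast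
    finally have "(\<Sum>i\<le>n. val n a i * val n \<delta> i * (y (get \<beta> i) * val n ?\<zeta> i)) = 0" .
    hence "(\<Sum>i\<le>n. val n a i * val n \<delta> i * val n ?\<zeta> i) = 0"
      by (rule unblock[where t = y, OF _ _ asupp[OF a]]) (rule GD(5), rule yG, rule \<beta>n(1))
    thus ?thesis by (simp add: \<nu>_dot val_vmul mult.assoc)
  qed
  hence inD: "(vmul n \<delta> ?\<zeta>, [], blocks n \<beta>) \<in> set D" using tor[OF mem] by auto
  have "x \<in> dset n ?q ?G (vmul n \<delta> ?\<zeta>, [], blocks n \<beta>)"
    unfolding dset_def fst_conv snd_conv list.map(1)
  proof (rule orbit_setI[of "[]" _ _ "\<lambda>i. y (get \<beta> i)"])
    fix i assume i: "i \<le> n"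
    show "y (get \<beta> i) \<in> ?G" using yG \<beta>n(1)[OF i] by blast
    show "x i = val n (vmul n \<delta> ?\<zeta>) i * orb ?q [] [] i * y (get \<beta> i)"
      using xy[OF i] y\<zeta>[OF i] by (simp add: val_vmul mult_ac)
  next
    fix z assume "z \<in> set (blocks n \<beta>)"
    thus "y (get \<beta> (fst z)) = y (get \<beta> (snd z))" using \<beta>n(2) by (simp add: blocks_mem)
  qed simp
  thus False using nocov inD by blast
qed

lemma derivable_covers:
  assumes "0 \<notin> \<nu> ` set (mus @ gams)" "e > 0"
    "\<And>x. (\<And>m. \<exists>v\<in>grp (mus @ gams). x = v ^ (p ^ m)) \<Longrightarrow> x \<in> \<nu> ` set mus"
    "derivable (covstep (n, e, mus, gams)) (rows, D)"
  shows "covers n (p ^ e) (grp (mus @ gams)) rows D"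
proof -
  have "case x of (rows, D) \<Rightarrow> covers n (p ^ e) (grp (mus @ gams)) rows D"
    if "derivable (covstep (n, e, mus, gams)) x" for x
    using that
  proof (rule derivable_induct)
    fix L x assume L: "\<And>y. y \<in> set L \<Longrightarrow> case y of (rows, D) \<Rightarrow> covers n (p ^ e) (grp (mus @ gams)) rows D"
      and step: "covstep (n, e, mus, gams) L x"
    obtain rows D where x: "x = (rows, D)" by fastforce
    have L': "covers n (p ^ e) (grp (mus @ gams)) U D'" if "(U, D') \<in> set L" for U D' using L[OF that] by simp
    from step consider "cov_split n (mus @ gams) L rows D" | "cov_comb n L rows D" | "cov_iso n e mus (mus @ gams) L rows D"
      unfolding covstep_def x by auto
    thus "case x of (rows, D) \<Rightarrow> covers n (p ^ e) (grp (mus @ gams)) rows D"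
      unfolding x prod.case
      by cases (rule split_sound[OF assms(1) _ L'] comb_sound[OF _ L'] iso_sound[OF assms(1-3) _ L']; assumption)+
  qed
  from this[OF assms(4)] show ?thesis by simp
qed

lemma covstep_mono:
  assumes "set L \<subseteq> set L'" "covstep c L x"
  shows "covstep c L' x"
proof -
  have "cov_split n gens L rows D \<Longrightarrow> cov_split n gens L' rows D" for n gens rows D
    unfolding cov_split_def using assms(1) by (meson subsetD)
  moreover have "cov_comb n L rows D \<Longrightarrow> cov_comb n L' rows D" for n rows D
    unfolding cov_comb_def using assms(1) by (meson subsetD)
  moreover have "cov_iso n e mus gens L rows D \<Longrightarrow> cov_iso n e mus gens L' rows D" for n e mus gens rows D
    unfolding cov_iso_def
    apply (elim exE conjE)
    apply (intro exI conjI)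
          apply assumption+
    apply (rule ballI, drule (1) bspec)
    apply (erule disjE, erule disjI1, rule disjI2)
    apply (elim exE conjE)
    apply (intro exI conjI, assumption, erule subsetD[OF assms(1)], assumption)
    done
  ultimately show ?thesis using assms(2) unfolding covstep_def by blast
qed

end


subsection \<open>Existence of coverings\<close>

declare List.n_lists.simps [simp del]

context named_field
begin

definition inc :: "nat \<Rightarrow> nat \<Rightarrow> (nat \<Rightarrow> 'k) set \<Rightarrow> (nat \<Rightarrow> 'k) \<Rightarrow> (nat \<Rightarrow> 'k) list \<Rightarrow> (nat \<times> nat) set \<Rightarrow> bool" where
  "inc n q V v0 vs E \<longleftrightarrow> (\<forall>ls \<sigma>. length ls = length vs \<longrightarrow> (\<forall>i. \<sigma> i = 0 \<or> \<sigma> i = 1) \<longrightarrow>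
     (\<forall>z\<in>E. \<sigma> (fst z) = \<sigma> (snd z)) \<longrightarrow> (\<lambda>i. v0 i * orb q vs ls i * \<sigma> i) \<in> V)"

lemma incI:
  assumes "\<And>ls \<sigma>. length ls = length vs \<Longrightarrow> (\<And>i. \<sigma> i = 0 \<or> \<sigma> i = 1) \<Longrightarrow>
     (\<And>z. z \<in> E \<Longrightarrow> \<sigma> (fst z) = \<sigma> (snd z)) \<Longrightarrow> (\<lambda>i. v0 i * orb q vs ls i * \<sigma> i) \<in> V"
  shows "inc n q V v0 vs E"
  unfolding inc_def by (intro allI impI) (rule assms; simp)

lemma incD:
  assumes "inc n q V v0 vs E" "length ls = length vs" "\<And>i. \<sigma> i = 0 \<or> \<sigma> i = 1"
    "\<And>z. z \<in> E \<Longrightarrow> \<sigma> (fst z) = \<sigma> (snd z)"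
  shows "(\<lambda>i. v0 i * orb q vs ls i * \<sigma> i) \<in> V"
  using assms(1)[unfolded inc_def, THEN spec, of ls, THEN spec, of \<sigma>] assms(2-4) by simp

text \<open>
  Vectors with entries 0 and 1 suffice because they are fixed by Frobenius and span all vectors
  that are constant on blocks.
\<close>

lemma inc_general:
  assumes V: "subsp n V" and inc: "inc n q V v0 vs E" and v0: "v0 \<in> vecs n"
    and ls: "length ls = length vs" and \<sigma>: "\<And>i. i \<le> n \<Longrightarrow> \<sigma> i \<in> F" "\<And>z. z \<in> E \<Longrightarrow> \<sigma> (fst z) = \<sigma> (snd z)"
  shows "(\<lambda>i. v0 i * orb q vs ls i * \<sigma> i) \<in> V"
proof -
  let ?C = "\<sigma> ` {..n}"
  let ?f = "\<lambda>c i. v0 i * orb q vs ls i * (if \<sigma> i = c then 1 else 0)"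
  have "(\<lambda>i. \<Sum>c\<in>?C. c * ?f c i) \<in> V"
  proof (rule subsp_sum[OF V])
    show "c \<in> F" if "c \<in> ?C" for c using that \<sigma>(1) by auto
    show "(\<lambda>i. v0 i * orb q vs ls i * (if \<sigma> i = c then 1 else 0)) \<in> V" for c
      by (rule incD[OF inc ls]) (simp_all add: \<sigma>(2))
  qed
  moreover have "(\<lambda>i. \<Sum>c\<in>?C. c * ?f c i) = (\<lambda>i. v0 i * orb q vs ls i * \<sigma> i)"
  proof
    fix i
    show "(\<Sum>c\<in>?C. c * ?f c i) = v0 i * orb q vs ls i * \<sigma> i"
    proof (cases "i \<le> n")
      case True
      have "(\<Sum>c\<in>?C. c * ?f c i) = (\<Sum>c\<in>?C. if c = \<sigma> i then v0 i * orb q vs ls i * c else 0)"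
        by (rule sum.cong) auto
      thus ?thesis using True by simp
    next
      case False
      hence "v0 i = 0" using v0 by (simp add: vecs_def)
      thus ?thesis by simp
    qed
  qed
  ultimately show ?thesis by simp
qed

lemma orb_vecs: "z \<in> vecs n \<Longrightarrow> (\<And>v. v \<in> set vs \<Longrightarrow> v \<in> vecs n) \<Longrightarrow> (\<lambda>i. z i * orb q vs ls i) \<in> vecs n"
proof (induction vs arbitrary: z ls)
  case (Cons v vs)
  show ?case
  proof (cases ls)
    case (Cons l ls')
    have "(\<lambda>i. z i * v i ^ (q ^ l)) \<in> vecs n"
      using \<open>z \<in> vecs n\<close> vecs_F[OF Cons.prems(2)[of v]] by (auto simp: vecs_def F_mult F_power)
    from Cons.IH[OF this Cons.prems(2)] show ?thesis using Cons by (simp add: mult.assoc)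
  qed (use Cons in simp)
qed simp

text \<open>This is \<open>shift_down\<close> applied to one exponent at a time: with the other
  factors frozen, membership in \<open>A\<close> is a linear condition on the remaining one,
  expressed by \<open>descent\<close> with \<open>m = 0\<close>.\<close>

lemma orb_down:
  assumes A: "subsp n A"
  shows "z \<in> vecs n \<Longrightarrow> (\<And>v. v \<in> set vs \<Longrightarrow> v \<in> vecs n) \<Longrightarrow>
    (\<And>ls. length ls = length vs \<Longrightarrow> (\<And>l. l \<in> set ls \<Longrightarrow> N \<le> l) \<Longrightarrow> (\<lambda>i. z i * orb (p ^ e) vs ls i) \<in> A) \<Longrightarrow>
    length ls = length vs \<Longrightarrow> (\<lambda>i. z i * orb (p ^ e) vs ls i) \<in> A"
proof (induction vs arbitrary: z ls)
  case Nil
  show ?case using Nil.prems(3)[of "[]"] by simp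
next
  case (Cons v vs)
  obtain l ls' where ls: "ls = l # ls'" "length ls' = length vs" using Cons.prems(4) by (cases ls) auto
  have v: "v \<in> vecs n" using Cons.prems(2) by simp
  have step: "(\<lambda>i. z i * v i ^ ((p ^ e) ^ k) * orb (p ^ e) vs ls' i) \<in> A" if k: "k \<ge> N" for k
  proof (rule Cons.IH)
    show "(\<lambda>i. z i * v i ^ ((p ^ e) ^ k)) \<in> vecs n"
      using Cons.prems(1) vecs_F[OF v] by (auto simp: vecs_def F_mult F_power)
    fix ks assume "length ks = length vs" "\<And>l. l \<in> set ks \<Longrightarrow> N \<le> l"
    thus "(\<lambda>i. z i * v i ^ ((p ^ e) ^ k) * orb (p ^ e) vs ks i) \<in> A"
      using Cons.prems(3)[of "k # ks"] k by (auto simp: mult.assoc)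
  qed (use Cons.prems ls in auto)
  let ?A = "descent n A (\<lambda>i. z i * orb (p ^ e) vs ls' i) 0"
  have "vpow v ((p ^ e) ^ l) \<in> ?A"
  proof (rule shift_down[OF subsp_descent[OF A] v])
    fix k assume "N \<le> k"
    from step[OF this] show "vpow v ((p ^ e) ^ k) \<in> ?A"
      using vecs_vpow[OF v] p_pos by (simp add: descent_def mult_ac)
  qed
  thus ?case by (simp add: descent_def ls mult_ac)
qed

text \<open>The same freezing of factors with \<open>shift_up\<close>. It turns a condition on all
  exponent vectors into finitely many tests.\<close>

lemma orb_up:
  assumes A: "subsp n A"
  shows "z \<in> vecs n \<Longrightarrow> (\<And>v. v \<in> set vs \<Longrightarrow> v \<in> vecs n) \<Longrightarrow>
    (\<And>ls. length ls = length vs \<Longrightarrow> (\<And>l. l \<in> set ls \<Longrightarrow> l \<le> n) \<Longrightarrow> (\<lambda>i. z i * orb (p ^ e) vs ls i) \<in> A) \<Longrightarrow>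
    length ls = length vs \<Longrightarrow> (\<lambda>i. z i * orb (p ^ e) vs ls i) \<in> A"
proof (induction vs arbitrary: z ls)
  case Nil
  show ?case using Nil.prems(3)[of "[]"] by simp
next
  case (Cons v vs)
  obtain l ls' where ls: "ls = l # ls'" "length ls' = length vs" using Cons.prems(4) by (cases ls) auto
  have v: "v \<in> vecs n" using Cons.prems(2) by simp
  have step: "(\<lambda>i. z i * v i ^ ((p ^ e) ^ k) * orb (p ^ e) vs ls' i) \<in> A" if k: "k \<le> n" for k
  proof (rule Cons.IH)
    show "(\<lambda>i. z i * v i ^ ((p ^ e) ^ k)) \<in> vecs n"
      using Cons.prems(1) vecs_F[OF v] by (auto simp: vecs_def F_mult F_power)
    fix ks assume "length ks = length vs" "\<And>l. l \<in> set ks \<Longrightarrow> l \<le> n"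
    thus "(\<lambda>i. z i * v i ^ ((p ^ e) ^ k) * orb (p ^ e) vs ks i) \<in> A"
      using Cons.prems(3)[of "k # ks"] k by (auto simp: mult.assoc)
  qed (use Cons.prems ls in auto)
  let ?A = "descent n A (\<lambda>i. z i * orb (p ^ e) vs ls' i) 0"
  have "vpow v ((p ^ e) ^ l) \<in> ?A"
  proof (rule shift_up[OF subsp_descent[OF A] v])
    fix k assume "k \<le> n"
    from step[OF this] show "vpow v ((p ^ e) ^ k) \<in> ?A"
      using vecs_vpow[OF v] p_pos by (simp add: descent_def mult_ac)
  qed
  thus ?case by (simp add: descent_def ls mult_ac)
qed

text \<open>The invariant of the induction on the dimension. Its clause \<open>inc\<close> is the
  inclusion opposite to \<open>covers\<close>. The length clause lets each moving point cost a
  dimension, which with the clause on the full space leaves at most \<open>n - 1\<close> of them.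
  The last clause keeps the equations inside the blocks of \<open>V\<close>, as
  \<open>cov_iso\<close> demands.\<close>

definition dgood :: "nat \<Rightarrow> nat \<Rightarrow> 'k set \<Rightarrow> (nat \<Rightarrow> 'k) set \<Rightarrow> descr \<Rightarrow> bool" where
  "dgood n q G V d \<longleftrightarrow> (\<forall>i\<le>n. val n (fst d) i \<in> G) \<and> (\<forall>v\<in>set (fst (snd d)). \<forall>i\<le>n. val n v i \<in> G) \<and>
     (\<forall>z\<in>set (snd (snd d)). fst z \<le> n \<and> snd z \<le> n) \<and>
     inc n q V (val n (fst d)) (map (val n) (fst (snd d))) (set (snd (snd d))) \<and>
     Suc (length (fst (snd d))) \<le> card (piv V) \<and> (card (piv V) = Suc n \<longrightarrow> fst (snd d) = []) \<and>
     (\<forall>\<beta>. bstable \<beta> V \<longrightarrow> (\<forall>z\<in>set (snd (snd d)). \<beta> (fst z) = \<beta> (snd z)))"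

lemma dgoodD:
  assumes "dgood n q G V d"
  shows "\<forall>i\<le>n. val n (fst d) i \<in> G" "\<forall>v\<in>set (fst (snd d)). \<forall>i\<le>n. val n v i \<in> G"
    "\<forall>z\<in>set (snd (snd d)). fst z \<le> n \<and> snd z \<le> n"
    "inc n q V (val n (fst d)) (map (val n) (fst (snd d))) (set (snd (snd d)))"
    "Suc (length (fst (snd d))) \<le> card (piv V)" "card (piv V) = Suc n \<longrightarrow> fst (snd d) = []"
    "\<forall>\<beta>. bstable \<beta> V \<longrightarrow> (\<forall>z\<in>set (snd (snd d)). \<beta> (fst z) = \<beta> (snd z))"
  using assms unfolding dgood_def by - (elim conjE, assumption)+

lemma piv_full:
  assumes "subsp n V" "card (piv V) = Suc n"
  shows "V = vecs n"
proof (rule subsp_eqI[OF assms(1) vecs_subsp subspD(1)[OF assms(1)]])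
  have "piv V = {..n}" using card_subset_eq[of "{..n}" "piv V"] piv_le[OF subspD(1)[OF assms(1)]] assms(2) by simp
  thus "piv (vecs n) \<subseteq> piv V" using piv_le[of "vecs n" n] by simp
qed

text \<open>A descent of the full space is full again, so a drop of dimension excludes this case, in
  which no moving point is allowed.\<close>

lemma descent_smaller_not_full:
  assumes V: "subsp n V" and g: "\<And>i. i \<le> n \<Longrightarrow> g i \<in> F" and lt: "card (piv (descent n V g m)) < card (piv V)"
  shows "card (piv V) \<noteq> Suc n"
proof
  assume "card (piv V) = Suc n"
  hence V': "V = vecs n" by (rule piv_full[OF V])
  have "descent n V g m = vecs n"
  proof (intro equalityI subsetI)
    fix y assume y: "y \<in> vecs n"
    have "(\<lambda>i. g i * y i ^ (p ^ m)) \<in> vecs n"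
      using y g p_pos by (auto simp: vecs_def F_mult F_power)
    thus "y \<in> descent n V g m" using y by (simp add: descent_def V')
  qed (simp add: descent_def)
  thus False using lt V' by simp
qed

lemma zero_one_power: "(\<sigma>::'k) = 0 \<or> \<sigma> = 1 \<Longrightarrow> k > 0 \<Longrightarrow> \<sigma> ^ k = \<sigma>"
  by (auto simp: power_0_left)

lemma dgood_shift:
  assumes G: "mult_subgroup G" "G \<subseteq> F" and V: "subsp n V" and g: "\<And>i. i \<le> n \<Longrightarrow> val n g i \<in> G"
    and lt: "card (piv (descent n V (val n g) m)) < card (piv V)"
    and d: "dgood n q G (descent n V (val n g) m) d"
  shows "dgood n q G V (shift_descr n (p ^ m) g d)"
proof -
  have pm: "p ^ m > 0" using p_pos by simp
  note D = d[unfolded dgood_def]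
  have inc: "inc n q V (val n (vmul n g (vpw n (fst d) (p ^ m))))
      (map (\<lambda>v i. v i ^ p ^ m) (map (val n) (fst (snd d)))) (set (snd (snd d)))"
  proof (rule incI)
    fix ls :: "nat list" and \<sigma> :: "nat \<Rightarrow> 'k"
    assume ls: "length ls = length (map (\<lambda>v i. v i ^ p ^ m) (map (val n) (fst (snd d))))"
      and \<sigma>: "\<And>i. \<sigma> i = 0 \<or> \<sigma> i = 1" "\<And>z. z \<in> set (snd (snd d)) \<Longrightarrow> \<sigma> (fst z) = \<sigma> (snd z)"
    have "(\<lambda>i. val n (fst d) i * orb q (map (val n) (fst (snd d))) ls i * \<sigma> i) \<in> descent n V (val n g) m"
      by (rule incD[OF dgoodD(4)[OF d]]) (use ls \<sigma> in simp_all)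
    hence "(\<lambda>i. val n g i * (val n (fst d) i * orb q (map (val n) (fst (snd d))) ls i * \<sigma> i) ^ p ^ m) \<in> V"
      by (simp add: descent_def)
    thus "(\<lambda>i. val n (vmul n g (vpw n (fst d) (p ^ m))) i *
             orb q (map (\<lambda>v i. v i ^ p ^ m) (map (val n) (fst (snd d)))) ls i * \<sigma> i) \<in> V"
      by (simp add: val_vmul val_vpw[OF pm] orb_power power_mult_distrib zero_one_power[OF \<sigma>(1) pm] mult.assoc del: map_map)
  qed
  have nf: "card (piv V) \<noteq> Suc n" by (rule descent_smaller_not_full[OF V _ lt]) simp
  show ?thesis
    unfolding dgood_def shift_descr_def fst_conv snd_conv map_val_vpw[OF pm]
  proof (intro conjI)
    show "\<forall>i\<le>n. val n (vmul n g (vpw n (fst d) (p ^ m))) i \<in> G"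
      using D g by (simp add: val_vmul val_vpw[OF pm] mult_subgroupD(3)[OF G(1)] mult_subgroup_power[OF G(1)])
    show "\<forall>v\<in>set (map (\<lambda>v. vpw n v (p ^ m)) (fst (snd d))). \<forall>i\<le>n. val n v i \<in> G"
      using D by (simp add: val_vpw[OF pm] mult_subgroup_power[OF G(1)])
    show "\<forall>\<beta>. bstable \<beta> V \<longrightarrow> (\<forall>z\<in>set (snd (snd d)). \<beta> (fst z) = \<beta> (snd z))"
      using D bstable_descent by simp
  qed (use D inc lt nf in simp_all)
qed

text \<open>Iterating Frobenius on the translate of \<open>V\<close>, which is stable under it,
  gives only exponents of the old moving points that are at least the exponent \<open>l0\<close> of
  the new one. The remaining exponents are supplied by \<open>orb_down\<close>.\<close>

lemma dgood_twist:
  assumes G: "mult_subgroup G" "G \<subseteq> F" and V: "subsp n V" and g: "\<And>i. i \<le> n \<Longrightarrow> val n g i \<in> G"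
    and \<delta>: "\<And>i. i \<le> n \<Longrightarrow> val n \<delta> i \<in> G"
    and stab: "\<And>y. y \<in> vecs n \<Longrightarrow> (\<lambda>i. val n \<delta> i * y i) \<in> V \<Longrightarrow> (\<lambda>i. val n \<delta> i * y i ^ (p ^ e)) \<in> V"
    and lt: "card (piv (descent n V (val n (vmul n \<delta> g)) e)) < card (piv V)"
    and d: "dgood n (p ^ e) G (descent n V (val n (vmul n \<delta> g)) e) d"
  shows "dgood n (p ^ e) G V (twist_descr n (p ^ e) \<delta> g d)"
proof -
  let ?q = "p ^ e"
  have q: "?q > 0" using p_pos by simp
  note D = d[unfolded dgood_def]
  let ?w = "val n (vmul n g (vpw n (fst d) ?q))" and ?vs = "map (val n) (fst (snd d))"
  let ?vs' = "map (\<lambda>v i. v i ^ ?q) ?vs"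
  let ?A = "descent n V (val n \<delta>) 0"
  have A: "subsp n ?A" by (rule subsp_descent[OF V])
  have A_iff: "y \<in> ?A \<longleftrightarrow> y \<in> vecs n \<and> (\<lambda>i. val n \<delta> i * y i) \<in> V" for y by (simp add: descent_def)
  have vs': "v \<in> vecs n" if "v \<in> set ?vs'" for v using that vecs_vpow[OF val_vecs q] by auto
  have stabA: "vpow y (?q ^ k) \<in> ?A" if "y \<in> ?A" for y k
  proof (induction k)
    case 0
    show ?case using that by simp
  next
    case (Suc k)
    hence "vpow (vpow y (?q ^ k)) ?q \<in> ?A" using stab vecs_vpow[OF _ q] unfolding A_iff by blast
    thus ?case by (simp add: mult.commute flip: power_mult)
  qed
  have inc: "inc n ?q V (val n \<delta>) (?w # ?vs') (set (snd (snd d)))"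
  proof (rule incI)
    fix ls :: "nat list" and \<sigma> :: "nat \<Rightarrow> 'k"
    assume ls: "length ls = length (?w # ?vs')"
      and \<sigma>: "\<And>i. \<sigma> i = 0 \<or> \<sigma> i = 1" "\<And>z. z \<in> set (snd (snd d)) \<Longrightarrow> \<sigma> (fst z) = \<sigma> (snd z)"
    obtain l0 ks where lk: "ls = l0 # ks" "length ks = length ?vs'" using ls by (cases ls) auto
    have base: "(\<lambda>i. ?w i * orb ?q ?vs' js i * \<sigma> i) \<in> ?A" if js: "length js = length ?vs'" for js
    proof -
      have "(\<lambda>i. val n (fst d) i * orb ?q ?vs js i * \<sigma> i) \<in> descent n V (val n (vmul n \<delta> g)) e"
        by (rule incD[OF dgoodD(4)[OF d]]) (use js \<sigma> in simp_all)
      hence "(\<lambda>i. val n (vmul n \<delta> g) i * (val n (fst d) i * orb ?q ?vs js i * \<sigma> i) ^ ?q) \<in> V"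
        by (simp add: descent_def)
      hence "(\<lambda>i. val n \<delta> i * (?w i * orb ?q ?vs' js i * \<sigma> i)) \<in> V"
        by (simp add: val_vmul val_vpw[OF q] orb_power power_mult_distrib zero_one_power[OF \<sigma>(1) q] mult.assoc del: map_map)
      moreover have "(\<lambda>i. ?w i * orb ?q ?vs' js i * \<sigma> i) \<in> vecs n"
      proof -
        have "(\<lambda>i. ?w i * orb ?q ?vs' js i) \<in> vecs n" by (rule orb_vecs[OF val_vecs vs'])
        moreover have "\<sigma> i \<in> F" for i using \<sigma>(1)[of i] F_0 F_1 by auto
        ultimately show ?thesis by (simp add: vecs_def F_mult)
      qed
      ultimately show ?thesis by (simp add: A_iff)
    qed
    let ?z = "\<lambda>i. ?w i ^ (?q ^ l0) * \<sigma> i"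
    have zv: "?z \<in> vecs n"
    proof -
      have "\<sigma> i \<in> F" for i using \<sigma>(1)[of i] F_0 F_1 by auto
      thus ?thesis using val_vecs[of n "vmul n g (vpw n (fst d) ?q)"] p_pos by (simp add: vecs_def F_mult F_power power_0_left)
    qed
    have "(\<lambda>i. ?z i * orb ?q ?vs' ks i) \<in> ?A"
    proof (rule orb_down[where N = l0, OF A zv vs'])
      fix js :: "nat list"
      assume js: "length js = length ?vs'" "\<And>l. l \<in> set js \<Longrightarrow> l0 \<le> l"
      have "js = map (\<lambda>l. l + l0) (map (\<lambda>l. l - l0) js)" using js(2) by (simp add: map_idI)
      hence "orb ?q ?vs' js i = orb ?q ?vs' (map (\<lambda>l. l - l0) js) i ^ (?q ^ l0)" for i
        using orb_shift by metis
      moreover have "vpow (\<lambda>i. ?w i * orb ?q ?vs' (map (\<lambda>l. l - l0) js) i * \<sigma> i) (?q ^ l0) \<in> ?A"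
        by (rule stabA, rule base) (simp add: js(1))
      moreover have "\<sigma> i ^ (?q ^ l0) = \<sigma> i" for i by (rule zero_one_power[OF \<sigma>(1)]) (use p_pos in simp)
      ultimately show "(\<lambda>i. ?z i * orb ?q ?vs' js i) \<in> ?A" by (simp add: power_mult_distrib mult_ac)
    qed (use lk vs' in simp_all)
    hence "(\<lambda>i. val n \<delta> i * (?z i * orb ?q ?vs' ks i)) \<in> V" unfolding A_iff by blast
    thus "(\<lambda>i. val n \<delta> i * orb ?q (?w # ?vs') ls i * \<sigma> i) \<in> V" by (simp add: lk mult_ac)
  qed
  have nf: "card (piv V) \<noteq> Suc n" by (rule descent_smaller_not_full[OF V _ lt]) simp
  show ?thesis
    unfolding dgood_def twist_descr_def fst_conv snd_conv list.map(2) map_val_vpw[OF q]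
  proof (intro conjI)
    show "\<forall>v\<in>set (vmul n g (vpw n (fst d) ?q) # map (\<lambda>v. vpw n v ?q) (fst (snd d))). \<forall>i\<le>n. val n v i \<in> G"
      using D g by (simp add: val_vmul val_vpw[OF q] mult_subgroupD(3)[OF G(1)] mult_subgroup_power[OF G(1)])
    show "\<forall>\<beta>. bstable \<beta> V \<longrightarrow> (\<forall>z\<in>set (snd (snd d)). \<beta> (fst z) = \<beta> (snd z))"
      using D bstable_descent by simp
  qed (use D inc lt nf \<delta> in simp_all)
qed

text \<open>Shows that a class which is not trivial in the sense of \<open>cov_iso\<close> lowers
  the dimension. If it does not drop, \<open>descent_rvec\<close> gives
  \<open>\<zeta> * g s = g j * u ^ (p ^ e)\<close> along each link, with torsion
  \<open>\<zeta>\<close> equal to its own \<open>p ^ e\<close>-th power; so \<open>g s\<close> and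
  \<open>g j\<close> differ by a \<open>p ^ e\<close>-th power.\<close>

lemma returned:
  assumes G: "mult_subgroup G" "\<And>x s. x ^ s \<in> G \<Longrightarrow> s > 0 \<Longrightarrow> x \<in> G" and V: "subsp n V"
    and \<delta>: "\<And>i. i \<le> n \<Longrightarrow> \<delta> i \<in> G" and g: "\<And>i. i \<le> n \<Longrightarrow> g i \<in> G"
    and edges: "\<And>s j. s \<in> piv V \<Longrightarrow> j \<le> n \<Longrightarrow> rvec V s j \<noteq> 0 \<Longrightarrow> rvec V s j * \<delta> s / \<delta> j \<in> torsion \<inter> G"
    and tor: "\<And>\<zeta>. \<zeta> \<in> torsion \<inter> G \<Longrightarrow> \<zeta> ^ (p ^ e) = \<zeta>"
    and card: "card (piv V) \<le> card (piv (descent n V (\<lambda>i. \<delta> i * g i) e))" and i: "i \<le> n"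
  shows "\<exists>v\<in>G. g i = g (block n V i) * v ^ (p ^ e)"
proof -
  note GD = mult_subgroupD[OF G(1)]
  define h where "h = (\<lambda>i. if i \<le> n then g i else 1)"
  have hG: "h i \<in> G" for i using g GD(2) by (simp add: h_def)
  define P where "P = (\<lambda>i j. \<exists>v\<in>G. h j = h i * v ^ (p ^ e))"
  have "P (block n V i) i"
  proof (rule linkedD[OF linked_sym[OF block_linked]])
    show "P i i" for i unfolding P_def by (rule bexI[of _ 1]) (simp_all add: GD(2))
  next
    fix i j assume "P i j"
    then obtain v where v: "v \<in> G" "h j = h i * v ^ (p ^ e)" unfolding P_def by blast
    show "P j i" unfolding P_def
      by (rule bexI[OF _ GD(4)[OF v(1)]]) (use v GD(5)[OF v(1)] in \<open>simp add: power_inverse field_simps\<close>)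
  next
    fix i j k assume "P i j" "P j k"
    then obtain v w where v: "v \<in> G" "h j = h i * v ^ (p ^ e)" and w: "w \<in> G" "h k = h j * w ^ (p ^ e)"
      unfolding P_def by blast
    show "P i k" unfolding P_def
      by (rule bexI[OF _ GD(3)[OF v(1) w(1)]]) (simp add: v(2) w(2) power_mult_distrib mult_ac)
  next
    fix s j assume sj: "s \<in> piv V" "j \<le> n" "rvec V s j \<noteq> 0"
    have sn: "s \<le> n" using sj(1) piv_le[OF subspD(1)[OF V]] by blast
    have nz: "\<delta> i * g i \<noteq> 0" if "i \<le> n" for i using GD(5)[OF \<delta>[OF that]] GD(5)[OF g[OF that]] by simp
    obtain u where u: "rvec V s j = inverse (\<delta> s * g s) * (\<delta> j * g j * u j ^ (p ^ e))"
      using descent_rvec[OF V nz card sj(1)] by blast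
    let ?\<zeta> = "rvec V s j * \<delta> s / \<delta> j"
    note ns = GD(5)[OF \<delta>[OF sn]] GD(5)[OF g[OF sn]] GD(5)[OF \<delta>[OF sj(2)]] GD(5)[OF g[OF sj(2)]]
    have u0: "u j \<noteq> 0" using u sj(3) p_pos by (auto simp: power_0_left)
    have "?\<zeta> * g s = g j * u j ^ (p ^ e)" unfolding u using ns by (simp add: field_simps)
    hence eq0: "?\<zeta> ^ (p ^ e) * g s = g j * u j ^ (p ^ e)" unfolding tor[OF edges[OF sj]] .
    have gen: "b = a * (c / w)" if "c * a = b * w" "w \<noteq> 0" for a b c w :: 'k
      using that by (simp add: field_simps)
    have "g j = g s * (?\<zeta> ^ (p ^ e) / u j ^ (p ^ e))" by (rule gen[OF eq0]) (use u0 in simp)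
    hence eq: "g j = g s * (?\<zeta> / u j) ^ (p ^ e)" by (simp only: power_divide[of ?\<zeta> "u j"])
    hence "(?\<zeta> / u j) ^ (p ^ e) = g j / g s" using ns by simp
    also have "\<dots> \<in> G" by (rule mult_subgroup_divide[OF G(1) g[OF sj(2)] g[OF sn]])
    finally have "?\<zeta> / u j \<in> G" by (rule G(2)) (use p_pos in simp)
    thus "P s j" unfolding P_def h_def using eq sn sj(2) by auto
  qed
  thus ?thesis using i block_le[of n V i] by (simp add: P_def h_def)
qed

text \<open>The equations expressing the dependent coordinates, normalised by \<open>\<delta>\<close>.\<close>

definition rrow :: "(nat \<Rightarrow> 'k) set \<Rightarrow> (nat \<Rightarrow> 'k) \<Rightarrow> nat \<Rightarrow> nat \<Rightarrow> 'k" where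
  "rrow V \<delta> j i = (if i = j then 1 else if i \<in> piv V then - rvec V i j else 0) / \<delta> j"

lemma rrow_sum:
  assumes V: "subsp n V" and j: "j \<le> n" "j \<notin> piv V"
  shows "(\<Sum>i\<le>n. rrow V \<delta> j i * x i) = (x j - (\<Sum>s\<in>piv V. x s * rvec V s j)) / \<delta> j"
proof -
  have Pn: "piv V \<subseteq> {..n}" "finite (piv V)"
    using piv_le[OF subspD(1)[OF V]] finite_piv[OF subspD(1)[OF V]] by simp_all
  have "(\<Sum>i\<le>n. rrow V \<delta> j i * x i)
      = (\<Sum>i\<le>n. ((if i = j then x i else 0) + (if i \<in> piv V then - (x i * rvec V i j) else 0)) / \<delta> j)"
    using j by (intro sum.cong) (auto simp: rrow_def)
  also have "\<dots> = (x j + (\<Sum>i\<in>{..n} \<inter> piv V. - (x i * rvec V i j))) / \<delta> j"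
    using j by (simp add: sum.distrib sum.inter_restrict flip: sum_divide_distrib)
  also have "{..n} \<inter> piv V = piv V" using Pn by blast
  finally show ?thesis by (simp add: sum_negf)
qed

lemma rrow_sols:
  assumes V: "subsp n V" and x: "x \<in> vecs n" and \<delta>: "\<And>i. i \<le> n \<Longrightarrow> \<delta> i \<noteq> 0"
  shows "(\<forall>j\<le>n. j \<notin> piv V \<longrightarrow> (\<Sum>i\<le>n. rrow V \<delta> j i * x i) = 0) \<longleftrightarrow> x \<in> V"
proof
  assume *: "\<forall>j\<le>n. j \<notin> piv V \<longrightarrow> (\<Sum>i\<le>n. rrow V \<delta> j i * x i) = 0"
  show "x \<in> V"
  proof (rule expansion_mem[OF V x])
    fix j assume j: "j \<le> n"
    show "x j = (\<Sum>s\<in>piv V. x s * rvec V s j)"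
    proof (cases "j \<in> piv V")
      case True
      thus ?thesis by (simp add: sum_delta_piv[OF V])
    next
      case False
      hence "(\<Sum>i\<le>n. rrow V \<delta> j i * x i) = 0" using * j by blast
      thus ?thesis using rrow_sum[OF V j False, of \<delta> x] \<delta>[OF j] by simp
    qed
  qed
next
  assume "x \<in> V"
  thus "\<forall>j\<le>n. j \<notin> piv V \<longrightarrow> (\<Sum>i\<le>n. rrow V \<delta> j i * x i) = 0"
    using rrow_sum[OF V] expansion[OF V] by (metis (no_types, lifting) cancel_comm_monoid_add_class.diff_cancel div_0)
qed

end

section \<open>Existence of coverings by induction on the dimension\<close>

locale rooted_group = named_field F p B S \<nu> ad ml z0 z1 bs
  for F :: "'k::field set" and p B S \<nu> ad ml z0 z1 bs +
  fixes mus gams :: "nat list" and e :: nat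
  assumes gens0: "0 \<notin> \<nu> ` set (mus @ gams)"
    and root: "\<And>x s. x ^ s \<in> grp (mus @ gams) \<Longrightarrow> s > 0 \<Longrightarrow> x \<in> grp (mus @ gams)"
    and tor_mus: "torsion \<inter> grp (mus @ gams) \<subseteq> \<nu> ` set mus"
    and tor_frob: "\<And>\<zeta>. \<zeta> \<in> torsion \<inter> grp (mus @ gams) \<Longrightarrow> \<zeta> ^ (p ^ e) = \<zeta>"
begin

abbreviation "gens \<equiv> mus @ gams"
abbreviation "Gam \<equiv> grp gens"
abbreviation "q \<equiv> p ^ e"

lemma Gam: "mult_subgroup Gam" "Gam \<subseteq> F" "fin_gen Gam"
proof -
  show "mult_subgroup Gam" using mult_subgroup_hull[OF gens0] by (simp add: grp_def)
  show "Gam \<subseteq> F" by (rule grp_subset_F[OF gens0])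
  show "fin_gen Gam" unfolding fin_gen_def grp_def
    by (rule exI[of _ "\<nu> ` set gens"]) (simp add: hull_subset)
qed

lemma Gam_nz: "x \<in> Gam \<Longrightarrow> x \<noteq> 0"
  by (rule mult_subgroupD(5)[OF Gam(1)])

lemma q_pos: "q > 0"
  using p_pos by simp

definition solved :: "nat \<Rightarrow> nat list list \<Rightarrow> bool" where
  "solved n rows \<longleftrightarrow> (\<exists>D. derivable (covstep (n, e, mus, gams)) (rows, D) \<and> (\<forall>d\<in>set D. dgood n q Gam (sols n rows) d))"

lemma solved_split:
  assumes m: "\<And>g. (\<And>i. i \<le> n \<Longrightarrow> g i \<in> Gam) \<Longrightarrow> card (piv (descent n (sols n rows) g m)) < card (piv (sols n rows))"
    and IH: "\<And>U. card (piv (sols n U)) < card (piv (sols n rows)) \<Longrightarrow> solved n U"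
  shows "solved n rows"
proof -
  let ?V = "sols n rows"
  obtain T where T: "transversal gens T (p ^ m)" using ex_transversal[OF gens0] p_pos by fastforce
  let ?NL = "List.n_lists (Suc n) T"
  have gG: "val n g i \<in> Gam" if "g \<in> set ?NL" "i \<le> n" for g i
    by (rule n_lists_val[OF that(1) _ that(2)]) (use T in \<open>simp add: transversal_def in_grp_iff[OF gens0]\<close>)
  have ex: "\<exists>U D. coord_chain n m (scale n g rows) U \<and> sols n U = descent n ?V (val n g) m \<and>
      derivable (covstep (n, e, mus, gams)) (U, D) \<and> (\<forall>d\<in>set D. dgood n q Gam (sols n U) d)"
    if g: "g \<in> set ?NL" for g
  proof -
    obtain U where U: "coord_chain n m (scale n g rows) U" "sols n U = descent n ?V (val n g) m"
      using ex_chain_descent by blast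
    have "solved n U" by (rule IH) (use m[of "val n g"] gG[OF g] U(2) in simp)
    thus ?thesis using U unfolding solved_def by blast
  qed
  then obtain U D where UD: "\<And>g. g \<in> set ?NL \<Longrightarrow> coord_chain n m (scale n g rows) (U g) \<and> sols n (U g) = descent n ?V (val n g) m \<and>
      derivable (covstep (n, e, mus, gams)) (U g, D g) \<and> (\<forall>d\<in>set (D g). dgood n q Gam (sols n (U g)) d)"
    by metis
  define DD where "DD = concat (map (\<lambda>g. map (shift_descr n (p ^ m) g) (D g)) ?NL)"
  let ?cs = "map (\<lambda>g. (U g, D g)) ?NL"
  have "cov_split n gens ?cs rows DD"
    unfolding cov_split_def
  proof (rule exI[of _ m], rule exI[of _ T], rule conjI[OF T], rule ballI)
    fix g assume g: "g \<in> set ?NL"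
    show "\<exists>U D'. coord_chain n m (scale n g rows) U \<and> (U, D') \<in> set ?cs \<and>
        (\<forall>d\<in>set D'. shift_descr n (p ^ m) g d \<in> set DD)"
      by (rule exI[of _ "U g"], rule exI[of _ "D g"]) (use UD[OF g] g in \<open>auto simp: DD_def\<close>)
  qed
  hence cs: "covstep (n, e, mus, gams) ?cs (rows, DD)" by (simp add: covstep_def)
  have der: "derivable (covstep (n, e, mus, gams)) (rows, DD)"
  proof (rule derivable_step[where cs = ?cs])
    fix y assume "y \<in> set ?cs"
    then obtain g where "g \<in> set ?NL" "y = (U g, D g)" by auto
    thus "derivable (covstep (n, e, mus, gams)) y" using UD by blast
  qed (rule covstep_mono, assumption, assumption, fact)
  have "dgood n q Gam ?V d" if d: "d \<in> set DD" for d
  proof -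
    obtain g d' where g: "g \<in> set ?NL" "d' \<in> set (D g)" "d = shift_descr n (p ^ m) g d'"
      using d by (auto simp: DD_def)
    show ?thesis unfolding g(3)
      by (rule dgood_shift[OF Gam(1,2) subsp_sols]) (use gG[OF g(1)] m[of "val n g"] UD[OF g(1)] g(2) in auto)
  qed
  thus ?thesis unfolding solved_def using der by blast
qed

text \<open>The given rows need neither be supported in blocks nor have coefficients fixed by
  Frobenius after translation. The rule \<open>cov_iso\<close> is therefore applied to the rows
  \<open>rrow\<close>, and \<open>cov_comb\<close> leads back to the given ones.\<close>

lemma solved_iso:
  assumes iso: "\<And>m. \<exists>g. (\<forall>i\<le>n. g i \<in> Gam) \<and> card (piv (sols n rows)) \<le> card (piv (descent n (sols n rows) g m))"
    and IH: "\<And>U. card (piv (sols n U)) < card (piv (sols n rows)) \<Longrightarrow> solved n U"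
  shows "solved n rows"
proof -
  let ?V = "sols n rows"
  note V = subsp_sols[of n rows]
  obtain \<delta>0 where \<delta>0: "\<forall>i\<le>n. \<delta>0 i \<in> Gam"
    and edges0: "\<forall>s\<in>piv ?V. \<forall>j\<le>n. rvec ?V s j \<noteq> 0 \<longrightarrow> rvec ?V s j * \<delta>0 s / \<delta>0 j \<in> torsion \<inter> Gam"
    using isotrivial[OF Gam(1,3,2) _ V iso] root by blast
  define \<delta> where "\<delta> = name_vec n (\<lambda>i. if i \<le> n then \<delta>0 i else 0)"
  have v\<delta>: "val n \<delta> i = \<delta>0 i" if "i \<le> n" for i
  proof -
    have "(\<lambda>i. if i \<le> n then \<delta>0 i else 0) \<in> vecs n" using \<delta>0 Gam(2) by (auto simp: vecs_def)
    thus ?thesis using that by (simp add: \<delta>_def val_name_vec)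
  qed
  have \<delta>G: "val n \<delta> i \<in> Gam" if "i \<le> n" for i using \<delta>0 v\<delta> that by simp
  have \<delta>nz: "val n \<delta> i \<noteq> 0" if "i \<le> n" for i by (rule Gam_nz[OF \<delta>G[OF that]])
  have Pn: "piv ?V \<subseteq> {..n}" by (rule piv_le[OF subspD(1)[OF V]])
  have edges: "rvec ?V s j * val n \<delta> s / val n \<delta> j \<in> torsion \<inter> Gam"
    if "s \<in> piv ?V" "j \<le> n" "rvec ?V s j \<noteq> 0" for s j
    using edges0 that v\<delta>[of s] v\<delta>[of j] Pn by auto
  define \<beta> where "\<beta> = tab n (block n ?V)"
  have \<beta>: "get \<beta> i = block n ?V i" if "i \<le> n" for i using that by (simp add: \<beta>_def)
  have \<beta>n: "get \<beta> i \<le> n \<and> get \<beta> (get \<beta> i) = get \<beta> i" if "i \<le> n" for i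
    using that block_le[of n ?V i] by (simp add: \<beta> block_block)
  define js where "js = filter (\<lambda>j. j \<notin> piv ?V) [0..<Suc n]"
  have js: "set js = {j. j \<le> n \<and> j \<notin> piv ?V}" by (auto simp: js_def less_Suc_eq_le simp del: upt_Suc)
  have rvF: "rvec ?V s j \<in> F" if "s \<in> piv ?V" for s j
    by (rule vecs_F[OF subsetD[OF subspD(1)[OF V] rvec(1)[OF V that]]])
  have rrF: "(\<lambda>i. rrow ?V (val n \<delta>) j i) \<in> vecs n" if "j \<in> set js" for j
    using that Pn rvF by (auto simp: js vecs_def rrow_def F_0 F_1 intro!: F_divide F_uminus)
  define rr where "rr = map (\<lambda>j. name_vec n (rrow ?V (val n \<delta>) j)) js"
  have vrr: "val n (name_vec n (rrow ?V (val n \<delta>) j)) = rrow ?V (val n \<delta>) j" if "j \<in> set js" for j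
    by (rule val_name_vec[OF rrF[OF that]])
  have srr: "sols n rr = ?V"
  proof (intro set_eqI)
    fix x
    show "x \<in> sols n rr \<longleftrightarrow> x \<in> ?V"
    proof (cases "x \<in> vecs n")
      case True
      have "x \<in> sols n rr \<longleftrightarrow> (\<forall>j\<in>set js. (\<Sum>i\<le>n. rrow ?V (val n \<delta>) j i * x i) = 0)"
        using True by (simp add: sols_iff rr_def vrr)
      also have "\<dots> \<longleftrightarrow> x \<in> ?V" using rrow_sols[where \<delta> = "val n \<delta>", OF V True \<delta>nz] by (auto simp: js)
      finally show ?thesis .
    qed (simp add: sols_iff)
  qed
  have supp: "block n ?V i = block n ?V j" if "j \<in> set js" "i \<le> n" "rrow ?V (val n \<delta>) j i \<noteq> 0" for i j
  proof (cases "i = j")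
    case False
    hence "i \<in> piv ?V" "rvec ?V i j \<noteq> 0" using that(3) by (auto simp: rrow_def split: if_splits)
    thus ?thesis using block_eq[OF linked_edge] that(1) by (simp add: js)
  qed simp
  have frob: "(rrow ?V (val n \<delta>) j i * val n \<delta> i) ^ q = rrow ?V (val n \<delta>) j i * val n \<delta> i"
    if j: "j \<in> set js" and i: "i \<le> n" for i j
  proof -
    have jn: "j \<le> n" "j \<notin> piv ?V" using j by (simp_all add: js)
    consider "i = j" | "i \<noteq> j" "i \<in> piv ?V" "rvec ?V i j \<noteq> 0" | "rrow ?V (val n \<delta>) j i = 0"
      unfolding rrow_def by (cases "i = j"; cases "i \<in> piv ?V"; cases "rvec ?V i j = 0") auto
    thus ?thesis
    proof cases
      case 1
      thus ?thesis using \<delta>nz[OF jn(1)] by (simp add: rrow_def)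
    next
      case 2
      let ?\<zeta> = "rvec ?V i j * val n \<delta> i / val n \<delta> j"
      have "rrow ?V (val n \<delta>) j i * val n \<delta> i = - ?\<zeta>" using 2 by (simp add: rrow_def)
      moreover have "(- ?\<zeta>) ^ q = - ?\<zeta>"
        using frob_minus[of 0 ?\<zeta> e] tor_frob[OF edges[OF 2(2) jn(1) 2(3)]] p_pos by (simp add: power_0_left)
      ultimately show ?thesis by metis
    qed (use q_pos in \<open>simp add: power_0_left\<close>)
  qed
  \<comment> \<open>Each normalised row lives in one block, so cutting a vector down to a block
    multiplies the value of every row by 0 or 1.\<close>
  have bst: "bstable (get \<beta>) ?V"
    unfolding bstable_def
  proof (intro allI ballI)
    fix b x assume x: "x \<in> ?V"
    have xv: "x \<in> vecs n" using x by (simp add: sols_iff)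
    let ?y = "\<lambda>i. if get \<beta> i = b then x i else 0"
    have yv: "?y \<in> vecs n" using xv by (auto simp: vecs_def F_0)
    have "(\<Sum>i\<le>n. rrow ?V (val n \<delta>) j i * ?y i) = 0" if j: "j \<le> n" "j \<notin> piv ?V" for j
    proof -
      have jj: "j \<in> set js" using j by (simp add: js)
      have "(\<Sum>i\<le>n. rrow ?V (val n \<delta>) j i * ?y i)
          = (\<Sum>i\<le>n. (if block n ?V j = b then 1 else 0) * (rrow ?V (val n \<delta>) j i * x i))"
      proof (rule sum.cong)
        fix i assume "i \<in> {..n}"
        thus "rrow ?V (val n \<delta>) j i * ?y i = (if block n ?V j = b then 1 else 0) * (rrow ?V (val n \<delta>) j i * x i)"
          using supp[OF jj, of i] \<beta>[of i] by (cases "rrow ?V (val n \<delta>) j i = 0") auto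
      qed simp
      also have "\<dots> = (if block n ?V j = b then 1 else 0) * (\<Sum>i\<le>n. rrow ?V (val n \<delta>) j i * x i)"
        by (simp only: sum_distrib_left)
      finally show ?thesis using rrow_sols[where \<delta> = "val n \<delta>", OF V xv \<delta>nz] x j by simp
    qed
    thus "?y \<in> ?V" using rrow_sols[where \<delta> = "val n \<delta>", OF V yv \<delta>nz] by blast
  qed
  \<comment> \<open>By \<open>frob\<close>, raising an equation to the power \<open>q\<close> gives
    the same equation for the \<open>q\<close>-th powers.\<close>
  have stab: "(\<lambda>i. val n \<delta> i * y i ^ q) \<in> ?V" if y: "y \<in> vecs n" and m: "(\<lambda>i. val n \<delta> i * y i) \<in> ?V" for y
  proof -
    have "(\<Sum>i\<le>n. rrow ?V (val n \<delta>) j i * (val n \<delta> i * y i ^ q)) = 0" if j: "j \<le> n" "j \<notin> piv ?V" for j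
    proof -
      have "(\<Sum>i\<le>n. rrow ?V (val n \<delta>) j i * (val n \<delta> i * y i ^ q)) = (\<Sum>i\<le>n. (rrow ?V (val n \<delta>) j i * (val n \<delta> i * y i)) ^ q)"
        using frob[of j] j by (intro sum.cong) (simp_all add: js power_mult_distrib flip: mult.assoc)
      also have "\<dots> = (\<Sum>i\<le>n. rrow ?V (val n \<delta>) j i * (val n \<delta> i * y i)) ^ q" by (simp add: frob_sum)
      also have "(\<Sum>i\<le>n. rrow ?V (val n \<delta>) j i * (val n \<delta> i * y i)) = 0"
        using rrow_sols[where \<delta> = "val n \<delta>", OF V vecs_mult[OF val_vecs y] \<delta>nz] m j by blast
      finally show ?thesis using q_pos by (simp add: power_0_left)
    qed
    thus ?thesis using rrow_sols[where \<delta> = "val n \<delta>", OF V vecs_mult[OF val_vecs vecs_vpow[OF y q_pos]] \<delta>nz] by blast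
  qed
  obtain T where T: "transversal gens T q" using ex_transversal[OF gens0 q_pos] by blast
  let ?NL = "List.n_lists (Suc n) T"
  have gG: "val n g i \<in> Gam" if "g \<in> set ?NL" "i \<le> n" for g i
    by (rule n_lists_val[OF that(1) _ that(2)]) (use T in \<open>simp add: transversal_def in_grp_iff[OF gens0]\<close>)
  define ret where "ret = (\<lambda>g. \<forall>i<Suc n. \<exists>s. in_grp gens s \<and> \<nu> (get g i) = \<nu> (ml (get g (get \<beta> i)) (pw s q)))"
  have small: "card (piv (descent n ?V (val n (vmul n \<delta> g)) e)) < card (piv ?V)" if g: "g \<in> set ?NL" and r: "\<not> ret g" for g
  proof (rule ccontr)
    assume "\<not> ?thesis"
    moreover have "val n (vmul n \<delta> g) = (\<lambda>i. val n \<delta> i * val n g i)" by (rule ext) (rule val_vmul)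
    ultimately have c: "card (piv ?V) \<le> card (piv (descent n ?V (\<lambda>i. val n \<delta> i * val n g i) e))" by simp
    have "ret g" unfolding ret_def
    proof (intro allI impI)
      fix i assume "i < Suc n"
      hence i: "i \<le> n" by simp
      obtain v where v: "v \<in> Gam" "val n g i = val n g (block n ?V i) * v ^ q"
        using returned[OF Gam(1) _ V \<delta>G gG[OF g] edges tor_frob c i] root by blast
      have "\<nu> (nm v) = v" using v(1) Gam(2) by (intro \<nu>_nm) blast
      thus "\<exists>s. in_grp gens s \<and> \<nu> (get g i) = \<nu> (ml (get g (get \<beta> i)) (pw s q))"
        using v i \<beta>n[OF i] by (intro exI[of _ "nm v"]) (simp add: in_grp_iff[OF gens0] val_def \<beta>)
    qed
    thus False using r by simp
  qed
  have ex: "\<exists>U D. coord_chain n e (scale n (vmul n \<delta> g) rr) U \<and> sols n U = descent n ?V (val n (vmul n \<delta> g)) e \<and>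
      derivable (covstep (n, e, mus, gams)) (U, D) \<and> (\<forall>d\<in>set D. dgood n q Gam (sols n U) d)"
    if g: "g \<in> set ?NL" and r: "\<not> ret g" for g
  proof -
    obtain U where U: "coord_chain n e (scale n (vmul n \<delta> g) rr) U" "sols n U = descent n ?V (val n (vmul n \<delta> g)) e"
      using ex_chain_descent[of n e "vmul n \<delta> g" rr] unfolding srr by blast
    have "solved n U" by (rule IH) (use small[OF g r] U(2) in simp)
    thus ?thesis using U unfolding solved_def by blast
  qed
  then obtain U D where UD: "\<And>g. g \<in> set ?NL \<Longrightarrow> \<not> ret g \<Longrightarrow> coord_chain n e (scale n (vmul n \<delta> g) rr) (U g) \<and>
      sols n (U g) = descent n ?V (val n (vmul n \<delta> g)) e \<and>
      derivable (covstep (n, e, mus, gams)) (U g, D g) \<and> (\<forall>d\<in>set (D g). dgood n q Gam (sols n (U g)) d)"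
    by metis
  let ?NM = "List.n_lists (Suc n) mus"
  \<comment> \<open>All vectors over the finite list \<open>mus\<close> are tried; those whose
    \<open>\<delta>\<close>-multiple solves the equations give the descriptions without moving
    points.\<close>
  define D1 where "D1 = map (\<lambda>\<zeta>. (vmul n \<delta> \<zeta>, [] :: nat list list, blocks n \<beta>)) (filter (\<lambda>\<zeta>. \<forall>a\<in>set rr. \<nu> (dot n a (vmul n \<delta> \<zeta>)) = \<nu> z0) ?NM)"
  define gl where "gl = filter (\<lambda>g. \<not> ret g) ?NL"
  define DD where "DD = D1 @ concat (map (\<lambda>g. map (twist_descr n q \<delta> g) (D g)) gl)"
  have gl: "g \<in> set ?NL" "\<not> ret g" if "g \<in> set gl" for g using that by (auto simp: gl_def)
  have twist: "dgood n q Gam ?V (twist_descr n q \<delta> g d)" "\<forall>z\<in>set (snd (snd d)). fst z \<le> n \<and> snd z \<le> n \<and> get \<beta> (fst z) = get \<beta> (snd z)"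
    if g: "g \<in> set ?NL" "\<not> ret g" and d: "d \<in> set (D g)" for g d
  proof -
    have dg: "dgood n q Gam (descent n ?V (val n (vmul n \<delta> g)) e) d" using UD[OF g] d by auto
    show "dgood n q Gam ?V (twist_descr n q \<delta> g d)"
      by (rule dgood_twist[OF Gam(1,2) V gG[OF g(1)] \<delta>G stab small[OF g] dg])
    show "\<forall>z\<in>set (snd (snd d)). fst z \<le> n \<and> snd z \<le> n \<and> get \<beta> (fst z) = get \<beta> (snd z)"
      using dg bstable_descent[OF bst] unfolding dgood_def by blast
  qed
  have step: "cov_iso n e mus gens (map (\<lambda>g. (U g, D g)) gl) rr DD"
    unfolding cov_iso_def
  proof (rule exI[of _ \<delta>], rule exI[of _ \<beta>], rule exI[of _ T], intro conjI)
    show "\<forall>i<Suc n. in_grp gens (get \<delta> i)"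
      using \<delta>G by (auto simp: in_grp_iff[OF gens0] val_def less_Suc_eq_le split: if_splits)
    show "\<forall>i<Suc n. get \<beta> i < Suc n \<and> get \<beta> (get \<beta> i) = get \<beta> i" using \<beta>n by (simp add: less_Suc_eq_le)
    have rrv: "\<nu> (get (name_vec n (rrow ?V (val n \<delta>) j)) i) = rrow ?V (val n \<delta>) j i" if "j \<in> set js" "i \<le> n" for i j
      using fun_cong[OF vrr[OF that(1)], of i] that(2) by (simp add: val_def)
    show "\<forall>a\<in>set rr. \<forall>i<Suc n. \<nu> (pw (ml (get a i) (get \<delta> i)) q) = \<nu> (ml (get a i) (get \<delta> i))"
    proof (intro ballI allI impI)
      fix a i assume "a \<in> set rr" "i < Suc n"
      then obtain j where "j \<in> set js" "a = name_vec n (rrow ?V (val n \<delta>) j)" "i \<le> n" by (auto simp: rr_def)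
      thus "\<nu> (pw (ml (get a i) (get \<delta> i)) q) = \<nu> (ml (get a i) (get \<delta> i))"
        using frob[of j i] by (simp add: rrv val_def[of n \<delta>])
    qed
    show "\<forall>a\<in>set rr. \<forall>i<Suc n. \<forall>j<Suc n. \<nu> (get a i) = \<nu> z0 \<or> \<nu> (get a j) = \<nu> z0 \<or> get \<beta> i = get \<beta> j"
    proof (intro ballI allI impI)
      fix a i k assume "a \<in> set rr" "i < Suc n" "k < Suc n"
      then obtain j where "j \<in> set js" "a = name_vec n (rrow ?V (val n \<delta>) j)" "i \<le> n" "k \<le> n" by (auto simp: rr_def)
      thus "\<nu> (get a i) = \<nu> z0 \<or> \<nu> (get a k) = \<nu> z0 \<or> get \<beta> i = get \<beta> k"
        using supp[of j i] supp[of j k]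
        by (cases "rrow ?V (val n \<delta>) j i = 0"; cases "rrow ?V (val n \<delta>) j k = 0") (simp_all add: rrv \<beta>)
    qed
    show "\<forall>\<zeta>\<in>set ?NM. (\<exists>a\<in>set rr. \<nu> (dot n a (vmul n \<delta> \<zeta>)) \<noteq> \<nu> z0) \<or> (vmul n \<delta> \<zeta>, [], blocks n \<beta>) \<in> set DD"
    proof
      fix \<zeta> assume "\<zeta> \<in> set ?NM"
      thus "(\<exists>a\<in>set rr. \<nu> (dot n a (vmul n \<delta> \<zeta>)) \<noteq> \<nu> z0) \<or> (vmul n \<delta> \<zeta>, [], blocks n \<beta>) \<in> set DD"
        unfolding DD_def D1_def by (cases "\<forall>a\<in>set rr. \<nu> (dot n a (vmul n \<delta> \<zeta>)) = \<nu> z0") auto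
    qed
    show "\<forall>g\<in>set ?NL. (\<forall>i<Suc n. \<exists>s. in_grp gens s \<and> \<nu> (get g i) = \<nu> (ml (get g (get \<beta> i)) (pw s q))) \<or>
        (\<exists>U' D'. coord_chain n e (scale n (vmul n \<delta> g) rr) U' \<and> (U', D') \<in> set (map (\<lambda>g. (U g, D g)) gl) \<and>
           (\<forall>d\<in>set D'. (\<forall>z\<in>set (snd (snd d)). fst z < Suc n \<and> snd z < Suc n \<and> get \<beta> (fst z) = get \<beta> (snd z)) \<and>
              twist_descr n q \<delta> g d \<in> set DD))"
    proof
      fix g assume g: "g \<in> set ?NL"
      show "(\<forall>i<Suc n. \<exists>s. in_grp gens s \<and> \<nu> (get g i) = \<nu> (ml (get g (get \<beta> i)) (pw s q))) \<or>
        (\<exists>U' D'. coord_chain n e (scale n (vmul n \<delta> g) rr) U' \<and> (U', D') \<in> set (map (\<lambda>g. (U g, D g)) gl) \<and>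
           (\<forall>d\<in>set D'. (\<forall>z\<in>set (snd (snd d)). fst z < Suc n \<and> snd z < Suc n \<and> get \<beta> (fst z) = get \<beta> (snd z)) \<and>
              twist_descr n q \<delta> g d \<in> set DD))"
      proof (cases "ret g")
        case False
        hence gm: "g \<in> set gl" using g by (simp add: gl_def)
        have a: "coord_chain n e (scale n (vmul n \<delta> g) rr) (U g)" using UD[OF g False] by blast
        have b: "(U g, D g) \<in> set (map (\<lambda>g. (U g, D g)) gl)" using gm by auto
        have c: "\<forall>d\<in>set (D g). (\<forall>z\<in>set (snd (snd d)). fst z < Suc n \<and> snd z < Suc n \<and> get \<beta> (fst z) = get \<beta> (snd z)) \<and>
              twist_descr n q \<delta> g d \<in> set DD"
          using twist(2)[OF g False] gm unfolding DD_def by (auto simp: less_Suc_eq_le)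
        show ?thesis by (rule disjI2, rule exI[of _ "U g"], rule exI[of _ "D g"]) (intro conjI a b c)
      qed (simp add: ret_def)
    qed
  qed (rule T)
  hence "covstep (n, e, mus, gams) (map (\<lambda>g. (U g, D g)) gl) (rr, DD)" by (simp add: covstep_def)
  have der1: "derivable (covstep (n, e, mus, gams)) (rr, DD)"
  proof (rule derivable_step[where cs = "map (\<lambda>g. (U g, D g)) gl"])
    fix y assume "y \<in> set (map (\<lambda>g. (U g, D g)) gl)"
    then obtain g where "g \<in> set gl" "y = (U g, D g)" by auto
    thus "derivable (covstep (n, e, mus, gams)) y" using UD gl by blast
  qed (rule covstep_mono, assumption, assumption, fact)
  \<comment> \<open>The new rows vanish on the solution space of the old ones, so
    \<open>duality\<close> provides the coefficients of the certificate.\<close>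
  have lc: "lincomb n rows r" if "r \<in> set rr" for r
  proof -
    obtain j where j: "j \<in> set js" "r = name_vec n (rrow ?V (val n \<delta>) j)" using \<open>r \<in> set rr\<close> by (auto simp: rr_def)
    have "\<exists>ks. (\<forall>j. ks j \<in> F) \<and> (\<forall>i\<le>n. val n r i = (\<Sum>j<length (map (val n) rows). ks j * (map (val n) rows ! j) i))"
    proof (rule duality)
      fix x assume "x \<in> sol n (set (map (val n) rows))"
      hence x: "x \<in> ?V" by (simp add: sols_def)
      hence xv: "x \<in> vecs n" by (simp add: sols_iff)
      have "j \<le> n" "j \<notin> piv ?V" using j(1) by (simp_all add: js)
      hence "(\<Sum>i\<le>n. rrow ?V (val n \<delta>) j i * x i) = 0" using rrow_sols[where \<delta> = "val n \<delta>", OF V xv \<delta>nz] x by blast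
      thus "(\<Sum>i\<le>n. val n r i * x i) = 0" unfolding j(2) vrr[OF j(1)] .
    qed auto
    then obtain ks where ks: "\<And>j. ks j \<in> F" "\<And>i. i \<le> n \<Longrightarrow> val n r i = (\<Sum>j<length rows. ks j * (map (val n) rows ! j) i)"
      by auto
    show ?thesis
      unfolding lincomb_def
    proof (rule exI[of _ "map (\<lambda>j. nm (ks j)) [0..<length rows]"], intro allI impI)
      fix i assume "i < Suc n"
      hence i: "i \<le> n" by simp
      have "(\<Sum>j<length rows. ks j * (map (val n) rows ! j) i)
          = (\<Sum>j<length rows. \<nu> (get (map (\<lambda>j. nm (ks j)) [0..<length rows]) j) * \<nu> (get (get rows j) i))"
        by (rule sum.cong) (simp_all add: get_nth ks(1) val_def i)
      thus "\<nu> (get r i) = \<nu> (sm (map (\<lambda>j. ml (get (map (\<lambda>j. nm (ks j)) [0..<length rows]) j) (get (get rows j) i)) [0..<length rows]))"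
        using ks(2)[OF i] i by (simp add: val_def o_def sum_list_upt)
    qed
  qed
  have "cov_comb n [(rr, DD)] rows DD" unfolding cov_comb_def using lc by (intro exI[of _ rr]) simp
  hence "covstep (n, e, mus, gams) [(rr, DD)] (rows, DD)" by (simp add: covstep_def)
  have der: "derivable (covstep (n, e, mus, gams)) (rows, DD)"
  proof (rule derivable_step[where cs = "[(rr, DD)]"])
    fix y assume "y \<in> set [(rr, DD)]"
    thus "derivable (covstep (n, e, mus, gams)) y" using der1 by simp
  qed (rule covstep_mono, assumption, assumption, fact)
  have "dgood n q Gam ?V d" if d: "d \<in> set D1" for d
  proof -
    obtain \<zeta> where \<zeta>: "\<zeta> \<in> set ?NM" "\<forall>a\<in>set rr. \<nu> (dot n a (vmul n \<delta> \<zeta>)) = 0" "d = (vmul n \<delta> \<zeta>, [], blocks n \<beta>)"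
      using d by (auto simp: D1_def)
    have \<zeta>G: "val n \<zeta> i \<in> Gam" if "i \<le> n" for i
      by (rule n_lists_val[OF \<zeta>(1) _ that]) (rule grp_gen, simp)
    have mem: "val n (vmul n \<delta> \<zeta>) \<in> ?V"
      using \<zeta>(2) val_vecs[of n "vmul n \<delta> \<zeta>"] unfolding srr[symmetric] by (simp add: sols_iff \<nu>_dot)
    have inc: "inc n q ?V (val n (vmul n \<delta> \<zeta>)) [] (set (blocks n \<beta>))"
    proof (rule incI)
      fix ls :: "nat list" and \<sigma> :: "nat \<Rightarrow> 'k"
      assume \<sigma>: "\<And>i. \<sigma> i = 0 \<or> \<sigma> i = 1" "\<And>z. z \<in> set (blocks n \<beta>) \<Longrightarrow> \<sigma> (fst z) = \<sigma> (snd z)"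
      let ?x = "\<lambda>i. val n (vmul n \<delta> \<zeta>) i * \<sigma> i"
      have s: "\<sigma> i = \<sigma> (block n ?V i)" if "i \<le> n" for i
        using \<sigma>(2)[of "(i, get \<beta> i)"] that by (simp add: blocks_mem \<beta>)
      have xv: "?x \<in> vecs n"
      proof -
        have "\<sigma> i \<in> F" for i using \<sigma>(1)[of i] F_0 F_1 by auto
        thus ?thesis using val_vecs[of n "vmul n \<delta> \<zeta>"] by (auto simp: vecs_def F_mult)
      qed
      have "(\<Sum>i\<le>n. rrow ?V (val n \<delta>) j i * ?x i) = 0" if j: "j \<le> n" "j \<notin> piv ?V" for j
      proof -
        have jj: "j \<in> set js" using j by (simp add: js)
        have "(\<Sum>i\<le>n. rrow ?V (val n \<delta>) j i * ?x i)
            = (\<Sum>i\<le>n. \<sigma> (block n ?V j) * (rrow ?V (val n \<delta>) j i * val n (vmul n \<delta> \<zeta>) i))"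
        proof (rule sum.cong)
          fix i assume "i \<in> {..n}"
          thus "rrow ?V (val n \<delta>) j i * ?x i = \<sigma> (block n ?V j) * (rrow ?V (val n \<delta>) j i * val n (vmul n \<delta> \<zeta>) i)"
            using supp[OF jj, of i] s[of i] by (cases "rrow ?V (val n \<delta>) j i = 0") auto
        qed simp
        also have "\<dots> = \<sigma> (block n ?V j) * (\<Sum>i\<le>n. rrow ?V (val n \<delta>) j i * val n (vmul n \<delta> \<zeta>) i)"
          by (simp only: sum_distrib_left)
        finally show ?thesis using rrow_sols[where \<delta> = "val n \<delta>", OF V val_vecs \<delta>nz, of "vmul n \<delta> \<zeta>"] mem j by simp
      qed
      hence "?x \<in> ?V" using rrow_sols[where \<delta> = "val n \<delta>", OF V xv \<delta>nz] by blast
      thus "(\<lambda>i. val n (vmul n \<delta> \<zeta>) i * orb q [] ls i * \<sigma> i) \<in> ?V" by simp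
    qed
    \<comment> \<open>The solution is nonzero, hence the dimension is at least 1, as the length
      clause demands of a description with no moving point.\<close>
    have nz: "val n (vmul n \<delta> \<zeta>) 0 \<noteq> 0" using \<delta>nz[of 0] Gam_nz[OF \<zeta>G[of 0]] by (simp add: val_vmul)
    have "piv ?V \<noteq> {}" using leading[OF mem nz] by blast
    hence card: "Suc 0 \<le> card (piv ?V)" using finite_piv[OF subspD(1)[OF V]] by (simp add: Suc_le_eq card_gt_0_iff)
    have comp: "b (fst z) = b (snd z)" if b: "bstable b ?V" and z: "z \<in> set (blocks n \<beta>)" for b :: "nat \<Rightarrow> nat" and z
    proof -
      have "b i = b (block n ?V i)" for i
      proof (rule linkedD[OF block_linked[of n ?V i], where P = "\<lambda>i j. b i = b j"])
        fix s j assume "s \<in> piv ?V" "rvec ?V s j \<noteq> 0"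
        from bstable_rvec[OF V b this] show "b s = b j" by simp
      qed simp_all
      thus ?thesis using z by (simp add: blocks_mem \<beta>)
    qed
    show ?thesis
      unfolding dgood_def \<zeta>(3) fst_conv snd_conv list.map(1)
    proof (intro conjI)
      show "\<forall>i\<le>n. val n (vmul n \<delta> \<zeta>) i \<in> Gam"
        using \<delta>G \<zeta>G by (simp add: val_vmul mult_subgroupD(3)[OF Gam(1)])
      show "\<forall>z\<in>set (blocks n \<beta>). fst z \<le> n \<and> snd z \<le> n" using \<beta>n by (simp add: blocks_mem)
      show "\<forall>b. bstable b ?V \<longrightarrow> (\<forall>z\<in>set (blocks n \<beta>). b (fst z) = b (snd z))" using comp by blast
    qed (use inc card in simp_all)
  qed
  moreover have "dgood n q Gam ?V d" if d: "d \<in> set DD" "d \<notin> set D1" for d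
    using d twist(1) gl unfolding DD_def by auto
  ultimately show ?thesis unfolding solved_def using der by blast
qed

theorem solved: "solved n rows"
proof (induction "card (piv (sols n rows))" arbitrary: rows rule: less_induct)
  case less
  show ?case
  proof (cases "\<exists>m. \<forall>g. (\<forall>i\<le>n. g i \<in> Gam) \<longrightarrow> card (piv (descent n (sols n rows) g m)) < card (piv (sols n rows))")
    case True
    then obtain m where m: "\<forall>g. (\<forall>i\<le>n. g i \<in> Gam) \<longrightarrow> card (piv (descent n (sols n rows) g m)) < card (piv (sols n rows))" ..
    show ?thesis
    proof (rule solved_split[where m = m])
      fix g assume "\<And>i. i \<le> n \<Longrightarrow> g i \<in> Gam"
      thus "card (piv (descent n (sols n rows) g m)) < card (piv (sols n rows))" using m by simp
    qed (rule less)
  next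
    case False
    hence "\<exists>g. (\<forall>i\<le>n. g i \<in> Gam) \<and> card (piv (sols n rows)) \<le> card (piv (descent n (sols n rows) g m))" for m
      by (metis not_less)
    note desc = this
    show ?thesis
    proof (rule solved_iso)
      show "\<exists>g. (\<forall>i\<le>n. g i \<in> Gam) \<and> card (piv (sols n rows)) \<le> card (piv (descent n (sols n rows) g m))" for m
        by (rule desc)
    qed (rule less)
  qed
qed

end


subsection \<open>Certified decompositions\<close>

lemma orb_append:
  "length ls = length vs \<Longrightarrow> orb q (vs @ vs') (ls @ ls') i = orb q vs ls i * orb q vs' ls' i"
  by (simp add: orb_def)

lemma orb_prod: "length ls = length vs \<Longrightarrow> orb q vs ls i = (\<Prod>j<length vs. (vs ! j) i ^ (q ^ (ls ! j)))"
proof (induction vs arbitrary: ls)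
  case (Cons v vs)
  then obtain l ls' where "ls = l # ls'" "length ls' = length vs" by (cases ls) auto
  thus ?case using Cons.IH[of ls'] by (simp add: prod.lessThan_Suc_shift del: prod.lessThan_Suc)
qed simp

lemma power_mod_group:
  assumes G: "mult_subgroup G" and v: "v \<noteq> 0" "v ^ q / v \<in> G"
  shows "v ^ (q ^ l) / v \<in> G"
proof (induction l)
  case 0
  show ?case using v(1) mult_subgroupD(2)[OF G] by simp
next
  case (Suc l)
  have "v ^ (q ^ Suc l) / v = (v ^ (q ^ l) / v) ^ q * (v ^ q / v)"
    using v(1) by (simp add: power_divide mult.commute flip: power_mult)
  also have "\<dots> \<in> G" by (rule mult_subgroupD(3)[OF G mult_subgroup_power[OF G Suc] v(2)])
  finally show ?case .
qed

text \<open>The class modulo \<open>G\<close> of an orbit point does not depend on the exponents;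
  the plain product of the moving points represents it.\<close>

lemma orb_mod_group:
  assumes G: "mult_subgroup G" and vs: "\<And>v. v \<in> set vs \<Longrightarrow> v i \<noteq> 0 \<and> v i ^ q / v i \<in> G"
    and ls: "length ls = length vs"
  shows "orb q vs ls i / prod_list (map (\<lambda>v. v i) vs) \<in> G"
  using vs ls
proof (induction vs arbitrary: ls)
  case Nil
  thus ?case by (simp add: mult_subgroupD(2)[OF G])
next
  case (Cons v vs)
  obtain l ls' where l: "ls = l # ls'" "length ls' = length vs" using Cons.prems(2) by (cases ls) auto
  have "orb q (v # vs) ls i / prod_list (map (\<lambda>v. v i) (v # vs))
      = (v i ^ (q ^ l) / v i) * (orb q vs ls' i / prod_list (map (\<lambda>v. v i) vs))" by (simp add: l)
  also have "\<dots> \<in> G"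
  proof (rule mult_subgroupD(3)[OF G])
    show "v i ^ (q ^ l) / v i \<in> G" by (rule power_mod_group[OF G]) (use Cons.prems(1)[of v] in simp_all)
    show "orb q vs ls' i / prod_list (map (\<lambda>v. v i) vs) \<in> G"
      by (rule Cons.IH[OF _ l(2)]) (use Cons.prems(1) in simp)
  qed
  finally show ?case .
qed

lemma group_absorb:
  assumes G: "mult_subgroup (G :: 'k::field set)" and a: "a / b \<in> G" and b: "b \<noteq> 0"
  shows "c * a \<in> G \<longleftrightarrow> c * b \<in> G"
proof -
  have a0: "a \<noteq> 0" using mult_subgroupD(5)[OF G a] by auto
  have "c * a = c * b * (a / b)" "c * b = c * a * inverse (a / b)" using a0 b by (simp_all add: field_simps)
  thus ?thesis using mult_subgroupD(3)[OF G _ a] mult_subgroupD(3)[OF G _ mult_subgroupD(4)[OF G a]] by metis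
qed

context named_field
begin

definition gpw :: "nat list \<Rightarrow> nat list \<Rightarrow> nat" where
  "gpw gams ev = prd (map (\<lambda>i. pw (get gams i) (get ev i)) [0..<length gams])"

lemma \<nu>_gpw: "\<nu> (gpw gams ev) = zprod {..<length gams} (\<lambda>i. \<nu> (get gams i)) (\<lambda>i. int (get ev i))"
proof -
  have "prod_list (map f [0..<k]) = (\<Prod>j<k. f j)" for f :: "nat \<Rightarrow> 'k" and k
    by (induction k) (simp_all add: mult.commute)
  thus ?thesis by (simp add: gpw_def zprod_def o_def)
qed

text \<open>A positive witness for independence: no nontrivial product with exponents below
  \<open>p\<close> is a \<open>p\<close>-th power in \<open>F\<close>, because some coordinate at a
  basis element other than 1 is nonzero.\<close>

definition indep_cert :: "nat list \<Rightarrow> bool" where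
  "indep_cert gams \<longleftrightarrow> (\<forall>ev\<in>set (List.n_lists (length gams) [0..<p]). (\<forall>k\<in>set ev. k = 0) \<or>
     (\<exists>cs j. j < length bs \<and> \<nu> (get bs j) \<noteq> \<nu> z1 \<and> \<nu> (get cs j) \<noteq> \<nu> z0 \<and>
        \<nu> (gpw gams ev) = \<nu> (sm (map (\<lambda>j. ml (pw (get cs j) p) (get bs j)) [0..<length bs]))))"

text \<open>A positive witness for non-membership in \<open>G\<close>. For each representative
  \<open>h\<close> of \<open>G\<close> modulo \<open>N\<close>-th powers, \<open>x\<close> divided
  by \<open>h\<close> is, up to \<open>N\<close>-th powers, \<open>\<zeta>\<close> times a product
  of the \<open>gams\<close>; either \<open>\<zeta>\<close> is not 1 or some exponent is not a
  multiple of \<open>N\<close>. Non-divisibility is spelled out with a bounded quantifier.\<close>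

definition cert_notin :: "nat list \<Rightarrow> nat list \<Rightarrow> nat \<Rightarrow> nat list \<Rightarrow> nat \<Rightarrow> bool" where
  "cert_notin mus gams N H x \<longleftrightarrow> (\<forall>h\<in>set H. \<exists>s \<zeta> ev. in_grp (mus @ gams) s \<and> \<zeta> \<in> set mus \<and>
     \<nu> (ml x (pw s N)) = \<nu> (ml h (ml \<zeta> (gpw gams ev))) \<and>
     (\<nu> \<zeta> \<noteq> \<nu> z1 \<or> (\<exists>i<length gams. \<forall>c<Suc (get ev i). get ev i \<noteq> N * c)))"

text \<open>The group generated by \<open>mus @ gams\<close> lies between \<open>G\<close> and its
  radical; \<open>mus\<close> lists torsion elements killed by \<open>N\<close>, and
  \<open>gams\<close> is an independent family. The clause with \<open>p ^ e * p ^ e\<close> says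
  that, with \<open>q = p ^ e\<close>, raising the \<open>q\<close>-th power of a generator to the
  power \<open>q\<close> changes it only by a factor in \<open>G\<close>. \<open>H\<close>
  represents \<open>G\<close> modulo \<open>N\<close>-th powers, \<open>R\<close> the larger group
  modulo \<open>G\<close>.\<close>

definition group_data :: "nat list \<Rightarrow> nat list \<Rightarrow> nat list \<Rightarrow> nat \<Rightarrow> nat \<Rightarrow> nat list \<Rightarrow> nat list \<Rightarrow> bool" where
  "group_data gs mus gams e N H R \<longleftrightarrow> 0 < e \<and> 0 < N \<and> (\<forall>b\<in>set (mus @ gams). \<nu> b \<noteq> \<nu> z0) \<and>
     (\<forall>g\<in>set gs. in_grp (mus @ gams) g) \<and> (\<forall>b\<in>set (mus @ gams). \<exists>s. in_grp gs (pw b (Suc s))) \<and>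
     (\<exists>\<zeta>\<in>set mus. \<nu> \<zeta> = \<nu> z1) \<and> (\<forall>\<zeta>\<in>set mus. \<forall>\<zeta>'\<in>set mus. \<exists>\<zeta>''\<in>set mus. \<nu> (ml \<zeta> \<zeta>') = \<nu> \<zeta>'') \<and>
     (\<forall>\<zeta>\<in>set mus. \<nu> (pw \<zeta> N) = \<nu> z1) \<and> indep_cert gams \<and>
     (\<forall>b\<in>set (mus @ gams). \<exists>g. in_grp gs g \<and> \<nu> (pw b (p ^ e * p ^ e)) = \<nu> (ml (pw b (p ^ e)) g)) \<and>
     (\<exists>h\<in>set H. \<nu> h = \<nu> z1) \<and>
     (\<forall>h\<in>set H. \<forall>g\<in>set gs. \<exists>h' s. h' \<in> set H \<and> in_grp (mus @ gams) s \<and> \<nu> (ml h g) = \<nu> (ml h' (pw s N))) \<and>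
     (\<exists>r\<in>set R. \<nu> r = \<nu> z1) \<and> (\<forall>r\<in>set R. in_grp (mus @ gams) r) \<and>
     (\<forall>r\<in>set R. \<forall>b\<in>set (mus @ gams). \<exists>r' g. r' \<in> set R \<and> in_grp gs g \<and> \<nu> (ml r b) = \<nu> (ml r' g))"

text \<open>
  \<open>unroll\<close> separates in each index \<open>l\<^sub>j\<close> the value 0 from the positive values, whose class modulo
  the group no longer depends on \<open>l\<^sub>j\<close>.
\<close>

definition unroll_step :: "nat \<Rightarrow> nat \<Rightarrow> (nat list \<times> nat list list) list \<Rightarrow> nat list \<Rightarrow> (nat list \<times> nat list list) list" where
  "unroll_step n k st v = concat (map (\<lambda>z. [(vmul n (fst z) v, snd z), (fst z, snd z @ [vpw n v k])]) st)"

definition unroll :: "nat \<Rightarrow> nat \<Rightarrow> nat list \<Rightarrow> nat list list \<Rightarrow> (nat list \<times> nat list list) list" where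
  "unroll n k v0 vs = foldl (unroll_step n k) [(v0, [])] vs"

text \<open>Under the hypotheses of \<open>orb_mod_group\<close> this vector shows, coordinate by
  coordinate, the common class modulo \<open>G\<close> of all points of an orbit.\<close>

definition vprd :: "nat \<Rightarrow> nat list \<Rightarrow> nat list list \<Rightarrow> nat list" where
  "vprd n v0 vs = foldl (vmul n) v0 vs"

lemma val_vprd: "val n (vprd n v0 vs) i = val n v0 i * prod_list (map (\<lambda>v. v i) (map (val n) vs))"
  unfolding vprd_def by (induction vs arbitrary: v0) (simp_all add: val_vmul mult.assoc)

definition orbn :: "nat \<Rightarrow> nat \<Rightarrow> nat list \<Rightarrow> nat list list \<Rightarrow> nat list \<Rightarrow> nat list" where
  "orbn n k v0 vs ls = foldl (\<lambda>a j. vmul n a (vpw n (get vs j) (k ^ get ls j))) v0 [0..<length vs]"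

lemma val_orbn:
  assumes "k > 0" "length ls = length vs"
  shows "val n (orbn n k v0 vs ls) i = val n v0 i * orb k (map (val n) vs) ls i"
proof -
  have "val n (foldl (\<lambda>a j. vmul n a (vpw n (get vs j) (k ^ get ls j))) v0 [0..<m]) i
      = val n v0 i * (\<Prod>j<m. val n (get vs j) i ^ (k ^ get ls j))" for m
    using assms(1) by (induction m) (simp_all add: val_vmul val_vpw mult_ac)
  moreover have "(\<Prod>j<length vs. val n (get vs j) i ^ (k ^ get ls j)) = orb k (map (val n) vs) ls i"
    using assms(2) by (subst orb_prod) (auto intro!: prod.cong simp: get_nth)
  ultimately show ?thesis by (simp add: orbn_def)
qed

text \<open>Finite tests for infinite families: exponents up to \<open>n\<close> suffice by
  \<open>orb_up\<close>, factors with entries 0 and 1 by \<open>inc_general\<close>. As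
  \<open>v ^ q\<close> and \<open>v\<close> agree modulo \<open>G\<close>, the coordinates of all
  orbit points lie in \<open>G\<close> as soon as those of \<open>vprd\<close> do.\<close>

definition descr_ok :: "nat \<Rightarrow> nat list list \<Rightarrow> nat list \<Rightarrow> nat list \<Rightarrow> nat \<Rightarrow> descr \<Rightarrow> bool" where
  "descr_ok n rows gs gens e d \<longleftrightarrow> length (fst d) = Suc n \<and> (\<forall>i<Suc n. in_grp gens (get (fst d) i)) \<and>
     length (fst (snd d)) \<le> n - 1 \<and>
     (\<forall>v\<in>set (fst (snd d)). length v = Suc n \<and> (\<forall>i<Suc n. in_grp gens (get v i)) \<and>
        (\<forall>i<Suc n. \<exists>g. in_grp gs g \<and> \<nu> (pw (get v i) (p ^ e)) = \<nu> (ml (get v i) g))) \<and>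
     (\<forall>z\<in>set (snd (snd d)). fst z < Suc n \<and> snd z < Suc n) \<and>
     (\<forall>i<Suc n. in_grp gs (get (vprd n (fst d) (fst (snd d))) i)) \<and>
     (\<forall>ls\<in>set (List.n_lists (length (fst (snd d))) [0..<Suc n]). \<forall>\<chi>\<in>set (List.n_lists (Suc n) [z0, z1]).
        (\<exists>z\<in>set (snd (snd d)). get \<chi> (fst z) \<noteq> get \<chi> (snd z)) \<or>
        (\<forall>a\<in>set rows. \<nu> (dot n a (vmul n (orbn n (p ^ e) (fst d) (fst (snd d)) ls) \<chi>)) = \<nu> z0))"

text \<open>Here \<open>\<tau>\<close> records the classes modulo \<open>G\<close> of the factor
  \<open>\<sigma>\<close> and is absorbed into the leading vector. Each unrolled piece then lies in
  a single class, so it is either listed or has a coordinate that is outside \<open>G\<close>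
  throughout.\<close>

definition cov_final :: "nat \<Rightarrow> nat \<Rightarrow> nat list \<Rightarrow> nat list \<Rightarrow> nat \<Rightarrow> nat list \<Rightarrow> nat list \<Rightarrow> descr list \<Rightarrow> descr list \<Rightarrow> bool" where
  "cov_final n e mus gams N H R D ds \<longleftrightarrow> (\<forall>d\<in>set D. (\<forall>z\<in>set (snd (snd d)). fst z < Suc n \<and> snd z < Suc n) \<and>
     (\<forall>v\<in>set (fst (snd d)). \<forall>i<Suc n. in_grp (mus @ gams) (get v i)) \<and>
     (\<forall>\<tau>\<in>set (List.n_lists (Suc n) R). (\<exists>z\<in>set (snd (snd d)). \<nu> (get \<tau> (fst z)) \<noteq> \<nu> (get \<tau> (snd z))) \<or>
        (\<forall>w\<in>set (unroll n (p ^ e) (vmul n (fst d) \<tau>) (fst (snd d))). (fst w, snd w, snd (snd d)) \<in> set ds \<or>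
           (\<exists>i<Suc n. cert_notin mus gams N H (get (vprd n (fst w) (snd w)) i)))))"

definition certified :: "nat \<Rightarrow> nat list list \<Rightarrow> nat list \<Rightarrow> nat \<Rightarrow> descr list \<Rightarrow> bool" where
  "certified n rows gs e ds \<longleftrightarrow> (\<exists>mus gams D N H R. group_data gs mus gams e N H R \<and>
     derivable (covstep (n, e, mus, gams)) (rows, D) \<and> (\<forall>d\<in>set ds. descr_ok n rows gs (mus @ gams) e d) \<and>
     cov_final n e mus gams N H R D ds)"

text \<open>An exponent 0 multiplies \<open>v\<close> into the leading vector; an exponent
  \<open>Suc j\<close> of \<open>v\<close> is the exponent \<open>j\<close> of
  \<open>v ^ k\<close>.\<close>

lemma unroll_covers:
  assumes k: "k > 0"
  shows "(a, b) \<in> set st \<Longrightarrow> length js = length b \<Longrightarrow> length ls = length vs \<Longrightarrow>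
    \<exists>w\<in>set (foldl (unroll_step n k) st vs). \<exists>ks. length ks = length (snd w) \<and>
      (\<forall>i. val n a i * orb k (map (val n) b) js i * orb k (map (val n) vs) ls i
         = val n (fst w) i * orb k (map (val n) (snd w)) ks i)"
proof (induction vs arbitrary: st a b js ls)
  case Nil
  thus ?case by (intro bexI[of _ "(a, b)"] exI[of _ js]) auto
next
  case (Cons v vs)
  obtain l ls' where l: "ls = l # ls'" "length ls' = length vs" using Cons.prems(3) by (cases ls) auto
  show ?case
  proof (cases l)
    case 0
    have "(vmul n a v, b) \<in> set (unroll_step n k st v)" using Cons.prems(1) by (force simp: unroll_step_def)
    from Cons.IH[OF this Cons.prems(2) l(2)] show ?thesis
      by (simp add: l 0 val_vmul mult_ac)
  next
    case (Suc j)
    have "(a, b @ [vpw n v k]) \<in> set (unroll_step n k st v)" using Cons.prems(1) by (force simp: unroll_step_def)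
    moreover have "length (js @ [j]) = length (b @ [vpw n v k])" using Cons.prems(2) by simp
    ultimately show ?thesis using Cons.IH[of a "b @ [vpw n v k]" "unroll_step n k st v" "js @ [j]" ls'] l(2) Cons.prems(2)
      by (simp add: l Suc orb_append val_vpw[OF k] mult_ac flip: power_mult)
  qed
qed

text \<open>Unrolling creates no new points, so inclusion in the variety is inherited. It also
  records that the new moving points are \<open>k\<close>-th powers, which is what fixes their
  classes modulo \<open>G\<close>.\<close>

lemma unroll_origin:
  assumes k: "k > 0"
  shows "w \<in> set (foldl (unroll_step n k) st vs) \<Longrightarrow>
    \<exists>a b us. (a, b) \<in> set st \<and> snd w = b @ map (\<lambda>v. vpw n v k) us \<and> set us \<subseteq> set vs \<and> length us \<le> length vs \<and>
      (length a = Suc n \<longrightarrow> length (fst w) = Suc n) \<and>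
      (\<forall>ks. length ks = length us \<longrightarrow> (\<exists>ls. length ls = length vs \<and>
         (\<forall>i. val n (fst w) i * orb k (map (\<lambda>v i. v i ^ k) (map (val n) us)) ks i = val n a i * orb k (map (val n) vs) ls i)))"
proof (induction vs arbitrary: st)
  case Nil
  thus ?case by (intro exI[of _ "fst w"] exI[of _ "snd w"] exI[of _ "[]"]) auto
next
  case (Cons v vs)
  have w: "w \<in> set (foldl (unroll_step n k) (unroll_step n k st v) vs)" using Cons.prems by simp
  obtain a b us where ab: "(a, b) \<in> set (unroll_step n k st v)" and us: "snd w = b @ map (\<lambda>v. vpw n v k) us"
    "set us \<subseteq> set vs" "length us \<le> length vs" "length a = Suc n \<longrightarrow> length (fst w) = Suc n"
    and eq: "\<forall>ks. length ks = length us \<longrightarrow> (\<exists>ls. length ls = length vs \<and>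
         (\<forall>i. val n (fst w) i * orb k (map (\<lambda>v i. v i ^ k) (map (val n) us)) ks i = val n a i * orb k (map (val n) vs) ls i))"
    using Cons.IH[OF w] by blast
  from ab obtain a0 b0 where st: "(a0, b0) \<in> set st" and
    cs: "(a = vmul n a0 v \<and> b = b0) \<or> (a = a0 \<and> b = b0 @ [vpw n v k])"
    by (auto simp: unroll_step_def)
  from cs show ?case
  proof
    assume c: "a = vmul n a0 v \<and> b = b0"
    have "\<exists>ls. length ls = length (v # vs) \<and> (\<forall>i. val n (fst w) i * orb k (map (\<lambda>v i. v i ^ k) (map (val n) us)) ks i
        = val n a0 i * orb k (map (val n) (v # vs)) ls i)" if kl: "length ks = length us" for ks
    proof -
      obtain ls where ls: "length ls = length vs" "\<forall>i. val n (fst w) i * orb k (map (\<lambda>v i. v i ^ k) (map (val n) us)) ks i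
        = val n a i * orb k (map (val n) vs) ls i" using eq kl by blast
      show ?thesis by (rule exI[of _ "0 # ls"]) (use ls c in \<open>simp add: val_vmul mult.assoc\<close>)
    qed
    thus ?case using st us c
      by (intro exI[of _ a0] exI[of _ b0] exI[of _ us]) (auto simp: vmul_def)
  next
    assume c: "a = a0 \<and> b = b0 @ [vpw n v k]"
    have "\<exists>ls. length ls = length (v # vs) \<and> (\<forall>i. val n (fst w) i * orb k (map (\<lambda>v i. v i ^ k) (map (val n) (v # us))) ks i
        = val n a0 i * orb k (map (val n) (v # vs)) ls i)" if kl: "length ks = length (v # us)" for ks
    proof -
      obtain j js where ks: "ks = j # js" "length js = length us" using kl by (cases ks) auto
      obtain ls where ls: "length ls = length vs" "\<forall>i. val n (fst w) i * orb k (map (\<lambda>v i. v i ^ k) (map (val n) us)) js i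
        = val n a i * orb k (map (val n) vs) ls i" using eq ks(2) by blast
      show ?thesis
      proof (rule exI[of _ "Suc j # ls"], intro conjI allI)
        fix i
        have "val n (fst w) i * orb k (map (\<lambda>v i. v i ^ k) (map (val n) (v # us))) ks i
            = (val n v i ^ k) ^ (k ^ j) * (val n (fst w) i * orb k (map (\<lambda>v i. v i ^ k) (map (val n) us)) js i)"
          by (simp add: ks(1) mult_ac)
        also have "\<dots> = (val n v i ^ k) ^ (k ^ j) * (val n a0 i * orb k (map (val n) vs) ls i)" using ls(2) c by simp
        finally show "val n (fst w) i * orb k (map (\<lambda>v i. v i ^ k) (map (val n) (v # us))) ks i
            = val n a0 i * orb k (map (val n) (v # vs)) (Suc j # ls) i" by (simp add: mult_ac flip: power_mult)
      qed (simp add: ls(1))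
    qed
    thus ?case using st us c
      by (intro exI[of _ a0] exI[of _ b0] exI[of _ "v # us"]) auto
  qed
qed

text \<open>Infinite descent on a relation: reducing its exponents modulo \<open>p\<close> leaves a
  \<open>p\<close>-th power, so by the certificate all exponents are divisible by \<open>p\<close>.
  Injectivity of Frobenius allows division by \<open>p\<close>, which makes a nonzero relation
  smaller.\<close>

lemma indep_of_cert:
  assumes cert: "indep_cert gams" and nz: "\<And>i. i < length gams \<Longrightarrow> \<nu> (get gams i) \<noteq> 0"
  shows "indep_mod_torsion {..<length gams} (\<lambda>i. \<nu> (get gams i))"
proof -
  let ?r = "length gams" and ?z = "zprod {..<length gams} (\<lambda>i. \<nu> (get gams i))"
  have nz': "\<nu> (get gams i) \<noteq> 0" if "i \<in> {..<?r}" for i using nz that by simp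
  have key: "\<forall>i<?r. f i = 0" if "?z f = 1" for f
    using that
  proof (induction "\<Sum>i<?r. nat \<bar>f i\<bar>" arbitrary: f rule: less_induct)
    case less
    define ev where "ev = map (\<lambda>i. nat (f i mod int p)) [0..<?r]"
    have evi: "int (get ev i) = f i mod int p" if "i < ?r" for i
      using that p_pos by (simp add: ev_def get_nth)
    have mem: "ev \<in> set (List.n_lists ?r [0..<p])"
      using p_pos by (auto simp: set_n_lists ev_def nat_less_iff)
    have zf: "?z f = ?z (\<lambda>i. f i div int p) ^ p * ?z (\<lambda>i. int (get ev i))"
    proof -
      have "?z f = ?z (\<lambda>i. f i div int p * int p + int (get ev i))"
        by (rule zprod_cong) (simp add: evi)
      also have "\<dots> = ?z (\<lambda>i. f i div int p * int p) * ?z (\<lambda>i. int (get ev i))"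
        using nz' by (intro zprod_add) simp
      finally show ?thesis unfolding zprod_mult .
    qed
    have gF: "\<nu> (get gams i) powi k \<in> F" for i k by (simp add: power_int_def F_power F_inverse)
    show ?case
    proof (cases "\<forall>k\<in>set ev. k = 0")
      case True
      hence dvd: "f i mod int p = 0" if "i < ?r" for i
        using evi[OF that] that by (simp add: ev_def get_nth)
      have "?z (\<lambda>i. int (get ev i)) = ?z (\<lambda>_. 0)" by (rule zprod_cong) (simp add: evi dvd)
      hence "?z (\<lambda>i. f i div int p) ^ p = 1" using zf less.prems by simp
      hence "?z (\<lambda>i. f i div int p) ^ p = 1 ^ p" by simp
      hence z1: "?z (\<lambda>i. f i div int p) = 1" by (simp only: frob1_eq_iff)
      show ?thesis
      proof (rule ccontr)
        assume "\<not> ?thesis"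
        then obtain i0 where i0: "i0 < ?r" "f i0 \<noteq> 0" by blast
        have le: "nat \<bar>f i div int p\<bar> \<le> nat \<bar>f i\<bar>" if i: "i < ?r" for i
        proof -
          obtain c where c: "f i = int p * c" using dvd[OF i] by (metis dvd_def mod_0_imp_dvd)
          have "1 * \<bar>c\<bar> \<le> int p * \<bar>c\<bar>" using p_ge_2 by (intro mult_right_mono) simp_all
          thus ?thesis using c p_pos by (simp add: abs_mult)
        qed
        have lt: "nat \<bar>f i0 div int p\<bar> < nat \<bar>f i0\<bar>"
        proof -
          obtain c where c: "f i0 = int p * c" using dvd[OF i0(1)] by (metis dvd_def mod_0_imp_dvd)
          have "c \<noteq> 0" using c i0 by auto
          hence "\<bar>c\<bar> < \<bar>int p * c\<bar>" using p_ge_2 by (simp add: abs_mult)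
          thus ?thesis using c p_pos \<open>c \<noteq> 0\<close> by simp
        qed
        have "(\<Sum>i<?r. nat \<bar>f i div int p\<bar>) < (\<Sum>i<?r. nat \<bar>f i\<bar>)"
          by (rule sum_strict_mono_ex1) (use le lt i0 in auto)
        from less.hyps[OF this z1] have "f i0 div int p = 0" using i0(1) by blast
        thus False using i0 dvd[OF i0(1)] by (metis div_mult_mod_eq add.right_neutral mult_zero_left)
      qed
    next
      case False
      then obtain cs j where c: "j < length bs" "\<nu> (get bs j) \<noteq> 1" "\<nu> (get cs j) \<noteq> 0"
        "\<nu> (gpw gams ev) = \<nu> (sm (map (\<lambda>j. ml (pw (get cs j) p) (get bs j)) [0..<length bs]))"
        using cert mem unfolding indep_cert_def \<nu>_z0 \<nu>_z1 by blast
      define y where "y = inverse (?z (\<lambda>i. f i div int p))"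
      have zF: "?z (\<lambda>i. f i div int p) \<in> F" unfolding zprod_def by (rule F_prod) (rule gF)
      have "\<nu> (gpw gams ev) = y ^ p"
        using zf less.prems zprod_nonzero[of "{..<?r}" "\<lambda>i. \<nu> (get gams i)"] nz'
        unfolding \<nu>_gpw y_def by (simp add: power_inverse field_simps)
      moreover have "\<nu> (sm (map (\<lambda>j. ml (pw (get cs j) p) (get bs j)) [0..<length bs]))
          = (\<Sum>j<length bs. \<nu> (get cs (bindex (\<nu> (get bs j)))) ^ p * \<nu> (get bs j))"
        unfolding \<nu>_sm map_map o_def \<nu>_ml \<nu>_pw sum_list_upt by (rule sum.cong) (simp_all add: bindex)
      moreover have "\<dots> = (\<Sum>s\<in>S. \<nu> (get cs (bindex s)) ^ p * s)" by (rule sum_bs)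
      ultimately have eq: "(\<Sum>s\<in>S. \<nu> (get cs (bindex s)) ^ p * s) = y ^ p" using c(4) by simp
      have "\<nu> (get bs j) \<in> S" using bs(1) c(1) by (auto simp: get_nth)
      hence "\<nu> (get cs (bindex (\<nu> (get bs j)))) = 0"
        by (intro coords_of_power[of "\<lambda>s. \<nu> (get cs (bindex s))" y]) (use eq c(2) zF in \<open>simp_all add: y_def F_inverse\<close>)
      thus ?thesis using c(1,3) by (simp add: bindex)
    qed
  qed
  show ?thesis
    unfolding indep_mod_torsion_def
  proof (intro allI impI ballI)
    fix f i assume "?z f \<in> torsion" and i: "i \<in> {..<?r}"
    then obtain s where s: "s > 0" "?z f ^ s = 1" by (auto simp: torsion_def)
    hence "?z (\<lambda>i. f i * int s) = 1" by (simp add: zprod_mult)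
    from key[OF this] have "f i * int s = 0" using i by blast
    thus "f i = 0" using s(1) by simp
  qed
qed

end

section \<open>Soundness of certificates\<close>

locale certified_group = named_field F p B S \<nu> ad ml z0 z1 bs
  for F :: "'k::field set" and p B S \<nu> ad ml z0 z1 bs +
  fixes gs mus gams :: "nat list" and e N :: nat and H R :: "nat list"
  assumes gs0: "0 \<notin> \<nu> ` set gs" and data: "group_data gs mus gams e N H R"
begin

abbreviation "gens \<equiv> mus @ gams"
abbreviation "q \<equiv> p ^ e"

lemma gens0: "0 \<notin> \<nu> ` set gens"
  using data unfolding group_data_def by auto

lemma e_pos: "e > 0" and N_pos: "N > 0"
  using data unfolding group_data_def by blast+

lemma q_pos: "q > 0"
  using p_pos by simp

lemma G: "mult_subgroup (grp gs)"
  using mult_subgroup_hull[OF gs0] by (simp add: grp_def)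

lemma Gam: "mult_subgroup (grp gens)"
  using mult_subgroup_hull[OF gens0] by (simp add: grp_def)

lemma in_G [simp]: "in_grp gs x \<longleftrightarrow> \<nu> x \<in> grp gs"
  by (rule in_grp_iff[OF gs0])

lemma in_Gam [simp]: "in_grp gens x \<longleftrightarrow> \<nu> x \<in> grp gens"
  by (rule in_grp_iff[OF gens0])

lemma G_Gam: "grp gs \<subseteq> grp gens"
proof -
  have "\<nu> ` set gs \<subseteq> grp gens" using data unfolding group_data_def by auto
  thus ?thesis using Gam unfolding grp_def[of gs] by (rule hull_minimal)
qed

lemma Gam_root: "grp gens \<subseteq> root_closure (grp gs)"
proof -
  have "\<nu> ` set gens \<subseteq> root_closure (grp gs)"
  proof
    fix x assume "x \<in> \<nu> ` set gens"
    then obtain b s where "x = \<nu> b" "in_grp gs (pw b (Suc s))" using data unfolding group_data_def by blast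
    thus "x \<in> root_closure (grp gs)" unfolding root_closure_def by (auto intro!: exI[of _ "Suc s"] simp del: power_Suc)
  qed
  thus ?thesis unfolding grp_def[of gens] by (rule hull_minimal) (rule root_closure_subgroup[OF G])
qed

abbreviation "zp \<equiv> zprod {..<length gams} (\<lambda>i. \<nu> (get gams i))"

lemma gam_mem: "i \<in> {..<length gams} \<Longrightarrow> \<nu> (get gams i) \<in> grp gens"
  by (rule grp_gen) (simp add: get_nth)

lemma gam_nz: "i \<in> {..<length gams} \<Longrightarrow> \<nu> (get gams i) \<noteq> 0"
  using mult_subgroupD(5)[OF Gam gam_mem] .

lemma mus_torsion: "\<zeta> \<in> set mus \<Longrightarrow> \<nu> \<zeta> ^ N = 1"
  using data unfolding group_data_def by auto

lemma mus_nz: "\<zeta> \<in> set mus \<Longrightarrow> \<nu> \<zeta> \<noteq> 0"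
  using gens0 by auto

lemma represent:
  assumes "x \<in> grp gens"
  shows "\<exists>\<zeta>\<in>set mus. \<exists>f. x = \<nu> \<zeta> * zp f"
proof -
  let ?A = "{x. \<exists>\<zeta>\<in>set mus. \<exists>f. x = \<nu> \<zeta> * zp f}"
  have one: "\<exists>\<zeta>\<in>set mus. \<nu> \<zeta> = 1" and mult: "\<And>\<zeta> \<zeta>'. \<zeta> \<in> set mus \<Longrightarrow> \<zeta>' \<in> set mus \<Longrightarrow> \<exists>\<zeta>''\<in>set mus. \<nu> \<zeta> * \<nu> \<zeta>' = \<nu> \<zeta>''"
    using data unfolding group_data_def by auto
  have pwr: "\<exists>\<zeta>'\<in>set mus. \<nu> \<zeta> ^ k = \<nu> \<zeta>'" if "\<zeta> \<in> set mus" for \<zeta> k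
  proof (induction k)
    case 0
    show ?case using one by auto
  next
    case (Suc k)
    thus ?case using mult[OF that] by (metis power_Suc)
  qed
  have za: "zp (\<lambda>i. f i + f' i) = zp f * zp f'" for f f' by (rule zprod_add) (rule gam_nz)
  have "mult_subgroup ?A"
  proof (rule mult_subgroupI)
    have "\<nu> \<zeta> * zp f \<noteq> 0" if "\<zeta> \<in> set mus" for \<zeta> f
      using mus_nz[OF that] zprod_nonzero[of "{..<length gams}" "\<lambda>i. \<nu> (get gams i)" f] gam_nz by simp
    thus "0 \<notin> ?A" by force
    obtain \<zeta> where \<zeta>: "\<zeta> \<in> set mus" "\<nu> \<zeta> = 1" using one by blast
    show "1 \<in> ?A" by (rule CollectI, rule bexI[OF _ \<zeta>(1)], rule exI[of _ "\<lambda>_. 0"]) (simp add: \<zeta>(2))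
  next
    fix x y assume "x \<in> ?A" "y \<in> ?A"
    then obtain \<zeta> f \<zeta>' f' where x: "\<zeta> \<in> set mus" "x = \<nu> \<zeta> * zp f" and y: "\<zeta>' \<in> set mus" "y = \<nu> \<zeta>' * zp f'" by blast
    obtain \<zeta>'' where z: "\<zeta>'' \<in> set mus" "\<nu> \<zeta> * \<nu> \<zeta>' = \<nu> \<zeta>''" using mult[OF x(1) y(1)] by blast
    show "x * y \<in> ?A"
      by (rule CollectI, rule bexI[OF _ z(1)], rule exI[of _ "\<lambda>i. f i + f' i"]) (simp add: za x(2) y(2) flip: z(2))
  next
    fix x assume "x \<in> ?A"
    then obtain \<zeta> f where x: "\<zeta> \<in> set mus" "x = \<nu> \<zeta> * zp f" by blast
    obtain \<zeta>' where z: "\<zeta>' \<in> set mus" "\<nu> \<zeta> ^ (N - 1) = \<nu> \<zeta>'" using pwr[OF x(1)] by blast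
    \<comment> \<open>The list \<open>mus\<close> is known to be closed under products only; since
      \<open>N\<close> kills it, inverses are obtained as powers.\<close>
    have "\<nu> \<zeta> * \<nu> \<zeta> ^ (N - 1) = 1" using mus_torsion[OF x(1)] N_pos by (simp flip: power_Suc)
    hence "inverse (\<nu> \<zeta>) = \<nu> \<zeta>'" using z(2) by (metis inverse_unique)
    thus "inverse x \<in> ?A" using z(1) by (auto simp: x zprod_minus[symmetric])
  qed
  moreover have "\<nu> ` set gens \<subseteq> ?A"
  proof
    fix x assume "x \<in> \<nu> ` set gens"
    then consider b where "b \<in> set mus" "x = \<nu> b" | i where "i < length gams" "x = \<nu> (get gams i)"
      by (auto simp: in_set_conv_nth get_nth)
    thus "x \<in> ?A"
    proof cases
      case 1
      show ?thesis by (rule CollectI, rule bexI[OF _ 1(1)], rule exI[of _ "\<lambda>_. 0"]) (simp add: 1(2))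
    next
      case 2
      obtain \<zeta> where \<zeta>: "\<zeta> \<in> set mus" "\<nu> \<zeta> = 1" using one by blast
      show ?thesis
        by (rule CollectI, rule bexI[OF _ \<zeta>(1)], rule exI[of _ "\<lambda>j. if j = i then 1 else 0"])
           (use 2 \<zeta>(2) zprod_single[of "{..<length gams}" i "\<lambda>i. \<nu> (get gams i)"] in simp)
    qed
  qed
  ultimately have "grp gens \<subseteq> ?A" unfolding grp_def by (intro hull_minimal)
  thus ?thesis using assms by blast
qed

lemma indep: "indep_mod_torsion {..<length gams} (\<lambda>i. \<nu> (get gams i))"
  using indep_of_cert[of gams] data gam_nz unfolding group_data_def by auto

lemma mus_in_torsion: "\<zeta> \<in> set mus \<Longrightarrow> \<nu> \<zeta> \<in> torsion"
  using mus_torsion N_pos by (auto simp: torsion_def)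

lemma gens_mod: "gens_mod_torsion (grp gens) {..<length gams} (\<lambda>i. \<nu> (get gams i))"
  unfolding gens_mod_torsion_def
proof (intro conjI ballI)
  fix x assume "x \<in> grp gens"
  then obtain \<zeta> f where "\<zeta> \<in> set mus" "x = \<nu> \<zeta> * zp f" using represent by blast
  thus "\<exists>f. x / zp f \<in> torsion"
    using mus_in_torsion zprod_nonzero[of "{..<length gams}" "\<lambda>i. \<nu> (get gams i)" f] gam_nz
    by (intro exI[of _ f]) simp
qed (simp_all add: gam_mem del: lessThan_iff)

lemma zp_torsion: "zp f \<in> torsion \<Longrightarrow> zp f = 1"
proof -
  assume "zp f \<in> torsion"
  hence "\<forall>i\<in>{..<length gams}. f i = 0" using indep unfolding indep_mod_torsion_def by blast
  hence "zp f = zp (\<lambda>_. 0)" by (intro zprod_cong) simp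
  thus ?thesis by simp
qed

text \<open>Supplies the hypothesis of \<open>iso_sound\<close> on infinitely divisible elements:
  such an element is torsion, so the independent part in its representation is torsion too and hence
  1.\<close>

lemma divisible_mus:
  assumes "\<And>m. \<exists>v\<in>grp gens. x = v ^ (p ^ m)"
  shows "x \<in> \<nu> ` set mus"
proof -
  have tor: "x \<in> torsion"
    by (rule infinitely_divisible_torsion[OF gens_mod indep mult_subgroupD(1)[OF Gam] p_ge_2 assms])
  have "x \<in> grp gens" using assms[of 0] by auto
  then obtain \<zeta> f where x: "\<zeta> \<in> set mus" "x = \<nu> \<zeta> * zp f" using represent by blast
  have "zp f = x / \<nu> \<zeta>" using x mus_nz by simp
  also have "\<dots> \<in> torsion" by (rule mult_subgroup_divide[OF torsion_subgroup tor mus_in_torsion[OF x(1)]])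
  finally have "zp f = 1" by (rule zp_torsion)
  thus ?thesis using x by simp
qed

text \<open>If \<open>x\<close> were in \<open>G\<close>, it would be \<open>h * u ^ N\<close> for
  some representative \<open>h\<close>. Comparison with the witness for this \<open>h\<close> makes
  \<open>\<zeta>\<close> times the product an \<open>N\<close>-th power; independence then forces
  \<open>\<zeta>\<close> to be 1 and all exponents to be multiples of \<open>N\<close>.\<close>

lemma not_in_sound:
  assumes "cert_notin mus gams N H x"
  shows "\<nu> x \<notin> grp gs"
proof
  assume x: "\<nu> x \<in> grp gs"
  let ?H = "(\<lambda>s. s ^ N) ` grp gens"
  have "\<exists>t'\<in>\<nu> ` set H. \<exists>h\<in>?H. 1 * \<nu> x = t' * h"
  proof (rule reps_all[OF gs0 mult_subgroup_powers[OF Gam]])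
    show "\<nu> x \<in> mult_subgroup hull \<nu> ` set gs" using x by (simp add: grp_def)
    obtain h where "h \<in> set H" "\<nu> h = 1" using data unfolding group_data_def by auto
    thus "1 \<in> \<nu> ` set H" by force
    fix a assume "a \<in> mult_subgroup hull \<nu> ` set gs"
    hence "a \<in> grp gens" using G_Gam by (auto simp: grp_def)
    thus "\<exists>k>0. a ^ k \<in> ?H" using N_pos by blast
  next
    fix t b assume "t \<in> \<nu> ` set H" "b \<in> \<nu> ` set gs"
    then obtain h g where hg: "h \<in> set H" "t = \<nu> h" "g \<in> set gs" "b = \<nu> g" by blast
    have "\<forall>h\<in>set H. \<forall>g\<in>set gs. \<exists>h' s. h' \<in> set H \<and> in_grp (mus @ gams) s \<and> \<nu> (ml h g) = \<nu> (ml h' (pw s N))"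
      using data unfolding group_data_def by argo
    then obtain h' s where "h' \<in> set H" "\<nu> s \<in> grp gens" "\<nu> h * \<nu> g = \<nu> h' * \<nu> s ^ N"
      using hg(1,3) unfolding in_Gam \<nu>_ml \<nu>_pw by blast
    thus "\<exists>t'\<in>\<nu> ` set H. \<exists>h\<in>?H. t * b = t' * h" using hg by blast
  qed
  then obtain h u where h: "h \<in> set H" "u \<in> grp gens" "\<nu> x = \<nu> h * u ^ N" by auto
  obtain s \<zeta> ev where s: "\<nu> s \<in> grp gens" "\<zeta> \<in> set mus" "\<nu> x * \<nu> s ^ N = \<nu> h * (\<nu> \<zeta> * \<nu> (gpw gams ev))"
    and bad: "\<nu> \<zeta> \<noteq> 1 \<or> (\<exists>i<length gams. \<forall>c<Suc (get ev i). get ev i \<noteq> N * c)"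
    using assms h(1) unfolding cert_notin_def in_Gam \<nu>_ml \<nu>_pw \<nu>_z1 by blast
  have h0: "\<nu> h \<noteq> 0" using h(3) x mult_subgroupD(5)[OF G x] by auto
  obtain \<zeta>' f where f: "\<zeta>' \<in> set mus" "u * \<nu> s = \<nu> \<zeta>' * zp f"
    using represent[OF mult_subgroupD(3)[OF Gam h(2) s(1)]] by blast
  have nz: "zp f \<noteq> 0" for f using zprod_nonzero[of "{..<length gams}" "\<lambda>i. \<nu> (get gams i)" f] gam_nz by simp
  have "\<nu> h * (u * \<nu> s) ^ N = \<nu> h * (\<nu> \<zeta> * \<nu> (gpw gams ev))"
    using s(3) unfolding h(3) by (simp add: power_mult_distrib mult.assoc)
  hence "(u * \<nu> s) ^ N = \<nu> \<zeta> * \<nu> (gpw gams ev)" using h0 by simp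
  hence eq: "zp (\<lambda>i. f i * int N) = \<nu> \<zeta> * zp (\<lambda>i. int (get ev i))"
    unfolding f(2) \<nu>_gpw zprod_mult by (simp add: power_mult_distrib mus_torsion[OF f(1)])
  have "zp (\<lambda>i. f i * int N + - int (get ev i)) = zp (\<lambda>i. f i * int N) * zp (\<lambda>i. - int (get ev i))"
    using gam_nz by (intro zprod_add) simp
  also have "\<dots> = \<nu> \<zeta>" unfolding eq zprod_minus using nz by simp
  finally have z: "zp (\<lambda>i. f i * int N + - int (get ev i)) = \<nu> \<zeta>" .
  hence t: "zp (\<lambda>i. f i * int N + - int (get ev i)) \<in> torsion" using mus_in_torsion[OF s(2)] by simp
  have "\<nu> \<zeta> = 1" using zp_torsion[OF t] z by simp
  moreover have "\<exists>c<Suc (get ev i). get ev i = N * c" if i: "i < length gams" for i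
  proof -
    have "f i * int N + - int (get ev i) = 0" using indep t i unfolding indep_mod_torsion_def by blast
    hence "int N dvd int (get ev i)" by (metis add.right_inverse add_right_cancel dvd_triv_right minus_equation_iff neg_eq_iff_add_eq_0 add.commute minus_minus)
    hence "N dvd get ev i" by simp
    then obtain c where c: "get ev i = N * c" by (elim dvdE)
    moreover have "1 * c \<le> N * c" using N_pos by (intro mult_right_mono) simp_all
    ultimately have "c < Suc (get ev i)" by (simp only: mult_1 less_Suc_eq_le)
    thus ?thesis using c by blast
  qed
  ultimately show False using bad by blast
qed

text \<open>The moving points after unrolling are \<open>q\<close>-th powers. The relation certified
  for generators is multiplicative and so extends to the whole group.\<close>

lemma power_class:
  assumes "x \<in> grp gens"
  shows "(x ^ q) ^ q / x ^ q \<in> grp gs"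
proof -
  let ?A = "{x \<in> grp gens. (x ^ q) ^ q / x ^ q \<in> grp gs}"
  note D = mult_subgroupD[OF Gam] and E = mult_subgroupD[OF G]
  have "mult_subgroup ?A"
  proof (rule mult_subgroupI)
    fix x y assume "x \<in> ?A" "y \<in> ?A"
    moreover have "((x * y) ^ q) ^ q / (x * y) ^ q = ((x ^ q) ^ q / x ^ q) * ((y ^ q) ^ q / y ^ q)"
      by (simp add: power_mult_distrib)
    ultimately show "x * y \<in> ?A" using D(3) E(3) by (simp del: times_divide_times_eq times_divide_eq_left times_divide_eq_right)
  next
    fix x assume x: "x \<in> ?A"
    have "(inverse x ^ q) ^ q / inverse x ^ q = inverse ((x ^ q) ^ q / x ^ q)"
      by (simp add: power_inverse field_simps)
    also have "\<dots> \<in> grp gs" by (rule E(4)) (use x in blast)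
    finally show "inverse x \<in> ?A" using x D(4) by blast
  qed (use D E in auto)
  moreover have "\<nu> ` set gens \<subseteq> ?A"
  proof
    fix x assume "x \<in> \<nu> ` set gens"
    then obtain b where b: "b \<in> set gens" "x = \<nu> b" by blast
    have "\<forall>b\<in>set gens. \<exists>g. in_grp gs g \<and> \<nu> (pw b (p ^ e * p ^ e)) = \<nu> (ml (pw b (p ^ e)) g)"
      using data unfolding group_data_def by argo
    then obtain g where g: "\<nu> g \<in> grp gs" "\<nu> b ^ (q * q) = \<nu> b ^ q * \<nu> g"
      using b(1) unfolding in_G \<nu>_ml \<nu>_pw by blast
    have "x \<in> grp gens" using grp_gen[OF b(1)] b(2) by simp
    moreover from this have "x \<noteq> 0" by (rule D(5))
    ultimately show "x \<in> ?A" using g b(2) by (simp add: power_mult)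
  qed
  ultimately have "grp gens \<subseteq> ?A" unfolding grp_def[of gens] by (intro hull_minimal)
  thus ?thesis using assms by blast
qed

lemma coset_reps:
  assumes "x \<in> grp gens"
  shows "\<exists>r\<in>set R. \<exists>g\<in>grp gs. x = \<nu> r * g"
proof -
  have "\<exists>t'\<in>\<nu> ` set R. \<exists>h\<in>grp gs. 1 * x = t' * h"
  proof (rule reps_all[OF gens0 G])
    show "x \<in> mult_subgroup hull \<nu> ` set gens" using assms by (simp add: grp_def)
    obtain r where "r \<in> set R" "\<nu> r = 1" using data unfolding group_data_def by auto
    thus "1 \<in> \<nu> ` set R" by force
    fix a assume "a \<in> mult_subgroup hull \<nu> ` set gens"
    thus "\<exists>k>0. a ^ k \<in> grp gs" using Gam_root by (auto simp: grp_def[of gens] root_closure_def)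
  next
    fix t b assume "t \<in> \<nu> ` set R" "b \<in> \<nu> ` set gens"
    then obtain r c where rc: "r \<in> set R" "t = \<nu> r" "c \<in> set gens" "b = \<nu> c" by blast
    have "\<forall>r\<in>set R. \<forall>b\<in>set gens. \<exists>r' g. r' \<in> set R \<and> in_grp gs g \<and> \<nu> (ml r b) = \<nu> (ml r' g)"
      using data unfolding group_data_def by argo
    then obtain r' g where "r' \<in> set R" "\<nu> g \<in> grp gs" "\<nu> r * \<nu> c = \<nu> r' * \<nu> g"
      using rc(1,3) unfolding in_G \<nu>_ml by blast
    thus "\<exists>t'\<in>\<nu> ` set R. \<exists>h\<in>grp gs. t * b = t' * h" using rc by blast
  qed
  thus ?thesis by auto
qed

text \<open>The covering over the larger group gives a factor \<open>\<sigma>\<close> there; its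
  part in \<open>R\<close> moves into the leading vector and leaves a factor over \<open>G\<close>.
  The unrolled piece containing \<open>x\<close> has constant class modulo \<open>G\<close>, which
  is trivial because \<open>x\<close> is over \<open>G\<close>, so no coordinate of it can be
  certified to lie outside.\<close>

lemma final_cover:
  assumes der: "derivable (covstep (n, e, mus, gams)) (rows, D)" and fin: "cov_final n e mus gams N H R D ds"
    and x: "x \<in> sols n rows" "\<And>i. i \<le> n \<Longrightarrow> x i \<in> grp gs"
  shows "\<exists>d\<in>set ds. x \<in> dset n q (grp gs) d"
proof -
  have "covers n q (grp gens) rows D"
    by (rule derivable_covers[OF gens0 e_pos divisible_mus der])
  then obtain d where d: "d \<in> set D" "x \<in> dset n q (grp gens) d"
    using x G_Gam unfolding covers_def by blast
  let ?E = "snd (snd d)" and ?vs = "map (val n) (fst (snd d))"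
  obtain ls \<sigma> where ls: "length ls = length ?vs" and \<sigma>: "\<And>i. i \<le> n \<Longrightarrow> \<sigma> i \<in> grp gens"
    "\<And>z. z \<in> set ?E \<Longrightarrow> \<sigma> (fst z) = \<sigma> (snd z)"
    and xi: "\<And>i. i \<le> n \<Longrightarrow> x i = val n (fst d) i * orb q ?vs ls i * \<sigma> i"
    using d(2) unfolding dset_def by (rule orbit_setE) blast
  have E: "fst z \<le> n \<and> snd z \<le> n" if "z \<in> set ?E" for z using fin[unfolded cov_final_def, rule_format, OF d(1), THEN conjunct1] that by (simp add: less_Suc_eq_le)
  obtain r g where rg: "\<And>y. y \<in> grp gens \<Longrightarrow> r y \<in> set R \<and> g y \<in> grp gs \<and> y = \<nu> (r y) * g y"
    using coset_reps by metis
  define \<tau> where "\<tau> = tab n (\<lambda>i. r (\<sigma> i))"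
  have \<tau>: "get \<tau> i = r (\<sigma> i)" if "i \<le> n" for i using that by (simp add: \<tau>_def)
  have "\<tau> \<in> set (List.n_lists (Suc n) R)"
    using rg \<sigma>(1) by (auto simp: set_n_lists \<tau>_def tab_def less_Suc_eq_le simp del: upt_Suc)
  moreover have "\<not> (\<exists>z\<in>set ?E. \<nu> (get \<tau> (fst z)) \<noteq> \<nu> (get \<tau> (snd z)))" using E \<sigma>(2) \<tau> by simp
  ultimately have un: "(fst w, snd w, ?E) \<in> set ds \<or> (\<exists>i<Suc n. cert_notin mus gams N H (get (vprd n (fst w) (snd w)) i))"
    if "w \<in> set (unroll n q (vmul n (fst d) \<tau>) (fst (snd d)))" for w
    using fin d(1) that unfolding cov_final_def by blast
  obtain w ks where w: "w \<in> set (unroll n q (vmul n (fst d) \<tau>) (fst (snd d)))" and ks: "length ks = length (snd w)"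
    and weq: "\<forall>i. val n (vmul n (fst d) \<tau>) i * orb q (map (val n) []) [] i * orb q ?vs ls i
         = val n (fst w) i * orb q (map (val n) (snd w)) ks i"
    using unroll_covers[OF q_pos, of "vmul n (fst d) \<tau>" "[]" "[(vmul n (fst d) \<tau>, [])]" "[]" ls "fst (snd d)" n] ls
    unfolding unroll_def by auto
  have xw: "x i = val n (fst w) i * orb q (map (val n) (snd w)) ks i * g (\<sigma> i)" if i: "i \<le> n" for i
  proof -
    have "\<sigma> i = val n \<tau> i * g (\<sigma> i)" using rg[OF \<sigma>(1)[OF i]] i by (simp add: val_def \<tau>)
    hence "x i = val n (fst d) i * val n \<tau> i * orb q ?vs ls i * g (\<sigma> i)" using xi[OF i] by (simp add: mult_ac)
    thus ?thesis using weq by (simp add: val_vmul)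
  qed
  obtain us where us: "snd w = map (\<lambda>v. vpw n v q) us" "set us \<subseteq> set (fst (snd d))"
    using unroll_origin[OF q_pos w[unfolded unroll_def]] by auto
  have inG: "\<forall>v\<in>set (fst (snd d)). \<forall>i<Suc n. in_grp (mus @ gams) (get v i)"
    using fin d(1) unfolding cov_final_def by blast
  have xnz: "x i \<noteq> 0" if "i \<le> n" for i by (rule mult_subgroupD(5)[OF G x(2)[OF that]])
  have vG: "val n (vprd n (fst w) (snd w)) i \<in> grp gs" if i: "i \<le> n" for i
  proof -
    have gi: "g (\<sigma> i) \<in> grp gs" using rg[OF \<sigma>(1)[OF i]] by blast
    have "val n (fst w) i * orb q (map (val n) (snd w)) ks i = x i / g (\<sigma> i)"
      using xw[OF i] mult_subgroupD(5)[OF G gi] by simp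
    also have "\<dots> \<in> grp gs" by (rule mult_subgroup_divide[OF G x(2)[OF i] gi])
    finally have a: "val n (fst w) i * orb q (map (val n) (snd w)) ks i \<in> grp gs" .
    have cls: "v i \<noteq> 0 \<and> v i ^ q / v i \<in> grp gs" if mv: "v \<in> set (map (val n) (snd w))" for v
    proof -
      obtain u where u: "u \<in> set us" "v = val n (vpw n u q)"
        using mv unfolding us(1) set_map image_image by (elim imageE)
      have "in_grp (mus @ gams) (get u i)" using inG us(2) u(1) i by auto
      hence m: "val n u i \<in> grp gens" using i by (simp add: val_def in_Gam)
      have vi: "v i = val n u i ^ q" by (simp add: u(2) val_vpw[OF q_pos])
      show ?thesis using power_class[OF m] mult_subgroupD(5)[OF Gam m] unfolding vi by simp
    qed
    have "prod_list (map (\<lambda>v. v i) (map (val n) (snd w))) \<noteq> 0"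
      using cls by (force simp: prod_list_zero_iff)
    moreover have "orb q (map (val n) (snd w)) ks i / prod_list (map (\<lambda>v. v i) (map (val n) (snd w))) \<in> grp gs"
      by (rule orb_mod_group[OF G]) (rule cls, assumption, simp add: ks)
    ultimately show ?thesis using a unfolding val_vprd by (metis group_absorb[OF G])
  qed
  have "\<not> cert_notin mus gams N H (get (vprd n (fst w) (snd w)) i)" if "i < Suc n" for i
    using not_in_sound vG[of i] that by (auto simp: val_def)
  hence "(fst w, snd w, ?E) \<in> set ds" using un[OF w] by blast
  moreover have "x \<in> dset n q (grp gs) (fst w, snd w, ?E)"
    unfolding dset_def fst_conv snd_conv
    by (rule orbit_setI[of ks _ _ "\<lambda>i. g (\<sigma> i)"]) (use ks rg \<sigma> xw in simp_all)
  ultimately show ?thesis by blast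
qed

end


subsection \<open>Points with coordinates in a group\<close>

definition pt :: "nat \<Rightarrow> (nat \<Rightarrow> 'k::field) \<Rightarrow> 'k point" where
  "pt n x = ppoint (map x [0..<Suc n])"

lemma pt_cong: "(\<And>i. i \<le> n \<Longrightarrow> x i = y i) \<Longrightarrow> pt n x = pt n y"
  unfolding pt_def by (rule arg_cong[of _ _ ppoint], rule map_cong) auto

lemma ppoint_conv_pt: "length x = Suc n \<Longrightarrow> ppoint x = pt n (\<lambda>i. x ! i)"
  unfolding pt_def by (rule arg_cong[of _ _ ppoint], rule nth_equalityI) (auto simp del: upt_Suc)

lemma pt_eqD:
  assumes "pt n x = pt n y"
  obtains c where "c \<noteq> 0" "\<And>i. i \<le> n \<Longrightarrow> x i = c * y i"
proof -
  have "map x [0..<Suc n] \<in> pt n y" using ppoint_self[of "map x [0..<Suc n]"] assms by (simp only: pt_def)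
  then obtain c where c: "c \<noteq> 0" "map x [0..<Suc n] = map ((*) c) (map y [0..<Suc n])"
    by (auto simp: pt_def ppoint_def simp del: upt_Suc)
  have "x i = c * y i" if "i \<le> n" for i
    using c(2)[unfolded map_map map_eq_conv] that by (auto simp del: upt_Suc)
  thus ?thesis using c(1) that by blast
qed

lemma pmult_pt: "pmult (pt n x) (pt n y) = pt n (\<lambda>i. x i * y i)"
  unfolding pt_def pmult_ppoint
  by (rule arg_cong[of _ _ ppoint], rule nth_equalityI) (auto simp del: upt_Suc)

lemma ppower_pt: "ppower m (pt n x) = pt n (\<lambda>i. x i ^ m)"
  unfolding pt_def ppower_ppoint by (simp add: o_def del: upt_Suc)

lemma ppower_funpow_pt: "(ppower m ^^ l) (pt n x) = pt n (\<lambda>i. x i ^ (m ^ l))"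
  by (induction l) (simp_all add: ppower_pt mult.commute flip: power_mult)

lemma foldl_pmult_pt:
  "foldl pmult (pt n x) (map2 (\<lambda>l \<pi>. (ppower q ^^ l) \<pi>) ls (map (pt n) vs)) = pt n (\<lambda>i. x i * orb q vs ls i)"
proof (induction vs arbitrary: x ls)
  case (Cons v vs)
  thus ?case by (cases ls) (simp_all add: pmult_pt ppower_funpow_pt mult.assoc)
qed simp

lemma proj_over_iff:
  assumes "mult_subgroup G"
  shows "P \<in> proj_over n G \<longleftrightarrow> (\<exists>x. P = pt n x \<and> (\<forall>i\<le>n. x i \<in> G))"
proof
  assume "P \<in> proj_over n G"
  then obtain x where x: "P = ppoint x" "length x = Suc n" "set x \<subseteq> G"
    by (auto simp: proj_over_def hom_coords_def)
  hence "\<forall>i\<le>n. x ! i \<in> G" by (auto intro!: subsetD[OF x(3)] nth_mem)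
  thus "\<exists>x. P = pt n x \<and> (\<forall>i\<le>n. x i \<in> G)" using ppoint_conv_pt[OF x(2)] x(1) by blast
next
  assume "\<exists>x. P = pt n x \<and> (\<forall>i\<le>n. x i \<in> G)"
  then obtain x where x: "P = pt n x" "\<And>i. i \<le> n \<Longrightarrow> x i \<in> G" by blast
  have "hom_coords n (map x [0..<Suc n])"
    using mult_subgroupD(5)[OF assms x(2)[of 0]] unfolding hom_coords_def
    by (auto intro!: exI[of _ 0] simp: nth_append simp del: upt_Suc)
  thus "P \<in> proj_over n G"
    unfolding proj_over_def x(1) pt_def
    by (intro CollectI exI[of _ "map x [0..<Suc n]"]) (auto intro!: x(2) simp del: upt_Suc)
qed

lemma orbit_translates_pt:
  assumes G: "mult_subgroup G" and E: "E \<subseteq> {..n} \<times> {..n}"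
  shows "orbit_translates n q G (pt n v0) (map (pt n) vs) (equal_coords n E) = pt n ` orbit_set n q G v0 vs E"
proof (intro equalityI subsetI)
  fix P assume "P \<in> orbit_translates n q G (pt n v0) (map (pt n) vs) (equal_coords n E)"
  then obtain ls \<sigma> where ls: "length ls = length vs" and P: "P = pmult (pt n (\<lambda>i. v0 i * orb q vs ls i)) \<sigma>"
    and \<sigma>: "\<sigma> \<in> equal_coords n E" "\<sigma> \<in> proj_over n G"
    unfolding orbit_translates_def frob_orbit_def by (auto simp: foldl_pmult_pt)
  obtain x where x: "\<sigma> = pt n x" "\<And>i. i \<le> n \<Longrightarrow> x i \<in> G" using \<sigma>(2) unfolding proj_over_iff[OF G] by blast
  obtain y where y: "\<sigma> = ppoint y" "length y = Suc n" "\<forall>(i, j)\<in>E. y ! i = y ! j"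
    using \<sigma>(1) by (auto simp: equal_coords_def hom_coords_def)
  \<comment> \<open>The point has two coordinate vectors, \<open>x\<close> over \<open>G\<close> and
    \<open>y\<close> satisfying the equations. They are proportional, so \<open>x\<close> satisfies
    the equations as well.\<close>
  have "pt n x = pt n (\<lambda>i. y ! i)" using x(1) y(1) ppoint_conv_pt[OF y(2)] by simp
  then obtain c where c: "c \<noteq> 0" "\<And>i. i \<le> n \<Longrightarrow> x i = c * y ! i" by (rule pt_eqD) blast
  have xE: "x (fst z) = x (snd z)" if z: "z \<in> E" for z
  proof -
    have "fst z \<le> n" "snd z \<le> n" "y ! fst z = y ! snd z" using E y(3) z by auto
    thus ?thesis using c(2) by simp
  qed
  have "(\<lambda>i. v0 i * orb q vs ls i * x i) \<in> orbit_set n q G v0 vs E"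
    by (rule orbit_setI[OF ls x(2) xE]) simp_all
  thus "P \<in> pt n ` orbit_set n q G v0 vs E" unfolding P x(1) pmult_pt by (rule imageI)
next
  fix P assume "P \<in> pt n ` orbit_set n q G v0 vs E"
  then obtain x where P: "P = pt n x" and x: "x \<in> orbit_set n q G v0 vs E" by blast
  obtain ls \<sigma> where ls: "length ls = length vs" and \<sigma>: "\<And>i. i \<le> n \<Longrightarrow> \<sigma> i \<in> G" "\<And>z. z \<in> E \<Longrightarrow> \<sigma> (fst z) = \<sigma> (snd z)"
    and xi: "\<And>i. i \<le> n \<Longrightarrow> x i = v0 i * orb q vs ls i * \<sigma> i" by (rule orbit_setE[OF x]) blast
  have "P = pmult (pt n (\<lambda>i. v0 i * orb q vs ls i)) (pt n \<sigma>)" unfolding P pmult_pt by (rule pt_cong) (rule xi)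
  moreover have "pt n (\<lambda>i. v0 i * orb q vs ls i) \<in> frob_orbit q (pt n v0) (map (pt n) vs)"
    unfolding frob_orbit_def foldl_pmult_pt[symmetric] using ls by (intro CollectI exI[of _ ls]) simp
  moreover have "pt n \<sigma> \<in> proj_over n G" unfolding proj_over_iff[OF G] using \<sigma>(1) by blast
  moreover have "pt n \<sigma> \<in> equal_coords n E"
  proof -
    have "hom_coords n (map \<sigma> [0..<Suc n])"
      using mult_subgroupD(5)[OF G \<sigma>(1)[of 0]] unfolding hom_coords_def
      by (auto intro!: exI[of _ 0] simp: nth_append simp del: upt_Suc)
    moreover have "map \<sigma> [0..<Suc n] ! fst z = map \<sigma> [0..<Suc n] ! snd z" if "z \<in> E" for z
      using E \<sigma>(2)[OF that] that by (auto simp: less_Suc_eq_le simp del: upt_Suc)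
    ultimately show ?thesis unfolding equal_coords_def pt_def
      by (intro CollectI exI[of _ "map \<sigma> [0..<Suc n]"]) (auto simp del: upt_Suc)
  qed
  ultimately show "P \<in> orbit_translates n q G (pt n v0) (map (pt n) vs) (equal_coords n E)"
    unfolding orbit_translates_def by blast
qed

lemma (in named_field) variety_points:
  assumes G: "mult_subgroup G" "G \<subseteq> F" and rows: "\<And>r. r \<in> set rows \<Longrightarrow> length r = Suc n"
  shows "P \<in> linear_variety n (map \<nu> ` set rows) \<inter> proj_over n G \<longleftrightarrow>
    (\<exists>x\<in>sols n rows. P = pt n x \<and> (\<forall>i\<le>n. x i \<in> G))"
proof -
  have valr: "val n r i = map \<nu> r ! i" if "r \<in> set rows" "i \<le> n" for r i
    using rows[OF that(1)] that(2) by (simp add: val_def get_nth)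
  have sum: "(\<Sum>i\<le>n. val n r i * x i) = (\<Sum>i\<le>n. map \<nu> r ! i * x i)" if "r \<in> set rows" for r x
    by (rule sum.cong) (simp_all add: valr that)
  show ?thesis
  proof
    assume P: "P \<in> linear_variety n (map \<nu> ` set rows) \<inter> proj_over n G"
    then obtain x where x: "P = pt n x" "\<And>i. i \<le> n \<Longrightarrow> x i \<in> G" using proj_over_iff[OF G(1), of P n] by blast
    obtain y where y: "P = ppoint y" "length y = Suc n" "\<forall>a\<in>set rows. (\<Sum>i\<le>n. map \<nu> a ! i * y ! i) = 0"
      using P by (auto simp: linear_variety_def hom_coords_def)
    have "pt n x = pt n (\<lambda>i. y ! i)" using x(1) y(1) ppoint_conv_pt[OF y(2)] by simp
    then obtain c where c: "c \<noteq> 0" "\<And>i. i \<le> n \<Longrightarrow> x i = c * y ! i" by (rule pt_eqD) blast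
    define x' where "x' = (\<lambda>i. if i \<le> n then x i else 0)"
    have "x' \<in> sols n rows"
    proof (rule solsI)
      show "x' \<in> vecs n" using x(2) G(2) by (auto simp: vecs_def x'_def)
      fix a assume a: "a \<in> set rows"
      have "(\<Sum>i\<le>n. val n a i * x' i) = (\<Sum>i\<le>n. c * (map \<nu> a ! i * y ! i))"
        by (rule sum.cong) (simp_all add: valr[OF a] x'_def c(2))
      also have "\<dots> = 0" using y(3) a by (simp flip: sum_distrib_left)
      finally show "(\<Sum>i\<le>n. val n a i * x' i) = 0" .
    qed
    moreover have "P = pt n x'" unfolding x(1) by (rule pt_cong) (simp add: x'_def)
    ultimately show "\<exists>x\<in>sols n rows. P = pt n x \<and> (\<forall>i\<le>n. x i \<in> G)"
      using x(2) by (intro bexI[of _ x']) (simp_all add: x'_def)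
  next
    assume "\<exists>x\<in>sols n rows. P = pt n x \<and> (\<forall>i\<le>n. x i \<in> G)"
    then obtain x where x: "x \<in> sols n rows" "P = pt n x" "\<And>i. i \<le> n \<Longrightarrow> x i \<in> G" by blast
    have "hom_coords n (map x [0..<Suc n])"
      using mult_subgroupD(5)[OF G(1) x(3)[of 0]] unfolding hom_coords_def
      by (auto intro!: exI[of _ 0] simp: nth_append simp del: upt_Suc)
    moreover have "(\<Sum>i\<le>n. map \<nu> a ! i * map x [0..<Suc n] ! i) = 0" if a: "a \<in> set rows" for a
    proof -
      have "(\<Sum>i\<le>n. map \<nu> a ! i * map x [0..<Suc n] ! i) = (\<Sum>i\<le>n. map \<nu> a ! i * x i)"
        by (rule sum.cong) (auto simp del: upt_Suc)
      also have "\<dots> = (\<Sum>i\<le>n. val n a i * x i)" by (rule sum[OF a, symmetric])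
      also have "\<dots> = 0" using x(1) a by (simp add: sols_iff)
      finally show ?thesis .
    qed
    ultimately have "P \<in> linear_variety n (map \<nu> ` set rows)"
      unfolding linear_variety_def x(2) pt_def by (intro CollectI exI[of _ "map x [0..<Suc n]"]) auto
    thus "P \<in> linear_variety n (map \<nu> ` set rows) \<inter> proj_over n G"
      using proj_over_iff[OF G(1), of P n] x(2,3) by blast
  qed
qed

context certified_group
begin

text \<open>The two reductions behind \<open>descr_ok\<close> are carried out here:
  \<open>orb_up\<close> extends the tested exponents to all, then \<open>inc_general\<close> passes
  from factors with entries 0 and 1 to all factors over \<open>G\<close>.\<close>

lemma descr_sound:
  assumes d: "descr_ok n rows gs gens e d" and x: "x \<in> dset n q (grp gs) d"
  shows "\<exists>y\<in>sols n rows. pt n x = pt n y \<and> (\<forall>i\<le>n. y i \<in> grp gs)"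
proof -
  let ?v0 = "val n (fst d)" and ?vs = "map (val n) (fst (snd d))" and ?E = "set (snd (snd d))"
  have fin: "\<forall>ls\<in>set (List.n_lists (length (fst (snd d))) [0..<Suc n]). \<forall>\<chi>\<in>set (List.n_lists (Suc n) [z0, z1]).
        (\<exists>z\<in>?E. get \<chi> (fst z) \<noteq> get \<chi> (snd z)) \<or>
        (\<forall>a\<in>set rows. \<nu> (dot n a (vmul n (orbn n q (fst d) (fst (snd d)) ls) \<chi>)) = \<nu> z0)"
    and E: "\<forall>z\<in>?E. fst z < Suc n \<and> snd z < Suc n"
    and pr: "\<forall>i<Suc n. in_grp gs (get (vprd n (fst d) (fst (snd d))) i)"
    and vs: "\<forall>v\<in>set (fst (snd d)). length v = Suc n \<and> (\<forall>i<Suc n. in_grp gens (get v i)) \<and>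
        (\<forall>i<Suc n. \<exists>g. in_grp gs g \<and> \<nu> (pw (get v i) q) = \<nu> (ml (get v i) g))"
    using d unfolding descr_ok_def by argo+
  have inc: "inc n q (sols n rows) ?v0 ?vs ?E"
  proof (rule incI)
    fix ls :: "nat list" and \<sigma> :: "nat \<Rightarrow> 'k"
    assume ls: "length ls = length ?vs" and \<sigma>: "\<And>i. \<sigma> i = 0 \<or> \<sigma> i = 1" "\<And>z. z \<in> ?E \<Longrightarrow> \<sigma> (fst z) = \<sigma> (snd z)"
    define \<chi> where "\<chi> = tab n (\<lambda>i. if \<sigma> i = 0 then z0 else z1)"
    have \<chi>: "\<chi> \<in> set (List.n_lists (Suc n) [z0, z1])"
      by (auto simp: set_n_lists \<chi>_def tab_def simp del: upt_Suc)
    have \<chi>E: "\<not> (\<exists>z\<in>?E. get \<chi> (fst z) \<noteq> get \<chi> (snd z))"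
      using E \<sigma>(2) by (auto simp: \<chi>_def less_Suc_eq_le)
    have v\<chi>: "val n \<chi> i = \<sigma> i" if "i \<le> n" for i using that \<sigma>(1)[of i] by (auto simp: \<chi>_def val_tab)
    have "(\<lambda>i. (?v0 i * \<sigma> i) * orb q ?vs ls i) \<in> sols n rows"
    proof (rule orb_up[OF subsp_sols _ _ _ ls])
      have "\<sigma> i \<in> F" for i using \<sigma>(1)[of i] F_0 F_1 by auto
      thus v\<sigma>: "(\<lambda>i. ?v0 i * \<sigma> i) \<in> vecs n" by (simp add: vecs_def F_mult) (simp add: val_def)
      show "v \<in> vecs n" if "v \<in> set ?vs" for v using that val_vecs by auto
      fix ls :: "nat list" assume l: "length ls = length ?vs" "\<And>l. l \<in> set ls \<Longrightarrow> l \<le> n"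
      have mem: "ls \<in> set (List.n_lists (length (fst (snd d))) [0..<Suc n])"
        using l by (auto simp: set_n_lists less_Suc_eq_le simp del: upt_Suc)
      show "(\<lambda>i. (?v0 i * \<sigma> i) * orb q ?vs ls i) \<in> sols n rows"
      proof (rule solsI)
        show "(\<lambda>i. (?v0 i * \<sigma> i) * orb q ?vs ls i) \<in> vecs n"
          by (rule orb_vecs[OF v\<sigma>]) (use val_vecs in auto)
        fix a assume a: "a \<in> set rows"
        have "\<nu> (dot n a (vmul n (orbn n q (fst d) (fst (snd d)) ls) \<chi>)) = 0"
          using fin mem \<chi> \<chi>E a by (metis \<nu>_z0)
        moreover have "(\<Sum>i\<le>n. val n a i * (?v0 i * \<sigma> i * orb q ?vs ls i))
            = \<nu> (dot n a (vmul n (orbn n q (fst d) (fst (snd d)) ls) \<chi>))"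
          unfolding \<nu>_dot using l(1) by (intro sum.cong) (simp_all add: val_vmul val_orbn[OF q_pos] v\<chi> mult_ac)
        ultimately show "(\<Sum>i\<le>n. val n a i * (?v0 i * \<sigma> i * orb q ?vs ls i)) = 0" by simp
      qed
    qed
    thus "(\<lambda>i. ?v0 i * orb q ?vs ls i * \<sigma> i) \<in> sols n rows" by (simp add: mult_ac)
  qed
  obtain ls \<sigma> where ls: "length ls = length ?vs" and \<sigma>: "\<And>i. i \<le> n \<Longrightarrow> \<sigma> i \<in> grp gs" "\<And>z. z \<in> ?E \<Longrightarrow> \<sigma> (fst z) = \<sigma> (snd z)"
    and xi: "\<And>i. i \<le> n \<Longrightarrow> x i = ?v0 i * orb q ?vs ls i * \<sigma> i"
    by (rule orbit_setE[OF x[unfolded dset_def]]) blast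
  let ?y = "\<lambda>i. ?v0 i * orb q ?vs ls i * \<sigma> i"
  have y: "?y \<in> sols n rows"
    by (rule inc_general[OF subsp_sols inc val_vecs ls _ \<sigma>(2)]) (use \<sigma>(1) grp_subset_F[OF gs0] in blast)
  have "?y i \<in> grp gs" if i: "i \<le> n" for i
  proof (rule mult_subgroupD(3)[OF G _ \<sigma>(1)[OF i]])
    have cls: "v i \<noteq> 0 \<and> v i ^ q / v i \<in> grp gs" if v: "v \<in> set ?vs" for v
    proof -
      obtain u where u: "u \<in> set (fst (snd d))" "v = val n u" using v by auto
      have ui: "v i = \<nu> (get u i)" using i u(2) by (simp add: val_def)
      have u1: "\<nu> (get u i) \<in> grp gens" using vs u(1) i by (simp add: less_Suc_eq_le)
      have "\<exists>g. in_grp gs g \<and> \<nu> (pw (get u i) q) = \<nu> (ml (get u i) g)" using vs u(1) i by (simp add: less_Suc_eq_le)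
      then obtain g where "\<nu> g \<in> grp gs" "\<nu> (get u i) ^ q = \<nu> (get u i) * \<nu> g" unfolding in_G \<nu>_pw \<nu>_ml by blast
      thus ?thesis using mult_subgroupD(5)[OF Gam u1] unfolding ui by simp
    qed
    have nz: "prod_list (map (\<lambda>v. v i) ?vs) \<noteq> 0" using cls by (force simp: prod_list_zero_iff)
    have "val n (vprd n (fst d) (fst (snd d))) i \<in> grp gs" using pr i by (simp add: val_def less_Suc_eq_le)
    moreover have "orb q ?vs ls i / prod_list (map (\<lambda>v. v i) ?vs) \<in> grp gs"
      by (rule orb_mod_group[OF G _ ls]) (rule cls)
    ultimately show "?v0 i * orb q ?vs ls i \<in> grp gs"
      unfolding val_vprd using nz by (metis group_absorb[OF G])
  qed
  thus ?thesis using y by (intro bexI[of _ ?y]) (auto intro!: pt_cong xi)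
qed

end

theorem (in named_field) certified_sound:
  assumes gs0: "0 \<notin> \<nu> ` set gs" and rows: "\<And>r. r \<in> set rows \<Longrightarrow> length r = Suc n"
    and cert: "certified n rows gs e ds"
  shows "e > 0" "\<forall>d\<in>set ds. equations_in_range n d"
    "is_decomposition n (p ^ e) (mult_subgroup hull (\<nu> ` set gs)) (linear_variety n (map \<nu> ` set rows)) (denote n \<nu> ` set ds)"
proof -
  obtain mus gams D N H R where data: "group_data gs mus gams e N H R"
    and der: "derivable (covstep (n, e, mus, gams)) (rows, D)"
    and ok: "\<And>d. d \<in> set ds \<Longrightarrow> descr_ok n rows gs (mus @ gams) e d"
    and fin: "cov_final n e mus gams N H R D ds"
    using cert unfolding certified_def by blast
  interpret certified_group F p B S \<nu> ad ml z0 z1 bs gs mus gams e N H R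
    by unfold_locales (rule gs0, rule data)
  have E: "set (snd (snd d)) \<subseteq> {..n} \<times> {..n}" if "d \<in> set ds" for d
    using ok[OF that] unfolding descr_ok_def by (auto simp: less_Suc_eq_le)
  have len: "length (fst d) = Suc n" "length (fst (snd d)) \<le> n - 1" "\<And>v. v \<in> set (fst (snd d)) \<Longrightarrow> length v = Suc n"
    "\<And>i. i \<le> n \<Longrightarrow> \<nu> (get (fst d) i) \<in> grp gens"
    "\<And>v i. v \<in> set (fst (snd d)) \<Longrightarrow> i \<le> n \<Longrightarrow> \<nu> (get v i) \<in> grp gens" if "d \<in> set ds" for d
    using ok[OF that] unfolding descr_ok_def by (auto simp: less_Suc_eq_le)
  have ptv: "ppoint (map \<nu> v) = pt n (val n v)" if "length v = Suc n" for v
  proof -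
    have "ppoint (map \<nu> v) = pt n (\<lambda>i. map \<nu> v ! i)" by (rule ppoint_conv_pt) (simp add: that)
    also have "\<dots> = pt n (val n v)" by (rule pt_cong) (simp add: that val_def get_nth)
    finally show ?thesis .
  qed
  have den: "denote n \<nu> d = (pt n (val n (fst d)), map (pt n) (map (val n) (fst (snd d))), equal_coords n (set (snd (snd d))))"
    if "d \<in> set ds" for d
  proof -
    have "map (\<lambda>v. ppoint (map \<nu> v)) (fst (snd d)) = map (pt n) (map (val n) (fst (snd d)))"
      using len(3)[OF that] by (simp add: ptv)
    thus ?thesis using len(1)[OF that] by (cases d) (simp add: ptv)
  qed
  have tr: "(case denote n \<nu> d of (\<pi>0, \<pi>s, S) \<Rightarrow> orbit_translates n q (grp gs) \<pi>0 \<pi>s S) = pt n ` dset n q (grp gs) d"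
    if "d \<in> set ds" for d
    unfolding den[OF that] prod.case dset_def by (rule orbit_translates_pt[OF G E[OF that]])
  have root: "pt n (val n v) \<in> proj_over n (root_closure (grp gs))" if "\<And>i. i \<le> n \<Longrightarrow> \<nu> (get v i) \<in> grp gens" for v
    unfolding proj_over_iff[OF root_closure_subgroup[OF G]]
    using Gam_root that by (intro exI[of _ "val n v"]) (auto simp: val_def)
  show "e > 0" by (rule e_pos)
  show "\<forall>d\<in>set ds. equations_in_range n d"
  proof
    fix d assume "d \<in> set ds"
    from E[OF this] show "equations_in_range n d" by (cases d) simp
  qed
  show "is_decomposition n q (mult_subgroup hull (\<nu> ` set gs)) (linear_variety n (map \<nu> ` set rows)) (denote n \<nu> ` set ds)"
    unfolding is_decomposition_def grp_def[symmetric]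
  proof (intro conjI)
    show "\<forall>(\<pi>0, \<pi>s, S)\<in>denote n \<nu> ` set ds. \<pi>0 \<in> proj_over n (root_closure (grp gs)) \<and>
        set \<pi>s \<subseteq> proj_over n (root_closure (grp gs)) \<and> length \<pi>s \<le> n - 1 \<and> linear_subgroup n S"
    proof
      fix c assume "c \<in> denote n \<nu> ` set ds"
      then obtain d where d: "d \<in> set ds" "c = denote n \<nu> d" by blast
      have "linear_subgroup n (equal_coords n (set (snd (snd d))) :: 'k point set)"
        unfolding linear_subgroup_def using E[OF d(1)] by blast
      thus "case c of (\<pi>0, \<pi>s, S) \<Rightarrow> \<pi>0 \<in> proj_over n (root_closure (grp gs)) \<and>
        set \<pi>s \<subseteq> proj_over n (root_closure (grp gs)) \<and> length \<pi>s \<le> n - 1 \<and> linear_subgroup n S"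
        unfolding d(2) den[OF d(1)] prod.case
        using root[OF len(4)[OF d(1)]] root[OF len(5)[OF d(1)]] len(2)[OF d(1)] by auto
    qed
    show "linear_variety n (map \<nu> ` set rows) \<inter> proj_over n (grp gs) =
        (\<Union>(\<pi>0, \<pi>s, S)\<in>denote n \<nu> ` set ds. orbit_translates n q (grp gs) \<pi>0 \<pi>s S)" (is "?L = ?R")
    proof -
      have R: "P \<in> ?R \<longleftrightarrow> (\<exists>d\<in>set ds. P \<in> pt n ` dset n q (grp gs) d)" for P
      proof -
        have "P \<in> ?R \<longleftrightarrow> (\<exists>d\<in>set ds. P \<in> (case denote n \<nu> d of (\<pi>0, \<pi>s, S) \<Rightarrow> orbit_translates n q (grp gs) \<pi>0 \<pi>s S))"
          by (simp only: UN_iff bex_simps)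
        also have "\<dots> \<longleftrightarrow> (\<exists>d\<in>set ds. P \<in> pt n ` dset n q (grp gs) d)" using tr by (intro bex_cong) simp_all
        finally show ?thesis .
      qed
      have L: "P \<in> ?L \<longleftrightarrow> (\<exists>x\<in>sols n rows. P = pt n x \<and> (\<forall>i\<le>n. x i \<in> grp gs))" for P
        by (rule variety_points[OF G grp_subset_F[OF gs0]]) (rule rows)
      show ?thesis
      proof (intro equalityI subsetI)
        fix P assume "P \<in> ?L"
        then obtain x where x: "x \<in> sols n rows" "P = pt n x" "\<forall>i\<le>n. x i \<in> grp gs" unfolding L by blast
        obtain d where d: "d \<in> set ds" "x \<in> dset n q (grp gs) d" using final_cover[OF der fin x(1)] x(3) by blast
        show "P \<in> ?R" unfolding R x(2) by (rule bexI[OF _ d(1)], rule imageI, rule d(2))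
      next
        fix P assume "P \<in> ?R"
        then obtain d x where d: "d \<in> set ds" "P = pt n x" "x \<in> dset n q (grp gs) d" unfolding R by blast
        from descr_sound[OF ok[OF d(1)] d(3)] show "P \<in> ?L" unfolding L d(2) by blast
      qed
    qed
  qed simp
qed


subsection \<open>Existence of certificates\<close>

lemma uniform_exponent:
  assumes H: "mult_subgroup H"
  shows "finite B \<Longrightarrow> (\<And>b. b \<in> B \<Longrightarrow> \<exists>k>0. b ^ k \<in> H) \<Longrightarrow> \<exists>N>0. \<forall>b\<in>B. b ^ N \<in> H"
proof (induction B rule: finite_induct)
  case (insert b B)
  obtain k where k: "k > 0" "b ^ k \<in> H" using insert.prems[of b] by auto
  have "\<exists>N>0. \<forall>b\<in>B. b ^ N \<in> H" by (rule insert.IH) (use insert.prems in simp)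
  then obtain N where N: "N > 0" "\<forall>b\<in>B. b ^ N \<in> H" by blast
  have "c ^ (k * N) \<in> H" if "c \<in> insert b B" for c
  proof (cases "c = b")
    case True
    show ?thesis using mult_subgroup_power[OF H k(2), of N] by (simp add: True flip: power_mult)
  next
    case False
    hence "c ^ N \<in> H" using that N(2) by simp
    thus ?thesis using mult_subgroup_power[OF H, of "c ^ N" k] by (simp add: mult.commute flip: power_mult)
  qed
  thus ?case using k N by (intro exI[of _ "k * N"]) simp
qed (auto intro: exI[of _ 1])

lemma uniform_exponent_hull:
  assumes H: "mult_subgroup H" and B: "0 \<notin> B" "\<And>b. b \<in> B \<Longrightarrow> b ^ N \<in> H" and x: "x \<in> mult_subgroup hull B"
  shows "x ^ N \<in> H"
proof -
  let ?A = "{x. x \<noteq> 0 \<and> x ^ N \<in> H}"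
  have "mult_subgroup ?A"
    by (rule mult_subgroupI) (use mult_subgroupD[OF H] in \<open>auto simp: power_mult_distrib power_inverse\<close>)
  moreover have "B \<subseteq> ?A" using B by auto
  ultimately have "mult_subgroup hull B \<subseteq> ?A" by (intro hull_minimal)
  thus ?thesis using x by blast
qed

text \<open>The powers of \<open>p\<close> modulo \<open>N\<close> become periodic, and an exponent
  that is a multiple of the period and lies beyond the preperiod gives an idempotent
  residue.\<close>

lemma power_eventually_idempotent:
  fixes p N :: nat
  assumes "p > 0" "N > 0"
  shows "\<exists>e>0. \<exists>c. p ^ e * p ^ e = p ^ e + N * c"
proof -
  have "(\<lambda>a. p ^ a mod N) ` UNIV \<subseteq> {..<N}" using assms by auto
  hence "finite ((\<lambda>a. p ^ a mod N) ` UNIV)" by (rule finite_subset) simp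
  hence "\<not> inj (\<lambda>a. p ^ a mod N)" using infinite_UNIV_nat finite_imageD by blast
  then obtain a b where "a \<noteq> b" "p ^ a mod N = p ^ b mod N" by (auto simp: inj_def)
  hence "\<exists>a d. 0 < d \<and> p ^ (a + d) mod N = p ^ a mod N"
  proof (cases a b rule: linorder_cases)
    case less
    thus ?thesis using \<open>p ^ a mod N = p ^ b mod N\<close> by (intro exI[of _ a] exI[of _ "b - a"]) simp
  next
    case greater
    thus ?thesis using \<open>p ^ a mod N = p ^ b mod N\<close> by (intro exI[of _ b] exI[of _ "a - b"]) simp
  qed simp
  then obtain a d where d: "0 < d" "p ^ (a + d) mod N = p ^ a mod N" by blast
  have step: "p ^ (a + m + d) mod N = p ^ (a + m) mod N" for m
  proof -
    have "p ^ (a + m + d) mod N = (p ^ m * (p ^ (a + d) mod N)) mod N"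
      unfolding mod_mult_right_eq by (simp add: power_add mult_ac)
    also have "\<dots> = p ^ (a + m) mod N" unfolding d(2) mod_mult_right_eq by (simp add: power_add mult_ac)
    finally show ?thesis .
  qed
  have many: "p ^ (a + m + j * d) mod N = p ^ (a + m) mod N" for m j
  proof (induction j)
    case (Suc j)
    have "p ^ (a + m + Suc j * d) mod N = p ^ (a + (m + j * d) + d) mod N" by (simp add: add_ac)
    thus ?case unfolding step using Suc by (simp add: add_ac)
  qed simp
  \<comment> \<open>A positive multiple of the period \<open>d\<close> that is at least
    \<open>a\<close>.\<close>
  let ?e = "Suc a * d"
  have ae: "a \<le> ?e" using d(1) by (cases d) auto
  have "p ^ (?e + ?e) mod N = p ^ ?e mod N" using many[of "?e - a" "Suc a"] ae by simp
  moreover have "p ^ ?e \<le> p ^ (?e + ?e)" using assms(1) by (simp add: power_add)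
  ultimately have "N dvd p ^ (?e + ?e) - p ^ ?e" using mod_eq_dvd_iff_nat by blast
  then obtain c where "p ^ (?e + ?e) - p ^ ?e = N * c" by (elim dvdE)
  hence "p ^ (?e + ?e) = p ^ ?e + N * c" using \<open>p ^ ?e \<le> p ^ (?e + ?e)\<close> by linarith
  hence "p ^ ?e * p ^ ?e = p ^ ?e + N * c" by (simp only: power_add)
  thus ?thesis using d(1) by (intro exI[of _ ?e]) auto
qed

section \<open>Completeness of certificates\<close>

locale closed_group = named_field F p B S \<nu> ad ml z0 z1 bs
  for F :: "'k::field set" and p B S \<nu> ad ml z0 z1 bs +
  fixes gs :: "nat list" and ts as :: "'k list" and N e c :: nat
  assumes gs0: "0 \<notin> \<nu> ` set gs" and GamF: "root_closure (grp gs) \<subseteq> F"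
    and ts: "set ts = torsion \<inter> root_closure (grp gs)"
    and as: "set as \<subseteq> root_closure (grp gs)" "gens_mod_torsion (root_closure (grp gs)) {..<length as} ((!) as)"
      "indep_mod_torsion {..<length as} ((!) as)"
    and N_pos: "N > 0" and powN: "\<And>x. x \<in> root_closure (grp gs) \<Longrightarrow> x ^ N \<in> grp gs"
    and torN: "\<And>x. x \<in> torsion \<inter> root_closure (grp gs) \<Longrightarrow> x ^ N = 1"
    and e_pos: "e > 0" and pe: "p ^ e * p ^ e = p ^ e + N * c"
begin

abbreviation "q \<equiv> p ^ e"
abbreviation "Gam \<equiv> root_closure (grp gs)"
definition "mus = map nm ts"
definition "gams = map nm as"

lemma G: "mult_subgroup (grp gs)"
  using mult_subgroup_hull[OF gs0] by (simp add: grp_def)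

lemma Gam: "mult_subgroup Gam"
  by (rule root_closure_subgroup[OF G])

lemma \<nu>_nm_Gam: "x \<in> Gam \<Longrightarrow> \<nu> (nm x) = x"
  by (rule \<nu>_nm) (use GamF in blast)

lemma mus: "\<nu> ` set mus = torsion \<inter> Gam"
proof -
  have "\<nu> ` set mus = (\<lambda>x. \<nu> (nm x)) ` set ts" by (simp add: mus_def image_image)
  also have "\<dots> = (\<lambda>x. x) ` set ts" by (rule image_cong) (simp_all add: ts \<nu>_nm_Gam)
  finally show ?thesis by (simp add: ts)
qed

lemma asG: "i < length as \<Longrightarrow> as ! i \<in> Gam"
  using as(1) nth_mem by blast

lemma length_gams [simp]: "length gams = length as"
  by (simp add: gams_def)

lemma \<nu>_gams: "i < length as \<Longrightarrow> \<nu> (get gams i) = as ! i"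
  by (simp add: gams_def get_nth \<nu>_nm_Gam asG)

lemma set_gams: "\<nu> ` set gams \<subseteq> Gam"
  using as(1) by (auto simp: gams_def \<nu>_nm_Gam subset_iff)

abbreviation "zp \<equiv> zprod {..<length as} ((!) as)"

lemma zpG: "zp f \<in> Gam"
  by (rule zprod_mem[OF Gam]) (simp add: asG)

lemma zp_nz: "zp f \<noteq> 0"
  by (rule mult_subgroupD(5)[OF Gam zpG])

lemma zp_add: "zp (\<lambda>i. f i + g i) = zp f * zp g"
  by (rule zprod_add) (use mult_subgroupD(5)[OF Gam asG] in simp)

lemma \<nu>_gpw_as: "\<nu> (gpw gams ev) = zp (\<lambda>i. int (get ev i))"
  unfolding \<nu>_gpw length_gams by (rule zprod_cong) (simp add: \<nu>_gams)

lemma rep: "x \<in> Gam \<Longrightarrow> \<exists>f. x / zp f \<in> torsion \<inter> Gam"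
  using as(2) mult_subgroup_divide[OF Gam _ zpG] unfolding gens_mod_torsion_def by blast

lemma gens0: "0 \<notin> \<nu> ` set (mus @ gams)"
  using mus set_gams mult_subgroupD(1)[OF Gam] by (auto simp: image_Un)

lemma grp_gens: "grp (mus @ gams) = Gam"
proof
  show "grp (mus @ gams) \<subseteq> Gam"
    unfolding grp_def[of "mus @ gams"] by (rule hull_minimal) (use mus set_gams Gam in auto)
  show "Gam \<subseteq> grp (mus @ gams)"
  proof
    fix x assume x: "x \<in> Gam"
    note D = mult_subgroup_hull[OF gens0, folded grp_def]
    obtain f where "x / zp f \<in> torsion \<inter> Gam" using rep[OF x] by blast
    hence "x / zp f \<in> \<nu> ` set mus" unfolding mus .
    then obtain b where "x / zp f = \<nu> b" "b \<in> set mus" by (rule imageE)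
    hence b: "b \<in> set mus" "\<nu> b = x / zp f" by simp_all
    have "\<nu> b \<in> grp (mus @ gams)" by (rule grp_gen) (use b in simp)
    moreover have "zp f \<in> grp (mus @ gams)"
    proof (rule zprod_mem[OF D])
      fix i assume "i \<in> {..<length as}"
      hence "nm (as ! i) \<in> set (mus @ gams)" "\<nu> (nm (as ! i)) = as ! i" by (simp_all add: gams_def \<nu>_nm_Gam asG)
      thus "as ! i \<in> grp (mus @ gams)" using grp_gen by metis
    qed
    ultimately have "\<nu> b * zp f \<in> grp (mus @ gams)" by (rule mult_subgroupD(3)[OF D])
    thus "x \<in> grp (mus @ gams)" using b(2) zp_nz by simp
  qed
qed

lemma in_Gam: "in_grp (mus @ gams) x \<longleftrightarrow> \<nu> x \<in> Gam"
  unfolding in_grp_iff[OF gens0] grp_gens ..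

lemma in_G: "in_grp gs x \<longleftrightarrow> \<nu> x \<in> grp gs"
  by (rule in_grp_iff[OF gs0])

lemma gen_Gam: "b \<in> set (mus @ gams) \<Longrightarrow> \<nu> b \<in> Gam"
  using grp_gen[of b "mus @ gams"] grp_gens by simp

lemma q_pos: "q > 0"
  using p_pos by simp

text \<open>For \<open>x\<close> in the radical the last factor is a power of an element of
  \<open>G\<close>, so \<open>x ^ q\<close> and its \<open>q\<close>-th power have the same class
  modulo \<open>G\<close>.\<close>

lemma frob_class: "(x :: 'k) ^ (q * q) = x ^ q * (x ^ N) ^ c"
  unfolding pe power_add power_mult ..

lemma tor_frob: "x \<in> torsion \<inter> Gam \<Longrightarrow> x ^ q = x"
proof -
  assume "x \<in> torsion \<inter> Gam"
  hence "(x ^ q) ^ q = x ^ q" using frob_class[of x] torN by (simp add: power_mult)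
  thus "x ^ q = x" by simp
qed

sublocale rooted: rooted_group F p B S \<nu> ad ml z0 z1 bs mus gams e
proof
  show "0 \<notin> \<nu> ` set (mus @ gams)" by (rule gens0)
  show "x \<in> grp (mus @ gams)" if "x ^ s \<in> grp (mus @ gams)" "s > 0" for x s
    using that root_closure_root unfolding grp_gens by blast
  show "torsion \<inter> grp (mus @ gams) \<subseteq> \<nu> ` set mus" unfolding grp_gens mus ..
  show "\<zeta> ^ q = \<zeta>" if "\<zeta> \<in> torsion \<inter> grp (mus @ gams)" for \<zeta>
    using that unfolding grp_gens by (rule tor_frob)
qed

text \<open>If the coordinates at basis elements other than 1 all vanish, the product is a
  \<open>p\<close>-th power. Its root lies in the radical, so by independence every exponent is
  divisible by \<open>p\<close>, and being below \<open>p\<close> it is 0.\<close>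

lemma indep_cert: "indep_cert gams"
  unfolding indep_cert_def
proof
  fix ev assume "ev \<in> set (List.n_lists (length gams) [0..<p])"
  hence ev: "length ev = length as" "\<And>k. k \<in> set ev \<Longrightarrow> k < p" by (auto simp: set_n_lists)
  define x where "x = \<nu> (gpw gams ev)"
  have xG: "x \<in> Gam" unfolding x_def \<nu>_gpw_as by (rule zpG)
  hence xF: "x \<in> F" using GamF by blast
  define cs where "cs = map (\<lambda>j. nm (coord x (\<nu> (get bs j)))) [0..<length bs]"
  have cs: "\<nu> (get cs j) = coord x (\<nu> (get bs j))" if "j < length bs" for j
    using that by (simp add: cs_def get_nth coord[OF xF])
  have eq: "x = \<nu> (sm (map (\<lambda>j. ml (pw (get cs j) p) (get bs j)) [0..<length bs]))"
  proof -
    have "\<nu> (sm (map (\<lambda>j. ml (pw (get cs j) p) (get bs j)) [0..<length bs]))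
        = (\<Sum>j<length bs. coord x (\<nu> (get bs j)) ^ p * \<nu> (get bs j))"
      unfolding \<nu>_sm map_map o_def \<nu>_ml \<nu>_pw sum_list_upt by (rule sum.cong) (simp_all add: cs)
    also have "\<dots> = (\<Sum>s\<in>S. coord x s ^ p * s)" by (rule sum_bs)
    finally show ?thesis using coord(2)[OF xF] by simp
  qed
  show "(\<forall>k\<in>set ev. k = 0) \<or> (\<exists>cs j. j < length bs \<and> \<nu> (get bs j) \<noteq> \<nu> z1 \<and> \<nu> (get cs j) \<noteq> \<nu> z0 \<and>
        \<nu> (gpw gams ev) = \<nu> (sm (map (\<lambda>j. ml (pw (get cs j) p) (get bs j)) [0..<length bs])))"
  proof (cases "\<exists>j<length bs. \<nu> (get bs j) \<noteq> 1 \<and> \<nu> (get cs j) \<noteq> 0")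
    case True
    thus ?thesis using eq unfolding x_def \<nu>_z0 \<nu>_z1 by blast
  next
    case False
    have z: "coord x s = 0" if s: "s \<in> S" "s \<noteq> 1" for s
    proof -
      obtain j where "j < length bs" "\<nu> (get bs j) = s"
        using s(1) bs(1) by (auto simp: in_set_conv_nth get_nth)
      thus ?thesis using False s(2) cs[of j] by auto
    qed
    define y where "y = (if 1 \<in> S then coord x 1 else 0)"
    have "x = (\<Sum>s\<in>S. if s = 1 then coord x 1 ^ p else 0)"
      using coord(2)[OF xF, symmetric] z p_pos by (subst (asm) sum.cong[OF refl, where h = "\<lambda>s. if s = 1 then coord x 1 ^ p else 0"]) (auto simp: power_0_left)
    also have "\<dots> = y ^ p" using p_pos finite_S by (simp add: y_def power_0_left)
    finally have yp: "y ^ p = x" ..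
    hence "y \<in> Gam" using root_closure_root[of y p] xG p_pos by simp
    then obtain f where f: "y / zp f \<in> torsion \<inter> Gam" using rep by blast
    have "zp (\<lambda>i. int (get ev i) + - (f i * int p)) = y ^ p / zp f ^ p"
      unfolding zp_add zprod_minus zprod_mult yp by (simp add: x_def \<nu>_gpw_as divide_inverse)
    also have "\<dots> = (y / zp f) ^ p" by (simp add: power_divide)
    also have "\<dots> \<in> torsion" using f mult_subgroup_power[OF torsion_subgroup] by blast
    finally have zero: "int (get ev i) + - (f i * int p) = 0" if "i < length as" for i
      using as(3) that unfolding indep_mod_torsion_def by blast
    have "k = 0" if k: "k \<in> set ev" for k
    proof -
      obtain i where i: "i < length as" "k = get ev i" using k ev(1) by (auto simp: in_set_conv_nth get_nth)
      have "int k = f i * int p" using zero[OF i(1)] i(2) by simp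
      hence "int p dvd int k" by simp
      hence "p dvd k" by simp
      thus ?thesis using ev(2)[OF k] by (metis dvd_imp_le gr0I not_le)
    qed
    thus ?thesis by blast
  qed
qed

lemma ex_lists:
  obtains H R where "set H \<noteq> {}" "\<And>h. h \<in> set H \<Longrightarrow> \<nu> h \<in> grp gs" "group_data gs mus gams e N H R"
    "\<And>r. r \<in> set R \<Longrightarrow> \<nu> r \<in> Gam"
proof -
  let ?P = "(\<lambda>s. s ^ N) ` Gam"
  have inG: "\<nu> ` set gs \<subseteq> grp gs" using grp_gen by blast
  have "\<exists>T. finite T \<and> T \<subseteq> mult_subgroup hull (\<nu> ` set gs) \<and> 1 \<in> T \<and>
      (\<forall>t\<in>T. \<forall>b\<in>\<nu> ` set gs. \<exists>t'\<in>T. \<exists>h\<in>?P. t * b = t' * h)"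
  proof (rule ex_reps[OF _ gs0 mult_subgroup_powers[OF Gam]])
    fix b assume "b \<in> \<nu> ` set gs"
    hence "b \<in> Gam" using inG root_closure_superset by blast
    thus "\<exists>k>0. b ^ k \<in> ?P" using N_pos by (intro exI[of _ N]) simp
  qed simp
  then obtain T where T: "finite T" "T \<subseteq> grp gs" "1 \<in> T" "\<forall>t\<in>T. \<forall>b\<in>\<nu> ` set gs. \<exists>t'\<in>T. \<exists>h\<in>?P. t * b = t' * h"
    unfolding grp_def by meson
  have "\<exists>T. finite T \<and> T \<subseteq> mult_subgroup hull (\<nu> ` set (mus @ gams)) \<and> 1 \<in> T \<and>
      (\<forall>t\<in>T. \<forall>b\<in>\<nu> ` set (mus @ gams). \<exists>t'\<in>T. \<exists>h\<in>grp gs. t * b = t' * h)"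
  proof (rule ex_reps[OF _ gens0 G])
    fix b assume "b \<in> \<nu> ` set (mus @ gams)"
    hence "b \<in> Gam" using gen_Gam by blast
    thus "\<exists>k>0. b ^ k \<in> grp gs" using powN N_pos by blast
  qed simp
  then obtain U where U: "finite U" "U \<subseteq> Gam" "1 \<in> U"
    "\<forall>t\<in>U. \<forall>b\<in>\<nu> ` set (mus @ gams). \<exists>t'\<in>U. \<exists>h\<in>grp gs. t * b = t' * h"
    unfolding grp_def[of "mus @ gams", symmetric] grp_gens by meson
  obtain h r where h: "set h = T" and r: "set r = U" using finite_list[OF T(1)] finite_list[OF U(1)] by blast
  have GG: "grp gs \<subseteq> Gam" by (rule root_closure_superset)
  have nT: "\<nu> (nm t) = t" if "t \<in> T" for t using that T(2) GG by (intro \<nu>_nm_Gam) blast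
  have nU: "\<nu> (nm t) = t" if "t \<in> U" for t using that U(2) by (intro \<nu>_nm_Gam) blast
  have nH: "\<nu> x \<in> T" if "x \<in> set (map nm h)" for x using that h nT by auto
  have nR: "\<nu> x \<in> U" if "x \<in> set (map nm r)" for x using that r nU by auto
  have "group_data gs mus gams e N (map nm h) (map nm r)"
    unfolding group_data_def
  proof (intro conjI ballI)
    show "0 < e" by (rule e_pos)
    show "0 < N" by (rule N_pos)
    show "\<nu> b \<noteq> \<nu> z0" if "b \<in> set (mus @ gams)" for b using mult_subgroupD(5)[OF Gam gen_Gam[OF that]] by simp
    show "in_grp (mus @ gams) g" if "g \<in> set gs" for g unfolding in_Gam using grp_gen[OF that] GG by blast
    show "\<exists>s. in_grp gs (pw b (Suc s))" if "b \<in> set (mus @ gams)" for b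
      using powN[OF gen_Gam[OF that]] N_pos unfolding in_G \<nu>_pw by (intro exI[of _ "N - 1"]) simp
    show "\<exists>\<zeta>\<in>set mus. \<nu> \<zeta> = \<nu> z1"
    proof -
      have "1 \<in> torsion \<inter> Gam" using mult_subgroupD(2)[OF Gam] mult_subgroupD(2)[OF torsion_subgroup[where 'k = 'k]] by simp
      thus ?thesis unfolding mus[symmetric] by auto
    qed
    show "\<exists>\<zeta>''\<in>set mus. \<nu> (ml \<zeta> \<zeta>') = \<nu> \<zeta>''" if "\<zeta> \<in> set mus" "\<zeta>' \<in> set mus" for \<zeta> \<zeta>'
    proof -
      have "\<nu> \<zeta> \<in> torsion \<inter> Gam" "\<nu> \<zeta>' \<in> torsion \<inter> Gam" using that mus by blast+
      hence "\<nu> \<zeta> * \<nu> \<zeta>' \<in> torsion \<inter> Gam"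
        using mult_subgroupD(3)[OF Gam] mult_subgroupD(3)[OF torsion_subgroup[where 'k = 'k]] by blast
      thus ?thesis unfolding mus[symmetric] \<nu>_ml by blast
    qed
    show "\<nu> (pw \<zeta> N) = \<nu> z1" if "\<zeta> \<in> set mus" for \<zeta>
    proof -
      have "\<nu> \<zeta> \<in> torsion \<inter> Gam" using that mus by blast
      thus ?thesis using torN by simp
    qed
    show "indep_cert gams" by (rule indep_cert)
    show "\<exists>g. in_grp gs g \<and> \<nu> (pw b (q * q)) = \<nu> (ml (pw b q) g)" if "b \<in> set (mus @ gams)" for b
    proof (rule exI[of _ "nm ((\<nu> b ^ N) ^ c)"])
      have "(\<nu> b ^ N) ^ c \<in> grp gs" by (rule mult_subgroup_power[OF G powN[OF gen_Gam[OF that]]])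
      thus "in_grp gs (nm ((\<nu> b ^ N) ^ c)) \<and> \<nu> (pw b (q * q)) = \<nu> (ml (pw b q) (nm ((\<nu> b ^ N) ^ c)))"
        unfolding in_G \<nu>_ml \<nu>_pw using GG frob_class[of "\<nu> b"] \<nu>_nm_Gam by auto
    qed
    show "\<exists>x\<in>set (map nm h). \<nu> x = \<nu> z1" using T(3) h nT by auto
    show "\<exists>h' s. h' \<in> set (map nm h) \<and> in_grp (mus @ gams) s \<and> \<nu> (ml x g) = \<nu> (ml h' (pw s N))"
      if "x \<in> set (map nm h)" "g \<in> set gs" for x g
    proof -
      from T(4)[THEN bspec, OF nH[OF that(1)], THEN bspec, of "\<nu> g"] that(2)
      obtain t' s where ts: "t' \<in> T" "s \<in> Gam" "\<nu> x * \<nu> g = t' * s ^ N" by auto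
      show ?thesis
        by (rule exI[of _ "nm t'"], rule exI[of _ "nm s"])
           (use ts h nT \<nu>_nm_Gam in \<open>simp add: in_Gam\<close>)
    qed
    show "\<exists>x\<in>set (map nm r). \<nu> x = \<nu> z1" using U(3) r nU by auto
    show "in_grp (mus @ gams) x" if "x \<in> set (map nm r)" for x unfolding in_Gam using nR[OF that] U(2) by blast
    show "\<exists>r' g. r' \<in> set (map nm r) \<and> in_grp gs g \<and> \<nu> (ml x b) = \<nu> (ml r' g)"
      if "x \<in> set (map nm r)" "b \<in> set (mus @ gams)" for x b
    proof -
      from U(4)[THEN bspec, OF nR[OF that(1)], THEN bspec, OF imageI[OF that(2)]]
      obtain t' g where ts: "t' \<in> U" "g \<in> grp gs" "\<nu> x * \<nu> b = t' * g" by auto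
      have "\<nu> (nm g) = g" using ts(2) GG \<nu>_nm_Gam by blast
      thus ?thesis
        by (intro exI[of _ "nm t'"] exI[of _ "nm g"])
           (use ts r nU in \<open>simp add: in_G\<close>)
    qed
  qed
  moreover have "set (map nm h) \<noteq> {}" using T(3) h by auto
  moreover have "\<nu> x \<in> grp gs" if "x \<in> set (map nm h)" for x using nH[OF that] T(2) by blast
  moreover have "\<nu> x \<in> Gam" if "x \<in> set (map nm r)" for x using nR[OF that] U(2) by blast
  ultimately show ?thesis using that by blast
qed

text \<open>The quotient of \<open>x\<close> by \<open>h\<close> is written as torsion times
  independent part. If the torsion part were 1 and all exponents multiples of \<open>N\<close>, the
  quotient would be an \<open>N\<close>-th power of a radical element and thus lie in
  \<open>G\<close>.\<close>

lemma cert_notin_complete: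
  assumes H: "\<And>h. h \<in> set H \<Longrightarrow> \<nu> h \<in> grp gs" and x: "\<nu> x \<in> Gam" "\<nu> x \<notin> grp gs"
  shows "cert_notin mus gams N H x"
  unfolding cert_notin_def
proof
  fix h assume h: "h \<in> set H"
  have hG: "\<nu> h \<in> grp gs" "\<nu> h \<in> Gam" using H[OF h] root_closure_superset by blast+
  have h0: "\<nu> h \<noteq> 0" by (rule mult_subgroupD(5)[OF Gam hG(2)])
  let ?u = "\<nu> x / \<nu> h"
  have "?u \<in> Gam" by (rule mult_subgroup_divide[OF Gam x(1) hG(2)])
  then obtain f where f: "?u / zp f \<in> torsion \<inter> Gam" using rep by blast
  hence "?u / zp f \<in> \<nu> ` set mus" unfolding mus .
  then obtain \<zeta> where "?u / zp f = \<nu> \<zeta>" "\<zeta> \<in> set mus" by (rule imageE)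
  hence \<zeta>: "\<zeta> \<in> set mus" "\<nu> \<zeta> = ?u / zp f" by simp_all
  \<comment> \<open>Multiplying by \<open>s ^ N\<close> makes all exponents nonnegative, as the
    natural exponents of \<open>gpw\<close> require, without changing them modulo
    \<open>N\<close>.\<close>
  define s where "s = zp (\<lambda>i. \<bar>f i\<bar>)"
  have s: "s \<in> Gam" "\<nu> (nm s) = s" unfolding s_def using zpG \<nu>_nm_Gam by blast+
  define ev where "ev = map (\<lambda>i. nat (f i + \<bar>f i\<bar> * int N)) [0..<length as]"
  have nonneg: "0 \<le> f i + \<bar>f i\<bar> * int N" for i
  proof -
    have "\<bar>f i\<bar> * 1 \<le> \<bar>f i\<bar> * int N" using N_pos by (intro mult_left_mono) simp_all
    thus ?thesis by linarith
  qed
  have ev: "int (get ev i) = f i + \<bar>f i\<bar> * int N" if "i < length as" for i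
    using that nonneg by (simp add: ev_def get_nth)
  have gp: "\<nu> (gpw gams ev) = zp f * s ^ N"
  proof -
    have "\<nu> (gpw gams ev) = zp (\<lambda>i. f i + \<bar>f i\<bar> * int N)" unfolding \<nu>_gpw_as by (rule zprod_cong) (simp add: ev)
    thus ?thesis unfolding zp_add zprod_mult s_def .
  qed
  have eq: "\<nu> x * s ^ N = \<nu> h * (\<nu> \<zeta> * (zp f * s ^ N))"
    unfolding \<zeta>(2) using h0 zp_nz[of f] by simp
  have "\<nu> \<zeta> \<noteq> 1 \<or> (\<exists>i<length gams. \<forall>c<Suc (get ev i). get ev i \<noteq> N * c)"
  proof (rule ccontr)
    assume contr: "\<not> ?thesis"
    hence "\<forall>i. \<exists>c. i < length as \<longrightarrow> get ev i = N * c" by auto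
    then obtain c where c: "\<And>i. i < length as \<Longrightarrow> get ev i = N * c i" by metis
    have "f i = (int (c i) - \<bar>f i\<bar>) * int N" if "i < length as" for i
      using ev[OF that] c[OF that] by (simp add: algebra_simps)
    hence "zp f = zp (\<lambda>i. (int (c i) - \<bar>f i\<bar>) * int N)" by (intro zprod_cong) auto
    also have "\<dots> = zp (\<lambda>i. int (c i) - \<bar>f i\<bar>) ^ N" by (rule zprod_mult)
    also have "\<dots> \<in> grp gs" by (rule powN[OF zpG])
    finally have "zp f \<in> grp gs" .
    moreover have "?u = zp f" using contr \<zeta>(2) zp_nz[of f] by (simp add: field_simps)
    ultimately have "\<nu> h * ?u \<in> grp gs" using mult_subgroupD(3)[OF G hG(1)] by simp
    thus False using x(2) h0 by simp
  qed
  thus "\<exists>s \<zeta> ev. in_grp (mus @ gams) s \<and> \<zeta> \<in> set mus \<and> \<nu> (ml x (pw s N)) = \<nu> (ml h (ml \<zeta> (gpw gams ev))) \<and>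
     (\<nu> \<zeta> \<noteq> \<nu> z1 \<or> (\<exists>i<length gams. \<forall>c<Suc (get ev i). get ev i \<noteq> N * c))"
    by (intro exI[of _ "nm s"] exI[of _ \<zeta>] exI[of _ ev]) (simp add: in_Gam s \<zeta>(1) gp eq)
qed

lemma piece:
  assumes d: "dgood n q Gam (sols n rows) d" and \<tau>: "\<And>i. i \<le> n \<Longrightarrow> \<nu> (get \<tau> i) \<in> Gam"
    and \<tau>E: "\<And>z. z \<in> set (snd (snd d)) \<Longrightarrow> \<nu> (get \<tau> (fst z)) = \<nu> (get \<tau> (snd z))"
    and w: "w \<in> set (unroll n q (vmul n (fst d) \<tau>) (fst (snd d)))"
  shows "\<forall>i\<le>n. \<nu> (get (vprd n (fst w) (snd w)) i) \<in> Gam"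
    and "\<forall>i<Suc n. \<nu> (get (vprd n (fst w) (snd w)) i) \<in> grp gs \<Longrightarrow> descr_ok n rows gs (mus @ gams) e (fst w, snd w, snd (snd d))"
proof -
  let ?V = "sols n rows" and ?vs = "map (val n) (fst (snd d))" and ?E = "snd (snd d)"
  note D = dgoodD[OF d]
  obtain us where us: "snd w = map (\<lambda>v. vpw n v q) us" "set us \<subseteq> set (fst (snd d))" "length us \<le> length (fst (snd d))"
    "length (fst w) = Suc n"
    and eq: "\<And>ks. length ks = length us \<Longrightarrow> \<exists>ls. length ls = length (fst (snd d)) \<and>
       (\<forall>i. val n (fst w) i * orb q (map (\<lambda>v i. v i ^ q) (map (val n) us)) ks i
          = val n (vmul n (fst d) \<tau>) i * orb q ?vs ls i)"
    using unroll_origin[OF q_pos w[unfolded unroll_def]] by (auto simp: vmul_def)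
  have mvw: "map (val n) (snd w) = map (\<lambda>v i. v i ^ q) (map (val n) us)"
    unfolding us(1) map_map o_def by (rule map_cong) (simp_all add: val_vpw[OF q_pos] fun_eq_iff)
  have usG: "val n u i \<in> Gam" if "u \<in> set us" "i \<le> n" for u i using that us(2) D(2) by blast
  have wsG: "v i \<in> Gam" if "v \<in> set (map (val n) (snd w))" "i \<le> n" for v i
    using that usG mult_subgroup_power[OF Gam] unfolding mvw by auto
  have v0G: "val n (fst w) i \<in> Gam" if i: "i \<le> n" for i
  proof -
    \<comment> \<open>Evaluating the orbit at exponents 0 exhibits the leading vector as a quotient
      of elements of the radical.\<close>
    let ?ks = "replicate (length us) 0"
    obtain ls where "val n (fst w) i * orb q (map (val n) (snd w)) ?ks i = val n (vmul n (fst d) \<tau>) i * orb q ?vs ls i"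
      using eq[of ?ks] unfolding mvw by auto
    moreover have "orb q (map (val n) (snd w)) ?ks i \<in> Gam" by (rule orb_mem[OF Gam]) (rule wsG[OF _ i])
    moreover have "orb q ?vs ls i \<in> Gam" by (rule orb_mem[OF Gam]) (use D(2) i in auto)
    moreover have "val n (vmul n (fst d) \<tau>) i \<in> Gam"
      unfolding val_vmul using D(1) \<tau>[OF i] i mult_subgroupD(3)[OF Gam] by (simp add: val_def)
    ultimately show ?thesis
      using mult_subgroupD(3,4,5)[OF Gam] by (metis nonzero_eq_divide_eq mult_subgroup_divide[OF Gam])
  qed
  show 1: "\<forall>i\<le>n. \<nu> (get (vprd n (fst w) (snd w)) i) \<in> Gam"
  proof (intro allI impI)
    fix i assume i: "i \<le> n"
    have "prod_list (map (\<lambda>v. v i) (map (val n) vs)) \<in> Gam" if "\<And>v. v \<in> set (map (val n) vs) \<Longrightarrow> v i \<in> Gam" for vs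
      using that by (induction vs) (simp_all add: mult_subgroupD(2,3)[OF Gam])
    hence "val n (vprd n (fst w) (snd w)) i \<in> Gam"
      unfolding val_vprd using v0G[OF i] wsG[OF _ i] mult_subgroupD(3)[OF Gam] by blast
    thus "\<nu> (get (vprd n (fst w) (snd w)) i) \<in> Gam" using i by (simp add: val_def)
  qed
  assume pr: "\<forall>i<Suc n. \<nu> (get (vprd n (fst w) (snd w)) i) \<in> grp gs"
  show "descr_ok n rows gs (mus @ gams) e (fst w, snd w, ?E)"
    unfolding descr_ok_def fst_conv snd_conv
  proof (intro conjI ballI allI impI)
    show "length (fst w) = Suc n" by (rule us(4))
    show "in_grp (mus @ gams) (get (fst w) i)" if "i < Suc n" for i
      unfolding in_Gam using v0G[of i] that by (simp add: val_def)
    \<comment> \<open>The invariant allows at most \<open>card (piv ?V) - 1\<close> moving points;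
      only the full space could exceed the bound, and there none occur.\<close>
    show "length (snd w) \<le> n - 1"
    proof (cases "card (piv ?V) = Suc n")
      case True
      thus ?thesis using D(6) us(1,3) by simp
    next
      case False
      hence "card (piv ?V) \<le> n" using card_piv_le[OF subspD(1)[OF subsp_sols], of n rows] by simp
      thus ?thesis using D(5) us(1,3) by simp
    qed
    show "length v = Suc n" if "v \<in> set (snd w)" for v using that us(1) by (auto simp: vpw_def)
    show "in_grp (mus @ gams) (get v i)" if "v \<in> set (snd w)" "i < Suc n" for v i
      unfolding in_Gam using wsG[of "val n v" i] that by (simp add: val_def)
    show "\<exists>g. in_grp gs g \<and> \<nu> (pw (get v i) q) = \<nu> (ml (get v i) g)" if v: "v \<in> set (snd w)" and i: "i < Suc n" for v i
    proof -
      obtain u where u: "u \<in> set us" "v = vpw n u q" using v us(1) by auto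
      have uG: "\<nu> (get u i) \<in> Gam" using usG[OF u(1), of i] i by (simp add: val_def)
      have vi: "\<nu> (get v i) = \<nu> (get u i) ^ q" using i by (simp add: u(2) vpw_def)
      have g: "(\<nu> (get u i) ^ N) ^ c \<in> grp gs" by (rule mult_subgroup_power[OF G powN[OF uG]])
      have ng: "\<nu> (nm ((\<nu> (get u i) ^ N) ^ c)) = (\<nu> (get u i) ^ N) ^ c"
        by (rule \<nu>_nm_Gam) (use g root_closure_superset in blast)
      show ?thesis
      proof (rule exI[of _ "nm ((\<nu> (get u i) ^ N) ^ c)"], rule conjI)
        show "in_grp gs (nm ((\<nu> (get u i) ^ N) ^ c))" unfolding in_G ng by (rule g)
        show "\<nu> (pw (get v i) q) = \<nu> (ml (get v i) (nm ((\<nu> (get u i) ^ N) ^ c)))"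
          unfolding \<nu>_ml \<nu>_pw ng vi using frob_class[of "\<nu> (get u i)"] by (simp only: power_mult)
      qed
    qed
    show "fst z < Suc n" "snd z < Suc n" if "z \<in> set ?E" for z using D(3) that by (simp_all add: less_Suc_eq_le)
    show "in_grp gs (get (vprd n (fst w) (snd w)) i)" if "i < Suc n" for i unfolding in_G using pr that by blast
    fix ls \<chi> assume ls: "ls \<in> set (List.n_lists (length (snd w)) [0..<Suc n])" and \<chi>: "\<chi> \<in> set (List.n_lists (Suc n) [z0, z1])"
    show "(\<exists>z\<in>set ?E. get \<chi> (fst z) \<noteq> get \<chi> (snd z)) \<or>
        (\<forall>a\<in>set rows. \<nu> (dot n a (vmul n (orbn n q (fst w) (snd w) ls) \<chi>)) = \<nu> z0)"
    proof (subst disj_commute, intro disjCI ballI)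
      fix a assume \<chi>E: "\<not> (\<exists>z\<in>set ?E. get \<chi> (fst z) \<noteq> get \<chi> (snd z))" and a: "a \<in> set rows"
      have len: "length ls = length (snd w)" using ls by (simp add: set_n_lists)
      have lu: "length ls = length us" using len us(1) by simp
      obtain ls' where ls': "length ls' = length (fst (snd d))"
        "\<forall>i. val n (fst w) i * orb q (map (val n) (snd w)) ls i = val n (vmul n (fst d) \<tau>) i * orb q ?vs ls' i"
        using eq[OF lu] unfolding mvw by (elim exE conjE)
      have lv: "length ls' = length ?vs" using ls'(1) by simp
      have "(\<lambda>i. val n (fst d) i * orb q ?vs ls' i * (val n \<tau> i * val n \<chi> i)) \<in> ?V"
      proof (rule inc_general[OF subsp_sols D(4) val_vecs lv])
        fix z assume z: "z \<in> set ?E"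
        have "fst z \<le> n" "snd z \<le> n" "get \<chi> (fst z) = get \<chi> (snd z)" using D(3) \<chi>E z by blast+
        thus "val n \<tau> (fst z) * val n \<chi> (fst z) = val n \<tau> (snd z) * val n \<chi> (snd z)"
          using \<tau>E[OF z] by (simp add: val_def)
      qed (simp add: F_mult)
      hence "(\<Sum>i\<le>n. val n a i * (val n (fst d) i * orb q ?vs ls' i * (val n \<tau> i * val n \<chi> i))) = 0"
        using a by (simp add: sols_iff)
      moreover have "\<nu> (dot n a (vmul n (orbn n q (fst w) (snd w) ls) \<chi>))
          = (\<Sum>i\<le>n. val n a i * (val n (fst d) i * orb q ?vs ls' i * (val n \<tau> i * val n \<chi> i)))"
        unfolding \<nu>_dot val_vmul val_orbn[OF q_pos len] ls'(2)[rule_format] by (simp add: val_vmul mult_ac)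
      ultimately show "\<nu> (dot n a (vmul n (orbn n q (fst w) (snd w) ls) \<chi>)) = \<nu> z0" by simp
    qed
  qed
qed

lemma set_concat_map: "set (concat (map f xs)) = (\<Union>x\<in>set xs. set (f x))"
  by simp

lemma ex_certificate: "\<exists>ds. certified n rows gs e ds"
proof -
  obtain D where der: "derivable (covstep (n, e, mus, gams)) (rows, D)"
    and good: "\<And>d. d \<in> set D \<Longrightarrow> dgood n q Gam (sols n rows) d"
    using rooted.solved[of n rows] unfolding rooted.solved_def grp_gens by blast
  obtain H R where H: "\<And>h. h \<in> set H \<Longrightarrow> \<nu> h \<in> grp gs" and data: "group_data gs mus gams e N H R"
    and R: "\<And>r. r \<in> set R \<Longrightarrow> \<nu> r \<in> Gam" by (rule ex_lists) blast
  define ok where "ok = (\<lambda>(d :: descr) \<tau>. \<forall>z\<in>set (snd (snd d)). \<nu> (get \<tau> (fst z)) = \<nu> (get \<tau> (snd z)))"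
  define inG where "inG = (\<lambda>w. \<forall>i<Suc n. \<nu> (get (vprd n (fst w) (snd w)) i) \<in> grp gs)"
  define ds where "ds = concat (map (\<lambda>d. concat (map (\<lambda>\<tau>. map (\<lambda>w. (fst w, snd w, snd (snd d)))
    (filter inG (unroll n q (vmul n (fst d) \<tau>) (fst (snd d))))) (filter (ok d) (List.n_lists (Suc n) R)))) D)"
  have \<tau>G: "\<nu> (get \<tau> i) \<in> Gam" if "\<tau> \<in> set (List.n_lists (Suc n) R)" "i \<le> n" for \<tau> i
    using n_lists_val[OF that(1) R that(2)] that(2) by (simp add: val_def)
  have "descr_ok n rows gs (mus @ gams) e d'" if d'ds: "d' \<in> set ds" for d'
  proof -
    obtain d \<tau> w where d: "d \<in> set D" and \<tau>: "\<tau> \<in> set (List.n_lists (Suc n) R)" "ok d \<tau>"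
      and w: "w \<in> set (unroll n q (vmul n (fst d) \<tau>) (fst (snd d)))" "inG w" and d': "d' = (fst w, snd w, snd (snd d))"
      using d'ds unfolding ds_def set_concat_map UN_iff Bex_def set_map image_iff set_filter mem_Collect_eq by blast
    show ?thesis unfolding d'
      by (rule piece(2)[OF good[OF d] _ _ w(1)]) (use \<tau>G[OF \<tau>(1)] \<tau>(2) w(2) in \<open>auto simp: ok_def inG_def\<close>)
  qed
  moreover have "cov_final n e mus gams N H R D ds"
    unfolding cov_final_def
  proof (intro ballI conjI allI impI)
    fix d assume d: "d \<in> set D"
    note dg = dgoodD[OF good[OF d]]
    show "fst z < Suc n" "snd z < Suc n" if "z \<in> set (snd (snd d))" for z using dg(3) that by (simp_all add: less_Suc_eq_le)
    show "in_grp (mus @ gams) (get v i)" if "v \<in> set (fst (snd d))" "i < Suc n" for v i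
      unfolding in_Gam using dg(2) that by (simp add: val_def less_Suc_eq_le)
    fix \<tau> assume \<tau>: "\<tau> \<in> set (List.n_lists (Suc n) R)"
    show "(\<exists>z\<in>set (snd (snd d)). \<nu> (get \<tau> (fst z)) \<noteq> \<nu> (get \<tau> (snd z))) \<or>
        (\<forall>w\<in>set (unroll n q (vmul n (fst d) \<tau>) (fst (snd d))). (fst w, snd w, snd (snd d)) \<in> set ds \<or>
           (\<exists>i<Suc n. cert_notin mus gams N H (get (vprd n (fst w) (snd w)) i)))"
    proof (cases "ok d \<tau>")
      case True
      have "(fst w, snd w, snd (snd d)) \<in> set ds \<or> (\<exists>i<Suc n. cert_notin mus gams N H (get (vprd n (fst w) (snd w)) i))"
        if w: "w \<in> set (unroll n q (vmul n (fst d) \<tau>) (fst (snd d)))" for w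
      proof (cases "inG w")
        case inw: True
        have "(fst w, snd w, snd (snd d)) \<in> set ds"
          unfolding ds_def set_concat set_map
          by (rule UnionI, rule imageI, rule imageI, rule d, unfold set_concat set_map, rule UnionI, rule imageI, rule imageI)
             (use True \<tau> w inw in auto)
        thus ?thesis ..
      next
        case False
        then obtain i where i: "i < Suc n" "\<nu> (get (vprd n (fst w) (snd w)) i) \<notin> grp gs" by (auto simp: inG_def)
        have "\<nu> (get (vprd n (fst w) (snd w)) i) \<in> Gam"
          using piece(1)[OF good[OF d] _ _ w] \<tau>G[OF \<tau>] True i(1) by (auto simp: ok_def)
        from cert_notin_complete[OF H this i(2)] show ?thesis using i(1) by blast
      qed
      thus ?thesis by blast
    qed (auto simp: ok_def)
  qed
  ultimately show ?thesis unfolding certified_def using data der by blast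
qed

end

text \<open>\<open>N1\<close> carries the radical into \<open>G\<close> and \<open>N2\<close> kills
  its torsion, so their product serves as \<open>N\<close> for both purposes; \<open>e\<close> is
  then taken from \<open>power_eventually_idempotent\<close>.\<close>

theorem (in named_field) certified_complete:
  assumes gs0: "0 \<notin> \<nu> ` set gs" and GamF: "root_closure (grp gs) \<subseteq> F" and fg: "fin_gen (root_closure (grp gs))"
  shows "\<exists>e ds. certified n rows gs e ds"
proof -
  have G: "mult_subgroup (grp gs)" using mult_subgroup_hull[OF gs0] by (simp add: grp_def)
  let ?Gam = "root_closure (grp gs)"
  have Gam: "mult_subgroup ?Gam" by (rule root_closure_subgroup[OF G])
  obtain as where as: "set as \<subseteq> ?Gam" "gens_mod_torsion ?Gam {..<length as} ((!) as)" "indep_mod_torsion {..<length as} ((!) as)"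
    using ex_independent[OF Gam fg] by blast
  obtain ts where ts: "set ts = torsion \<inter> ?Gam" using finite_list[OF finite_torsion[OF Gam fg]] by blast
  obtain X where B: "finite X" "X \<subseteq> ?Gam" "?Gam = mult_subgroup hull X" using fg by (auto simp: fin_gen_def)
  have B0: "0 \<notin> X" using B(2) mult_subgroupD(1)[OF Gam] by blast
  have "\<exists>k>0. b ^ k \<in> grp gs" if "b \<in> X" for b using B(2) that by (auto simp: root_closure_def)
  then obtain N1 where N1: "N1 > 0" "\<forall>b\<in>X. b ^ N1 \<in> grp gs" using uniform_exponent[OF G B(1)] by blast
  have one: "mult_subgroup {1 :: 'k}" by (auto simp: mult_subgroup_def)
  have "\<exists>k>0. b ^ k \<in> {1}" if "b \<in> set ts" for b using that by (auto simp: ts torsion_def)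
  then obtain N2 where N2: "N2 > 0" "\<forall>b\<in>set ts. b ^ N2 \<in> {1}" using uniform_exponent[OF one, of "set ts"] by auto
  have pow: "x ^ (N1 * N2) \<in> grp gs" if "x \<in> ?Gam" for x
  proof -
    have "x ^ N1 \<in> grp gs" using uniform_exponent_hull[OF G B0, of N1] N1(2) B(3) that by blast
    from mult_subgroup_power[OF G this] show ?thesis by (simp add: power_mult)
  qed
  have tor: "x ^ (N1 * N2) = 1" if "x \<in> torsion \<inter> ?Gam" for x
  proof -
    have "x ^ N2 = 1" using that N2(2) ts by auto
    thus ?thesis by (simp add: mult.commute[of N1] power_mult)
  qed
  have N: "N1 * N2 > 0" using N1(1) N2(1) by simp
  obtain e c where e: "e > 0" "p ^ e * p ^ e = p ^ e + N1 * N2 * c"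
    using power_eventually_idempotent[OF p_pos N] by blast
  interpret cg: closed_group F p B S \<nu> ad ml z0 z1 bs gs ts as "N1 * N2" e c
    by unfold_locales (fact gs0 GamF ts as N pow tor e)+
  show ?thesis using cg.ex_certificate by blast
qed


subsection \<open>The algorithm\<close>

text \<open>The composition rules up to \<open>enumerable9\<close> treat a curried function as one
  of a tuple, so that each definition is unfolded once and for all, with projections as
  arguments.\<close>

lemma computable2:
  assumes "computable (\<lambda>z. F (fst z) (snd z))" "computable f" "computable g"
  shows "computable (\<lambda>x. F (f x) (g x))"
  using computable_comp[OF assms(1) computable_Pair[OF assms(2) assms(3)]] by simp

lemma computable3:
  assumes "computable (\<lambda>z. F (fst z) (fst (snd z)) (snd (snd z)))" "computable f" "computable g" "computable h"
  shows "computable (\<lambda>x. F (f x) (g x) (h x))"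
  using computable_comp[OF assms(1) computable_Pair[OF assms(2) computable_Pair[OF assms(3) assms(4)]]] by simp

lemma computable4:
  assumes "computable (\<lambda>z. F (fst z) (fst (snd z)) (fst (snd (snd z))) (snd (snd (snd z))))" "computable f" "computable g" "computable h" "computable i"
  shows "computable (\<lambda>x. F (f x) (g x) (h x) (i x))"
  using computable_comp[OF assms(1) computable_Pair[OF assms(2) computable_Pair[OF assms(3) computable_Pair[OF assms(4) assms(5)]]]] by simp

lemma computable5:
  assumes "computable (\<lambda>z. F (fst z) (fst (snd z)) (fst (snd (snd z))) (fst (snd (snd (snd z)))) (snd (snd (snd (snd z)))))" "computable f" "computable g" "computable h" "computable i" "computable j"
  shows "computable (\<lambda>x. F (f x) (g x) (h x) (i x) (j x))"
  using computable_comp[OF assms(1) computable_Pair[OF assms(2) computable_Pair[OF assms(3) computable_Pair[OF assms(4) computable_Pair[OF assms(5) assms(6)]]]]] by simp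

lemma enumerable2:
  assumes "enumerable (\<lambda>z. F (fst z) (snd z))" "computable f" "computable g"
  shows "enumerable (\<lambda>x. F (f x) (g x))"
  using enumerable_comp[OF assms(1) computable_Pair[OF assms(2) assms(3)]] by simp

lemma enumerable3:
  assumes "enumerable (\<lambda>z. F (fst z) (fst (snd z)) (snd (snd z)))" "computable f" "computable g" "computable h"
  shows "enumerable (\<lambda>x. F (f x) (g x) (h x))"
  using enumerable_comp[OF assms(1) computable_Pair[OF assms(2) computable_Pair[OF assms(3) assms(4)]]] by simp

lemma enumerable4:
  assumes "enumerable (\<lambda>z. F (fst z) (fst (snd z)) (fst (snd (snd z))) (snd (snd (snd z))))" "computable f" "computable g" "computable h" "computable i"
  shows "enumerable (\<lambda>x. F (f x) (g x) (h x) (i x))"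
  using enumerable_comp[OF assms(1) computable_Pair[OF assms(2) computable_Pair[OF assms(3) computable_Pair[OF assms(4) assms(5)]]]] by simp

lemma enumerable5:
  assumes "enumerable (\<lambda>z. F (fst z) (fst (snd z)) (fst (snd (snd z))) (fst (snd (snd (snd z)))) (snd (snd (snd (snd z)))))" "computable f" "computable g" "computable h" "computable i" "computable j"
  shows "enumerable (\<lambda>x. F (f x) (g x) (h x) (i x) (j x))"
  using enumerable_comp[OF assms(1) computable_Pair[OF assms(2) computable_Pair[OF assms(3) computable_Pair[OF assms(4) computable_Pair[OF assms(5) assms(6)]]]]] by simp

lemma enumerable6:
  assumes "enumerable (\<lambda>z. F (fst z) (fst (snd z)) (fst (snd (snd z))) (fst (snd (snd (snd z)))) (fst (snd (snd (snd (snd z))))) (snd (snd (snd (snd (snd z))))))" "computable f" "computable g" "computable h" "computable i" "computable j" "computable k"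
  shows "enumerable (\<lambda>x. F (f x) (g x) (h x) (i x) (j x) (k x))"
  using enumerable_comp[OF assms(1) computable_Pair[OF assms(2) computable_Pair[OF assms(3) computable_Pair[OF assms(4) computable_Pair[OF assms(5) computable_Pair[OF assms(6) assms(7)]]]]]] by simp

lemma enumerable7:
  assumes "enumerable (\<lambda>z. F (fst z) (fst (snd z)) (fst (snd (snd z))) (fst (snd (snd (snd z)))) (fst (snd (snd (snd (snd z))))) (fst (snd (snd (snd (snd (snd z)))))) (snd (snd (snd (snd (snd (snd z)))))))" "computable f" "computable g" "computable h" "computable i" "computable j" "computable k" "computable l"
  shows "enumerable (\<lambda>x. F (f x) (g x) (h x) (i x) (j x) (k x) (l x))"
  using enumerable_comp[OF assms(1) computable_Pair[OF assms(2) computable_Pair[OF assms(3) computable_Pair[OF assms(4) computable_Pair[OF assms(5) computable_Pair[OF assms(6) computable_Pair[OF assms(7) assms(8)]]]]]]] by simp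

lemma enumerable9:
  assumes "enumerable (\<lambda>z. F (fst z) (fst (snd z)) (fst (snd (snd z))) (fst (snd (snd (snd z)))) (fst (snd (snd (snd (snd z))))) (fst (snd (snd (snd (snd (snd z)))))) (fst (snd (snd (snd (snd (snd (snd z))))))) (fst (snd (snd (snd (snd (snd (snd (snd z)))))))) (snd (snd (snd (snd (snd (snd (snd (snd z)))))))))" "computable f" "computable g" "computable h" "computable i" "computable j" "computable k" "computable l" "computable m" "computable n"
  shows "enumerable (\<lambda>x. F (f x) (g x) (h x) (i x) (j x) (k x) (l x) (m x) (n x))"
  using enumerable_comp[OF assms(1) computable_Pair[OF assms(2) computable_Pair[OF assms(3) computable_Pair[OF assms(4) computable_Pair[OF assms(5) computable_Pair[OF assms(6) computable_Pair[OF assms(7) computable_Pair[OF assms(8) computable_Pair[OF assms(9) assms(10)]]]]]]]]] by simp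

lemma enumerable_atoms [enumerable_intros]:
  "computable f \<Longrightarrow> computable g \<Longrightarrow> enumerable (\<lambda>x. f x = g x)"
  "computable f \<Longrightarrow> computable g \<Longrightarrow> enumerable (\<lambda>x. f x \<noteq> g x)"
  "computable f' \<Longrightarrow> computable g' \<Longrightarrow> enumerable (\<lambda>x. (f' x :: nat) < g' x)"
  "computable f' \<Longrightarrow> computable g' \<Longrightarrow> enumerable (\<lambda>x. (f' x :: nat) \<le> g' x)"
  "computable f \<Longrightarrow> computable l \<Longrightarrow> enumerable (\<lambda>x. f x \<in> set (l x))"
  by (intro enumerable_decidable computable_intros, assumption+)+

lemma enc_nats: "enc l = list_encode l" for l :: "nat list"
  by (simp add: enc_list_def map_idI)

lemma enc_vecs: "enc vs = vecs_code vs" for vs :: "nat list list"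
proof -
  have "map enc vs = map list_encode vs" by (simp add: enc_nats)
  thus ?thesis by (simp only: enc_list_def[of vs] vecs_code_def)
qed

lemma enc_pairs: "enc E = list_encode (map prod_encode E)" for E :: "(nat \<times> nat) list"
proof -
  have "map enc E = map prod_encode E" by (simp add: enc_prod_def)
  thus ?thesis by (simp only: enc_list_def[of E])
qed

lemma computable_descr_code: "computable descr_code"
proof -
  have "descr_code = (\<lambda>d. enc [enc (fst d), enc (fst (snd d)), enc (snd (snd d))])"
    by (auto simp: fun_eq_iff enc_nats enc_vecs enc_pairs)
  moreover have "computable (\<lambda>d :: descr. enc [enc (fst d), enc (fst (snd d)), enc (snd (snd d))])"
    by (intro computable_intros)
  ultimately show ?thesis by simp
qed

lemma computable_binary:
  fixes f :: "nat \<Rightarrow> nat \<Rightarrow> nat"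
  assumes "prog 2 (\<lambda>xs. f (xs ! 0) (xs ! 1))"
  shows "computable (\<lambda>z. f (fst z) (snd z))"
proof -
  have "denc m = prod_decode m" for m
    by (metis denc_enc enc_nat_def enc_prod_def prod.collapse prod_decode_inverse)
  thus ?thesis
    unfolding computable_def enc_nat_def
    using prog_comp2[OF assms prog_fst[OF prog_proj] prog_snd[OF prog_proj], of 0 1 0] by simp
qed

locale computable_field = named_field F p B S \<nu> ad ml z0 z1 bs
  for F :: "'k::field set" and p B S \<nu> ad ml z0 z1 bs +
  assumes comp_ad: "computable (\<lambda>z. ad (fst z) (snd z))" and comp_ml: "computable (\<lambda>z. ml (fst z) (snd z))"
    and dec_eq: "decidable (\<lambda>z. \<nu> (fst z) = \<nu> (snd z))"
begin

lemma computable_ad [computable_intros]: "computable f \<Longrightarrow> computable g \<Longrightarrow> computable (\<lambda>x. ad (f x) (g x))"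
  by (rule computable2[OF comp_ad])

lemma computable_ml [computable_intros]: "computable f \<Longrightarrow> computable g \<Longrightarrow> computable (\<lambda>x. ml (f x) (g x))"
  by (rule computable2[OF comp_ml])

lemma decidable_\<nu>_eq [computable_intros]: "computable f \<Longrightarrow> computable g \<Longrightarrow> decidable (\<lambda>x. \<nu> (f x) = \<nu> (g x))"
  using decidable_comp[OF dec_eq computable_Pair] by fastforce

lemma enumerable_\<nu> [enumerable_intros]:
  "computable f \<Longrightarrow> computable g \<Longrightarrow> enumerable (\<lambda>x. \<nu> (f x) = \<nu> (g x))"
  "computable f \<Longrightarrow> computable g \<Longrightarrow> enumerable (\<lambda>x. \<nu> (f x) \<noteq> \<nu> (g x))"
  by (intro enumerable_decidable computable_intros, assumption+)+

lemma computable_pw [computable_intros]: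
  "computable a \<Longrightarrow> computable k \<Longrightarrow> computable (\<lambda>x. pw (a x) (k x))"
  by (rule computable2[where F = pw], unfold pw_def, intro computable_intros)

lemma computable_sm [computable_intros]:
  "computable a \<Longrightarrow> computable (\<lambda>x. sm (a x))"
  by (rule computable_comp[where f = sm], unfold sm_def, intro computable_intros)

lemma computable_prd [computable_intros]:
  "computable a \<Longrightarrow> computable (\<lambda>x. prd (a x))"
  by (rule computable_comp[where f = prd], unfold prd_def, intro computable_intros)

lemma computable_vmul [computable_intros]:
  "computable n \<Longrightarrow> computable a \<Longrightarrow> computable b \<Longrightarrow> computable (\<lambda>x. vmul (n x) (a x) (b x))"
  by (rule computable3[where F = vmul], unfold vmul_def tab_def, intro computable_intros)

lemma computable_vpw [computable_intros]:
  "computable n \<Longrightarrow> computable a \<Longrightarrow> computable k \<Longrightarrow> computable (\<lambda>x. vpw (n x) (a x) (k x))"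
  by (rule computable3[where F = vpw], unfold vpw_def tab_def, intro computable_intros)

lemma computable_dot [computable_intros]:
  "computable n \<Longrightarrow> computable a \<Longrightarrow> computable b \<Longrightarrow> computable (\<lambda>x. dot (n x) (a x) (b x))"
  by (rule computable3[where F = dot], unfold dot_def tab_def, intro computable_intros)

lemma computable_scale [computable_intros]:
  "computable n \<Longrightarrow> computable g \<Longrightarrow> computable a \<Longrightarrow> computable (\<lambda>x. scale (n x) (g x) (a x))"
  by (rule computable3[where F = scale], unfold scale_def, intro computable_intros)

lemma computable_shift_descr [computable_intros]:
  "computable n \<Longrightarrow> computable k \<Longrightarrow> computable g \<Longrightarrow> computable d \<Longrightarrow> computable (\<lambda>x. shift_descr (n x) (k x) (g x) (d x))"
  by (rule computable4[where F = shift_descr], unfold shift_descr_def, intro computable_intros)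

lemma computable_twist_descr [computable_intros]:
  "computable n \<Longrightarrow> computable k \<Longrightarrow> computable a \<Longrightarrow> computable g \<Longrightarrow> computable d \<Longrightarrow> computable (\<lambda>x. twist_descr (n x) (k x) (a x) (g x) (d x))"
  by (rule computable5[where F = twist_descr], unfold twist_descr_def, intro computable_intros)

lemma computable_blocks [computable_intros]:
  "computable n \<Longrightarrow> computable b \<Longrightarrow> computable (\<lambda>x. blocks (n x) (b x))"
  by (rule computable2[where F = blocks], unfold blocks_def, intro computable_intros)

lemma computable_gpw [computable_intros]:
  "computable a \<Longrightarrow> computable b \<Longrightarrow> computable (\<lambda>x. gpw (a x) (b x))"
  by (rule computable2[where F = gpw], unfold gpw_def, intro computable_intros)

lemma computable_vprd [computable_intros]:
  "computable n \<Longrightarrow> computable a \<Longrightarrow> computable b \<Longrightarrow> computable (\<lambda>x. vprd (n x) (a x) (b x))"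
  by (rule computable3[where F = vprd], unfold vprd_def, intro computable_intros)

lemma computable_orbn [computable_intros]:
  "computable n \<Longrightarrow> computable k \<Longrightarrow> computable a \<Longrightarrow> computable b \<Longrightarrow> computable l \<Longrightarrow> computable (\<lambda>x. orbn (n x) (k x) (a x) (b x) (l x))"
  by (rule computable5[where F = orbn], unfold orbn_def, intro computable_intros)

lemma computable_unroll_step [computable_intros]:
  "computable n \<Longrightarrow> computable k \<Longrightarrow> computable a \<Longrightarrow> computable b \<Longrightarrow> computable (\<lambda>x. unroll_step (n x) (k x) (a x) (b x))"
  by (rule computable4[where F = unroll_step], unfold unroll_step_def, intro computable_intros)

lemma computable_unroll [computable_intros]:
  "computable n \<Longrightarrow> computable k \<Longrightarrow> computable a \<Longrightarrow> computable b \<Longrightarrow> computable (\<lambda>x. unroll (n x) (k x) (a x) (b x))"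
  by (rule computable4[where F = unroll], unfold unroll_def, intro computable_intros)

lemma enumerable_in_grp [enumerable_intros]:
  "computable a \<Longrightarrow> computable b \<Longrightarrow> enumerable (\<lambda>x. in_grp (a x) (b x))"
  by (rule enumerable2[where F = in_grp], unfold in_grp_def, intro enumerable_intros computable_intros)

lemma enumerable_coord_rows [enumerable_intros]:
  "computable n \<Longrightarrow> computable a \<Longrightarrow> computable b \<Longrightarrow> enumerable (\<lambda>x. coord_rows (n x) (a x) (b x))"
  by (rule enumerable3[where F = coord_rows], unfold coord_rows_def, intro enumerable_intros computable_intros)

lemma enumerable_coord_chain [enumerable_intros]:
  "computable n \<Longrightarrow> computable m \<Longrightarrow> computable a \<Longrightarrow> computable b \<Longrightarrow> enumerable (\<lambda>x. coord_chain (n x) (m x) (a x) (b x))"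
  by (rule enumerable4[where F = coord_chain], unfold coord_chain_def, intro enumerable_intros computable_intros)

lemma enumerable_transversal [enumerable_intros]:
  "computable a \<Longrightarrow> computable t \<Longrightarrow> computable k \<Longrightarrow> enumerable (\<lambda>x. transversal (a x) (t x) (k x))"
  by (rule enumerable3[where F = transversal], unfold transversal_def \<nu>_z1[symmetric], intro enumerable_intros computable_intros)

lemma enumerable_lincomb [enumerable_intros]:
  "computable n \<Longrightarrow> computable a \<Longrightarrow> computable b \<Longrightarrow> enumerable (\<lambda>x. lincomb (n x) (a x) (b x))"
  by (rule enumerable3[where F = lincomb], unfold lincomb_def, intro enumerable_intros computable_intros)

lemma enumerable_cov_split [enumerable_intros]:
  "computable n \<Longrightarrow> computable g \<Longrightarrow> computable l \<Longrightarrow> computable a \<Longrightarrow> computable d \<Longrightarrow> enumerable (\<lambda>x. cov_split (n x) (g x) (l x) (a x) (d x))"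
  by (rule enumerable5[where F = cov_split], unfold cov_split_def, intro enumerable_intros computable_intros)

lemma enumerable_cov_comb [enumerable_intros]:
  "computable n \<Longrightarrow> computable l \<Longrightarrow> computable a \<Longrightarrow> computable d \<Longrightarrow> enumerable (\<lambda>x. cov_comb (n x) (l x) (a x) (d x))"
  by (rule enumerable4[where F = cov_comb], unfold cov_comb_def, intro enumerable_intros computable_intros)

lemma enumerable_cov_iso [enumerable_intros]:
  "computable n \<Longrightarrow> computable i \<Longrightarrow> computable m \<Longrightarrow> computable g \<Longrightarrow> computable l \<Longrightarrow> computable a \<Longrightarrow> computable d \<Longrightarrow> enumerable (\<lambda>x. cov_iso (n x) (i x) (m x) (g x) (l x) (a x) (d x))"
  by (rule enumerable7[where F = cov_iso], unfold cov_iso_def, intro enumerable_intros computable_intros)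

lemma enumerable_covstep [enumerable_intros]:
  "computable c \<Longrightarrow> computable l \<Longrightarrow> computable d \<Longrightarrow> enumerable (\<lambda>x. covstep (c x) (l x) (d x))"
  by (rule enumerable3[where F = covstep], unfold covstep_def, intro enumerable_intros computable_intros)

lemma enumerable_indep_cert [enumerable_intros]:
  "computable a \<Longrightarrow> enumerable (\<lambda>x. indep_cert (a x))"
  by (rule enumerable_comp[where P = indep_cert], unfold indep_cert_def, intro enumerable_intros computable_intros)

lemma enumerable_cert_notin [enumerable_intros]:
  "computable m \<Longrightarrow> computable g \<Longrightarrow> computable k \<Longrightarrow> computable h \<Longrightarrow> computable a \<Longrightarrow> enumerable (\<lambda>x. cert_notin (m x) (g x) (k x) (h x) (a x))"
  by (rule enumerable5[where F = cert_notin], unfold cert_notin_def, intro enumerable_intros computable_intros)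

lemma enumerable_group_data [enumerable_intros]:
  "computable s \<Longrightarrow> computable m \<Longrightarrow> computable g \<Longrightarrow> computable i \<Longrightarrow> computable k \<Longrightarrow> computable h \<Longrightarrow> computable r \<Longrightarrow> enumerable (\<lambda>x. group_data (s x) (m x) (g x) (i x) (k x) (h x) (r x))"
  by (rule enumerable7[where F = group_data], unfold group_data_def, intro enumerable_intros computable_intros)

lemma enumerable_descr_ok [enumerable_intros]:
  "computable n \<Longrightarrow> computable a \<Longrightarrow> computable s \<Longrightarrow> computable g \<Longrightarrow> computable i \<Longrightarrow> computable d \<Longrightarrow> enumerable (\<lambda>x. descr_ok (n x) (a x) (s x) (g x) (i x) (d x))"
  by (rule enumerable6[where F = descr_ok], unfold descr_ok_def, intro enumerable_intros computable_intros)

lemma enumerable_cov_final [enumerable_intros]: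
  "computable n \<Longrightarrow> computable i \<Longrightarrow> computable m \<Longrightarrow> computable g \<Longrightarrow> computable k \<Longrightarrow> computable h \<Longrightarrow> computable r \<Longrightarrow> computable d \<Longrightarrow> computable l \<Longrightarrow> enumerable (\<lambda>x. cov_final (n x) (i x) (m x) (g x) (k x) (h x) (r x) (d x) (l x))"
  by (rule enumerable9[where F = cov_final], unfold cov_final_def, intro enumerable_intros computable_intros)

lemma enumerable_certified: "enumerable (\<lambda>z. certified (fst (fst z)) (fst (snd (fst z))) (snd (snd (fst z))) (fst (snd z)) (snd (snd z)))"
  unfolding certified_def
  by (intro enumerable_intros computable_intros
      enumerable_derivable[OF enumerable3[OF _ computable_fst[OF computable_id] computable_fst[OF computable_snd[OF computable_id]] computable_snd[OF computable_snd[OF computable_id]], where F = covstep]])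

text \<open>The program from \<open>search\<close> has one coded argument and one coded result; it
  is composed with programs that pack the three arguments and rewrite the descriptions in the
  prescribed code.\<close>

theorem certified_search:
  "\<exists>A. \<forall>n rows gs. (\<exists>e ds. certified n rows gs e ds) \<longrightarrow> (\<exists>e ds. certified n rows gs e ds \<and>
     computes A [n, vecs_code rows, list_encode gs] (prod_encode (e, list_encode (map descr_code ds))))"
proof -
  obtain A where A: "\<And>x. (\<exists>y. certified (fst x) (fst (snd x)) (snd (snd x)) (fst y) (snd y)) \<Longrightarrow>
      \<exists>y. certified (fst x) (fst (snd x)) (snd (snd x)) (fst y) (snd y) \<and> computes A [enc x] (enc y)"
    using search[OF enumerable_certified] by blast
  have "prog 3 (\<lambda>xs. prod_encode (xs ! 0, prod_encode (xs ! 1, xs ! 2)))"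
    by (intro prog_prod_encode prog_proj) auto
  then obtain r where r: "\<And>a b c. computes r [a, b, c] (prod_encode (a, prod_encode (b, c)))"
    unfolding prog_def by (metis (no_types, lifting) length_Cons list.size(3) nth_Cons_0 nth_Cons_Suc numeral_2_eq_2 numeral_3_eq_3 One_nat_def)
  have "computable (\<lambda>y :: nat \<times> descr list. (fst y, map descr_code (snd y)))"
    by (intro computable_intros computable_comp[OF computable_descr_code])
  then obtain s where s: "\<And>y :: nat \<times> descr list. computes s [enc y] (enc (fst y, map descr_code (snd y)))"
    unfolding computable_def prog_def by (metis denc_enc length_Cons list.size(3) nth_Cons_0 One_nat_def)
  have enc_in: "enc (n, rows, gs) = prod_encode (n, prod_encode (vecs_code rows, list_encode gs))"
    for n :: nat and rows :: "nat list list" and gs :: "nat list"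
    by (simp add: enc_prod_def enc_nats enc_vecs)
  have "\<exists>e ds. certified n rows gs e ds \<and> computes (Comp s [Comp A [r]])
     [n, vecs_code rows, list_encode gs] (prod_encode (e, list_encode (map descr_code ds)))"
    if "\<exists>e ds. certified n rows gs e ds" for n rows gs
  proof -
    have "\<exists>y. certified n rows gs (fst y) (snd y)" using that by simp
    with A[of "(n, rows, gs)"] obtain y where y: "certified n rows gs (fst y) (snd y)"
      and comp: "computes A [enc (n, rows, gs)] (enc y)" by auto
    have "computes (Comp A [r]) [n, vecs_code rows, list_encode gs] (enc y)"
      by (rule computes.intros(4)[where ys = "[enc (n, rows, gs)]"]) (use r comp in \<open>simp_all add: enc_in\<close>)
    hence "computes (Comp s [Comp A [r]]) [n, vecs_code rows, list_encode gs] (enc (fst y, map descr_code (snd y)))"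
      by (intro computes.intros(4)[where ys = "[enc y]"]) (use s in simp_all)
    moreover have "enc (fst y, map descr_code (snd y)) = prod_encode (fst y, list_encode (map descr_code (snd y)))"
      by (simp add: enc_prod_def enc_nats)
    ultimately show ?thesis using y by metis
  qed
  thus ?thesis by blast
qed

end


subsection \<open>The theorem\<close>

text \<open>Some \<open>N\<close> sends the radical into \<open>G\<close>. Then \<open>G\<close> is
  generated by the \<open>N\<close>-th powers of generators of the radical and by those finitely
  many representatives modulo \<open>N\<close>-th powers that lie in \<open>G\<close>.\<close>

lemma fin_gen_of_root_closure:
  assumes G: "mult_subgroup G" and fg: "fin_gen (root_closure G)"
  shows "fin_gen G"
proof -
  note Gam = root_closure_subgroup[OF G]
  obtain X where X: "finite X" "X \<subseteq> root_closure G" "root_closure G = mult_subgroup hull X"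
    using fg by (auto simp: fin_gen_def)
  have X0: "0 \<notin> X" using X(2) mult_subgroupD(1)[OF Gam] by blast
  have "\<exists>k>0. b ^ k \<in> G" if "b \<in> X" for b using X(2) that by (auto simp: root_closure_def)
  then obtain N where N: "N > 0" "\<forall>b\<in>X. b ^ N \<in> G" using uniform_exponent[OF G X(1)] by blast
  let ?H = "(\<lambda>s. s ^ N) ` root_closure G"
  have "\<exists>T. finite T \<and> T \<subseteq> mult_subgroup hull X \<and> 1 \<in> T \<and> (\<forall>t\<in>T. \<forall>b\<in>X. \<exists>t'\<in>T. \<exists>h\<in>?H. t * b = t' * h)"
  proof (rule ex_reps[OF X(1) X0 mult_subgroup_powers[OF Gam]])
    fix b assume "b \<in> X"
    thus "\<exists>k>0. b ^ k \<in> ?H" using N(1) X(2) by (intro exI[of _ N]) auto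
  qed
  then obtain T where T: "finite T" "1 \<in> T" "\<And>t b. t \<in> T \<Longrightarrow> b \<in> X \<Longrightarrow> \<exists>t'\<in>T. \<exists>h\<in>?H. t * b = t' * h" by meson
  define Y where "Y = (T \<inter> G) \<union> (\<lambda>b. b ^ N) ` X"
  have YG: "Y \<subseteq> G" using N(2) by (auto simp: Y_def)
  have Y0: "0 \<notin> Y" using YG mult_subgroupD(1)[OF G] by blast
  have "G \<subseteq> mult_subgroup hull Y"
  proof
    fix g assume g: "g \<in> G"
    have "\<exists>t'\<in>T. \<exists>h\<in>?H. 1 * g = t' * h"
    proof (rule reps_all[OF X0 mult_subgroup_powers[OF Gam] T(3) _ _ T(2)])
      show "g \<in> mult_subgroup hull X" using g root_closure_superset X(3) by blast
      show "\<exists>k>0. a ^ k \<in> ?H" if "a \<in> mult_subgroup hull X" for a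
        using that N(1) unfolding X(3)[symmetric] by (intro exI[of _ N]) auto
    qed
    then obtain t y where t: "t \<in> T" "y \<in> root_closure G" "g = t * y ^ N" by auto
    have yY: "y ^ N \<in> mult_subgroup hull Y"
      by (rule uniform_exponent_hull[OF mult_subgroup_hull[OF Y0] X0])
         (use t(2) X(3) in \<open>auto intro!: hull_inc simp: Y_def\<close>)
    have yG: "y ^ N \<in> G"
      by (rule uniform_exponent_hull[OF G X0]) (use t(2) X(3) N(2) in auto)
    have "t = g / y ^ N" using t(3) mult_subgroupD(5)[OF G yG] by simp
    hence "t \<in> G" using mult_subgroup_divide[OF G g yG] by simp
    hence "t \<in> mult_subgroup hull Y" using t(1) by (intro hull_inc) (simp add: Y_def)
    thus "g \<in> mult_subgroup hull Y" unfolding t(3) by (rule mult_subgroupD(3)[OF mult_subgroup_hull[OF Y0] _ yY])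
  qed
  moreover have "mult_subgroup hull Y \<subseteq> G" by (rule hull_minimal[where S = mult_subgroup, OF YG G])
  moreover have "finite Y" using T(1) X(1) by (simp add: Y_def)
  ultimately show ?thesis using YG unfolding fin_gen_def by blast
qed

lemma is_subfield_hull: "is_subfield (is_subfield hull X)"
  unfolding is_subfield_def hull_def by auto

text \<open>Supplies names for the existence statement, where no presentation of the field is given:
  the closure under field operations is reached in countably many rounds.\<close>

lemma countable_subfield:
  fixes B :: "'k::field set"
  assumes "countable B"
  shows "countable (is_subfield hull B)"
proof -
  define step where "step = (\<lambda>X :: 'k set. X \<union> (\<lambda>z. fst z - snd z) ` (X \<times> X) \<union> (\<lambda>z. fst z * snd z) ` (X \<times> X) \<union> inverse ` X)"
  have diff: "x - y \<in> step X" and mult: "x * y \<in> step X" and inverse: "x \<in> X \<Longrightarrow> inverse x \<in> step X"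
    if "x \<in> X" "y \<in> X" for x y X
    unfolding step_def using that image_eqI[of _ "\<lambda>z. fst z - snd z" "(x, y)" "X \<times> X"]
      image_eqI[of _ "\<lambda>z. fst z * snd z" "(x, y)" "X \<times> X"] by simp_all
  let ?A = "\<lambda>m. (step ^^ m) (insert 0 (insert 1 B))"
  have "countable (?A m)" for m
    by (induction m) (use assms in \<open>simp_all add: step_def\<close>)
  hence "countable (\<Union>m. ?A m)" by simp
  moreover have "is_subfield hull B \<subseteq> (\<Union>m. ?A m)"
  proof (rule hull_minimal)
    show "B \<subseteq> (\<Union>m. ?A m)" by (rule subsetI, rule UN_I[of 0]) simp_all
    have inc: "?A m \<subseteq> ?A (m + k)" for m k
      by (induction k) (auto simp: step_def)
    have up: "?A m \<union> ?A k \<subseteq> ?A (m + k)" for m k using inc[of m k] inc[of k m] by (simp add: add.commute)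
    show "is_subfield (\<Union>m. ?A m)"
      unfolding is_subfield_def
    proof (intro conjI ballI)
      show "0 \<in> (\<Union>m. ?A m)" "1 \<in> (\<Union>m. ?A m)" by (rule UN_I[of 0]; simp)+
    next
      fix x y assume "x \<in> (\<Union>m. ?A m)" "y \<in> (\<Union>m. ?A m)"
      then obtain m k where "x \<in> ?A m" "y \<in> ?A k" by blast
      hence xy: "x \<in> ?A (m + k)" "y \<in> ?A (m + k)" using up[of m k] by blast+
      have "x - y \<in> ?A (Suc (m + k))" "x * y \<in> ?A (Suc (m + k))"
        unfolding funpow.simps comp_apply using xy by (rule diff mult)+
      thus "x - y \<in> (\<Union>m. ?A m)" "x * y \<in> (\<Union>m. ?A m)" by blast+
    next
      fix x assume "x \<in> (\<Union>m. ?A m)"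
      then obtain m where "x \<in> ?A m" by blast
      hence "inverse x \<in> ?A (Suc m)"
        unfolding funpow.simps comp_apply by (intro inverse)
      thus "inverse x \<in> (\<Union>m. ?A m)" by blast
    qed
  qed
  ultimately show ?thesis by (rule countable_subset[rotated])
qed

lemma ex_named_field:
  fixes \<nu> :: "nat \<Rightarrow> 'k::field"
  assumes char: "CHAR('k) = p" "p > 0" and B: "finite B" "range \<nu> = is_subfield hull B"
    and ad: "\<And>i j. \<nu> (ad i j) = \<nu> i + \<nu> j" and ml: "\<And>i j. \<nu> (ml i j) = \<nu> i * \<nu> j"
  shows "\<exists>S z0 z1 bs. named_field (range \<nu>) p B S \<nu> ad ml z0 z1 bs"
proof -
  interpret fg_subfield "range \<nu>" p B
    by unfold_locales (use char B is_subfield_hull in simp_all)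
  obtain S where S: "pbasis S" using ex_pbasis by blast
  interpret pbasis_subfield "range \<nu>" p B S by unfold_locales (rule S)
  obtain l where l: "set l = S" "distinct l" using finite_distinct_list[OF finite_S] by blast
  obtain z0 z1 where z: "\<nu> z0 = 0" "\<nu> z1 = 1" using F_0 F_1 by (metis imageE)
  have nu: "\<nu> (SOME i. \<nu> i = x) = x" if "x \<in> S" for x
    using S_F that by (intro someI_ex[of "\<lambda>i. \<nu> i = x"]) auto
  let ?bs = "map (\<lambda>x. SOME i. \<nu> i = x) l"
  have m: "map \<nu> ?bs = l" using nu l(1) unfolding map_map o_def by (intro map_idI nu) (simp add: l(1))
  have "\<nu> ` set ?bs = S" using arg_cong[OF m, of set] l(1) by (simp only: set_map)
  hence "named_field (range \<nu>) p B S \<nu> ad ml z0 z1 ?bs"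
    by unfold_locales (use ad ml z m l(2) in simp_all)
  thus ?thesis by blast
qed

theorem theorem2:
  fixes p :: nat
  assumes "CHAR('k::field) = p" and "p > 0"
  shows "(\<forall>n (V :: 'k point set) (G :: 'k set).
            n \<ge> 2 \<and> linear_subvariety n V \<and> mult_subgroup G \<and> fin_gen (root_closure G) \<longrightarrow>
            (\<exists>e>0. \<exists>C. is_decomposition n (p ^ e) G V C)) \<and>
         (\<forall>\<nu> :: nat \<Rightarrow> 'k. effective_presentation \<nu> \<longrightarrow> (\<exists>A. computes_decompositions p \<nu> A))"
proof (intro conjI allI impI)
  fix n and V :: "'k point set" and G :: "'k set"
  assume asm: "n \<ge> 2 \<and> linear_subvariety n V \<and> mult_subgroup G \<and> fin_gen (root_closure G)"
  hence G: "mult_subgroup G" and fg: "fin_gen (root_closure G)" by simp_all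
  obtain L where L: "finite L" "\<forall>a\<in>L. length a = n + 1" "V = linear_variety n L"
    using asm by (auto simp: linear_subvariety_def)
  obtain X where X: "finite X" "X \<subseteq> root_closure G" "root_closure G = mult_subgroup hull X"
    using fg by (auto simp: fin_gen_def)
  obtain Y where Y: "finite Y" "Y \<subseteq> G" "G = mult_subgroup hull Y"
    using fin_gen_of_root_closure[OF G fg] by (auto simp: fin_gen_def)
  \<comment> \<open>Generators of the radical are adjoined to the coefficients, so that the whole
    radical lies in the field whose elements are named.\<close>
  define B where "B = X \<union> (\<Union>a\<in>L. set a)"
  have B: "finite B" using X(1) L(1) by (simp add: B_def)
  define F where "F = is_subfield hull B"
  \<comment> \<open>A mere enumeration of \<open>F\<close>: the operations on its names are obtained
    by choice, which is enough for the existence of certificates and their soundness.\<close>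
  define \<nu> where "\<nu> = from_nat_into F"
  have sub: "is_subfield F" unfolding F_def by (rule is_subfield_hull)
  have range: "range \<nu> = F"
    unfolding \<nu>_def using sub countable_subfield[OF countable_finite[OF B]]
    by (intro range_from_nat_into) (auto simp: F_def is_subfield_def)
  have name: "\<exists>i. \<nu> i = x" if "x \<in> F" for x using that range by (metis imageE)
  have minus: "x - y \<in> F" and mult: "x * y \<in> F" if "x \<in> F" "y \<in> F" for x y
    using sub that by (simp_all add: is_subfield_def)
  have add: "x + y \<in> F" if "x \<in> F" "y \<in> F" for x y
    using minus[OF that(1) minus[of 0 y]] that(2) sub by (simp add: is_subfield_def)
  have \<nu>F: "\<nu> i \<in> F" for i using range by blast
  obtain ad where ad: "\<And>i j. \<nu> (ad i j) = \<nu> i + \<nu> j" using name[OF add[OF \<nu>F \<nu>F]] by metis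
  obtain ml where ml: "\<And>i j. \<nu> (ml i j) = \<nu> i * \<nu> j" using name[OF mult[OF \<nu>F \<nu>F]] by metis
  obtain S z0 z1 bs where "named_field (range \<nu>) p B S \<nu> ad ml z0 z1 bs"
    using ex_named_field[OF assms B range[unfolded F_def] ad ml] by blast
  then interpret named_field "range \<nu>" p B S \<nu> ad ml z0 z1 bs .
  have GamF: "root_closure G \<subseteq> F"
  proof -
    have "mult_subgroup (F - {0})" using sub by (intro mult_subgroupI) (auto simp: is_subfield_def)
    moreover have "X \<subseteq> F - {0}"
      using X(2) mult_subgroupD(1)[OF root_closure_subgroup[OF G]] hull_subset[of B is_subfield]
      by (auto simp: B_def F_def)
    ultimately have "mult_subgroup hull X \<subseteq> F - {0}" by (intro hull_minimal)
    thus ?thesis using X(3) by blast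
  qed
  obtain ys where ys: "set ys = Y" using finite_list[OF Y(1)] by blast
  obtain ls where ls: "set ls = L" using finite_list[OF L(1)] by blast
  define gs where "gs = map nm ys"
  define rows where "rows = map (map nm) ls"
  have "\<nu> (nm y) = y" if "y \<in> Y" for y
    using that Y(2) root_closure_superset[of G] GamF range by (intro \<nu>_nm) blast
  hence "\<nu> ` set gs = Y" using ys by (force simp: gs_def image_image)
  hence gs: "\<nu> ` set gs = Y" "grp gs = G" using Y(3) by (simp_all add: grp_def)
  have "map \<nu> (map nm a) = a" if "a \<in> L" for a
  proof -
    have "set a \<subseteq> F" using that hull_subset[of B is_subfield] by (auto simp: B_def F_def)
    hence "\<nu> (nm x) = x" if "x \<in> set a" for x using that range by (intro \<nu>_nm) blast
    thus ?thesis by (simp add: map_idI)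
  qed
  hence rows: "map \<nu> ` set rows = L" using ls by (force simp: rows_def image_image)
  have gs0: "0 \<notin> \<nu> ` set gs" using gs(1) Y(2) mult_subgroupD(1)[OF G] by blast
  obtain e ds where cert: "certified n rows gs e ds"
    using certified_complete[OF gs0] GamF fg range unfolding gs(2) by blast
  have len: "length r = Suc n" if "r \<in> set rows" for r using that L(2) ls by (auto simp: rows_def)
  from certified_sound(1)[OF gs0 _ cert] certified_sound(3)[OF gs0 _ cert] len
  show "\<exists>e>0. \<exists>C. is_decomposition n (p ^ e) G V C"
    unfolding gs(1) rows L(3)[symmetric] Y(3)[symmetric] by blast
next
  fix \<nu> :: "nat \<Rightarrow> 'k"
  assume "effective_presentation \<nu>"
  then obtain B f g h where B: "finite B" "range \<nu> = is_subfield hull B"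
    and f: "\<forall>i j. \<exists>k. computes f [i, j] k \<and> \<nu> k = \<nu> i + \<nu> j"
    and g: "\<forall>i j. \<exists>k. computes g [i, j] k \<and> \<nu> k = \<nu> i * \<nu> j"
    and h: "\<forall>i j. computes h [i, j] (if \<nu> i = \<nu> j then 1 else 0)"
    unfolding effective_presentation_def by blast
  obtain ad where ad: "\<And>i j. computes f [i, j] (ad i j)" "\<And>i j. \<nu> (ad i j) = \<nu> i + \<nu> j" using f by metis
  obtain ml where ml: "\<And>i j. computes g [i, j] (ml i j)" "\<And>i j. \<nu> (ml i j) = \<nu> i * \<nu> j" using g by metis
  have binary: "computable (\<lambda>z. op (fst z) (snd z))" if op: "\<And>i j. computes r [i, j] (op i j)" for r and op :: "nat \<Rightarrow> nat \<Rightarrow> nat"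
  proof (rule computable_binary, unfold prog_def, rule exI[of _ r], intro allI impI)
    fix xs :: "nat list" assume "length xs = 2"
    then obtain i j where "xs = [i, j]" by (auto simp: numeral_2_eq_2 length_Suc_conv)
    thus "computes r xs (op (xs ! 0) (xs ! 1))" using op[of i j] by simp
  qed
  obtain S z0 z1 bs where "named_field (range \<nu>) p B S \<nu> ad ml z0 z1 bs"
    using ex_named_field[OF assms B ad(2) ml(2)] by blast
  then interpret named_field "range \<nu>" p B S \<nu> ad ml z0 z1 bs .
  interpret computable_field "range \<nu>" p B S \<nu> ad ml z0 z1 bs
  proof
    show "computable (\<lambda>z. ad (fst z) (snd z))" by (rule binary) (rule ad)
    show "computable (\<lambda>z. ml (fst z) (snd z))" by (rule binary) (rule ml)
    show "decidable (\<lambda>z. \<nu> (fst z) = \<nu> (snd z))"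
      unfolding decidable_def by (rule binary[of h "\<lambda>i j. if \<nu> i = \<nu> j then 1 else 0"]) (use h in simp)
  qed
  obtain A where A: "\<And>n rows gs. \<exists>e ds. certified n rows gs e ds \<Longrightarrow> \<exists>e ds. certified n rows gs e ds \<and>
     computes A [n, vecs_code rows, list_encode gs] (prod_encode (e, list_encode (map descr_code ds)))"
    using certified_search by blast
  have "computes_decompositions p \<nu> A"
    unfolding computes_decompositions_def Let_def
  proof (intro allI impI)
    fix n and rows :: "nat list list" and gs :: "nat list"
    assume asm: "n \<ge> 2 \<and> (\<forall>r\<in>set rows. length r = n + 1) \<and> 0 \<notin> \<nu> ` set gs \<and>
        fin_gen (root_closure (mult_subgroup hull (\<nu> ` set gs))) \<and> root_closure (mult_subgroup hull (\<nu> ` set gs)) \<subseteq> range \<nu>"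
    hence gs0: "0 \<notin> \<nu> ` set gs" and len: "\<And>r. r \<in> set rows \<Longrightarrow> length r = Suc n" by simp_all
    have "\<exists>e ds. certified n rows gs e ds"
      by (rule certified_complete[OF gs0]) (use asm in \<open>simp_all add: grp_def\<close>)
    then obtain e ds where cert: "certified n rows gs e ds"
      and comp: "computes A [n, vecs_code rows, list_encode gs] (prod_encode (e, list_encode (map descr_code ds)))"
      using A by blast
    note S = certified_sound[OF gs0 _ cert]
    show "\<exists>e ds. computes A [n, vecs_code rows, list_encode gs] (prod_encode (e, list_encode (map descr_code ds))) \<and>
       e > 0 \<and> (\<forall>d\<in>set ds. equations_in_range n d) \<and>
       is_decomposition n (p ^ e) (mult_subgroup hull (\<nu> ` set gs)) (linear_variety n (map \<nu> ` set rows)) (denote n \<nu> ` set ds)"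
      using comp S(1)[OF len] S(2)[OF len] S(3)[OF len] by blast
  qed
  thus "\<exists>A. computes_decompositions p \<nu> A" by blast
qed


end
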